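(* Let $T>0$, let $S$ be a real orthogonal $n\times n$ matrix and let $D_0,D\in C([0,T],M_n(\mathbb{C}))$. Let $\nu\in\mathbb{C}$ be such that $\frac{d}{dt}-D_0+\nu I_n$ is invertible, and let $F=D\big(\frac{d}{dt}-D_0+\nu I_n\big)^{-1}$. Let $\gamma_0$ be the fundamental solution of $\dot\gamma_0(t)=D_0(t)\gamma_0(t)$, $\gamma_0(0)=I_n$, put $M=S\gamma_0(T)$, $\hat D(t)=\gamma_0^{-1}(t)D(t)\gamma_0(t)$, and for $k\ge1$ $$M_k=\int_0^T\hat D(t_1)\int_0^{t_1}\hat D(t_2)\cdots\int_0^{t_{k-1}}\hat D(t_k)\,dt_k\cdots dt_2\,dt_1,\qquad G_k=M_kM\big(M-e^{\nu T}I_n\big)^{-1}.$$ Then $$\mathrm{Tr}(F)=\frac12\int_0^T\mathrm{Tr}(D(t))\,dt-\mathrm{Tr}(G_1),$$ where $\mathrm{Tr}(F)$ is the conditional trace, and for every integer $m\ge2$ ($F^m$ being trace class) $$\mathrm{Tr}(F^m)=m\sum_{k=1}^m\frac{(-1)^k}{k}\Big[\sum_{j_1+\cdots+j_k=m}\mathrm{Tr}(G_{j_1}\cdots G_{j_k})\Big],$$ the inner sum being over all $k$-tuples of positive integers $(j_1,\dots,j_k)$ with sum $m$.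
   Context: $\frac{d}{dt}$ is the closed densely defined operator on $E=L^2([0,T],\mathbb{C}^n)$ with domain $D_S=\{z\in W^{1,2}([0,T],\mathbb{C}^n): z(0)=Sz(T)\}$; $D$ and $D_0$ act on $E$ as multiplication operators. $F$ is a Hilbert-Schmidt operator. Conditional trace: $\mathrm{Tr}(F)=\lim_{N\to\infty}\mathrm{Tr}(\hat P_NF\hat P_N)$, where $\hat P_N$ is the orthogonal projection of $E$ onto $V_N=\bigoplus_{\mu\in\sigma(\frac{d}{dt}),\,|\mu|\le N}\ker(\mu-\frac{d}{dt})$. For $m\ge2$ the trace of $F^m$ is the usual one. *)

theory Defs
  imports "HOL-Analysis.Analysis"
begin

text \<open>
  Elements of the Hilbert space of square integrable functions from [0,T] to complex n-space are
  represented by functions on the real line, two of which denote the same element iff they agree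
  almost everywhere on [0,T]; the values outside [0,T] are irrelevant.
  Accordingly, operators are functions on representatives, compared up to null sets.
\<close>

type_synonym 'n vfun = "real \<Rightarrow> complex ^ 'n"

definition L2 :: "real \<Rightarrow> ('n::finite) vfun set" where
  "L2 T = {f. f \<in> borel_measurable (lebesgue_on {0..T}) \<and>
              integrable (lebesgue_on {0..T}) (\<lambda>t. (norm (f t))\<^sup>2)}"

definition l2_inner :: "real \<Rightarrow> ('n::finite) vfun \<Rightarrow> 'n vfun \<Rightarrow> complex" where
  "l2_inner T f g = (LINT t|lebesgue_on {0..T}. (\<Sum>i\<in>UNIV. f t $ i * cnj (g t $ i)))"

definition l2_norm :: "real \<Rightarrow> ('n::finite) vfun \<Rightarrow> real" where
  "l2_norm T f = sqrt (LINT t|lebesgue_on {0..T}. (norm (f t))\<^sup>2)"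

definition l2_eq :: "real \<Rightarrow> ('n::finite) vfun \<Rightarrow> 'n vfun \<Rightarrow> bool" where
  "l2_eq T f g \<longleftrightarrow> (AE t in lebesgue_on {0..T}. f t = g t)"

definition orthonormal_basis :: "real \<Rightarrow> ('n::finite) vfun set \<Rightarrow> bool" where
  "orthonormal_basis T B \<longleftrightarrow> B \<subseteq> L2 T \<and>
     (\<forall>e\<in>B. \<forall>e'\<in>B. l2_inner T e e' = (if e = e' then 1 else 0)) \<and>
     (\<forall>f\<in>L2 T. (\<forall>e\<in>B. l2_inner T f e = 0) \<longrightarrow> l2_eq T f (\<lambda>_. 0))"

text \<open>
  Trace class operators are the nuclear ones: norm convergent sums of rank one operators
  \<open>f \<mapsto> \<langle>f, u k\<rangle> v k\<close> with summable norms.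
\<close>

definition trace_class :: "real \<Rightarrow> (('n::finite) vfun \<Rightarrow> 'n vfun) \<Rightarrow> bool" where
  "trace_class T A \<longleftrightarrow> (\<forall>f\<in>L2 T. A f \<in> L2 T) \<and>
     (\<exists>u v :: nat \<Rightarrow> 'n vfun. range u \<subseteq> L2 T \<and> range v \<subseteq> L2 T \<and>
        summable (\<lambda>k. l2_norm T (u k) * l2_norm T (v k)) \<and>
        (\<forall>f\<in>L2 T. (\<lambda>N. l2_norm T (\<lambda>t. A f t - (\<Sum>k<N. l2_inner T f (u k) *s v k t)))
                     \<longlonglongrightarrow> 0))"

definition has_trace :: "real \<Rightarrow> (('n::finite) vfun \<Rightarrow> 'n vfun) \<Rightarrow> complex \<Rightarrow> bool" where
  "has_trace T A \<tau> \<longleftrightarrow> trace_class T A \<and>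
     (\<forall>B. orthonormal_basis T B \<longrightarrow> ((\<lambda>e. l2_inner T (A e) e) has_sum \<tau>) B)"

definition orth_proj :: "real \<Rightarrow> ('n::finite) vfun set \<Rightarrow> 'n vfun \<Rightarrow> 'n vfun" where
  "orth_proj T V f = (SOME g. g \<in> V \<and> (\<forall>h\<in>V. l2_inner T (\<lambda>t. f t - g t) h = 0))"

definition mult_op :: "(real \<Rightarrow> complex ^ 'n ^ 'n) \<Rightarrow> ('n::finite) vfun \<Rightarrow> 'n vfun" where
  "mult_op D f = (\<lambda>t. D t *v f t)"

text \<open>
  An unbounded operator \<open>A\<close> is given by its graph: \<open>A z w\<close> says that \<open>z\<close> lies in the
  domain and is mapped to (the class of) \<open>w\<close>.
\<close>

type_synonym 'n unbounded_op = "'n vfun \<Rightarrow> 'n vfun \<Rightarrow> bool"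

definition op_add :: "real \<Rightarrow> ('n::finite) unbounded_op \<Rightarrow> ('n vfun \<Rightarrow> 'n vfun) \<Rightarrow> 'n unbounded_op" where
  "op_add T A B z f \<longleftrightarrow> f \<in> L2 T \<and> (\<exists>w. A z w \<and> l2_eq T f (\<lambda>t. w t + B z t))"

definition scalar_minus_op :: "real \<Rightarrow> complex \<Rightarrow> ('n::finite) unbounded_op \<Rightarrow> 'n unbounded_op" where
  "scalar_minus_op T \<mu> A z f \<longleftrightarrow> f \<in> L2 T \<and> (\<exists>w. A z w \<and> l2_eq T f (\<lambda>t. \<mu> *s z t - w t))"

definition op_kernel :: "('n::finite) unbounded_op \<Rightarrow> 'n vfun set" where
  "op_kernel A = {z. A z (\<lambda>_. 0)}"

definition op_invertible :: "real \<Rightarrow> ('n::finite) unbounded_op \<Rightarrow> bool" where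
  "op_invertible T A \<longleftrightarrow>
     (\<forall>z z' f. A z f \<and> A z' f \<longrightarrow> l2_eq T z z') \<and>
     (\<forall>f\<in>L2 T. \<exists>z. A z f) \<and>
     (\<exists>C. \<forall>z f. A z f \<longrightarrow> l2_norm T z \<le> C * l2_norm T f)"

definition op_inverse :: "('n::finite) unbounded_op \<Rightarrow> 'n vfun \<Rightarrow> 'n vfun" where
  "op_inverse A f = (SOME z. A z f)"

definition op_spectrum :: "real \<Rightarrow> ('n::finite) unbounded_op \<Rightarrow> complex set" where
  "op_spectrum T A = {\<mu>. \<not> op_invertible T (scalar_minus_op T \<mu> A)}"

definition eigen_sum :: "real \<Rightarrow> ('n::finite) unbounded_op \<Rightarrow> real \<Rightarrow> 'n vfun set" where
  "eigen_sum T A N =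
     {\<lambda>t. \<Sum>\<mu>\<in>I. z \<mu> t | I z. finite I \<and> I \<subseteq> {\<mu> \<in> op_spectrum T A. cmod \<mu> \<le> N} \<and>
                              (\<forall>\<mu>\<in>I. z \<mu> \<in> op_kernel (scalar_minus_op T \<mu> A))}"

definition has_conditional_trace ::
  "real \<Rightarrow> ('n::finite) unbounded_op \<Rightarrow> ('n vfun \<Rightarrow> 'n vfun) \<Rightarrow> complex \<Rightarrow> bool" where
  "has_conditional_trace T A F \<tau> \<longleftrightarrow>
     (\<exists>\<tau>N. (\<forall>N::nat. let P = orth_proj T (eigen_sum T A (real N)) in has_trace T (P \<circ> F \<circ> P) (\<tau>N N)) \<and>
           \<tau>N \<longlonglongrightarrow> \<tau>)"

text \<open>
  On an interval, the Sobolev space of order one consists of the absolutely continuous functions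
  with square integrable derivative, i.e. of the primitives of square integrable functions.
  A Sobolev function is represented by its continuous representative, so that its boundary
  values make sense.
\<close>

definition has_sobolev_deriv :: "real \<Rightarrow> ('n::finite) vfun \<Rightarrow> 'n vfun \<Rightarrow> bool" where
  "has_sobolev_deriv T z w \<longleftrightarrow> z \<in> L2 T \<and> w \<in> L2 T \<and>
     (\<forall>t\<in>{0..T}. z t = z 0 + (LINT s|lebesgue_on {0..t}. w s))"

definition W12 :: "real \<Rightarrow> ('n::finite) vfun set" where
  "W12 T = {z. \<exists>w. has_sobolev_deriv T z w}"

definition ddt_domain :: "real \<Rightarrow> real ^ 'n ^ 'n \<Rightarrow> ('n::finite) vfun set" where
  "ddt_domain T S = {z \<in> W12 T. z 0 = map_matrix complex_of_real S *v z T}"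

definition ddt :: "real \<Rightarrow> real ^ 'n ^ 'n \<Rightarrow> ('n::finite) unbounded_op" where
  "ddt T S z w \<longleftrightarrow> z \<in> ddt_domain T S \<and> has_sobolev_deriv T z w"

definition shifted_ddt ::
  "real \<Rightarrow> real ^ 'n ^ 'n \<Rightarrow> (real \<Rightarrow> complex ^ 'n ^ 'n) \<Rightarrow> complex \<Rightarrow> ('n::finite) unbounded_op" where
  "shifted_ddt T S D0 \<nu> = op_add T (ddt T S) (\<lambda>z t. - mult_op D0 z t + \<nu> *s z t)"

primrec iterated_integral :: "(real \<Rightarrow> complex ^ 'n ^ 'n) \<Rightarrow> nat \<Rightarrow> real \<Rightarrow> complex ^ 'n ^ ('n::finite)" where
  "iterated_integral D 0 t = mat 1"
| "iterated_integral D (Suc k) t = integral {0..t} (\<lambda>s. D s ** iterated_integral D k s)"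

definition compositions :: "nat \<Rightarrow> nat \<Rightarrow> nat list set" where
  "compositions m k = {js. length js = k \<and> (\<forall>j\<in>set js. 1 \<le> j) \<and> sum_list js = m}"

definition matrix_prod_list :: "(complex ^ 'n ^ 'n) list \<Rightarrow> complex ^ 'n ^ ('n::finite)" where
  "matrix_prod_list As = foldr (**) As (mat 1)"

end

theory Submission
  imports Defs "HOL-Computational_Algebra.Fundamental_Theorem_Algebra"
begin

text \<open>
  By variation of constants \<open>F = V - R\<close>, where \<open>V\<close> is the Volterra operator with kernel
  \<open>A(t) B(s)\<close> for \<open>s < t\<close>, \<open>A = D X\<close> and \<open>B = X\<^sup>-\<^sup>1\<close> for the fundamental solution \<open>X\<close> of
  \<open>z' = (D0 - \<nu>) z\<close>, and \<open>R f = A Q \<integral> B f\<close> has finite rank.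

  For \<open>m \<ge> 2\<close> the trace of \<open>V\<^sup>m\<close> vanishes, and telescoping \<open>F\<^sup>m - V\<^sup>m\<close> leaves finitely many rank one
  operators whose traces are computed from the iterated integrals. They add up to the coefficient
  of \<open>x\<^sup>m\<close> in \<open>- x \<cdot> d/dx tr log (1 + \<Sum>j. G j x\<^sup>j)\<close>.

  For \<open>m = 1\<close>, \<open>R\<close> contributes \<open>tr (G 1)\<close>, while \<open>V\<close> need not be trace class. In an orthonormal basis of
  eigenvectors of \<open>d/dt\<close>, the conditional trace of \<open>V\<close> becomes a sum of symmetric partial sums of
  Fourier series at a jump. These converge to half of the jump, which gives the factor \<open>1/2\<close>.
\<close>

text \<open>The projections dictate the basis: the eigenspaces of d/dt are spanned by e^{i(theta + 2
  pi k)t/T} x, where x runs through an orthonormal eigenbasis of S and S x = e^{-i theta} x. The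
  cut-off |mu| <= N is symmetric in theta + 2 pi k and not in k, so for each x the window of
  admissible k is symmetric only up to a bounded shift. The half jump survives this because the
  Fourier coefficients of a sawtooth are O(1/k). The regularity of the two kernel factors is uneven.
  D, and with it A, is merely continuous, while B is Lipschitz because the fundamental solution is
  C^1. The convergence criterion at the jump needs a linear modulus of continuity, and it suffices
  that one factor provides it. For m >= 2, V^m is a product of Hilbert-Schmidt operators, hence
  nuclear. The exponentials in nu cancel in B A, which is \<open>Dhat\<close>; nu survives only as
  e^{nu T} in the boundary term. This is why the iterated integrals of \<open>Dhat\<close> alone
  describe all powers. Operators act on representatives, so formulas are proved pointwise on [0,T]
  and then transferred up to null sets.\<close>

abbreviation leb_upto :: "real \<Rightarrow> real measure" where
  "leb_upto T \<equiv> lebesgue_on {0..T}"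

section \<open>The Hermitian form on complex n-space\<close>

definition cdot :: "complex ^ 'n \<Rightarrow> complex ^ 'n \<Rightarrow> complex" where
  "cdot x y = (\<Sum>i\<in>UNIV. x $ i * cnj (y $ i))"

lemma cdot_add_left: "cdot (x + y) z = cdot x z + cdot y z"
  and cdot_add_right: "cdot z (x + y) = cdot z x + cdot z y"
  and cdot_diff_left: "cdot (x - y) z = cdot x z - cdot y z"
  and cdot_diff_right: "cdot z (x - y) = cdot z x - cdot z y"
  and cdot_smult_left: "cdot (c *s x) z = c * cdot x z"
  and cdot_smult_right: "cdot z (c *s x) = cnj c * cdot z x"
  and cdot_zero_left [simp]: "cdot 0 z = 0"
  and cdot_zero_right [simp]: "cdot z 0 = 0"
  by (simp_all add: cdot_def algebra_simps sum.distrib sum_distrib_left sum_subtractf)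

lemma cdot_sum_left: "cdot (\<Sum>i\<in>I. f i) z = (\<Sum>i\<in>I. cdot (f i) z)"
  by (induction I rule: infinite_finite_induct) (simp_all add: cdot_add_left)

lemma cdot_cnj: "cdot y x = cnj (cdot x y)"
  by (simp add: cdot_def mult.commute)

lemma cdot_axis_right: "cdot x (axis i 1) = x $ i"
proof -
  have "cdot x (axis i 1) = (\<Sum>j\<in>UNIV. if j = i then x $ j else 0)"
    unfolding cdot_def by (intro sum.cong) (auto simp: axis_def)
  then show ?thesis by simp
qed

lemma norm_vec_power2: "(norm x)\<^sup>2 = (\<Sum>i\<in>UNIV. (cmod (x $ i))\<^sup>2)" for x :: "complex ^ 'n"
  by (simp add: norm_vec_def L2_set_def sum_nonneg)

lemma cdot_self: "cdot x x = of_real ((norm x)\<^sup>2)"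
  unfolding norm_vec_power2 cdot_def by (simp add: complex_norm_square[symmetric] del: of_real_power)

lemma norm_cdot_le: "cmod (cdot x y) \<le> norm x * norm y"
proof -
  have "cmod (cdot x y) \<le> (\<Sum>i\<in>UNIV. cmod (x $ i * cnj (y $ i)))"
    unfolding cdot_def by (rule norm_sum)
  also have "\<dots> = (\<Sum>i\<in>UNIV. \<bar>cmod (x $ i)\<bar> * \<bar>cmod (y $ i)\<bar>)"
    by (simp add: norm_mult)
  also have "\<dots> \<le> L2_set (\<lambda>i. cmod (x $ i)) UNIV * L2_set (\<lambda>i. cmod (y $ i)) UNIV"
    by (rule L2_set_mult_ineq)
  finally show ?thesis by (simp add: norm_vec_def)
qed

lemma norm_smult_vec: "norm (c *s x) = cmod c * norm x" for x :: "complex ^ 'n"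
  by (simp add: norm_vec_def vector_scalar_mult_def norm_mult L2_set_right_distrib)

lemma bounded_bilinear_cdot: "bounded_bilinear cdot"
proof
  fix a a' b b' :: "complex ^ 'n" and r :: real
  show "cdot (r *\<^sub>R a) b = r *\<^sub>R cdot a b" "cdot a (r *\<^sub>R b) = r *\<^sub>R cdot a b"
    by (simp_all add: cdot_def scaleR_sum_right)
  show "\<exists>K. \<forall>a b. norm (cdot a b) \<le> norm a * norm b * K"
    by (intro exI[of _ 1]) (simp add: norm_cdot_le)
qed (simp_all add: cdot_add_left cdot_add_right)

lemma bounded_bilinear_smult: "bounded_bilinear ((*s) :: complex \<Rightarrow> complex ^ 'n \<Rightarrow> complex ^ 'n)"
proof
  fix a :: complex and b :: "complex ^ 'n" and r :: real
  show "(r *\<^sub>R a) *s b = r *\<^sub>R (a *s b)" "a *s (r *\<^sub>R b) = r *\<^sub>R (a *s b)"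
    by (simp_all add: vec_eq_iff)
  show "\<exists>K. \<forall>(a::complex) (b::complex ^ 'n). norm (a *s b) \<le> norm a * norm b * K"
    by (intro exI[of _ 1]) (simp add: norm_smult_vec)
qed (simp_all add: vec_eq_iff algebra_simps)

text \<open>Stated for an arbitrary bounded bilinear map so that it serves scalar multiples,
  \<open>cdot\<close>, matrix-vector and matrix-matrix products alike.\<close>

lemma borel_measurable_bilinear:
  fixes f :: "'a \<Rightarrow> 'b::{second_countable_topology,real_normed_vector}"
    and g :: "'a \<Rightarrow> 'c::{second_countable_topology,real_normed_vector}"
    and h :: "'b \<Rightarrow> 'c \<Rightarrow> 'd::real_normed_vector"
  assumes "bounded_bilinear h" "f \<in> borel_measurable M" "g \<in> borel_measurable M"
  shows "(\<lambda>x. h (f x) (g x)) \<in> borel_measurable M"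
proof (rule borel_measurable_continuous_Pair)
  show "continuous_on UNIV (\<lambda>x. h (fst x) (snd x))"
    by (rule bounded_bilinear.continuous_on[OF assms(1)]) (auto intro: continuous_intros)
qed (use assms in auto)

section \<open>Square integrable functions on [0,T]\<close>

lemma finite_measure_leb_upto: "finite_measure (leb_upto T)"
  by (rule finite_measure_lebesgue_on) auto

lemma sigma_finite_leb_upto: "sigma_finite_measure (leb_upto T)"
  by (rule finite_measure.axioms(1)[OF finite_measure_leb_upto])

lemma integrable_leb_upto_bounded:
  fixes f :: "real \<Rightarrow> 'a::{banach,second_countable_topology}"
  assumes "f \<in> borel_measurable (leb_upto T)" "\<And>t. t \<in> {0..T} \<Longrightarrow> norm (f t) \<le> C"
  shows "integrable (leb_upto T) f"
  by (rule finite_measure.integrable_const_bound[OF finite_measure_leb_upto, of _ C])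
    (use assms in \<open>auto intro!: AE_I2\<close>)

lemma L2_integrable_norm2: "f \<in> L2 T \<Longrightarrow> integrable (leb_upto T) (\<lambda>t. (norm (f t))\<^sup>2)"
  and L2_measurable: "f \<in> L2 T \<Longrightarrow> f \<in> borel_measurable (leb_upto T)"
  by (auto simp: L2_def)

lemma L2_dominated:
  assumes f: "f \<in> L2 T" and g: "g \<in> borel_measurable (leb_upto T)"
    and le: "\<And>t. t \<in> {0..T} \<Longrightarrow> norm (g t) \<le> C * norm (f t)"
  shows "g \<in> L2 T"
proof -
  have "integrable (leb_upto T) (\<lambda>t. (norm (g t))\<^sup>2)"
  proof (rule Bochner_Integration.integrable_bound)
    show "integrable (leb_upto T) (\<lambda>t. C\<^sup>2 * (norm (f t))\<^sup>2)"
      using L2_integrable_norm2[OF f] by simp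
    show "AE t in leb_upto T. norm ((norm (g t))\<^sup>2) \<le> norm (C\<^sup>2 * (norm (f t))\<^sup>2)"
    proof (rule AE_I2)
      fix t assume "t \<in> space (leb_upto T)"
      then have "(norm (g t))\<^sup>2 \<le> (C * norm (f t))\<^sup>2"
        using le[of t] by (intro power_mono) auto
      then show "norm ((norm (g t))\<^sup>2) \<le> norm (C\<^sup>2 * (norm (f t))\<^sup>2)"
        by (simp add: power_mult_distrib)
    qed
  qed (use g in measurable)
  with g show ?thesis by (simp add: L2_def)
qed

lemma L2_bounded:
  assumes "f \<in> borel_measurable (leb_upto T)" "\<And>t. t \<in> {0..T} \<Longrightarrow> norm (f t) \<le> C"
  shows "f \<in> L2 T"
proof -
  have "integrable (leb_upto T) (\<lambda>t. (norm (f t))\<^sup>2)"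
    using assms by (intro integrable_leb_upto_bounded[where C = "C\<^sup>2"]) (auto intro!: power_mono)
  with assms show ?thesis by (simp add: L2_def)
qed

lemma L2_add:
  assumes "f \<in> L2 T" "g \<in> L2 T" shows "(\<lambda>t. f t + g t) \<in> L2 T"
proof -
  have [measurable]: "f \<in> borel_measurable (leb_upto T)" "g \<in> borel_measurable (leb_upto T)"
    using assms by (auto simp: L2_def)
  have "integrable (leb_upto T) (\<lambda>t. (norm (f t + g t))\<^sup>2)"
  proof (rule Bochner_Integration.integrable_bound)
    show "integrable (leb_upto T) (\<lambda>t. 2 * (norm (f t))\<^sup>2 + 2 * (norm (g t))\<^sup>2)"
      using assms by (auto simp: L2_def)
    show "AE t in leb_upto T. norm ((norm (f t + g t))\<^sup>2) \<le> norm (2 * (norm (f t))\<^sup>2 + 2 * (norm (g t))\<^sup>2)"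
    proof (rule AE_I2)
      fix t
      have "(norm (f t + g t))\<^sup>2 \<le> (norm (f t) + norm (g t))\<^sup>2"
        by (intro power_mono norm_triangle_ineq) auto
      also have "\<dots> \<le> 2 * (norm (f t))\<^sup>2 + 2 * (norm (g t))\<^sup>2"
        using sum_squares_bound[of "norm (f t)" "norm (g t)"] by (simp add: power2_sum)
      finally show "norm ((norm (f t + g t))\<^sup>2) \<le> norm (2 * (norm (f t))\<^sup>2 + 2 * (norm (g t))\<^sup>2)"
        by simp
    qed
  qed measurable
  then show ?thesis by (auto simp: L2_def)
qed

lemma measurable_smult_const: "f \<in> borel_measurable M \<Longrightarrow> (\<lambda>t. c *s (f t :: complex ^ 'n)) \<in> borel_measurable M"
  by (rule borel_measurable_bilinear[OF bounded_bilinear_smult borel_measurable_const])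

lemma measurable_cdot: "f \<in> borel_measurable M \<Longrightarrow> g \<in> borel_measurable M \<Longrightarrow> (\<lambda>t. cdot (f t) (g t)) \<in> borel_measurable M"
  by (rule borel_measurable_bilinear[OF bounded_bilinear_cdot])

lemma L2_smult: "f \<in> L2 T \<Longrightarrow> (\<lambda>t. c *s f t) \<in> L2 T"
  by (rule L2_dominated[of f T _ "cmod c"]) (auto simp: norm_smult_vec intro: measurable_smult_const L2_measurable)

lemma L2_zero [simp]: "(\<lambda>_. 0) \<in> L2 T"
  by (simp add: L2_def)

lemma L2_diff: "f \<in> L2 T \<Longrightarrow> g \<in> L2 T \<Longrightarrow> (\<lambda>t. f t - g t) \<in> L2 T"
  using L2_add[of f T "\<lambda>t. (-1) *s g t"] L2_smult[of g T "-1"] by simp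

lemma L2_sum: "(\<And>i. i \<in> I \<Longrightarrow> f i \<in> L2 T) \<Longrightarrow> (\<lambda>t. \<Sum>i\<in>I. f i t) \<in> L2 T"
  by (induction I rule: infinite_finite_induct) (auto intro: L2_add)

lemma L2_integrable: "f \<in> L2 T \<Longrightarrow> integrable (leb_upto T) f"
proof (rule Bochner_Integration.integrable_bound)
  assume f: "f \<in> L2 T"
  show "integrable (leb_upto T) (\<lambda>t. 1 + (norm (f t))\<^sup>2)"
    using L2_integrable_norm2[OF f] integrable_leb_upto_bounded[of "\<lambda>_. 1::real" T 1] by auto
  show "AE t in leb_upto T. norm (f t) \<le> norm (1 + (norm (f t))\<^sup>2)"
  proof (rule AE_I2)
    fix t
    have "norm (f t) \<le> 1 + (norm (f t))\<^sup>2"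
      using sum_squares_bound[of "norm (f t)" 1] norm_ge_zero[of "f t"] zero_le_power2[of "norm (f t)"]
      unfolding mult_1_right one_power2 by linarith
    then show "norm (f t) \<le> norm (1 + (norm (f t))\<^sup>2)" by simp
  qed
qed (auto simp: L2_def)

lemma L2_integrable_norm_mult:
  assumes "f \<in> L2 T" "g \<in> L2 T"
  shows "integrable (leb_upto T) (\<lambda>t. norm (f t) * norm (g t))"
proof (rule Bochner_Integration.integrable_bound)
  show "integrable (leb_upto T) (\<lambda>t. (norm (f t))\<^sup>2 + (norm (g t))\<^sup>2)"
    using assms by (auto simp: L2_def)
  show "AE t in leb_upto T. norm (norm (f t) * norm (g t)) \<le> norm ((norm (f t))\<^sup>2 + (norm (g t))\<^sup>2)"
  proof (rule AE_I2)
    fix t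
    have "norm (f t) * norm (g t) \<le> (norm (f t))\<^sup>2 + (norm (g t))\<^sup>2"
      using sum_squares_bound[of "norm (f t)" "norm (g t)"]
        mult_nonneg_nonneg[OF norm_ge_zero norm_ge_zero, of "f t" "g t"] by linarith
    then show "norm (norm (f t) * norm (g t)) \<le> norm ((norm (f t))\<^sup>2 + (norm (g t))\<^sup>2)"
      by simp
  qed
qed (use assms[THEN L2_measurable] in measurable)

lemma L2_integrable_cdot:
  assumes "f \<in> L2 T" "g \<in> L2 T"
  shows "integrable (leb_upto T) (\<lambda>t. cdot (f t) (g t))"
  by (rule Bochner_Integration.integrable_bound[OF L2_integrable_norm_mult[OF assms]])
    (use assms[THEN L2_measurable] in \<open>auto intro: measurable_cdot simp: norm_cdot_le\<close>)

lemma l2_inner_cdot: "l2_inner T f g = (LINT t|leb_upto T. cdot (f t) (g t))"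
  by (simp add: l2_inner_def cdot_def)

lemma l2_inner_add_left: "f \<in> L2 T \<Longrightarrow> g \<in> L2 T \<Longrightarrow> h \<in> L2 T \<Longrightarrow>
    l2_inner T (\<lambda>t. f t + g t) h = l2_inner T f h + l2_inner T g h"
  and l2_inner_diff_left: "f \<in> L2 T \<Longrightarrow> g \<in> L2 T \<Longrightarrow> h \<in> L2 T \<Longrightarrow>
    l2_inner T (\<lambda>t. f t - g t) h = l2_inner T f h - l2_inner T g h"
  and l2_inner_smult_left: "l2_inner T (\<lambda>t. c *s f t) h = c * l2_inner T f h"
  and l2_inner_smult_right: "l2_inner T h (\<lambda>t. c *s f t) = cnj c * l2_inner T h f"
  by (simp_all add: l2_inner_cdot cdot_add_left cdot_diff_left cdot_smult_left cdot_smult_right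
      L2_integrable_cdot)

lemma l2_inner_cnj: "l2_inner T g f = cnj (l2_inner T f g)"
  unfolding l2_inner_cdot by (subst cdot_cnj) simp

lemma l2_inner_sum_left: "h \<in> L2 T \<Longrightarrow> (\<And>i. i \<in> I \<Longrightarrow> f i \<in> L2 T) \<Longrightarrow>
    l2_inner T (\<lambda>t. \<Sum>i\<in>I. f i t) h = (\<Sum>i\<in>I. l2_inner T (f i) h)"
  by (simp add: l2_inner_cdot cdot_sum_left L2_integrable_cdot)

lemma l2_inner_diff_right: "f \<in> L2 T \<Longrightarrow> g \<in> L2 T \<Longrightarrow> h \<in> L2 T \<Longrightarrow>
    l2_inner T h (\<lambda>t. f t - g t) = l2_inner T h f - l2_inner T h g"
  by (subst (1 2 3) l2_inner_cnj, simp add: l2_inner_diff_left)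

lemma l2_inner_sum_right: "h \<in> L2 T \<Longrightarrow> (\<And>i. i \<in> I \<Longrightarrow> f i \<in> L2 T) \<Longrightarrow>
    l2_inner T h (\<lambda>t. \<Sum>i\<in>I. f i t) = (\<Sum>i\<in>I. l2_inner T h (f i))"
  by (subst (1 2) l2_inner_cnj) (simp add: l2_inner_sum_left)

lemma l2_norm_nonneg [simp]: "0 \<le> l2_norm T f"
  by (simp add: l2_norm_def)

lemma l2_norm_power2: "(l2_norm T f)\<^sup>2 = (LINT t|leb_upto T. (norm (f t))\<^sup>2)"
  by (simp add: l2_norm_def)

lemma l2_inner_self: "l2_inner T f f = of_real ((l2_norm T f)\<^sup>2)"
  unfolding l2_norm_power2 l2_inner_cdot cdot_self by (simp del: of_real_power)

lemma l2_norm_smult: "l2_norm T (\<lambda>t. c *s f t) = cmod c * l2_norm T f"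
  by (simp add: l2_norm_def norm_smult_vec power_mult_distrib real_sqrt_mult)

lemma l2_norm_zero [simp]: "l2_norm T (\<lambda>_. 0) = 0"
  by (simp add: l2_norm_def)

lemma l2_norm_minus_commute: "l2_norm T (\<lambda>t. f t - g t) = l2_norm T (\<lambda>t. g t - f t)"
  by (simp add: l2_norm_def norm_minus_commute)

lemma l2_eq_refl [simp]: "l2_eq T f f"
  and l2_eq_sym: "l2_eq T f g \<Longrightarrow> l2_eq T g f"
  by (auto simp: l2_eq_def elim: AE_mp)

lemma l2_eqI: "(\<And>t. t \<in> {0..T} \<Longrightarrow> f t = g t) \<Longrightarrow> l2_eq T f g"
  unfolding l2_eq_def by (rule AE_I2) simp

lemma l2_inner_cong:
  assumes "l2_eq T f f'" "l2_eq T g g'" and L: "f \<in> L2 T" "f' \<in> L2 T" "g \<in> L2 T" "g' \<in> L2 T"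
  shows "l2_inner T f g = l2_inner T f' g'"
  unfolding l2_inner_cdot
proof (rule integral_cong_AE)
  show "AE t in leb_upto T. cdot (f t) (g t) = cdot (f' t) (g' t)"
    using assms(1,2) unfolding l2_eq_def by eventually_elim simp
qed (use L in \<open>auto intro: measurable_cdot L2_measurable\<close>)

lemma l2_norm_cong:
  assumes "l2_eq T f f'" and L: "f \<in> L2 T" "f' \<in> L2 T"
  shows "l2_norm T f = l2_norm T f'"
proof -
  have "of_real ((l2_norm T f)\<^sup>2) = (of_real ((l2_norm T f')\<^sup>2) :: complex)"
    unfolding l2_inner_self[symmetric] using assms by (intro l2_inner_cong) auto
  then show ?thesis by (simp del: of_real_power)
qed

lemma l2_norm_eq_0_iff: "f \<in> L2 T \<Longrightarrow> l2_norm T f = 0 \<longleftrightarrow> l2_eq T f (\<lambda>_. 0)"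
  using integral_nonneg_eq_0_iff_AE[of "leb_upto T" "\<lambda>t. (norm (f t))\<^sup>2"]
  by (simp add: l2_norm_def l2_eq_def L2_def)

lemma l2_norm_diff_power2:
  assumes "f \<in> L2 T" "g \<in> L2 T"
  shows "(l2_norm T (\<lambda>t. f t - g t))\<^sup>2 = (l2_norm T f)\<^sup>2 - 2 * Re (l2_inner T f g) + (l2_norm T g)\<^sup>2"
proof -
  have "of_real ((l2_norm T (\<lambda>t. f t - g t))\<^sup>2)
      = l2_inner T f f - l2_inner T f g - (l2_inner T g f - l2_inner T g g)"
    using assms unfolding l2_inner_self[symmetric]
    by (simp add: l2_inner_diff_left l2_inner_diff_right L2_diff)
  then have "Re (of_real ((l2_norm T (\<lambda>t. f t - g t))\<^sup>2))
      = Re (l2_inner T f f - l2_inner T f g - (cnj (l2_inner T f g) - l2_inner T g g))"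
    using l2_inner_cnj[of T g f] by simp
  then show ?thesis by (simp add: l2_inner_self)
qed

text \<open>The squared distance from f to the multiples of g is nonnegative at its minimiser c =
  <f,g>/|g|^2; a g of norm zero is null almost everywhere and is treated separately.\<close>

lemma l2_Cauchy_Schwarz:
  assumes "f \<in> L2 T" "g \<in> L2 T"
  shows "cmod (l2_inner T f g) \<le> l2_norm T f * l2_norm T g"
proof (cases "l2_norm T g = 0")
  case True
  then have "l2_eq T g (\<lambda>_. 0)" using l2_norm_eq_0_iff assms by blast
  then have "l2_inner T f g = l2_inner T f (\<lambda>_. 0)" using assms by (intro l2_inner_cong) auto
  then show ?thesis by (simp add: l2_inner_cdot)
next
  case False
  define a where "a = l2_inner T f g"
  define c where "c = a / of_real ((l2_norm T g)\<^sup>2)"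
  have "0 \<le> (l2_norm T (\<lambda>t. f t - c *s g t))\<^sup>2" by simp
  also have "\<dots> = (l2_norm T f)\<^sup>2 - 2 * Re (cnj c * a) + (cmod c)\<^sup>2 * (l2_norm T g)\<^sup>2"
    using assms by (simp add: l2_norm_diff_power2 L2_smult l2_inner_smult_right l2_norm_smult
        power_mult_distrib a_def)
  also have "Re (cnj c * a) = (cmod a)\<^sup>2 / (l2_norm T g)\<^sup>2"
    unfolding c_def by (simp add: complex_mult_cnj cmod_def power2_eq_square[of "Re a"]
        power2_eq_square[of "Im a"] add_divide_distrib)
  also have "(cmod c)\<^sup>2 * (l2_norm T g)\<^sup>2 = (cmod a)\<^sup>2 / (l2_norm T g)\<^sup>2"
    using False by (simp add: c_def norm_divide norm_mult power_divide power2_eq_square)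
  finally have "(cmod a)\<^sup>2 / (l2_norm T g)\<^sup>2 \<le> (l2_norm T f)\<^sup>2" by simp
  moreover have "0 < (l2_norm T g)\<^sup>2" using False by simp
  ultimately have "(cmod a)\<^sup>2 \<le> (l2_norm T f * l2_norm T g)\<^sup>2"
    by (simp add: pos_divide_le_eq power_mult_distrib)
  then show ?thesis unfolding a_def by (rule power2_le_imp_le) simp
qed

lemma l2_norm_triangle:
  assumes "f \<in> L2 T" "g \<in> L2 T"
  shows "l2_norm T (\<lambda>t. f t + g t) \<le> l2_norm T f + l2_norm T g"
proof (rule power2_le_imp_le)
  have "(l2_norm T (\<lambda>t. f t - (-1) *s g t))\<^sup>2
      = (l2_norm T f)\<^sup>2 - 2 * Re (l2_inner T f (\<lambda>t. (-1) *s g t)) + (l2_norm T g)\<^sup>2"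
    using assms by (subst l2_norm_diff_power2) (simp_all only: L2_smult l2_norm_smult, simp)
  also have "\<dots> = (l2_norm T f)\<^sup>2 + 2 * Re (l2_inner T f g) + (l2_norm T g)\<^sup>2"
    by (subst l2_inner_smult_right) simp
  also have "\<dots> \<le> (l2_norm T f + l2_norm T g)\<^sup>2"
    using l2_Cauchy_Schwarz[OF assms] complex_Re_le_cmod[of "l2_inner T f g"] by (simp add: power2_sum)
  finally show "(l2_norm T (\<lambda>t. f t + g t))\<^sup>2 \<le> (l2_norm T f + l2_norm T g)\<^sup>2"
    by simp
qed simp

lemma l2_norm_bounded:
  assumes "f \<in> borel_measurable (leb_upto T)" "\<And>t. t \<in> {0..T} \<Longrightarrow> norm (f t) \<le> C" "0 \<le> T" "0 \<le> C"
  shows "l2_norm T f \<le> C * sqrt T"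
proof -
  have "(LINT t|leb_upto T. (norm (f t))\<^sup>2) \<le> (LINT t|leb_upto T. C\<^sup>2)"
    using assms L2_bounded[of f T C] integrable_leb_upto_bounded[of "\<lambda>_. C\<^sup>2" T "C\<^sup>2"]
    by (intro integral_mono) (auto simp: L2_def intro!: power_mono)
  also have "\<dots> = C\<^sup>2 * T"
    using assms(3) by (simp add: measure_restrict_space)
  finally have "l2_norm T f \<le> sqrt (C\<^sup>2 * T)"
    by (simp add: l2_norm_def)
  with assms show ?thesis by (simp add: real_sqrt_mult)
qed

text \<open>Cauchy-Schwarz for |f| against the constant 1.\<close>

lemma L1_le_l2_norm:
  assumes "f \<in> L2 T" "0 \<le> T"
  shows "(LINT t|leb_upto T. norm (f t)) \<le> sqrt T * l2_norm T f"
proof -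
  \<comment> \<open>\<open>l2_inner\<close> takes vector-valued arguments only, so the two scalar
    functions are placed in one-dimensional vectors.\<close>
  define g h :: "real \<Rightarrow> complex ^ 1" where "g = (\<lambda>t. \<chi> i. of_real (norm (f t)))" and "h = (\<lambda>_. \<chi> i. 1)"
  have nv: "norm (\<chi> i. c :: complex ^ 1) = cmod c" for c
    by (simp add: norm_vec_def L2_set_def)
  have [measurable]: "f \<in> borel_measurable (leb_upto T)" using assms by (simp add: L2_def)
  have "g = (\<lambda>t. complex_of_real (norm (f t)) *s (\<chi> i. 1))" by (auto simp: g_def vec_eq_iff fun_eq_iff)
  then have gm: "g \<in> borel_measurable (leb_upto T)"
    by simp (rule borel_measurable_bilinear[OF bounded_bilinear_smult], measurable)
  have gL: "g \<in> L2 T" using gm assms by (auto simp: L2_def g_def nv)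
  have hL: "h \<in> L2 T" by (rule L2_bounded[of _ _ 1]) (auto simp: h_def nv)
  have "l2_inner T g h = (LINT t|leb_upto T. of_real (norm (f t)))"
    by (simp add: l2_inner_def g_def h_def)
  also have "\<dots> = of_real (LINT t|leb_upto T. norm (f t))" by simp
  finally have "cmod (l2_inner T g h) = (LINT t|leb_upto T. norm (f t))" by simp
  moreover have "l2_norm T h \<le> 1 * sqrt T"
    by (rule l2_norm_bounded) (auto simp: h_def nv assms)
  moreover have "l2_norm T g = l2_norm T f" by (simp add: l2_norm_def g_def nv)
  ultimately show ?thesis
    using l2_Cauchy_Schwarz[OF gL hL] mult_right_mono[OF \<open>l2_norm T h \<le> 1 * sqrt T\<close>, of "l2_norm T f"]
    by (simp add: mult.commute)
qed

text \<open>Riesz-Fischer for a rapidly converging sequence. The increments have summable L1 norms,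
  hence are absolutely summable almost everywhere, which yields a pointwise limit; Fatou's lemma
  turns it into a limit in norm.\<close>

lemma l2_complete:
  fixes g :: "nat \<Rightarrow> ('n::finite) vfun"
  assumes T: "0 \<le> T" and gL: "\<And>n. g n \<in> L2 T"
    and close: "\<And>n. l2_norm T (\<lambda>t. g (Suc n) t - g n t) \<le> (1/2) ^ n"
  obtains h where "h \<in> L2 T" "(\<lambda>n. l2_norm T (\<lambda>t. g n t - h t)) \<longlonglongrightarrow> 0"
proof -
  define d where "d n t = g (Suc n) t - g n t" for n t
  have gm [measurable]: "g n \<in> borel_measurable (leb_upto T)" for n
    using gL by (simp add: L2_measurable)
  have dL: "d n \<in> L2 T" for n
    unfolding d_def by (intro L2_diff gL)
  then have [measurable]: "d n \<in> borel_measurable (leb_upto T)" for n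
    by (simp add: L2_measurable)
  \<comment> \<open>The right-hand side is the exact geometric sum, kept in this form so that the
    induction on k closes.\<close>
  have dist: "l2_norm T (\<lambda>t. g (n + k) t - g n t) \<le> 2 * (1/2) ^ n - 2 * (1/2) ^ (n + k)" for n k
  proof (induction k)
    case (Suc k)
    have "l2_norm T (\<lambda>t. d (n + k) t + (g (n + k) t - g n t))
        \<le> l2_norm T (d (n + k)) + l2_norm T (\<lambda>t. g (n + k) t - g n t)"
      by (intro l2_norm_triangle dL L2_diff gL)
    also have "\<dots> \<le> (1/2) ^ (n + k) + (2 * (1/2) ^ n - 2 * (1/2) ^ (n + k))"
      using close[of "n + k"] Suc by (intro add_mono) (auto simp: d_def[abs_def])
    finally show ?case by (simp add: d_def)
  qed simp
  have "(\<integral>\<^sup>+ t. (\<Sum>n. ennreal (norm (d n t))) \<partial>leb_upto T) = (\<Sum>n. \<integral>\<^sup>+ t. ennreal (norm (d n t)) \<partial>leb_upto T)"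
    by (rule nn_integral_suminf) measurable
  also have "\<dots> \<le> (\<Sum>n. ennreal (sqrt T * (1/2) ^ n))"
  proof (rule suminf_le)
    fix n
    have "(\<integral>\<^sup>+ t. ennreal (norm (d n t)) \<partial>leb_upto T) = ennreal (LINT t|leb_upto T. norm (d n t))"
      using L2_integrable[OF dL[of n]] by (intro nn_integral_eq_integral) auto
    also have "\<dots> \<le> ennreal (sqrt T * l2_norm T (d n))"
      using L1_le_l2_norm[OF dL T] by (rule ennreal_leI)
    also have "\<dots> \<le> ennreal (sqrt T * (1/2) ^ n)"
      using close[of n] T by (intro ennreal_leI mult_left_mono) (auto simp: d_def[abs_def])
    finally show "(\<integral>\<^sup>+ t. ennreal (norm (d n t)) \<partial>leb_upto T) \<le> ennreal (sqrt T * (1/2) ^ n)" .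
  qed auto
  also have "\<dots> = ennreal (\<Sum>n. sqrt T * (1/2) ^ n)"
    using T by (intro suminf_ennreal2) (auto intro!: summable_mult summable_geometric)
  also have "\<dots> < \<infinity>" by simp
  finally have "(\<integral>\<^sup>+ t. (\<Sum>n. ennreal (norm (d n t))) \<partial>leb_upto T) \<noteq> \<infinity>" by simp
  then have "AE t in leb_upto T. (\<Sum>n. ennreal (norm (d n t))) \<noteq> \<infinity>"
    by (intro nn_integral_PInf_AE) measurable
  then have conv: "AE t in leb_upto T. convergent (\<lambda>n. g n t)"
  proof eventually_elim
    case (elim t)
    then have "summable (\<lambda>n. norm (d n t))"
      by (intro summable_suminf_not_top) auto
    then have "summable (\<lambda>n. d n t)" by (rule summable_norm_cancel)
    then have "convergent (\<lambda>n. \<Sum>k<n. g (Suc k) t - g k t)"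
      by (simp add: summable_iff_convergent d_def)
    then have "convergent (\<lambda>n. g n t - g 0 t)"
      by (subst (asm) sum_lessThan_telescope)
    then show ?case
      using convergent_add[OF _ convergent_const[of "g 0 t"]] by fastforce
  qed
  define h where "h t = lim (\<lambda>n. g n t)" for t
  have hm [measurable]: "h \<in> borel_measurable (leb_upto T)"
    unfolding h_def by (rule borel_measurable_lim_metric) measurable
  have lim: "AE t in leb_upto T. (\<lambda>n. g n t) \<longlonglongrightarrow> h t"
    using conv by eventually_elim (simp add: h_def convergent_LIMSEQ_iff)
  \<comment> \<open>Fatou is applied in k with n fixed: the norms of \<open>g (n + k) - g n\<close>
    are bounded uniformly in k by \<open>dist\<close>.\<close>
  have bound: "(\<integral>\<^sup>+ t. ennreal ((norm (g n t - h t))\<^sup>2) \<partial>leb_upto T) \<le> ennreal ((2 * (1/2) ^ n)\<^sup>2)" for n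
  proof -
    have "(\<integral>\<^sup>+ t. ennreal ((norm (g n t - h t))\<^sup>2) \<partial>leb_upto T)
        = (\<integral>\<^sup>+ t. liminf (\<lambda>k. ennreal ((norm (g (n + k) t - g n t))\<^sup>2)) \<partial>leb_upto T)"
    proof (rule nn_integral_cong_AE)
      show "AE t in leb_upto T. ennreal ((norm (g n t - h t))\<^sup>2)
          = liminf (\<lambda>k. ennreal ((norm (g (n + k) t - g n t))\<^sup>2))"
        using lim
      proof eventually_elim
        case (elim t)
        then have "(\<lambda>k. g (n + k) t) \<longlonglongrightarrow> h t"
          using LIMSEQ_ignore_initial_segment[of "\<lambda>n. g n t" "h t" n] by (simp add: add.commute)
        then have "(\<lambda>k. ennreal ((norm (g (n + k) t - g n t))\<^sup>2)) \<longlonglongrightarrow> ennreal ((norm (h t - g n t))\<^sup>2)"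
          by (intro tendsto_ennrealI tendsto_intros)
        then show ?case
          by (subst lim_imp_Liminf) (simp_all only: trivial_limit_sequentially norm_minus_commute not_False_eq_True)
      qed
    qed
    also have "\<dots> \<le> liminf (\<lambda>k. \<integral>\<^sup>+ t. ennreal ((norm (g (n + k) t - g n t))\<^sup>2) \<partial>leb_upto T)"
      by (rule nn_integral_liminf) measurable
    also have "\<dots> \<le> ennreal ((2 * (1/2) ^ n)\<^sup>2)"
    proof (rule order_trans[OF Liminf_le_Limsup Limsup_bounded[OF always_eventually]], simp, rule allI)
      fix k
      have "(\<integral>\<^sup>+ t. ennreal ((norm (g (n + k) t - g n t))\<^sup>2) \<partial>leb_upto T)
          = ennreal ((l2_norm T (\<lambda>t. g (n + k) t - g n t))\<^sup>2)"
        unfolding l2_norm_power2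
        using L2_diff[OF gL[of "n + k"] gL[of n]] by (intro nn_integral_eq_integral) (auto simp: L2_def)
      also have "\<dots> \<le> ennreal ((2 * (1/2) ^ n)\<^sup>2)"
      proof (intro ennreal_leI power_mono)
        have "0 \<le> 2 * (1/2::real) ^ (n + k)" by simp
        then show "l2_norm T (\<lambda>t. g (n + k) t - g n t) \<le> 2 * (1/2) ^ n"
          using dist[of n k] by linarith
      qed simp
      finally show "(\<integral>\<^sup>+ t. ennreal ((norm (g (n + k) t - g n t))\<^sup>2) \<partial>leb_upto T) \<le> ennreal ((2 * (1/2) ^ n)\<^sup>2)" .
    qed
    finally show ?thesis .
  qed
  have diffL: "(\<lambda>t. g n t - h t) \<in> L2 T" for n
  proof -
    have "(\<integral>\<^sup>+ t. ennreal (norm ((norm (g n t - h t))\<^sup>2)) \<partial>leb_upto T) < \<infinity>"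
      using le_less_trans[OF bound[of n] ennreal_less_top] by simp
    then show ?thesis by (simp add: L2_def integrable_iff_bounded)
  qed
  have "(\<lambda>t. g 0 t - (g 0 t - h t)) \<in> L2 T" by (intro L2_diff gL diffL)
  then have hL: "h \<in> L2 T" by simp
  have nb: "l2_norm T (\<lambda>t. g n t - h t) \<le> 2 * (1/2) ^ n" for n
  proof (rule power2_le_imp_le)
    have "ennreal ((l2_norm T (\<lambda>t. g n t - h t))\<^sup>2) \<le> ennreal ((2 * (1/2) ^ n)\<^sup>2)"
      using bound[of n] nn_integral_eq_integral[OF L2_integrable_norm2[OF diffL[of n]]]
      unfolding l2_norm_power2 by simp
    then show "(l2_norm T (\<lambda>t. g n t - h t))\<^sup>2 \<le> (2 * (1/2) ^ n)\<^sup>2"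
      by (subst (asm) ennreal_le_iff) auto
  qed simp
  have "(\<lambda>n. 2 * (1/2::real) ^ n) \<longlonglongrightarrow> 2 * 0"
    by (intro tendsto_mult tendsto_const LIMSEQ_power_zero) auto
  then have "(\<lambda>n. 2 * (1/2::real) ^ n) \<longlonglongrightarrow> 0" by simp
  then have "(\<lambda>n. l2_norm T (\<lambda>t. g n t - h t)) \<longlonglongrightarrow> 0"
    by (rule Lim_null_comparison[rotated]) (simp add: nb)
  with hL show ?thesis by (rule that)
qed

section \<open>Orthonormal sets, Bessel and Parseval\<close>

definition orthonormal_set :: "real \<Rightarrow> ('n::finite) vfun set \<Rightarrow> bool" where
  "orthonormal_set T B \<longleftrightarrow> B \<subseteq> L2 T \<and> (\<forall>e\<in>B. \<forall>e'\<in>B. l2_inner T e e' = (if e = e' then 1 else 0))"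

definition fourier_sum :: "real \<Rightarrow> ('n::finite) vfun set \<Rightarrow> 'n vfun \<Rightarrow> 'n vfun" where
  "fourier_sum T S f = (\<lambda>t. \<Sum>e\<in>S. l2_inner T f e *s e t)"

lemma orthonormal_basis_iff: "orthonormal_basis T B \<longleftrightarrow> orthonormal_set T B \<and>
     (\<forall>f\<in>L2 T. (\<forall>e\<in>B. l2_inner T f e = 0) \<longrightarrow> l2_eq T f (\<lambda>_. 0))"
  by (auto simp: orthonormal_basis_def orthonormal_set_def)

lemma orthonormal_subset: "orthonormal_set T B \<Longrightarrow> S \<subseteq> B \<Longrightarrow> orthonormal_set T S"
  unfolding orthonormal_set_def by blast

lemma fourier_sum_L2: "orthonormal_set T S \<Longrightarrow> fourier_sum T S f \<in> L2 T"
  unfolding fourier_sum_def by (intro L2_sum L2_smult) (auto simp: orthonormal_set_def)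

lemma fourier_sum_inner_left:
  assumes "orthonormal_set T S" "g \<in> L2 T"
  shows "l2_inner T (fourier_sum T S f) g = (\<Sum>e\<in>S. l2_inner T f e * l2_inner T e g)"
  unfolding fourier_sum_def using assms
  by (subst l2_inner_sum_left) (auto simp: orthonormal_set_def l2_inner_smult_left intro!: L2_smult)

lemma fourier_sum_inner_basis:
  assumes "orthonormal_set T B" "finite S" "S \<subseteq> B" "e \<in> B"
  shows "l2_inner T (fourier_sum T S f) e = (if e \<in> S then l2_inner T f e else 0)"
proof -
  have "l2_inner T (fourier_sum T S f) e = (\<Sum>e'\<in>S. l2_inner T f e' * l2_inner T e' e)"
    by (rule fourier_sum_inner_left[OF orthonormal_subset[OF assms(1,3)]])
      (use assms in \<open>auto simp: orthonormal_set_def\<close>)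
  also have "\<dots> = (\<Sum>e'\<in>S. if e' = e then l2_inner T f e else 0)"
    using assms by (intro sum.cong) (auto simp: orthonormal_set_def)
  finally show ?thesis using assms by simp
qed

lemma norm_fourier_sum:
  assumes "orthonormal_set T S" "finite S"
  shows "(l2_norm T (fourier_sum T S f))\<^sup>2 = (\<Sum>e\<in>S. (cmod (l2_inner T f e))\<^sup>2)"
proof -
  let ?p = "fourier_sum T S f"
  have "of_real ((l2_norm T ?p)\<^sup>2) = l2_inner T ?p ?p"
    by (simp add: l2_inner_self)
  also have "\<dots> = (\<Sum>e\<in>S. l2_inner T f e * l2_inner T e ?p)"
    using assms by (intro fourier_sum_inner_left fourier_sum_L2)
  also have "\<dots> = (\<Sum>e\<in>S. l2_inner T f e * cnj (l2_inner T f e))"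
    using assms by (intro sum.cong refl) (simp add: l2_inner_cnj[of T _ ?p] fourier_sum_inner_basis[of T S])
  also have "\<dots> = of_real (\<Sum>e\<in>S. (cmod (l2_inner T f e))\<^sup>2)"
    by (simp add: complex_norm_square[symmetric] del: of_real_power)
  finally show ?thesis by (simp only: of_real_eq_iff)
qed

text \<open>Pythagoras. The right-hand side decreases when S grows, which is how one good finite set
  controls all larger ones in \<open>Parseval\<close>.\<close>

lemma norm_diff_fourier_sum:
  assumes "orthonormal_set T S" "finite S" "f \<in> L2 T"
  shows "(l2_norm T (\<lambda>t. f t - fourier_sum T S f t))\<^sup>2
    = (l2_norm T f)\<^sup>2 - (\<Sum>e\<in>S. (cmod (l2_inner T f e))\<^sup>2)"
proof -
  let ?p = "fourier_sum T S f"
  have "l2_inner T f ?p = cnj (\<Sum>e\<in>S. l2_inner T f e * l2_inner T e f)"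
    using assms by (subst l2_inner_cnj) (simp add: fourier_sum_inner_left)
  also have "(\<Sum>e\<in>S. l2_inner T f e * l2_inner T e f) = of_real (\<Sum>e\<in>S. (cmod (l2_inner T f e))\<^sup>2)"
    by (subst (2) l2_inner_cnj) (simp add: complex_norm_square[symmetric] del: of_real_power)
  finally have "Re (l2_inner T f ?p) = (\<Sum>e\<in>S. (cmod (l2_inner T f e))\<^sup>2)" by simp
  then show ?thesis
    using assms by (simp add: l2_norm_diff_power2 fourier_sum_L2 norm_fourier_sum)
qed

lemma Bessel_inequality:
  assumes "orthonormal_set T S" "finite S" "f \<in> L2 T"
  shows "(\<Sum>e\<in>S. (cmod (l2_inner T f e))\<^sup>2) \<le> (l2_norm T f)\<^sup>2"
  using norm_diff_fourier_sum[OF assms] zero_le_power2[of "l2_norm T (\<lambda>t. f t - fourier_sum T S f t)"]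
  by linarith

text \<open>Cauchy-Schwarz for finite sums with Bessel's inequality for each factor. The bound does
  not depend on S; it is the dominating term in the later exchanges of limits.\<close>

lemma Bessel_bilinear:
  assumes S: "orthonormal_set T S" "finite S" and L: "f \<in> L2 T" "g \<in> L2 T"
  shows "(\<Sum>e\<in>S. cmod (l2_inner T f e * l2_inner T e g)) \<le> l2_norm T f * l2_norm T g"
proof -
  have "(\<Sum>e\<in>S. cmod (l2_inner T f e * l2_inner T e g))
      = (\<Sum>e\<in>S. \<bar>cmod (l2_inner T f e)\<bar> * \<bar>cmod (l2_inner T g e)\<bar>)"
    by (intro sum.cong refl) (simp add: norm_mult l2_inner_cnj[of T g])
  also have "\<dots> \<le> L2_set (\<lambda>e. cmod (l2_inner T f e)) S * L2_set (\<lambda>e. cmod (l2_inner T g e)) S"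
    by (rule L2_set_mult_ineq)
  also have "\<dots> \<le> l2_norm T f * l2_norm T g"
    using Bessel_inequality[OF S L(1)] Bessel_inequality[OF S L(2)]
    by (intro mult_mono) (auto simp: L2_set_def intro!: real_le_lsqrt sum_nonneg)
  finally show ?thesis .
qed

text \<open>B is a set without enumeration, so a sequence is produced by hand: finite subsets whose
  Bessel sums approach the supremum. Their Fourier sums converge to some h, and f - h is orthogonal
  to B, hence null by the definition of a basis.\<close>

lemma orthonormal_basis_approx:
  assumes T: "0 \<le> T" and B: "orthonormal_basis T B" and fL: "f \<in> L2 T" and "\<epsilon> > 0"
  obtains S where "finite S" "S \<subseteq> B" "l2_norm T (\<lambda>t. f t - fourier_sum T S f t) < \<epsilon>"
proof -
  have ON: "orthonormal_set T B" using B by (simp add: orthonormal_basis_iff)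
  have quarter: "(1/4::real) ^ n = ((1/2) ^ n)\<^sup>2" for n
    by (simp add: power2_eq_square flip: power_mult_distrib)
  define c where "c e = (cmod (l2_inner T f e))\<^sup>2" for e
  define s where "s = (SUP S\<in>{S. finite S \<and> S \<subseteq> B}. sum c S)"
  have bdd: "bdd_above (sum c ` {S. finite S \<and> S \<subseteq> B})"
    using Bessel_inequality[OF orthonormal_subset[OF ON] _ fL]
    unfolding c_def by (intro bdd_aboveI[of _ "(l2_norm T f)\<^sup>2"]) auto
  have le_s: "sum c S \<le> s" if "finite S" "S \<subseteq> B" for S
    unfolding s_def using that by (intro cSUP_upper bdd) auto
  \<comment> \<open>The defect (1/4)^n of the squared norms becomes (1/2)^n for the norms, as
    \<open>l2_complete\<close> asks.\<close>
  have "\<exists>S. finite S \<and> S \<subseteq> B \<and> s - (1/4) ^ n < sum c S" for n :: nat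
  proof -
    have "s - (1/4) ^ n < (SUP S\<in>{S. finite S \<and> S \<subseteq> B}. sum c S)" by (simp add: s_def)
    then have "\<exists>S\<in>{S. finite S \<and> S \<subseteq> B}. s - (1/4) ^ n < sum c S"
      by (subst (asm) less_cSUP_iff[OF _ bdd]) auto
    then show ?thesis by auto
  qed
  then obtain S' where S': "\<And>n. finite (S' n)" "\<And>n. S' n \<subseteq> B" "\<And>n::nat. s - (1/4) ^ n < sum c (S' n)"
    by metis
  \<comment> \<open>Nested sets make consecutive Fourier sums differ by a Fourier sum over the set
    difference.\<close>
  define S where "S n = (\<Union>i\<le>n. S' i)" for n
  have S: "finite (S n)" "S n \<subseteq> B" "S n \<subseteq> S (Suc n)" for n
    using S' unfolding S_def by (auto simp: atMost_Suc)
  have Sc: "s - (1/4) ^ n < sum c (S n)" for n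
    by (rule less_le_trans[OF S'(3) sum_mono2]) (use S(1) in \<open>auto simp: S_def c_def\<close>)
  define g where "g n = fourier_sum T (S n) f" for n
  have gL: "g n \<in> L2 T" for n
    unfolding g_def by (rule fourier_sum_L2[OF orthonormal_subset[OF ON S(2)]])
  have "l2_norm T (\<lambda>t. g (Suc n) t - g n t) \<le> (1/2) ^ n" for n
  proof (rule power2_le_imp_le)
    have "(\<lambda>t. g (Suc n) t - g n t) = fourier_sum T (S (Suc n) - S n) f"
      using S by (auto simp: g_def fourier_sum_def sum_diff)
    then have "(l2_norm T (\<lambda>t. g (Suc n) t - g n t))\<^sup>2 = sum c (S (Suc n) - S n)"
      using norm_fourier_sum[of T "S (Suc n) - S n" f] orthonormal_subset[OF ON, of "S (Suc n) - S n"] S[of "Suc n"]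
      by (auto simp: c_def)
    also have "\<dots> = sum c (S (Suc n)) - sum c (S n)" using S by (simp add: sum_diff)
    also have "\<dots> \<le> (1/4) ^ n" using Sc[of n] le_s[OF S(1,2)[of "Suc n"]] by linarith
    also have "\<dots> = ((1/2) ^ n)\<^sup>2" by (rule quarter)
    finally show "(l2_norm T (\<lambda>t. g (Suc n) t - g n t))\<^sup>2 \<le> ((1/2) ^ n)\<^sup>2" .
  qed simp
  from l2_complete[OF T gL this] obtain h where hL: "h \<in> L2 T"
    and lim: "(\<lambda>n. l2_norm T (\<lambda>t. g n t - h t)) \<longlonglongrightarrow> 0" by blast
  have "l2_inner T (\<lambda>t. f t - h t) e = 0" if e: "e \<in> B" for e
  proof -
    have eL: "e \<in> L2 T" using e ON by (auto simp: orthonormal_set_def)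
    have "complex_of_real ((l2_norm T e)\<^sup>2) = of_real 1"
      using ON e unfolding l2_inner_self[symmetric] by (simp add: orthonormal_set_def)
    then have "(l2_norm T e)\<^sup>2 = 1" by (simp only: of_real_eq_iff)
    then have n1: "l2_norm T e = 1" using l2_norm_nonneg[of T e] by (simp add: power2_eq_1_iff)
    have "cmod (l2_inner T (\<lambda>t. f t - h t) e) \<le> (1/2) ^ n + l2_norm T (\<lambda>t. g n t - h t)" for n
    proof -
      have "l2_inner T (\<lambda>t. f t - h t) e = l2_inner T (\<lambda>t. f t - g n t) e + l2_inner T (\<lambda>t. g n t - h t) e"
        using fL gL hL eL by (simp add: l2_inner_diff_left)
      moreover have "cmod (l2_inner T (\<lambda>t. g n t - h t) e) \<le> l2_norm T (\<lambda>t. g n t - h t)"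
        using l2_Cauchy_Schwarz[OF L2_diff[OF gL hL] eL] n1 by simp
      moreover have "cmod (l2_inner T (\<lambda>t. f t - g n t) e) \<le> (1/2) ^ n"
      \<comment> \<open>If e belongs to \<open>S n\<close>, the coefficient of f - g n at e is zero.
        Otherwise adding e to \<open>S n\<close> cannot push the sum beyond the supremum s, so the
        coefficient is at most (1/2)^n.\<close>
      proof (cases "e \<in> S n")
        case True
        then show ?thesis
          using fL gL eL fourier_sum_inner_basis[OF ON S(1,2) e, of n f] by (simp add: l2_inner_diff_left g_def)
      next
        case False
        then have "l2_inner T (\<lambda>t. f t - g n t) e = l2_inner T f e"
          using fL gL eL fourier_sum_inner_basis[OF ON S(1,2) e, of n f] by (simp add: l2_inner_diff_left g_def)
        moreover have "c e + sum c (S n) \<le> s"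
          using le_s[of "insert e (S n)"] S[of n] e False by simp
        ultimately have "(cmod (l2_inner T (\<lambda>t. f t - g n t) e))\<^sup>2 \<le> (1/4) ^ n"
          using Sc[of n] by (simp add: c_def)
        also have "(1/4::real) ^ n = ((1/2) ^ n)\<^sup>2" by (rule quarter)
        finally show ?thesis by (rule power2_le_imp_le) simp
      qed
      ultimately show ?thesis
        using norm_triangle_ineq[of "l2_inner T (\<lambda>t. f t - g n t) e" "l2_inner T (\<lambda>t. g n t - h t) e"] by simp
    qed
    moreover have "(\<lambda>n. (1/2::real) ^ n + l2_norm T (\<lambda>t. g n t - h t)) \<longlonglongrightarrow> 0 + 0"
      by (intro tendsto_add lim LIMSEQ_power_zero) auto
    ultimately have "cmod (l2_inner T (\<lambda>t. f t - h t) e) \<le> 0"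
      by (intro LIMSEQ_le_const[of _ 0]) (auto intro!: exI[of _ 0])
    then show ?thesis by simp
  qed
  then have "l2_eq T (\<lambda>t. f t - h t) (\<lambda>_. 0)"
    using B L2_diff[OF fL hL] by (auto simp: orthonormal_basis_def)
  then have fh: "l2_norm T (\<lambda>t. f t - h t) = 0"
    using l2_norm_eq_0_iff[OF L2_diff[OF fL hL]] by simp
  from order_tendstoD(2)[OF lim \<open>\<epsilon> > 0\<close>] obtain n where n: "l2_norm T (\<lambda>t. g n t - h t) < \<epsilon>"
    unfolding eventually_sequentially by auto
  have "l2_norm T (\<lambda>t. (f t - h t) + (h t - g n t)) \<le> l2_norm T (\<lambda>t. f t - h t) + l2_norm T (\<lambda>t. h t - g n t)"
    by (intro l2_norm_triangle L2_diff fL gL hL)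
  then have "l2_norm T (\<lambda>t. f t - g n t) < \<epsilon>"
    using fh n l2_norm_minus_commute[of T "g n" h] by simp
  with S show ?thesis by (intro that[of "S n"]) (auto simp: g_def)
qed

lemma Parseval:
  assumes T: "0 \<le> T" and B: "orthonormal_basis T B" and L: "f \<in> L2 T" "g \<in> L2 T"
  shows "((\<lambda>e. l2_inner T f e * l2_inner T e g) has_sum l2_inner T f g) B"
  unfolding has_sum_def tendsto_iff eventually_finite_subsets_at_top
proof (intro allI impI)
  have ON: "orthonormal_set T B" using B by (simp add: orthonormal_basis_iff)
  fix \<epsilon> :: real assume "\<epsilon> > 0"
  define \<delta> where "\<delta> = \<epsilon> / (l2_norm T g + 1)"
  have g1: "l2_norm T g + 1 > 0" using l2_norm_nonneg[of T g] by linarith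
  then have "\<delta> > 0" using \<open>\<epsilon> > 0\<close> by (simp add: \<delta>_def)
  then obtain S where S: "finite S" "S \<subseteq> B" "l2_norm T (\<lambda>t. f t - fourier_sum T S f t) < \<delta>"
    using orthonormal_basis_approx[OF T B L(1)] by blast
  have "dist (\<Sum>e\<in>S'. l2_inner T f e * l2_inner T e g) (l2_inner T f g) < \<epsilon>"
    if S': "finite S'" "S \<subseteq> S'" "S' \<subseteq> B" for S'
  proof -
    have "(l2_norm T (\<lambda>t. f t - fourier_sum T S' f t))\<^sup>2 \<le> (l2_norm T (\<lambda>t. f t - fourier_sum T S f t))\<^sup>2"
      using S S' L orthonormal_subset[OF ON] by (simp add: norm_diff_fourier_sum sum_mono2)
    then have le: "l2_norm T (\<lambda>t. f t - fourier_sum T S' f t) < \<delta>"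
      using S(3) power2_le_imp_le[OF _ l2_norm_nonneg] by fastforce
    have FL: "fourier_sum T S' f \<in> L2 T" by (rule fourier_sum_L2[OF orthonormal_subset[OF ON S'(3)]])
    have "l2_inner T f g - (\<Sum>e\<in>S'. l2_inner T f e * l2_inner T e g)
        = l2_inner T (\<lambda>t. f t - fourier_sum T S' f t) g"
      using FL L fourier_sum_inner_left[OF orthonormal_subset[OF ON S'(3)] L(2)] by (simp add: l2_inner_diff_left)
    then have "dist (\<Sum>e\<in>S'. l2_inner T f e * l2_inner T e g) (l2_inner T f g)
        \<le> l2_norm T (\<lambda>t. f t - fourier_sum T S' f t) * l2_norm T g"
      using l2_Cauchy_Schwarz[OF L2_diff[OF L(1) FL] L(2)] by (simp add: dist_norm norm_minus_commute)
    also have "\<dots> \<le> \<delta> * l2_norm T g"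
      using le by (intro mult_right_mono) auto
    also have "\<dots> < \<delta> * (l2_norm T g + 1)" using \<open>\<delta> > 0\<close> by simp
    also have "\<dots> = \<epsilon>" using g1 by (simp add: \<delta>_def)
    finally show ?thesis .
  qed
  with S show "\<exists>X. finite X \<and> X \<subseteq> B \<and> (\<forall>Y. finite Y \<and> X \<subseteq> Y \<and> Y \<subseteq> B \<longrightarrow>
      dist (\<Sum>e\<in>Y. l2_inner T f e * l2_inner T e g) (l2_inner T f g) < \<epsilon>)"
    by blast
qed

section \<open>Nuclear operators and their trace\<close>

definition nuclear_rep :: "real \<Rightarrow> (('n::finite) vfun \<Rightarrow> 'n vfun) \<Rightarrow> (nat \<Rightarrow> 'n vfun) \<Rightarrow> (nat \<Rightarrow> 'n vfun) \<Rightarrow> bool" where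
  "nuclear_rep T A u v \<longleftrightarrow> range u \<subseteq> L2 T \<and> range v \<subseteq> L2 T \<and>
     summable (\<lambda>k. l2_norm T (u k) * l2_norm T (v k)) \<and> (\<forall>f\<in>L2 T. A f \<in> L2 T) \<and>
     (\<forall>f\<in>L2 T. (\<lambda>N. l2_norm T (\<lambda>t. A f t - (\<Sum>k<N. l2_inner T f (u k) *s v k t))) \<longlonglongrightarrow> 0)"

lemma trace_class_iff: "trace_class T A \<longleftrightarrow> (\<exists>u v. nuclear_rep T A u v)"
proof
  assume "trace_class T A"
  then obtain u v where "\<forall>f\<in>L2 T. A f \<in> L2 T" "range u \<subseteq> L2 T" "range v \<subseteq> L2 T"
      "summable (\<lambda>k. l2_norm T (u k) * l2_norm T (v k))"
      "\<forall>f\<in>L2 T. (\<lambda>N. l2_norm T (\<lambda>t. A f t - (\<Sum>k<N. l2_inner T f (u k) *s v k t))) \<longlonglongrightarrow> 0"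
    unfolding trace_class_def by blast
  then have "nuclear_rep T A u v" by (simp add: nuclear_rep_def)
  then show "\<exists>u v. nuclear_rep T A u v" by blast
next
  assume "\<exists>u v. nuclear_rep T A u v"
  then obtain u v where "nuclear_rep T A u v" by blast
  then show "trace_class T A"
    unfolding trace_class_def nuclear_rep_def
    by (intro conjI exI[of _ u] exI[of _ v]) simp_all
qed

lemma nuclear_repD:
  fixes f :: "('n::finite) vfun" and A :: "'n vfun \<Rightarrow> 'n vfun"
  assumes "nuclear_rep T A u v"
  shows "u k \<in> L2 T" "v k \<in> L2 T" "summable (\<lambda>k. l2_norm T (u k) * l2_norm T (v k))"
    "f \<in> L2 T \<Longrightarrow> A f \<in> L2 T"
    "f \<in> L2 T \<Longrightarrow> (\<lambda>N. l2_norm T (\<lambda>t. A f t - (\<Sum>k<N. l2_inner T f (u k) *s v k t))) \<longlonglongrightarrow> 0"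
  using assms unfolding nuclear_rep_def by blast+

text \<open>For each k, Parseval gives the trace of the k-th rank one operator in the basis B.
  Summation over k and over B may be exchanged by Tannery's theorem along the finite subsets of B,
  because \<open>Bessel_bilinear\<close> dominates the k-th term uniformly in the subset.\<close>

lemma nuclear_trace:
  assumes T: "0 \<le> T" and N: "nuclear_rep T A u v" and B: "orthonormal_basis T B"
  shows "((\<lambda>e. l2_inner T (A e) e) has_sum (\<Sum>k. l2_inner T (v k) (u k))) B"
proof -
  have ON: "orthonormal_set T B" using B by (simp add: orthonormal_basis_iff)
  have BL: "e \<in> L2 T" if "e \<in> B" for e using ON that by (auto simp: orthonormal_set_def)
  have L: "u k \<in> L2 T" "v k \<in> L2 T" for k using N by (auto simp: nuclear_rep_def)
  define a where "a k S = (\<Sum>e\<in>S. l2_inner T (v k) e * l2_inner T e (u k))" for k S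
  have sums: "(\<lambda>k. l2_inner T (v k) e * l2_inner T e (u k)) sums l2_inner T (A e) e" if e: "e \<in> B" for e
    unfolding sums_def LIM_zero_iff[symmetric, of _ "l2_inner T (A e) e"]
  proof (rule Lim_null_comparison)
    have AL: "A e \<in> L2 T" using N BL[OF e] by (auto simp: nuclear_rep_def)
    have PL: "(\<lambda>t. \<Sum>k<n. l2_inner T e (u k) *s v k t) \<in> L2 T" for n
      by (intro L2_sum L2_smult L)
    show "\<forall>\<^sub>F n in sequentially. norm ((\<Sum>k<n. l2_inner T (v k) e * l2_inner T e (u k)) - l2_inner T (A e) e)
        \<le> l2_norm T (\<lambda>t. A e t - (\<Sum>k<n. l2_inner T e (u k) *s v k t)) * l2_norm T e"
    proof (intro always_eventually allI)
      fix n
      have "(\<Sum>k<n. l2_inner T (v k) e * l2_inner T e (u k)) = l2_inner T (\<lambda>t. \<Sum>k<n. l2_inner T e (u k) *s v k t) e"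
        using L BL[OF e] by (subst l2_inner_sum_left) (auto intro: L2_smult simp: l2_inner_smult_left mult.commute)
      then have "l2_inner T (A e) e - (\<Sum>k<n. l2_inner T (v k) e * l2_inner T e (u k))
          = l2_inner T (\<lambda>t. A e t - (\<Sum>k<n. l2_inner T e (u k) *s v k t)) e"
        using AL PL BL[OF e] by (simp add: l2_inner_diff_left)
      then show "norm ((\<Sum>k<n. l2_inner T (v k) e * l2_inner T e (u k)) - l2_inner T (A e) e)
        \<le> l2_norm T (\<lambda>t. A e t - (\<Sum>k<n. l2_inner T e (u k) *s v k t)) * l2_norm T e"
        using l2_Cauchy_Schwarz[OF L2_diff[OF AL PL] BL[OF e]] by (simp add: norm_minus_commute)
    qed
    have "(\<lambda>n. l2_norm T (\<lambda>t. A e t - (\<Sum>k<n. l2_inner T e (u k) *s v k t)) * l2_norm T e) \<longlonglongrightarrow> 0 * l2_norm T e"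
      using N BL[OF e] by (intro tendsto_mult tendsto_const) (auto simp: nuclear_rep_def)
    then show "(\<lambda>n. l2_norm T (\<lambda>t. A e t - (\<Sum>k<n. l2_inner T e (u k) *s v k t)) * l2_norm T e) \<longlonglongrightarrow> 0"
      by simp
  qed
  have sumA: "(\<Sum>k. a k S) = (\<Sum>e\<in>S. l2_inner T (A e) e)" if "S \<subseteq> B" for S
  proof -
    have "(\<lambda>k. a k S) sums (\<Sum>e\<in>S. l2_inner T (A e) e)"
      unfolding a_def using that sums by (intro sums_sum) auto
    then show ?thesis by (rule sums_unique[symmetric])
  qed
  have bound: "norm (a k S) \<le> l2_norm T (u k) * l2_norm T (v k)" if "finite S" "S \<subseteq> B" for k S
    unfolding a_def
    by (rule order_trans[OF norm_sum])
      (use Bessel_bilinear[OF orthonormal_subset[OF ON that(2)] that(1) L(2) L(1)] in \<open>simp add: mult.commute\<close>)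
  have ev: "\<forall>\<^sub>F S in finite_subsets_at_top B. finite S \<and> S \<subseteq> B"
    by (auto simp: eventually_finite_subsets_at_top)
  have "((\<lambda>S. \<Sum>k. a k S) \<longlongrightarrow> (\<Sum>k. l2_inner T (v k) (u k))) (finite_subsets_at_top B)"
  proof (rule tannerys_theorem[THEN conjunct2, THEN conjunct2])
    show "((\<lambda>S. a k S) \<longlongrightarrow> l2_inner T (v k) (u k)) (finite_subsets_at_top B)" for k
      using Parseval[OF T B L(2) L(1), of k k] by (simp add: has_sum_def a_def)
    show "\<forall>\<^sub>F (k, S) in sequentially \<times>\<^sub>F finite_subsets_at_top B. norm (a k S) \<le> l2_norm T (u k) * l2_norm T (v k)"
      unfolding eventually_prod_filter
      by (rule exI[of _ "\<lambda>_. True"], rule exI[of _ "\<lambda>S. finite S \<and> S \<subseteq> B"]) (use ev bound in auto)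
    show "summable (\<lambda>k. l2_norm T (u k) * l2_norm T (v k))" using N by (simp add: nuclear_rep_def)
  qed simp
  then show ?thesis
    unfolding has_sum_def
    by (rule tendsto_cong[THEN iffD1, rotated]) (use ev in \<open>eventually_elim, simp add: sumA\<close>)
qed

lemma has_trace_nuclear:
  assumes "0 \<le> T" "nuclear_rep T A u v"
  shows "has_trace T A (\<Sum>k. l2_inner T (v k) (u k))"
  using nuclear_trace[OF assms] assms by (auto simp: has_trace_def trace_class_iff)

text \<open>Only trace class membership uses a representation, obtained by prepending one pair. The
  value a is carried along as given, and the new term is summed over each basis by Parseval.\<close>

lemma has_trace_add_rank_one:
  fixes A :: "('n::finite) vfun \<Rightarrow> 'n vfun"
  assumes T: "0 \<le> T" and A: "has_trace T A a" and L: "u0 \<in> L2 T" "v0 \<in> L2 T"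
  shows "has_trace T (\<lambda>f t. A f t + l2_inner T f u0 *s v0 t) (a + l2_inner T v0 u0)"
proof -
  obtain u v where N: "nuclear_rep T A u v" using A by (auto simp: has_trace_def trace_class_iff)
  note AL = nuclear_repD(4)[OF N]
  have "nuclear_rep T (\<lambda>f t. A f t + l2_inner T f u0 *s v0 t) (case_nat u0 u) (case_nat v0 v)"
    unfolding nuclear_rep_def
  proof (intro conjI ballI)
    show "range (case_nat u0 u) \<subseteq> L2 T" "range (case_nat v0 v) \<subseteq> L2 T"
      using nuclear_repD(1,2)[OF N] L by (auto split: nat.splits)
    show "summable (\<lambda>k. l2_norm T (case_nat u0 u k) * l2_norm T (case_nat v0 v k))"
      by (rule summable_Suc_iff[THEN iffD1]) (simp add: nuclear_repD(3)[OF N])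
    fix f :: "'n vfun" assume f: "f \<in> L2 T"
    show "(\<lambda>t. A f t + l2_inner T f u0 *s v0 t) \<in> L2 T"
      by (rule L2_add[OF AL[OF f] L2_smult[OF L(2)]])
    \<comment> \<open>Started at \<open>Suc N\<close>, the partial sum contains the prepended term,
      which cancels the added rank one operator.\<close>
    have "(\<lambda>N. l2_norm T (\<lambda>t. A f t + l2_inner T f u0 *s v0 t
        - (\<Sum>k<Suc N. l2_inner T f (case_nat u0 u k) *s case_nat v0 v k t))) \<longlonglongrightarrow> 0"
      using nuclear_repD(5)[OF N f] by (simp add: sum.lessThan_Suc_shift del: sum.lessThan_Suc)
    then show "(\<lambda>N. l2_norm T (\<lambda>t. A f t + l2_inner T f u0 *s v0 t
        - (\<Sum>k<N. l2_inner T f (case_nat u0 u k) *s case_nat v0 v k t))) \<longlonglongrightarrow> 0"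
      by (rule filterlim_sequentially_Suc[THEN iffD1])
  qed
  moreover have "((\<lambda>e. l2_inner T (\<lambda>t. A e t + l2_inner T e u0 *s v0 t) e) has_sum (a + l2_inner T v0 u0)) B"
    if B: "orthonormal_basis T B" for B
  proof -
    have BL: "e \<in> L2 T" if "e \<in> B" for e using B that by (auto simp: orthonormal_basis_def)
    have "((\<lambda>e. l2_inner T (A e) e + l2_inner T v0 e * l2_inner T e u0) has_sum (a + l2_inner T v0 u0)) B"
      using A B by (intro has_sum_add Parseval T L) (auto simp: has_trace_def)
    then show ?thesis
      by (rule has_sum_cong[THEN iffD1, rotated])
        (simp add: l2_inner_add_left AL BL L L2_smult l2_inner_smult_left mult.commute)
  qed
  ultimately show ?thesis by (auto simp: has_trace_def trace_class_iff)
qed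

lemma has_trace_add_finite_rank:
  assumes T: "0 \<le> T" and A: "has_trace T A a" and I: "finite I"
    and L: "\<And>i. i \<in> I \<Longrightarrow> u i \<in> L2 T" "\<And>i. i \<in> I \<Longrightarrow> v i \<in> L2 T"
  shows "has_trace T (\<lambda>f t. A f t + (\<Sum>i\<in>I. l2_inner T f (u i) *s v i t)) (a + (\<Sum>i\<in>I. l2_inner T (v i) (u i)))"
  using I L
proof (induction I)
  case (insert i I)
  have "has_trace T (\<lambda>f t. A f t + (\<Sum>i\<in>I. l2_inner T f (u i) *s v i t) + l2_inner T f (u i) *s v i t)
      (a + (\<Sum>i\<in>I. l2_inner T (v i) (u i)) + l2_inner T (v i) (u i))"
    using insert by (intro has_trace_add_rank_one T) auto
  with insert show ?case by (simp add: add_ac)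
qed (use A in simp)

lemma has_trace_zero: "0 \<le> T \<Longrightarrow> has_trace T (\<lambda>_ _. 0) 0"
  using has_trace_nuclear[of T "\<lambda>_ _. 0" "\<lambda>_ _. 0" "\<lambda>_ _. 0"]
  by (simp add: nuclear_rep_def l2_inner_cdot image_subset_iff)

text \<open>Allows a trace to be computed for a convenient pointwise formula and moved to the
  operator in question, whose representatives may differ on a null set.\<close>

lemma has_trace_cong:
  assumes A: "has_trace T A a" and A': "\<And>f. f \<in> L2 T \<Longrightarrow> A' f \<in> L2 T" "\<And>f. f \<in> L2 T \<Longrightarrow> l2_eq T (A f) (A' f)"
  shows "has_trace T A' a"
proof -
  obtain u v where N: "nuclear_rep T A u v" using A by (auto simp: has_trace_def trace_class_iff)
  note AL = nuclear_repD(4)[OF N]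
  have eq: "l2_norm T (\<lambda>t. A' f t - (\<Sum>k<n. l2_inner T f (u k) *s v k t))
      = l2_norm T (\<lambda>t. A f t - (\<Sum>k<n. l2_inner T f (u k) *s v k t))" if "f \<in> L2 T" for f n
  proof (rule l2_norm_cong)
    show "l2_eq T (\<lambda>t. A' f t - (\<Sum>k<n. l2_inner T f (u k) *s v k t)) (\<lambda>t. A f t - (\<Sum>k<n. l2_inner T f (u k) *s v k t))"
      using A'(2)[OF that] unfolding l2_eq_def by eventually_elim simp
  qed (intro L2_diff L2_sum L2_smult AL A'(1) that nuclear_repD(2)[OF N])+
  have "nuclear_rep T A' u v"
    unfolding nuclear_rep_def
  proof (intro conjI ballI)
    show "range u \<subseteq> L2 T" "range v \<subseteq> L2 T" using nuclear_repD(1,2)[OF N] by blast+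
    show "summable (\<lambda>k. l2_norm T (u k) * l2_norm T (v k))" by (rule nuclear_repD(3)[OF N])
    show "A' f \<in> L2 T" if "f \<in> L2 T" for f using that by (rule A'(1))
    show "(\<lambda>N. l2_norm T (\<lambda>t. A' f t - (\<Sum>k<N. l2_inner T f (u k) *s v k t))) \<longlonglongrightarrow> 0" if "f \<in> L2 T" for f
      unfolding eq[OF that] by (rule nuclear_repD(5)[OF N that])
  qed
  moreover have "((\<lambda>e. l2_inner T (A' e) e) has_sum a) B" if B: "orthonormal_basis T B" for B
  proof -
    have BL: "e \<in> L2 T" if "e \<in> B" for e using B that by (auto simp: orthonormal_basis_def)
    have "((\<lambda>e. l2_inner T (A e) e) has_sum a) B" using A B by (simp add: has_trace_def)
    then show ?thesis
      by (rule has_sum_cong[THEN iffD1, rotated]) (intro l2_inner_cong, auto simp: A' AL BL)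
  qed
  ultimately show ?thesis by (auto simp: has_trace_def trace_class_iff)
qed

section \<open>Matrix products and traces\<close>

lemma bounded_bilinear_matrix_mult:
  "bounded_bilinear ((**) :: complex ^ 'n ^ 'n \<Rightarrow> complex ^ 'n ^ 'n \<Rightarrow> complex ^ 'n ^ 'n)"
  unfolding bilinear_conv_bounded_bilinear[symmetric] bilinear_def
  by (auto intro!: linearI simp: vec_eq_iff matrix_matrix_mult_def scaleR_sum_right algebra_simps sum.distrib)

lemma bounded_bilinear_matrix_vector_mult:
  "bounded_bilinear ((*v) :: complex ^ 'n ^ 'n \<Rightarrow> complex ^ 'n \<Rightarrow> complex ^ 'n)"
  unfolding bilinear_conv_bounded_bilinear[symmetric] bilinear_def
  by (auto intro!: linearI simp: vec_eq_iff matrix_vector_mult_def scaleR_sum_right algebra_simps sum.distrib)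

lemma trace_scaleR: "trace (c *\<^sub>R A) = c *\<^sub>R trace (A :: complex ^ 'n ^ 'n)"
  by (simp add: trace_def scaleR_sum_right)

lemma trace_mult_commute: "trace (A ** B) = trace (B ** A)" for A B :: "complex ^ 'n ^ 'n"
  unfolding trace_def matrix_matrix_mult_def by (simp, subst sum.swap, simp add: mult.commute)

lemma trace_sum: "trace (\<Sum>i\<in>I. f i) = (\<Sum>i\<in>I. trace (f i :: complex ^ 'n ^ 'n))"
  unfolding trace_def by (simp add: sum_component) (rule sum.swap)

lemma matrix_mult_sum_left: "(\<Sum>i\<in>I. f i) ** A = (\<Sum>i\<in>I. f i ** (A :: complex ^ 'n ^ 'n))"
  and matrix_mult_sum_right: "A ** (\<Sum>i\<in>I. f i) = (\<Sum>i\<in>I. A ** (f i :: complex ^ 'n ^ 'n))"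
  by (rule bounded_bilinear.sum_left[OF bounded_bilinear_matrix_mult],
      rule bounded_bilinear.sum_right[OF bounded_bilinear_matrix_mult])

lemma matrix_mult_minus: "(- A) ** B = - (A ** B)" "A ** (- B) = - (A ** B :: complex ^ 'n ^ 'n)"
  by (simp_all add: vec_eq_iff matrix_matrix_mult_def sum_negf)

section \<open>Sums over compositions\<close>

text \<open>The coefficient of x^m in G(x)^k, where G(x) is the sum of G j x^j over j >= 1.\<close>

definition composition_sum :: "(nat \<Rightarrow> complex ^ 'n ^ 'n) \<Rightarrow> nat \<Rightarrow> nat \<Rightarrow> complex ^ 'n ^ 'n" where
  "composition_sum G k m = (\<Sum>js\<in>compositions m k. matrix_prod_list (map G js))"

lemma compositions_0: "compositions m 0 = (if m = 0 then {[]} else {})"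
  by (auto simp: compositions_def)

lemma compositions_Suc: "compositions m (Suc k) = (\<Union>j\<in>{1..m}. (#) j ` compositions (m - j) k)"
proof (intro set_eqI iffI)
  fix js assume js: "js \<in> compositions m (Suc k)"
  then obtain j js' where "js = j # js'" by (cases js) (auto simp: compositions_def)
  with js show "js \<in> (\<Union>j\<in>{1..m}. (#) j ` compositions (m - j) k)"
    by (auto simp: compositions_def intro!: bexI[of _ j])
qed (auto simp: compositions_def)

lemma finite_compositions [simp]: "finite (compositions m k)"
  by (induction k arbitrary: m) (auto simp: compositions_0 compositions_Suc)

lemma sum_compositions_Suc:
  "(\<Sum>js\<in>compositions m (Suc k). f js) = (\<Sum>j=1..m. \<Sum>js\<in>compositions (m - j) k. f (j # js))"
  unfolding compositions_Suc by (subst sum.UNION_disjoint) (auto simp: sum.reindex)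

lemma composition_sum_0: "composition_sum G 0 m = (if m = 0 then mat 1 else 0)"
  by (simp add: composition_sum_def compositions_0 matrix_prod_list_def)

lemma composition_sum_Suc: "composition_sum G (Suc k) m = (\<Sum>j=1..m. G j ** composition_sum G k (m - j))"
  unfolding composition_sum_def sum_compositions_Suc
  by (simp add: matrix_prod_list_def matrix_mult_sum_right)

lemma composition_sum_eq_0: "m < k \<Longrightarrow> composition_sum G k m = 0"
proof (induction k arbitrary: m)
  case (Suc k)
  have "G j ** composition_sum G k (m - j) = 0" if "j \<in> {1..m}" for j
  proof -
    have "m - j < k" using Suc.prems that by auto
    then show ?thesis by (simp add: Suc.IH)
  qed
  then show ?case unfolding composition_sum_Suc by (intro sum.neutral) auto
qed simp

lemma matrix_prod_list_append: "matrix_prod_list (xs @ ys) = matrix_prod_list xs ** matrix_prod_list ys"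
  by (induction xs) (simp_all add: matrix_prod_list_def matrix_mul_assoc)

lemma trace_matrix_prod_rotate: "trace (matrix_prod_list (map G (rotate i js))) = trace (matrix_prod_list (map G js))"
proof (induction i)
  case (Suc i)
  have "trace (matrix_prod_list (map G (rotate1 xs))) = trace (matrix_prod_list (map G xs))" for xs
  proof (cases xs)
    case (Cons x ys)
    have "trace (matrix_prod_list (map G ys @ [G x])) = trace (matrix_prod_list ([G x] @ map G ys))"
      unfolding matrix_prod_list_append by (rule trace_mult_commute)
    then show ?thesis by (simp add: Cons)
  qed simp
  with Suc show ?case by (simp del: rotate1.simps)
qed simp

lemma sum_list_rotate: "sum_list (rotate i xs) = sum_list (xs :: nat list)"
proof (induction i)
  case (Suc i)
  have "sum_list (rotate1 ys) = sum_list ys" for ys :: "nat list" by (cases ys) auto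
  with Suc show ?case by (simp del: rotate1.simps)
qed simp

text \<open>Each of the \<open>k\<close> positions of a composition can be rotated to the front.\<close>
lemma composition_trace_weighted:
  "of_nat m * (\<Sum>js\<in>compositions m (Suc k). trace (matrix_prod_list (map G js)))
    = of_nat (Suc k) * (\<Sum>j=1..m. of_nat j * trace (G j ** composition_sum G k (m - j)))"
proof -
  let ?t = "\<lambda>js. trace (matrix_prod_list (map G js))"
  have rot: "(\<Sum>js\<in>compositions m (Suc k). of_nat (js ! i) * ?t js) = (\<Sum>js\<in>compositions m (Suc k). of_nat (hd js) * ?t js)"
    if i: "i < Suc k" for i
  proof (rule sum.reindex_bij_witness[where i = "rotate (Suc k - i)" and j = "rotate i"])
    fix js assume js: "js \<in> compositions m (Suc k)"
    then have len: "length js = Suc k" by (simp add: compositions_def)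
    show "rotate (Suc k - i) (rotate i js) = js" "rotate i (rotate (Suc k - i) js) = js"
      using i len rotate_length01 rotate_conv_mod[of "Suc k" js] by (simp_all add: rotate_rotate)
    show "rotate i js \<in> compositions m (Suc k)" "rotate (Suc k - i) js \<in> compositions m (Suc k)"
      using js by (auto simp: compositions_def sum_list_rotate)
    show "of_nat (hd (rotate i js)) * ?t (rotate i js) = of_nat (js ! i) * ?t js"
      using i len hd_rotate_conv_nth[of js i] by (cases "js = []") (simp_all add: trace_matrix_prod_rotate)
  qed
  have "of_nat m * (\<Sum>js\<in>compositions m (Suc k). ?t js)
      = (\<Sum>js\<in>compositions m (Suc k). (\<Sum>i<Suc k. of_nat (js ! i)) * ?t js)"
    unfolding sum_distrib_left
  proof (intro sum.cong refl)
    fix js assume js: "js \<in> compositions m (Suc k)"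
    then have "sum_list js = m" "length js = Suc k" by (auto simp: compositions_def)
    then have "(\<Sum>i<Suc k. js ! i) = m"
      using sum_list_sum_nth[of js] by (simp only: atLeast0LessThan)
    then show "of_nat m * ?t js = (\<Sum>i<Suc k. of_nat (js ! i)) * ?t js"
      by (simp only: of_nat_sum[symmetric])
  qed
  also have "\<dots> = (\<Sum>i<Suc k. \<Sum>js\<in>compositions m (Suc k). of_nat (js ! i) * ?t js)"
    unfolding sum_distrib_right by (rule sum.swap)
  also have "\<dots> = (\<Sum>i<Suc k. \<Sum>js\<in>compositions m (Suc k). of_nat (hd js) * ?t js)"
    by (intro sum.cong refl rot) simp
  also have "\<dots> = of_nat (Suc k) * (\<Sum>js\<in>compositions m (Suc k). of_nat (hd js) * ?t js)"
    by (simp only: sum_constant card_lessThan)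
  also have "(\<Sum>js\<in>compositions m (Suc k). of_nat (hd js) * ?t js)
      = (\<Sum>j=1..m. of_nat j * trace (G j ** composition_sum G k (m - j)))"
    unfolding sum_compositions_Suc composition_sum_def
    by (simp add: matrix_prod_list_def matrix_mult_sum_right trace_sum sum_distrib_left)
  finally show ?thesis .
qed

text \<open>The coefficient of x^n in the Neumann series of 1/(1 + G(x)); the sum stops at n because
  G has no constant term.\<close>

definition alternating_sum :: "(nat \<Rightarrow> complex ^ 'n ^ 'n) \<Rightarrow> nat \<Rightarrow> complex ^ 'n ^ 'n" where
  "alternating_sum G n = (\<Sum>k\<le>n. (- 1) ^ k *\<^sub>R composition_sum G k n)"

text \<open>Provides one summation limit for all n at once, so that sums over k and over j can be
  interchanged.\<close>

lemma alternating_sum_ge: "n \<le> N \<Longrightarrow> (\<Sum>k\<le>N. (- 1) ^ k *\<^sub>R composition_sum G k n) = alternating_sum G n"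
  unfolding alternating_sum_def
  by (rule sum.mono_neutral_right) (auto simp: composition_sum_eq_0)

lemma alternating_sum_0: "alternating_sum G 0 = mat 1"
  by (simp add: alternating_sum_def composition_sum_0)

text \<open>Compares the coefficients of x^n in (1 + G(x)) R(x) = 1, where R is the Neumann
  series.\<close>

lemma alternating_sum_rec:
  assumes "n > 0"
  shows "alternating_sum G n = - (\<Sum>j=1..n. G j ** alternating_sum G (n - j))"
proof -
  obtain N where n: "n = Suc N" using assms by (cases n) auto
  have "alternating_sum G n = (\<Sum>k\<le>N. (- 1) ^ Suc k *\<^sub>R composition_sum G (Suc k) n)"
    unfolding alternating_sum_def n by (subst sum.atMost_Suc_shift) (simp add: composition_sum_0)
  also have "\<dots> = (\<Sum>k\<le>N. \<Sum>j=1..n. - (G j ** ((- 1) ^ k *\<^sub>R composition_sum G k (n - j))))"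
    unfolding composition_sum_Suc scaleR_sum_right
    by (simp add: bounded_bilinear.scaleR_right[OF bounded_bilinear_matrix_mult])
  also have "\<dots> = (\<Sum>j=1..n. - (G j ** (\<Sum>k\<le>N. (- 1) ^ k *\<^sub>R composition_sum G k (n - j))))"
    unfolding matrix_mult_sum_right sum_negf[symmetric] by (rule sum.swap)
  also have "\<dots> = (\<Sum>j=1..n. - (G j ** alternating_sum G (n - j)))"
    by (intro sum.cong refl) (subst alternating_sum_ge, auto simp: n)
  finally show ?thesis by (simp add: sum_negf)
qed

text \<open>The coefficient form of \<open>x \<cdot> d/dx tr log (1 + G(x)) = tr (x \<cdot> G'(x) (1 + G(x))\<inverse>)\<close>,
  where \<open>G(x) = \<Sum>j\<ge>1. G j x\<^sup>j\<close>.\<close>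
lemma log_trace_coefficient:
  assumes "m > 0"
  shows "of_nat m * (\<Sum>k=1..m. (- 1) ^ k / of_nat k * (\<Sum>js\<in>compositions m k. trace (matrix_prod_list (map G js))))
    = - (\<Sum>j=1..m. of_nat j * trace (G j ** alternating_sum G (m - j)))"
proof -
  obtain N where m: "m = Suc N" using assms by (cases m) auto
  let ?S = "\<lambda>k. \<Sum>js\<in>compositions m k. trace (matrix_prod_list (map G js))"
  have "of_nat m * (\<Sum>k=1..m. (- 1) ^ k / of_nat k * ?S k) = (\<Sum>k=1..m. of_nat m * ((- 1) ^ k / of_nat k * ?S k))"
    by (rule sum_distrib_left)
  also have "\<dots> = (\<Sum>k\<le>N. (- 1) ^ Suc k / of_nat (Suc k) * (of_nat m * ?S (Suc k)))"
    unfolding m by (rule sum.reindex_bij_witness[where i = Suc and j = "\<lambda>k. k - 1"]) auto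
  also have "\<dots> = (\<Sum>k\<le>N. (- 1) ^ Suc k * (\<Sum>j=1..m. of_nat j * trace (G j ** composition_sum G k (m - j))))"
    unfolding composition_trace_weighted by (simp del: of_nat_Suc power_Suc)
  also have "\<dots> = (\<Sum>k\<le>N. \<Sum>j=1..m. - (of_nat j * trace (G j ** ((- 1) ^ k *\<^sub>R composition_sum G k (m - j)))))"
    unfolding sum_distrib_left
    by (simp add: bounded_bilinear.scaleR_right[OF bounded_bilinear_matrix_mult]
        trace_scaleR scaleR_conv_of_real[where 'a = complex] mult_ac)
  also have "\<dots> = (\<Sum>j=1..m. - (of_nat j * trace (G j ** (\<Sum>k\<le>N. (- 1) ^ k *\<^sub>R composition_sum G k (m - j)))))"
    unfolding matrix_mult_sum_right trace_sum sum_distrib_left sum_negf[symmetric] by (rule sum.swap)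
  also have "\<dots> = (\<Sum>j=1..m. - (of_nat j * trace (G j ** alternating_sum G (m - j))))"
    by (intro sum.cong refl) (subst alternating_sum_ge, auto simp: m)
  finally show ?thesis by (simp add: sum_negf)
qed

section \<open>Eigenbases of unitary matrices\<close>

definition adj :: "complex ^ 'n ^ 'n \<Rightarrow> complex ^ 'n ^ 'n" where
  "adj A = (\<chi> i j. cnj (A $ j $ i))"

lemma cdot_adj: "cdot (A *v x) y = cdot x (adj A *v y)"
proof -
  have "cdot (A *v x) y = (\<Sum>i\<in>UNIV. \<Sum>j\<in>UNIV. A $ i $ j * x $ j * cnj (y $ i))"
    by (simp add: cdot_def matrix_vector_mult_def sum_distrib_right)
  also have "\<dots> = (\<Sum>j\<in>UNIV. \<Sum>i\<in>UNIV. A $ i $ j * x $ j * cnj (y $ i))" by (rule sum.swap)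
  also have "\<dots> = cdot x (adj A *v y)"
    by (simp add: cdot_def matrix_vector_mult_def adj_def sum_distrib_left mult_ac)
  finally show ?thesis .
qed

text \<open>Horner's scheme for the vector p(U) w.\<close>

definition apply_poly :: "complex ^ 'n ^ 'n \<Rightarrow> complex ^ 'n \<Rightarrow> complex poly \<Rightarrow> complex ^ 'n" where
  "apply_poly U w p = fold_coeffs (\<lambda>a v. a *s w + U *v v) p 0"

lemma apply_poly_0 [simp]: "apply_poly U w 0 = 0"
  by (simp add: apply_poly_def)

lemma apply_poly_pCons [simp]: "apply_poly U w (pCons a p) = a *s w + U *v apply_poly U w p"
  by (cases "p = 0 \<and> a = 0") (auto simp: apply_poly_def)

lemma apply_poly_add: "apply_poly U w (p + q) = apply_poly U w p + apply_poly U w q"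
  by (induction p q rule: poly_induct2) (simp_all add: vec.add matrix_vector_right_distrib algebra_simps vector_sadd_rdistrib)

lemma apply_poly_smult: "apply_poly U w (smult c p) = c *s apply_poly U w p"
  by (induction p) (simp_all add: vector_add_ldistrib vector_scalar_commute vector_smult_assoc)

lemma apply_poly_sum: "apply_poly U w (\<Sum>i\<in>I. p i) = (\<Sum>i\<in>I. apply_poly U w (p i))"
  by (induction I rule: infinite_finite_induct) (simp_all add: apply_poly_add)

lemma apply_poly_monom: "apply_poly U w (monom a k) = a *s (((*v) U) ^^ k) w"
  by (induction k) (simp_all add: monom_0 monom_Suc vector_scalar_commute)

text \<open>The vectors w, U w, ..., U^n w are n + 1 in number and hence dependent.\<close>

lemma apply_poly_annihilator:
  fixes U :: "complex ^ 'n ^ 'n"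
  shows "\<exists>p. p \<noteq> 0 \<and> apply_poly U w p = 0"
proof -
  define f where "f k = (((*v) U) ^^ k) w" for k
  show ?thesis
  \<comment> \<open>Dependence is a property of sets and does not see repetitions, so coinciding
    iterates are treated first; they give a difference of two monomials.\<close>
  proof (cases "inj_on f {..CARD('n)}")
    case False
    then obtain i j where ij: "i \<noteq> j" "f i = f j" by (auto simp: inj_on_def)
    have "apply_poly U w (monom 1 i + smult (-1) (monom 1 j)) = 0"
      using ij unfolding apply_poly_add apply_poly_smult apply_poly_monom by (simp add: f_def)
    moreover have "coeff (monom 1 i + smult (-1) (monom 1 j)) i \<noteq> (0::complex)" using ij by simp
    then have "monom 1 i + smult (-1) (monom 1 j) \<noteq> (0 :: complex poly)" by (metis coeff_0)
    ultimately show ?thesis by blast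
  next
    case True
    have "vec.dependent (f ` {..CARD('n)})"
    proof (rule ccontr)
      assume "\<not> vec.dependent (f ` {..CARD('n)})"
      then have "card (f ` {..CARD('n)}) \<le> vec.dim (UNIV :: (complex ^ 'n) set)"
        by (intro vec.independent_card_le_dim) auto
      then show False unfolding vec_dim_card card_image[OF True] by simp
    qed
    then obtain u k where u: "k \<le> CARD('n)" "u (f k) \<noteq> 0" "(\<Sum>v\<in>f ` {..CARD('n)}. u v *s v) = 0"
      by (subst (asm) vec.dependent_finite) auto
    define p where "p = (\<Sum>i\<le>CARD('n). monom (u (f i)) i)"
    have "apply_poly U w p = 0"
      using u(3) sum.reindex[OF True, of "\<lambda>v. u v *s v"]
      by (simp add: p_def apply_poly_sum apply_poly_monom f_def[symmetric])
    moreover have "coeff p k = u (f k)"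
      using u(1) by (simp add: p_def coeff_sum)
    then have "p \<noteq> 0" using u(2) by auto
    ultimately show ?thesis by blast
  qed
qed

text \<open>Let p be an annihilator of w of least degree and \<alpha> a root of it. With p = (X -
  \<alpha>) q, minimality gives q(U) w \<noteq> 0, and this vector is an eigenvector. It lies in W
  because W is an invariant subspace.\<close>

lemma eigenvector_exists:
  fixes U :: "complex ^ 'n ^ 'n"
  assumes w: "w \<in> W" "w \<noteq> 0"
    and W: "\<And>x y. x \<in> W \<Longrightarrow> y \<in> W \<Longrightarrow> x + y \<in> W" "\<And>c x. x \<in> W \<Longrightarrow> c *s x \<in> W" "\<And>x. x \<in> W \<Longrightarrow> U *v x \<in> W"
  obtains x \<alpha> where "x \<in> W" "x \<noteq> 0" "U *v x = \<alpha> *s x"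
proof -
  have in_W: "apply_poly U w p \<in> W" for p
  proof (induction p)
    case 0
    show ?case using W(2)[OF w(1), of 0] by simp
  next
    case (pCons a p)
    then show ?case using W w by simp
  qed
  obtain p where p: "p \<noteq> 0" "apply_poly U w p = 0"
    and min: "\<And>q. q \<noteq> 0 \<Longrightarrow> apply_poly U w q = 0 \<Longrightarrow> degree p \<le> degree q"
    using exists_least_iff[of "\<lambda>d. \<exists>p. p \<noteq> 0 \<and> apply_poly U w p = 0 \<and> degree p = d"]
      apply_poly_annihilator[of U w] by (metis leI)
  have "degree p \<noteq> 0"
  proof
    assume "degree p = 0"
    then obtain a where "p = [:a:]" by (rule degree_eq_zeroE)
    with p w show False by (auto simp: vec_eq_iff)
  qed
  then obtain \<alpha> where "poly p \<alpha> = 0"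
    using fundamental_theorem_of_algebra[of p] by (auto simp: constant_degree)
  then obtain q where q: "p = [:- \<alpha>, 1:] * q" by (auto simp: poly_eq_0_iff_dvd)
  with p have "q \<noteq> 0" by auto
  then have "degree q < degree p" unfolding q by (subst degree_mult_eq) auto
  with min[of q] \<open>q \<noteq> 0\<close> have "apply_poly U w q \<noteq> 0" by auto
  moreover have "U *v apply_poly U w q = \<alpha> *s apply_poly U w q"
  proof -
    have "p = smult (- \<alpha>) q + pCons 0 q" using q by simp
    then have "0 = (- \<alpha>) *s apply_poly U w q + U *v apply_poly U w q"
      using p(2) by (simp only: apply_poly_add apply_poly_smult apply_poly_pCons) (simp add: vec_eq_iff)
    then show ?thesis by (simp add: vec_eq_iff add_eq_0_iff)
  qed
  ultimately show ?thesis using that in_W by blast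
qed

text \<open>Bessel's inequality for each coordinate vector gives that the squared moduli of the i-th
  entries add up to at most 1; summing over i leaves card X on one side and n on the other. This
  bound makes a largest orthonormal set of eigenvectors available below.\<close>

lemma orthonormal_card_le:
  fixes X :: "(complex ^ 'n) set"
  assumes "finite X" and ortho: "\<And>x y. x \<in> X \<Longrightarrow> y \<in> X \<Longrightarrow> cdot x y = (if x = y then 1 else 0)"
  shows "card X \<le> CARD('n)"
proof -
  have bessel: "(\<Sum>x\<in>X. (cmod (x $ i))\<^sup>2) \<le> 1" for i
  proof -
    define e :: "complex ^ 'n" where "e = axis i 1"
    define p where "p = (\<Sum>x\<in>X. cdot e x *s x)"
    define s where "s = (\<Sum>x\<in>X. (cmod (x $ i))\<^sup>2)"
    have ex: "cdot e x = cnj (x $ i)" for x unfolding e_def by (subst cdot_cnj) (simp add: cdot_axis_right)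
    have pe: "cdot p e = of_real s"
      unfolding p_def cdot_sum_left s_def of_real_sum complex_norm_square cdot_smult_left ex
      by (simp add: e_def cdot_axis_right mult.commute)
    have px: "cdot p x = cdot e x" if "x \<in> X" for x
    proof -
      have "cdot p x = (\<Sum>y\<in>X. if y = x then cdot e x else 0)"
        unfolding p_def cdot_sum_left using ortho that by (intro sum.cong) (auto simp: cdot_smult_left)
      then show ?thesis using that assms(1) by simp
    qed
    have "cdot p p = (\<Sum>x\<in>X. cdot e x * cdot x p)"
      by (subst (1) p_def) (simp add: cdot_sum_left cdot_smult_left)
    also have "\<dots> = (\<Sum>x\<in>X. of_real ((cmod (x $ i))\<^sup>2))"
      unfolding complex_norm_square by (intro sum.cong refl, subst cdot_cnj) (simp add: px ex mult.commute)
    finally have pp: "cdot p p = of_real s" by (simp add: s_def)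
    have ee: "cdot e e = 1" by (simp add: e_def cdot_axis_right)
    have "cdot (e - p) (e - p) = 1 - of_real s"
      using pe pp ee cdot_cnj[of e p] by (simp add: cdot_diff_left cdot_diff_right)
    then have "complex_of_real ((norm (e - p))\<^sup>2) = of_real (1 - s)" by (simp add: cdot_self)
    then have "(norm (e - p))\<^sup>2 = 1 - s" by (simp only: of_real_eq_iff)
    then show ?thesis using zero_le_power2[of "norm (e - p)"] by (simp add: s_def)
  qed
  have "(\<Sum>x\<in>X. (norm x)\<^sup>2) = (\<Sum>i\<in>UNIV. \<Sum>x\<in>X. (cmod (x $ i))\<^sup>2)"
    unfolding norm_vec_power2 by (rule sum.swap)
  also have "\<dots> \<le> (\<Sum>i\<in>(UNIV :: 'n set). 1)" by (intro sum_mono bessel)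
  finally have "(\<Sum>x\<in>X. (norm x)\<^sup>2) \<le> real CARD('n)" by simp
  moreover have "(norm x)\<^sup>2 = 1" if "x \<in> X" for x
  proof -
    have "complex_of_real ((norm x)\<^sup>2) = of_real 1" using ortho[OF that that] by (simp add: cdot_self)
    then show ?thesis by (simp only: of_real_eq_iff)
  qed
  ultimately show ?thesis by simp
qed

text \<open>An orthonormal set of eigenvectors of largest cardinality spans: its orthogonal
  complement is invariant and, if nonzero, would contain a further eigenvector. The eigenvalues are
  written as e^{-i theta} so that z(t) = e^{i theta t/T} x satisfies z(0) = U z(T).\<close>

lemma unitary_eigenbasis:
  fixes U :: "complex ^ 'n ^ 'n"
  assumes iso: "\<And>x y. cdot (U *v x) (U *v y) = cdot x y"
  obtains X \<theta> where "finite X" "\<And>x y. x \<in> X \<Longrightarrow> y \<in> X \<Longrightarrow> cdot x y = (if x = y then 1 else 0)"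
    "\<And>x. x \<in> X \<Longrightarrow> U *v x = exp (- (\<i> * of_real (\<theta> x))) *s x"
    "\<And>v. v = (\<Sum>x\<in>X. cdot v x *s x)"
proof -
  define P where "P X \<longleftrightarrow> finite X \<and> (\<forall>x\<in>X. \<forall>y\<in>X. cdot x y = (if x = y then 1 else 0)) \<and>
    (\<forall>x\<in>X. \<exists>\<alpha>. U *v x = \<alpha> *s x)" for X :: "(complex ^ 'n) set"
  have "P {}" by (simp add: P_def)
  moreover have "card X \<le> CARD('n)" if "P X" for X
    by (rule orthonormal_card_le) (use that in \<open>auto simp: P_def\<close>)
  ultimately have "\<exists>X. P X \<and> (\<forall>Y. P Y \<longrightarrow> card Y \<le> card X)"
    by (intro ex_has_greatest_nat[of P "{}" card "Suc CARD('n)"]) (auto simp: less_Suc_eq_le)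
  then obtain X where X: "P X" and max: "\<And>Y. P Y \<Longrightarrow> card Y \<le> card X" by blast
  have fin: "finite X" and ortho: "\<And>x y. x \<in> X \<Longrightarrow> y \<in> X \<Longrightarrow> cdot x y = (if x = y then 1 else 0)"
    using X by (auto simp: P_def)
  have eig: "\<exists>\<alpha>. U *v x = \<alpha> *s x \<and> cmod \<alpha> = 1" if x: "x \<in> X" for x
  proof -
    obtain \<alpha> where a: "U *v x = \<alpha> *s x" using X x unfolding P_def by blast
    have "1 = cdot (U *v x) (U *v x)" using ortho[OF x x] by (simp add: iso)
    also have "\<dots> = \<alpha> * cnj \<alpha>" unfolding a using ortho[OF x x] by (simp add: cdot_smult_left cdot_smult_right)
    also have "\<dots> = of_real ((cmod \<alpha>)\<^sup>2)" by (simp only: complex_norm_square)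
    finally have "complex_of_real ((cmod \<alpha>)\<^sup>2) = of_real 1" by simp
    then have "(cmod \<alpha>)\<^sup>2 = 1" by (simp only: of_real_eq_iff)
    then have "cmod \<alpha> = 1" using norm_ge_zero[of \<alpha>] by (auto simp: power2_eq_1_iff)
    with a show ?thesis by blast
  qed
  have "\<exists>\<theta>. U *v x = exp (- (\<i> * of_real \<theta>)) *s x" if x: "x \<in> X" for x
  proof -
    obtain \<alpha> where a: "U *v x = \<alpha> *s x" "cmod \<alpha> = 1" using eig[OF x] by blast
    then have "\<alpha> = exp (- (\<i> * of_real (- Arg \<alpha>)))"
      using Arg_eq[of \<alpha>] a(2) by (cases "\<alpha> = 0") auto
    then show ?thesis using a(1) by (intro exI[of _ "- Arg \<alpha>"]) simp
  qed
  then obtain \<theta> where \<theta>: "\<And>x. x \<in> X \<Longrightarrow> U *v x = exp (- (\<i> * of_real (\<theta> x))) *s x" by metis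
  define W where "W = {v. \<forall>x\<in>X. cdot v x = 0}"
  have W0: "v = 0" if v: "v \<in> W" for v
  proof (rule ccontr)
    assume "v \<noteq> 0"
    have inv: "U *v y \<in> W" if y: "y \<in> W" for y
      unfolding W_def
    proof (intro CollectI ballI)
      fix x assume x: "x \<in> X"
      obtain \<alpha> where a: "U *v x = \<alpha> *s x" "cmod \<alpha> = 1" using eig[OF x] by blast
      \<comment> \<open>Invariance of the complement: x is replaced by U x at the cost of a
        unimodular factor, and then the isometry is used.\<close>
      have "cnj \<alpha> * cdot (U *v y) x = cdot (U *v y) (U *v x)" by (simp add: a cdot_smult_right)
      also have "\<dots> = 0" using x y by (simp add: iso W_def)
      finally show "cdot (U *v y) x = 0" using a by auto
    qed
    obtain x \<alpha> where x: "x \<in> W" "x \<noteq> 0" "U *v x = \<alpha> *s x"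
    proof (rule eigenvector_exists[OF v \<open>v \<noteq> 0\<close>, of U])
      show "x + y \<in> W" if "x \<in> W" "y \<in> W" for x y using that by (simp add: W_def cdot_add_left)
      show "c *s x \<in> W" if "x \<in> W" for c x using that by (simp add: W_def cdot_smult_left)
    qed (use inv that in blast)+
    define y where "y = of_real (1 / norm x) *s x"
    have yW: "y \<in> W" using x by (simp add: y_def W_def cdot_smult_left)
    have "norm y = 1" using x by (simp add: y_def norm_smult_vec norm_divide)
    then have yy: "cdot y y = 1" by (simp add: cdot_self)
    have "U *v y = \<alpha> *s y" using x(3) by (simp add: y_def vector_scalar_commute vector_smult_assoc mult.commute)
    moreover have "cdot z y = 0" "cdot y z = 0" if "z \<in> X" for z
      using yW that cdot_cnj[of z y] by (auto simp: W_def)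
    moreover have "y \<notin> X" using yy yW by (auto simp: W_def)
    ultimately have "P (insert y X)" using X yy by (auto simp: P_def)
    from max[OF this] show False using \<open>y \<notin> X\<close> fin by simp
  qed
  have "v = (\<Sum>x\<in>X. cdot v x *s x)" for v
  proof -
    have "cdot (v - (\<Sum>x\<in>X. cdot v x *s x)) y = 0" if y: "y \<in> X" for y
    proof -
      have "(\<Sum>x\<in>X. cdot v x * cdot x y) = (\<Sum>x\<in>X. if x = y then cdot v y else 0)"
        using ortho y by (intro sum.cong) auto
      then show ?thesis using y fin by (simp add: cdot_diff_left cdot_sum_left cdot_smult_left)
    qed
    then have "v - (\<Sum>x\<in>X. cdot v x *s x) = 0" by (intro W0) (simp add: W_def)
    then show ?thesis by simp
  qed
  with fin ortho \<theta> show ?thesis by (rule that)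
qed

lemma trace_eigenbasis:
  fixes A :: "complex ^ 'n ^ 'n"
  assumes X: "\<And>v. v = (\<Sum>x\<in>X. cdot v x *s x)"
  shows "trace A = (\<Sum>x\<in>X. cdot (A *v x) x)"
proof -
  have "A $ i $ i = (\<Sum>x\<in>X. (A *v x) $ i * cnj (x $ i))" for i
  proof -
    have "A $ i $ i = (A *v axis i 1) $ i"
      by (simp add: matrix_vector_mult_def axis_def if_distrib[of "(*) _"] cong: if_cong)
    also have "axis i 1 = (\<Sum>x\<in>X. cnj (x $ i) *s x)"
      by (subst X[of "axis i 1"]) (subst cdot_cnj, simp add: cdot_axis_right)
    also have "(A *v \<dots>) $ i = (\<Sum>x\<in>X. (A *v x) $ i * cnj (x $ i))"
      by (simp add: bounded_bilinear.sum_right[OF bounded_bilinear_matrix_vector_mult] vector_scalar_commute mult.commute)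
    finally show ?thesis .
  qed
  then show ?thesis
    unfolding trace_def cdot_def by (simp, subst sum.swap, simp)
qed

section \<open>Measurability and norm bounds for matrix-valued functions\<close>

lemma measurable_matrix_vector_mult:
  "A \<in> borel_measurable M \<Longrightarrow> f \<in> borel_measurable M \<Longrightarrow> (\<lambda>t. (A t :: complex ^ 'n ^ 'n) *v f t) \<in> borel_measurable M"
  by (rule borel_measurable_bilinear[OF bounded_bilinear_matrix_vector_mult])

lemma measurable_matrix_mult:
  "A \<in> borel_measurable M \<Longrightarrow> f \<in> borel_measurable M \<Longrightarrow> (\<lambda>t. (A t :: complex ^ 'n ^ 'n) ** (f t :: complex ^ 'n ^ 'n)) \<in> borel_measurable M"
  by (rule borel_measurable_bilinear[OF bounded_bilinear_matrix_mult])

lemma measurable_adj: "A \<in> borel_measurable M \<Longrightarrow> (\<lambda>t. adj (A t)) \<in> borel_measurable M"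
proof (rule measurable_compose[of A M borel])
  have "bounded_linear (adj :: complex ^ 'n ^ 'n \<Rightarrow> _)"
    unfolding linear_conv_bounded_linear[symmetric] by (rule linearI) (simp_all add: adj_def vec_eq_iff)
  then show "(adj :: complex ^ 'n ^ 'n \<Rightarrow> _) \<in> borel_measurable borel"
    by (intro borel_measurable_continuous_onI linear_continuous_on)
qed

lemma norm_matrix_power2: "(norm A)\<^sup>2 = (\<Sum>i\<in>UNIV. (norm (A $ i))\<^sup>2)" for A :: "complex ^ 'n ^ 'm"
  by (simp add: norm_vec_def L2_set_def sum_nonneg)

text \<open>The norm on matrices is the Frobenius norm, which dominates the operator norm by
  Cauchy-Schwarz in each row.\<close>

lemma norm_matrix_vector_mult_le: "norm (A *v x) \<le> norm A * norm x" for A :: "complex ^ 'n ^ 'n"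
proof (rule power2_le_imp_le)
  have comp: "(A *v x) $ i = cdot x (\<chi> j. cnj (A $ i $ j))" for i
    by (simp add: matrix_vector_mult_def cdot_def mult.commute)
  have row: "norm (\<chi> j. cnj (A $ i $ j)) = norm (A $ i)" for i
    by (simp add: norm_vec_def)
  have "(norm (A *v x))\<^sup>2 = (\<Sum>i\<in>UNIV. (cmod ((A *v x) $ i))\<^sup>2)" by (rule norm_vec_power2)
  also have "\<dots> \<le> (\<Sum>i\<in>UNIV. (norm x * norm (A $ i))\<^sup>2)"
    using norm_cdot_le[of x] by (intro sum_mono power_mono) (auto simp: comp row[symmetric])
  also have "\<dots> = (norm A * norm x)\<^sup>2"
    by (simp add: power_mult_distrib norm_matrix_power2 sum_distrib_left mult.commute)
  finally show "(norm (A *v x))\<^sup>2 \<le> (norm A * norm x)\<^sup>2" .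
qed simp

lemma norm_adj [simp]: "norm (adj A) = norm A"
proof -
  have "(norm (adj A))\<^sup>2 = (norm A)\<^sup>2"
    unfolding norm_matrix_power2 norm_vec_power2 by (simp add: adj_def) (rule sum.swap)
  then show ?thesis by simp
qed

section \<open>Integral operators with bounded kernels\<close>

definition kernel_op :: "real \<Rightarrow> (real \<Rightarrow> real \<Rightarrow> complex ^ 'n ^ 'n) \<Rightarrow> ('n::finite) vfun \<Rightarrow> 'n vfun" where
  "kernel_op T k f = (\<lambda>t. LINT s|leb_upto T. k t s *v f s)"

text \<open>The entries are conjugated so that a component of the integral operator is an inner
  product with f in the first argument.\<close>

definition kernel_row :: "(real \<Rightarrow> real \<Rightarrow> complex ^ 'n ^ 'n) \<Rightarrow> real \<Rightarrow> 'n \<Rightarrow> ('n::finite) vfun" where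
  "kernel_row k t i = (\<lambda>s. \<chi> j. cnj (k t s $ i $ j))"

definition adj_kernel :: "(real \<Rightarrow> real \<Rightarrow> complex ^ 'n ^ 'n) \<Rightarrow> real \<Rightarrow> real \<Rightarrow> complex ^ 'n ^ 'n" where
  "adj_kernel k = (\<lambda>t s. adj (k s t))"

locale bounded_kernel =
  fixes T :: real and k :: "real \<Rightarrow> real \<Rightarrow> complex ^ 'n ^ ('n::finite)" and C :: real
  assumes T: "0 \<le> T"
    and kernel_measurable: "(\<lambda>(t, s). k t s) \<in> borel_measurable (leb_upto T \<Otimes>\<^sub>M leb_upto T)"
    and kernel_bound: "t \<in> {0..T} \<Longrightarrow> s \<in> {0..T} \<Longrightarrow> norm (k t s) \<le> C"
begin

sublocale pair_sigma_finite "leb_upto T" "leb_upto T"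
  by (simp add: pair_sigma_finite_def sigma_finite_leb_upto)

lemma C_nonneg: "0 \<le> C"
  using order_trans[OF norm_ge_zero kernel_bound[of 0 0]] T by simp

lemma kernel_section: "t \<in> {0..T} \<Longrightarrow> k t \<in> borel_measurable (leb_upto T)"
  using measurable_Pair2[OF kernel_measurable, of t] by simp

lemma kernel_row_measurable: assumes "t \<in> {0..T}" shows "kernel_row k t i \<in> borel_measurable (leb_upto T)"
proof -
  have "(\<lambda>s. adj (k t s) *v axis i 1) \<in> borel_measurable (leb_upto T)"
    by (intro measurable_matrix_vector_mult measurable_adj kernel_section assms) simp
  also have "(\<lambda>s. adj (k t s) *v axis i 1) = kernel_row k t i"
    by (rule ext) (simp add: kernel_row_def matrix_vector_mult_def adj_def axis_def vec_eq_iff if_distrib[of "(*) _"] cong: if_cong)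
  finally show ?thesis .
qed

lemma kernel_row_bound: assumes "t \<in> {0..T}" "s \<in> {0..T}" shows "norm (kernel_row k t i s) \<le> C"
proof -
  have "norm (kernel_row k t i s) = norm (k t s $ i)" by (simp add: kernel_row_def norm_vec_def)
  also have "\<dots> \<le> norm (k t s)" by (rule Finite_Cartesian_Product.norm_nth_le)
  finally show ?thesis using kernel_bound[OF assms] by simp
qed

lemma kernel_row_L2: "t \<in> {0..T} \<Longrightarrow> kernel_row k t i \<in> L2 T"
  by (rule L2_bounded[of _ _ C]) (auto intro: kernel_row_measurable kernel_row_bound)

lemma kernel_row_norm: "t \<in> {0..T} \<Longrightarrow> l2_norm T (kernel_row k t i) \<le> C * sqrt T"
  by (rule l2_norm_bounded) (auto intro: kernel_row_measurable kernel_row_bound T C_nonneg)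

lemma kernel_integrable:
  assumes "t \<in> {0..T}" "f \<in> L2 T" shows "integrable (leb_upto T) (\<lambda>s. k t s *v f s)"
proof (rule Bochner_Integration.integrable_bound)
  show "integrable (leb_upto T) (\<lambda>s. C * norm (f s))" using L2_integrable[OF assms(2)] by simp
  show "(\<lambda>s. k t s *v f s) \<in> borel_measurable (leb_upto T)"
    by (intro measurable_matrix_vector_mult kernel_section assms L2_measurable)
  show "AE s in leb_upto T. norm (k t s *v f s) \<le> norm (C * norm (f s))"
  proof (rule AE_I2)
    fix s assume "s \<in> space (leb_upto T)"
    then have "norm (k t s) * norm (f s) \<le> C * norm (f s)"
      using kernel_bound assms by (intro mult_right_mono) auto
    then show "norm (k t s *v f s) \<le> norm (C * norm (f s))"
      using order_trans[OF norm_matrix_vector_mult_le] C_nonneg by simp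
  qed
qed

lemma kernel_op_component:
  assumes "t \<in> {0..T}" "f \<in> L2 T" shows "kernel_op T k f t $ i = l2_inner T f (kernel_row k t i)"
proof -
  have "kernel_op T k f t $ i = (LINT s|leb_upto T. (k t s *v f s) $ i)"
    unfolding kernel_op_def
    by (rule integral_bounded_linear[OF bounded_linear_vec_nth kernel_integrable[OF assms], symmetric])
  then show ?thesis
    by (simp add: l2_inner_def kernel_row_def matrix_vector_mult_def mult.commute)
qed

lemma kernel_op_pointwise:
  assumes "t \<in> {0..T}" "f \<in> L2 T" shows "norm (kernel_op T k f t) \<le> C * sqrt T * l2_norm T f"
proof -
  have "norm (kernel_op T k f t) \<le> (LINT s|leb_upto T. C * norm (f s))"
    unfolding kernel_op_def
  proof (rule Bochner_Integration.integral_norm_bound_integral[OF kernel_integrable[OF assms]])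
    show "integrable (leb_upto T) (\<lambda>s. C * norm (f s))" using L2_integrable[OF assms(2)] by simp
    fix s assume "s \<in> space (leb_upto T)"
    then have "norm (k t s) * norm (f s) \<le> C * norm (f s)"
      using kernel_bound assms by (intro mult_right_mono) auto
    then show "norm (k t s *v f s) \<le> C * norm (f s)" using norm_matrix_vector_mult_le order_trans by blast
  qed
  also have "\<dots> \<le> C * (sqrt T * l2_norm T f)"
    using L1_le_l2_norm[OF assms(2) T] C_nonneg by (simp add: mult_left_mono)
  finally show ?thesis by (simp add: mult.assoc)
qed

lemma kernel_op_measurable:
  assumes "f \<in> L2 T" shows "kernel_op T k f \<in> borel_measurable (leb_upto T)"
  unfolding kernel_op_def
proof (rule sigma_finite_measure.borel_measurable_lebesgue_integral[OF sigma_finite_leb_upto])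
  have "(\<lambda>p. (\<lambda>(t, s). k t s) p *v f (snd p)) \<in> borel_measurable (leb_upto T \<Otimes>\<^sub>M leb_upto T)"
    by (intro measurable_matrix_vector_mult kernel_measurable measurable_compose[OF measurable_snd] L2_measurable assms)
  then show "(\<lambda>(t, s). k t s *v f s) \<in> borel_measurable (leb_upto T \<Otimes>\<^sub>M leb_upto T)"
    by (simp add: case_prod_unfold)
qed

lemma kernel_op_L2: "f \<in> L2 T \<Longrightarrow> kernel_op T k f \<in> L2 T"
  by (rule L2_bounded[OF kernel_op_measurable kernel_op_pointwise])

lemma kernel_op_norm: assumes "f \<in> L2 T" shows "l2_norm T (kernel_op T k f) \<le> C * T * l2_norm T f"
proof -
  have "l2_norm T (kernel_op T k f) \<le> C * sqrt T * l2_norm T f * sqrt T"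
    using C_nonneg T by (intro l2_norm_bounded kernel_op_measurable kernel_op_pointwise assms) auto
  also have "\<dots> = C * (sqrt T * sqrt T) * l2_norm T f" by (simp only: mult_ac)
  finally show ?thesis using T by simp
qed

lemma kernel_op_diff: "f \<in> L2 T \<Longrightarrow> g \<in> L2 T \<Longrightarrow> t \<in> {0..T} \<Longrightarrow>
    kernel_op T k (\<lambda>t. f t - g t) t = kernel_op T k f t - kernel_op T k g t"
  unfolding kernel_op_def by (simp add: matrix_vector_mult_diff_distrib kernel_integrable)

lemma kernel_op_sum: 
  assumes "\<And>i. i \<in> I \<Longrightarrow> f i \<in> L2 T" "t \<in> {0..T}"
  shows "kernel_op T k (\<lambda>t. \<Sum>i\<in>I. c i *s f i t) t = (\<Sum>i\<in>I. c i *s kernel_op T k (f i) t)"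
proof -
  have int: "integrable (leb_upto T) (\<lambda>s. k t s *v (c i *s f i s))" if "i \<in> I" for i
    by (rule kernel_integrable[OF assms(2) L2_smult[OF assms(1)[OF that]]])
  have "(LINT s|leb_upto T. k t s *v (c i *s f i s)) = c i *s kernel_op T k (f i) t" if "i \<in> I" for i
    unfolding vector_scalar_commute kernel_op_def
    by (rule integral_bounded_linear[OF bounded_bilinear.bounded_linear_right[OF bounded_bilinear_smult]
          kernel_integrable[OF assms(2) assms(1)[OF that]]])
  then show ?thesis
    unfolding kernel_op_def by (simp add: bounded_bilinear.sum_right[OF bounded_bilinear_matrix_vector_mult] int)
qed

lemma kernel_op_cong: "(\<And>s. s \<in> {0..T} \<Longrightarrow> f s = g s) \<Longrightarrow> kernel_op T k f = kernel_op T k g"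
  unfolding kernel_op_def by (intro ext Bochner_Integration.integral_cong) auto

lemma adj_bounded_kernel: "bounded_kernel T (adj_kernel k) C"
proof
  have "(\<lambda>p. adj ((\<lambda>(t, s). k t s) (snd p, fst p))) \<in> borel_measurable (leb_upto T \<Otimes>\<^sub>M leb_upto T)"
    by (intro measurable_adj measurable_compose[OF _ kernel_measurable] measurable_Pair measurable_snd measurable_fst)
  then show "(\<lambda>(t, s). adj_kernel k t s) \<in> borel_measurable (leb_upto T \<Otimes>\<^sub>M leb_upto T)"
    by (simp add: case_prod_unfold adj_kernel_def)
qed (use T kernel_bound in \<open>auto simp: adj_kernel_def\<close>)

text \<open>Fubini's theorem; the integrand is dominated by C |g(t)| |f(s)|, which is integrable on
  the square because L2 functions on [0,T] are integrable.\<close>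

lemma kernel_op_adj:
  assumes f: "f \<in> L2 T" and g: "g \<in> L2 T"
  shows "l2_inner T (kernel_op T k f) g = l2_inner T f (kernel_op T (adj_kernel k) g)"
proof -
  interpret A: bounded_kernel T "adj_kernel k" C by (rule adj_bounded_kernel)
  have meas: "(\<lambda>p. cdot ((\<lambda>(t, s). k t s) p *v f (snd p)) (g (fst p))) \<in> borel_measurable (leb_upto T \<Otimes>\<^sub>M leb_upto T)"
    by (intro measurable_cdot measurable_matrix_vector_mult kernel_measurable
        measurable_compose[OF measurable_snd] measurable_compose[OF measurable_fst] L2_measurable f g)
  have int: "integrable (leb_upto T \<Otimes>\<^sub>M leb_upto T) (\<lambda>(t, s). cdot (k t s *v f s) (g t))"
  proof (rule Bochner_Integration.integrable_bound)
    have "integrable (leb_upto T \<Otimes>\<^sub>M leb_upto T) (\<lambda>(t, s). norm (g t) * norm (f s))"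
    proof (rule Fubini_integrable)
      show "(\<lambda>(t, s). norm (g t) * norm (f s)) \<in> borel_measurable (leb_upto T \<Otimes>\<^sub>M leb_upto T)"
        using measurable_compose[OF measurable_snd L2_measurable[OF f], of "leb_upto T"]
          measurable_compose[OF measurable_fst L2_measurable[OF g], of "leb_upto T"]
        by (simp add: case_prod_unfold)
    qed (use L2_integrable[OF f] L2_integrable[OF g] in auto)
    then show "integrable (leb_upto T \<Otimes>\<^sub>M leb_upto T) (\<lambda>p. C * (case p of (t, s) \<Rightarrow> norm (g t) * norm (f s)))"
      by (rule integrable_mult_right)
    show "(\<lambda>(t, s). cdot (k t s *v f s) (g t)) \<in> borel_measurable (leb_upto T \<Otimes>\<^sub>M leb_upto T)"
      using meas by (simp add: case_prod_unfold)
    show "AE p in leb_upto T \<Otimes>\<^sub>M leb_upto T. norm (case p of (t, s) \<Rightarrow> cdot (k t s *v f s) (g t))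
        \<le> norm (C * (case p of (t, s) \<Rightarrow> norm (g t) * norm (f s)))"
    proof (rule AE_I2, clarify)
      fix t s assume ts: "(t, s) \<in> space (leb_upto T \<Otimes>\<^sub>M leb_upto T)"
      have "norm (cdot (k t s *v f s) (g t)) \<le> norm (k t s *v f s) * norm (g t)" by (rule norm_cdot_le)
      also have "\<dots> \<le> (C * norm (f s)) * norm (g t)"
        using ts kernel_bound[of t s] norm_matrix_vector_mult_le[of "k t s" "f s"]
        by (intro mult_right_mono order_trans[OF norm_matrix_vector_mult_le mult_right_mono])
          (auto simp: space_pair_measure)
      finally show "norm (cdot (k t s *v f s) (g t)) \<le> norm (C * (norm (g t) * norm (f s)))"
        using C_nonneg by (simp add: mult_ac abs_mult)
    qed
  qed
  have "l2_inner T (kernel_op T k f) g = (LINT t|leb_upto T. (LINT s|leb_upto T. cdot (k t s *v f s) (g t)))"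
    unfolding l2_inner_cdot kernel_op_def
    by (intro Bochner_Integration.integral_cong refl, subst integral_bounded_linear[OF
          bounded_bilinear.bounded_linear_left[OF bounded_bilinear_cdot] kernel_integrable]) (auto intro: f)
  also have "\<dots> = (LINT s|leb_upto T. (LINT t|leb_upto T. cdot (k t s *v f s) (g t)))"
    by (rule Fubini_integral[OF int, symmetric])
  also have "\<dots> = (LINT s|leb_upto T. (LINT t|leb_upto T. cdot (f s) (adj_kernel k s t *v g t)))"
    by (simp add: cdot_adj adj_kernel_def)
  also have "\<dots> = l2_inner T f (kernel_op T (adj_kernel k) g)"
    unfolding l2_inner_cdot kernel_op_def
    by (intro Bochner_Integration.integral_cong refl, subst integral_bounded_linear[OF
          bounded_bilinear.bounded_linear_right[OF bounded_bilinear_cdot] A.kernel_integrable]) (auto intro: g)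
  finally show ?thesis .
qed

lemma kernel_op_power_L2: "f \<in> L2 T \<Longrightarrow> (kernel_op T k ^^ m) f \<in> L2 T"
  by (induction m) (auto intro: kernel_op_L2)

lemma kernel_op_power_norm: "f \<in> L2 T \<Longrightarrow> l2_norm T ((kernel_op T k ^^ m) f) \<le> (C * T) ^ m * l2_norm T f"
proof (induction m)
  case (Suc m)
  have "l2_norm T (kernel_op T k ((kernel_op T k ^^ m) f)) \<le> C * T * l2_norm T ((kernel_op T k ^^ m) f)"
    by (intro kernel_op_norm kernel_op_power_L2 Suc)
  also have "\<dots> \<le> C * T * ((C * T) ^ m * l2_norm T f)"
    using Suc C_nonneg T by (intro mult_left_mono) auto
  finally show ?case by (simp add: mult.assoc)
qed simp

lemma kernel_op_power_adj:
  assumes "f \<in> L2 T" "g \<in> L2 T"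
  shows "l2_inner T ((kernel_op T k ^^ m) f) g = l2_inner T f ((kernel_op T (adj_kernel k) ^^ m) g)"
  using assms(2)
proof (induction m arbitrary: g)
  case (Suc m)
  interpret A: bounded_kernel T "adj_kernel k" C by (rule adj_bounded_kernel)
  show ?case
    using Suc.prems kernel_op_adj[OF kernel_op_power_L2[OF assms(1)], of g m] Suc.IH[OF A.kernel_op_L2[OF Suc.prems]]
    by (simp add: funpow_swap1)
qed simp

text \<open>The Hilbert--Schmidt property: for fixed \<open>t\<close>, apply Bessel's inequality to the rows of \<open>k t\<close>.\<close>
lemma kernel_op_Hilbert_Schmidt:
  assumes S: "orthonormal_set T S" "finite S"
  shows "(\<Sum>e\<in>S. (l2_norm T (kernel_op T k e))\<^sup>2) \<le> CARD('n) * (C * sqrt T)\<^sup>2 * T"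
proof -
  have eL: "e \<in> L2 T" if "e \<in> S" for e using S that by (auto simp: orthonormal_set_def)
  have "(\<Sum>e\<in>S. (l2_norm T (kernel_op T k e))\<^sup>2) = (LINT t|leb_upto T. (\<Sum>e\<in>S. (norm (kernel_op T k e t))\<^sup>2))"
    unfolding l2_norm_power2 by (rule Bochner_Integration.integral_sum[symmetric])
      (intro L2_integrable_norm2 kernel_op_L2 eL)
  also have "\<dots> \<le> (LINT t|leb_upto T. CARD('n) * (C * sqrt T)\<^sup>2)"
  proof (rule integral_mono)
    show "integrable (leb_upto T) (\<lambda>t. \<Sum>e\<in>S. (norm (kernel_op T k e t))\<^sup>2)"
      by (intro Bochner_Integration.integrable_sum L2_integrable_norm2 kernel_op_L2 eL)
    show "integrable (leb_upto T) (\<lambda>t. CARD('n) * (C * sqrt T)\<^sup>2)"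
      by (intro integrable_leb_upto_bounded[of _ _ "CARD('n) * (C * sqrt T)\<^sup>2"]) auto
    fix t assume "t \<in> space (leb_upto T)"
    then have t: "t \<in> {0..T}" by simp
    have "(\<Sum>e\<in>S. (norm (kernel_op T k e t))\<^sup>2) = (\<Sum>e\<in>S. \<Sum>i\<in>UNIV. (cmod (l2_inner T (kernel_row k t i) e))\<^sup>2)"
      unfolding norm_vec_power2
      by (intro sum.cong refl) (simp add: kernel_op_component[OF t eL] l2_inner_cnj[of T _ "kernel_row k t _"])
    also have "\<dots> = (\<Sum>i\<in>UNIV. \<Sum>e\<in>S. (cmod (l2_inner T (kernel_row k t i) e))\<^sup>2)" by (rule sum.swap)
    also have "\<dots> \<le> (\<Sum>i\<in>(UNIV::'n set). (C * sqrt T)\<^sup>2)"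
      by (intro sum_mono order_trans[OF Bessel_inequality[OF S kernel_row_L2[OF t]]] power_mono kernel_row_norm t) simp
    finally show "(\<Sum>e\<in>S. (norm (kernel_op T k e t))\<^sup>2) \<le> CARD('n) * (C * sqrt T)\<^sup>2" by simp
  qed
  also have "\<dots> = CARD('n) * (C * sqrt T)\<^sup>2 * T"
    using T by (simp add: measure_restrict_space)
  finally show ?thesis .
qed

end

text \<open>Nuclear representations are indexed by natural numbers, so the expansion of an operator
  along a basis requires an enumerated basis; injectivity turns sums over the range into sums over
  indices.\<close>

definition orthonormal_seq :: "real \<Rightarrow> (nat \<Rightarrow> ('n::finite) vfun) \<Rightarrow> bool" where
  "orthonormal_seq T \<phi> \<longleftrightarrow> inj \<phi> \<and> orthonormal_basis T (range \<phi>)"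

lemma orthonormal_seqD:
  assumes "orthonormal_seq T \<phi>"
  shows "\<phi> n \<in> L2 T" "orthonormal_set T (\<phi> ` A)" "inj_on \<phi> A"
proof -
  have ON: "orthonormal_set T (range \<phi>)" using assms by (simp add: orthonormal_seq_def orthonormal_basis_iff)
  then show "\<phi> n \<in> L2 T" by (auto simp: orthonormal_set_def)
  show "orthonormal_set T (\<phi> ` A)" by (rule orthonormal_subset[OF ON]) auto
  show "inj_on \<phi> A" using assms by (auto simp: orthonormal_seq_def intro: inj_on_subset)
qed

lemma Parseval_seq:
  assumes "0 \<le> T" "orthonormal_seq T \<phi>" "f \<in> L2 T" "g \<in> L2 T"
  shows "(\<lambda>k. l2_inner T f (\<phi> k) * l2_inner T (\<phi> k) g) sums l2_inner T f g"
proof -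
  have "((\<lambda>e. l2_inner T f e * l2_inner T e g) has_sum l2_inner T f g) (range \<phi>)"
    using assms by (intro Parseval) (auto simp: orthonormal_seq_def)
  then have "((\<lambda>k. l2_inner T f (\<phi> k) * l2_inner T (\<phi> k) g) has_sum l2_inner T f g) UNIV"
    using has_sum_reindex[of \<phi> UNIV "\<lambda>e. l2_inner T f e * l2_inner T e g", THEN iffD1] assms(2)
    by (simp only: orthonormal_seq_def o_def)
  then show ?thesis by (rule has_sum_imp_sums)
qed

lemma fourier_sum_seq_tendsto:
  assumes "0 \<le> T" and \<phi>: "orthonormal_seq T \<phi>" and f: "f \<in> L2 T"
  shows "(\<lambda>N. l2_norm T (\<lambda>t. f t - (\<Sum>k<N. l2_inner T f (\<phi> k) *s \<phi> k t))) \<longlonglongrightarrow> 0"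
proof -
  have "(\<lambda>k. complex_of_real ((cmod (l2_inner T f (\<phi> k)))\<^sup>2)) sums of_real ((l2_norm T f)\<^sup>2)"
    using Parseval_seq[OF assms f] unfolding l2_inner_self complex_norm_square
    by (subst l2_inner_cnj) simp
  then have "(\<lambda>k. (cmod (l2_inner T f (\<phi> k)))\<^sup>2) sums (l2_norm T f)\<^sup>2"
    by (simp only: sums_of_real_iff)
  then have "(\<lambda>N. (l2_norm T f)\<^sup>2 - (\<Sum>k<N. (cmod (l2_inner T f (\<phi> k)))\<^sup>2)) \<longlonglongrightarrow> (l2_norm T f)\<^sup>2 - (l2_norm T f)\<^sup>2"
    unfolding sums_def by (intro tendsto_diff tendsto_const)
  moreover have "(l2_norm T f)\<^sup>2 - (\<Sum>k<N. (cmod (l2_inner T f (\<phi> k)))\<^sup>2)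
      = (l2_norm T (\<lambda>t. f t - (\<Sum>k<N. l2_inner T f (\<phi> k) *s \<phi> k t)))\<^sup>2" for N
    using norm_diff_fourier_sum[OF orthonormal_seqD(2)[OF \<phi>, of "{..<N}"] _ f] orthonormal_seqD(3)[OF \<phi>, of "{..<N}"]
    by (simp add: fourier_sum_def sum.reindex)
  ultimately have "(\<lambda>N. sqrt ((l2_norm T (\<lambda>t. f t - (\<Sum>k<N. l2_inner T f (\<phi> k) *s \<phi> k t)))\<^sup>2)) \<longlonglongrightarrow> sqrt 0"
    by (intro tendsto_real_sqrt) simp
  then show ?thesis by simp
qed

text \<open>For \<open>m \<ge> 2\<close> expand \<open>K\<^sup>m = K K\<^sup>m\<^sup>-\<^sup>1\<close> over an orthonormal basis. The trace is the integral of the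
  inner products of the rows of the kernels of \<open>K\<close> and \<open>(K\<^sup>m\<^sup>-\<^sup>1)\<^sup>*\<close> at \<open>t\<close>, whose supports are disjoint.\<close>
lemma (in bounded_kernel) Volterra_power_trace:
  fixes \<phi> :: "nat \<Rightarrow> 'n vfun"
  assumes volterra: "\<And>t s. t \<le> s \<Longrightarrow> k t s = 0" and \<phi>: "orthonormal_seq T \<phi>"
  shows "has_trace T (kernel_op T k ^^ Suc (Suc m)) 0"
proof -
  interpret A: bounded_kernel T "adj_kernel k" C by (rule adj_bounded_kernel)
  let ?K = "kernel_op T k" and ?K' = "kernel_op T (adj_kernel k)"
  \<comment> \<open>The power is K W. Expanding W f along \<phi> gives the terms <f, u n> v n, with
    u n the adjoint of W at \<phi> n and v n = K (\<phi> n).\<close>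
  define W where "W = ?K ^^ Suc m"
  define u v where "u n = (?K' ^^ Suc m) (\<phi> n)" and "v n = ?K (\<phi> n)" for n
  note \<phi>L = orthonormal_seqD(1)[OF \<phi>]
  have uL: "u n \<in> L2 T" and vL: "v n \<in> L2 T" for n
    unfolding u_def v_def by (intro A.kernel_op_power_L2 kernel_op_L2 \<phi>L)+
  have WL: "W f \<in> L2 T" if "f \<in> L2 T" for f unfolding W_def by (rule kernel_op_power_L2[OF that])
  have HS: "(\<Sum>n<N. (l2_norm T (kernel_op T k' (\<phi> n)))\<^sup>2) \<le> CARD('n) * (C * sqrt T)\<^sup>2 * T"
    if "bounded_kernel T k' C" for N k'
    using bounded_kernel.kernel_op_Hilbert_Schmidt[OF that orthonormal_seqD(2)[OF \<phi>, of "{..<N}"]]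
      orthonormal_seqD(3)[OF \<phi>, of "{..<N}"] by (simp add: sum.reindex)
  have sum_sq: "summable (\<lambda>n. (l2_norm T (kernel_op T k' (\<phi> n)))\<^sup>2)" if "bounded_kernel T k' C" for k'
    by (rule summableI_nonneg_bounded[OF _ HS[OF that]]) simp
  have "nuclear_rep T (?K ^^ Suc (Suc m)) u v"
    unfolding nuclear_rep_def
  proof (intro conjI ballI)
    show "range u \<subseteq> L2 T" "range v \<subseteq> L2 T" using uL vL by auto
    \<comment> \<open>Both u and v have square-summable norms by the Hilbert-Schmidt bound: one
      factor of the adjoint is kept for it, the other m factors are bounded in norm.\<close>
    show "summable (\<lambda>n. l2_norm T (u n) * l2_norm T (v n))"
    proof (rule summable_comparison_test')
      show "summable (\<lambda>n. ((C * T) ^ m)\<^sup>2 * (l2_norm T (?K' (\<phi> n)))\<^sup>2 + (l2_norm T (?K (\<phi> n)))\<^sup>2)"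
        by (intro summable_add summable_mult sum_sq A.bounded_kernel_axioms bounded_kernel_axioms)
      fix n
      have "l2_norm T (u n) \<le> (C * T) ^ m * l2_norm T (?K' (\<phi> n))"
        unfolding u_def funpow_Suc_right o_def by (intro A.kernel_op_power_norm A.kernel_op_L2 \<phi>L)
      then have "(l2_norm T (u n))\<^sup>2 \<le> ((C * T) ^ m)\<^sup>2 * (l2_norm T (?K' (\<phi> n)))\<^sup>2"
        unfolding power_mult_distrib[symmetric] by (rule power_mono) simp
      moreover have "l2_norm T (u n) * l2_norm T (v n) \<le> (l2_norm T (u n))\<^sup>2 + (l2_norm T (v n))\<^sup>2"
        using sum_squares_bound[of "l2_norm T (u n)" "l2_norm T (v n)"]
          mult_nonneg_nonneg[OF l2_norm_nonneg[of T "u n"] l2_norm_nonneg[of T "v n"]] by linarith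
      ultimately show "norm (l2_norm T (u n) * l2_norm T (v n))
          \<le> ((C * T) ^ m)\<^sup>2 * (l2_norm T (?K' (\<phi> n)))\<^sup>2 + (l2_norm T (?K (\<phi> n)))\<^sup>2"
        by (simp add: v_def abs_mult)
    qed
    fix f :: "'n vfun" assume f: "f \<in> L2 T"
    show "(?K ^^ Suc (Suc m)) f \<in> L2 T" by (rule kernel_op_power_L2[OF f])
    have fu: "l2_inner T f (u n) = l2_inner T (W f) (\<phi> n)" for n
      unfolding u_def W_def by (rule kernel_op_power_adj[OF f \<phi>L, symmetric])
    define R where "R N t = W f t - (\<Sum>n<N. l2_inner T (W f) (\<phi> n) *s \<phi> n t)" for N t
    have SL: "(\<lambda>t. \<Sum>n<N. l2_inner T (W f) (\<phi> n) *s \<phi> n t) \<in> L2 T" for N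
      by (intro L2_sum L2_smult \<phi>L)
    have RL: "R N \<in> L2 T" for N
      unfolding R_def[abs_def] by (rule L2_diff[OF WL[OF f] SL])
    have KR: "l2_norm T (\<lambda>t. (?K ^^ Suc (Suc m)) f t - (\<Sum>n<N. l2_inner T f (u n) *s v n t)) = l2_norm T (?K (R N))" for N
    proof (rule l2_norm_cong)
      show "l2_eq T (\<lambda>t. (?K ^^ Suc (Suc m)) f t - (\<Sum>n<N. l2_inner T f (u n) *s v n t)) (?K (R N))"
      proof (rule l2_eqI)
        fix t assume t: "t \<in> {0..T}"
        have "?K (R N) t = ?K (W f) t - (\<Sum>n<N. l2_inner T (W f) (\<phi> n) *s ?K (\<phi> n) t)"
          unfolding R_def[abs_def] by (subst kernel_op_diff[OF WL[OF f] SL t], subst kernel_op_sum[OF \<phi>L t]) simp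
        then show "(?K ^^ Suc (Suc m)) f t - (\<Sum>n<N. l2_inner T f (u n) *s v n t) = ?K (R N) t"
          by (simp add: fu v_def W_def)
      qed
      show "(\<lambda>t. (?K ^^ Suc (Suc m)) f t - (\<Sum>n<N. l2_inner T f (u n) *s v n t)) \<in> L2 T"
        by (intro L2_diff L2_sum L2_smult vL kernel_op_power_L2 f)
      show "?K (R N) \<in> L2 T" by (intro kernel_op_L2 RL)
    qed
    show "(\<lambda>N. l2_norm T (\<lambda>t. (?K ^^ Suc (Suc m)) f t - (\<Sum>n<N. l2_inner T f (u n) *s v n t))) \<longlonglongrightarrow> 0"
      unfolding KR
    proof (rule Lim_null_comparison)
      show "\<forall>\<^sub>F N in sequentially. norm (l2_norm T (?K (R N))) \<le> C * T * l2_norm T (R N)"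
        by (simp add: kernel_op_norm RL)
      show "(\<lambda>N. C * T * l2_norm T (R N)) \<longlonglongrightarrow> 0"
        unfolding R_def using tendsto_mult_right_zero[OF fourier_sum_seq_tendsto[OF T \<phi> WL[OF f]]] by simp
    qed
  qed
  then have tr: "has_trace T (?K ^^ Suc (Suc m)) (\<Sum>n. l2_inner T (v n) (u n))" by (rule has_trace_nuclear[OF T])
  \<comment> \<open>\<open>q t i\<close> represents the i-th component of u n at t, just as
    \<open>p t i\<close> represents that of v n. As a row of the kernel of the adjoint of W it is
    the m-th power of K applied to a row of the adjoint kernel.\<close>
  define p q where "p t i = kernel_row k t i" and "q t i = (?K ^^ m) (kernel_row (adj_kernel k) t i)" for t i
  have pL: "p t i \<in> L2 T" and qL: "q t i \<in> L2 T" if "t \<in> {0..T}" for t i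
    unfolding p_def q_def by (intro kernel_row_L2 kernel_op_power_L2 A.kernel_row_L2 that)+
  \<comment> \<open>A Volterra operator preserves vanishing on s <= t: in the integral for s, either
    s <= r and the kernel vanishes, or r < s <= t and the function does. Hence q lives on s > t,
    whereas p lives on s < t.\<close>
  have q_supp: "(?K ^^ j) (kernel_row (adj_kernel k) t i) s = 0" if "s \<le> t" for s t i j
    using that
  proof (induction j arbitrary: s)
    case 0
    then show ?case by (simp add: kernel_row_def adj_kernel_def adj_def volterra vec_eq_iff)
  next
    case (Suc j)
    have "k s r *v (?K ^^ j) (kernel_row (adj_kernel k) t i) r = 0" for r
      using Suc volterra[of s r] by (cases "s \<le> r") auto
    moreover have "kernel_op T k g s = 0" if "\<And>r. k s r *v g r = 0" for g
      unfolding kernel_op_def that by simp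
    ultimately show ?case by simp
  qed
  have qp: "l2_inner T (q t i) (p t i) = 0" for t i
  proof -
    have "cdot (q t i s) (p t i s) = 0" for s
      using q_supp[of s t m i] volterra[of t s]
      by (cases "s \<le> t") (simp_all add: q_def p_def kernel_row_def cdot_def)
    then show ?thesis by (simp add: l2_inner_cdot)
  qed
  have uc: "u n t $ i = l2_inner T (\<phi> n) (q t i)" if t: "t \<in> {0..T}" for n t i
  proof -
    have "u n t $ i = l2_inner T ((?K' ^^ m) (\<phi> n)) (kernel_row (adj_kernel k) t i)"
      unfolding u_def by (simp add: A.kernel_op_component[OF t A.kernel_op_power_L2[OF \<phi>L]])
    also have "\<dots> = cnj (l2_inner T (kernel_row (adj_kernel k) t i) ((?K' ^^ m) (\<phi> n)))" by (rule l2_inner_cnj)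
    also have "\<dots> = cnj (l2_inner T (q t i) (\<phi> n))"
      unfolding q_def by (simp add: kernel_op_power_adj[OF A.kernel_row_L2[OF t] \<phi>L])
    finally show ?thesis by (simp add: l2_inner_cnj[of T _ "q t i"])
  qed
  have vuc: "cdot (v n t) (u n t) = (\<Sum>i\<in>UNIV. l2_inner T (q t i) (\<phi> n) * l2_inner T (\<phi> n) (p t i))"
    if t: "t \<in> {0..T}" for n t
    unfolding cdot_def uc[OF t] v_def kernel_op_component[OF t \<phi>L]
    by (intro sum.cong refl) (simp add: p_def l2_inner_cnj[of T "q t _"] mult.commute)
  \<comment> \<open>For fixed t the partial sums tend to the inner products of q and p by Parseval,
    that is to 0; Bessel bounds them uniformly in N and t, so dominated convergence applies.\<close>
  have "(\<lambda>N. LINT t|leb_upto T. (\<Sum>n<N. cdot (v n t) (u n t))) \<longlonglongrightarrow> (LINT t|leb_upto T. 0)"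
  proof (rule integral_dominated_convergence)
    let ?B = "CARD('n) * ((C * T) ^ m * (C * sqrt T) * (C * sqrt T))"
    show "(\<lambda>t. \<Sum>n<N. cdot (v n t) (u n t)) \<in> borel_measurable (leb_upto T)" for N
      by (intro borel_measurable_sum measurable_cdot L2_measurable uL vL)
    show "integrable (leb_upto T) (\<lambda>t. ?B)" by (rule integrable_leb_upto_bounded[of _ _ "\<bar>?B\<bar>"]) auto
    show "AE t in leb_upto T. (\<lambda>N. \<Sum>n<N. cdot (v n t) (u n t)) \<longlonglongrightarrow> 0"
    proof (rule AE_I2)
      fix t assume "t \<in> space (leb_upto T)"
      then have t: "t \<in> {0..T}" by simp
      have "(\<lambda>n. \<Sum>i\<in>UNIV. l2_inner T (q t i) (\<phi> n) * l2_inner T (\<phi> n) (p t i)) sums (\<Sum>i\<in>UNIV. l2_inner T (q t i) (p t i))"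
        by (intro sums_sum Parseval_seq T \<phi> pL qL t)
      then show "(\<lambda>N. \<Sum>n<N. cdot (v n t) (u n t)) \<longlonglongrightarrow> 0"
        unfolding vuc[OF t] by (simp add: qp sums_def)
    qed
    show "AE t in leb_upto T. norm (\<Sum>n<N. cdot (v n t) (u n t)) \<le> ?B" for N
    proof (rule AE_I2)
      fix t assume "t \<in> space (leb_upto T)"
      then have t: "t \<in> {0..T}" by simp
      have "norm (\<Sum>n<N. cdot (v n t) (u n t)) = norm (\<Sum>i\<in>UNIV. \<Sum>n<N. l2_inner T (q t i) (\<phi> n) * l2_inner T (\<phi> n) (p t i))"
        unfolding vuc[OF t] by (subst sum.swap) simp
      also have "\<dots> \<le> (\<Sum>i\<in>UNIV. \<Sum>n<N. cmod (l2_inner T (q t i) (\<phi> n) * l2_inner T (\<phi> n) (p t i)))"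
        by (intro order_trans[OF norm_sum] sum_mono norm_sum)
      also have "\<dots> \<le> (\<Sum>i\<in>(UNIV::'n set). (C * T) ^ m * (C * sqrt T) * (C * sqrt T))"
      proof (rule sum_mono)
        fix i :: 'n
        have "(\<Sum>n<N. cmod (l2_inner T (q t i) (\<phi> n) * l2_inner T (\<phi> n) (p t i))) \<le> l2_norm T (q t i) * l2_norm T (p t i)"
          using Bessel_bilinear[OF orthonormal_seqD(2)[OF \<phi>, of "{..<N}"] _ qL[OF t] pL[OF t], of i i]
            orthonormal_seqD(3)[OF \<phi>, of "{..<N}"] by (simp add: sum.reindex)
        also have "\<dots> \<le> (C * T) ^ m * (C * sqrt T) * (C * sqrt T)"
        proof (rule mult_mono)
          have "l2_norm T (q t i) \<le> (C * T) ^ m * l2_norm T (kernel_row (adj_kernel k) t i)"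
            unfolding q_def by (rule kernel_op_power_norm[OF A.kernel_row_L2[OF t]])
          also have "\<dots> \<le> (C * T) ^ m * (C * sqrt T)"
            using C_nonneg T by (intro mult_left_mono A.kernel_row_norm t) auto
          finally show "l2_norm T (q t i) \<le> (C * T) ^ m * (C * sqrt T)" .
          show "l2_norm T (p t i) \<le> C * sqrt T" unfolding p_def by (rule kernel_row_norm[OF t])
        qed (use C_nonneg T in auto)
        finally show "(\<Sum>n<N. cmod (l2_inner T (q t i) (\<phi> n) * l2_inner T (\<phi> n) (p t i))) \<le> (C * T) ^ m * (C * sqrt T) * (C * sqrt T)" .
      qed
      finally show "norm (\<Sum>n<N. cdot (v n t) (u n t)) \<le> ?B" by simp
    qed
  qed simp
  moreover have "(LINT t|leb_upto T. (\<Sum>n<N. cdot (v n t) (u n t))) = (\<Sum>n<N. l2_inner T (v n) (u n))" for N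
    unfolding l2_inner_cdot by (rule Bochner_Integration.integral_sum) (intro L2_integrable_cdot uL vL)
  ultimately have "(\<lambda>n. l2_inner T (v n) (u n)) sums 0" by (simp add: sums_def)
  then have "(\<Sum>n. l2_inner T (v n) (u n)) = 0" by (simp add: sums_iff)
  with tr show ?thesis by simp
qed

section \<open>Primitives and integration by parts\<close>

lemma measurable_leb_continuous:
  "continuous_on {0..T} f \<Longrightarrow> f \<in> borel_measurable (leb_upto T)"
  by (rule continuous_imp_measurable_on_sets_lebesgue) auto

lemma integrable_leb_continuous:
  fixes f :: "real \<Rightarrow> 'a::euclidean_space"
  shows "continuous_on {0..T} f \<Longrightarrow> integrable (leb_upto T) f"
  by (rule continuous_imp_integrable_real)

lemma measurable_leb_id: "(\<lambda>t. t) \<in> borel_measurable (leb_upto T)"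
  by (rule measurable_leb_continuous) (rule continuous_on_id)

text \<open>The integral that occurs in \<open>has_sobolev_deriv\<close>. Its measure varies with t;
  \<open>primitive_alt\<close> moves it to the fixed interval, where Fubini applies.\<close>

definition primitive :: "(real \<Rightarrow> 'a::euclidean_space) \<Rightarrow> real \<Rightarrow> 'a" where
  "primitive f t = (LINT s|leb_upto t. f s)"

lemma primitive_alt:
  assumes "t \<in> {0..T}" shows "primitive f t = (LINT s|leb_upto T. (if s \<le> t then f s else 0))"
proof -
  have "(LINT s|leb_upto T. (if s \<le> t then f s else 0)) = (LINT s|leb_upto T. (if s \<in> {0..t} then f s else 0))"
    by (intro Bochner_Integration.integral_cong) auto
  also have "\<dots> = primitive f t"
    unfolding primitive_def using assms by (intro integral_restrict) auto
  finally show ?thesis by simp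
qed

text \<open>The kernel of the Volterra part is cut off at s < t and thus vanishes on the diagonal;
  the point t is a null set.\<close>

lemma primitive_strict:
  fixes f :: "real \<Rightarrow> 'a::euclidean_space"
  assumes "t \<in> {0..T}" "f \<in> borel_measurable (leb_upto T)"
  shows "(LINT s|leb_upto T. (if s < t then f s else 0)) = primitive f t"
  unfolding primitive_alt[OF assms(1)]
proof (rule integral_cong_AE)
  show "(\<lambda>s. if s < t then f s else 0) \<in> borel_measurable (leb_upto T)" "(\<lambda>s. if s \<le> t then f s else 0) \<in> borel_measurable (leb_upto T)"
    using assms(2) measurable_leb_id[of T] by measurable
  have "{t} \<in> null_sets (leb_upto T)"
    using assms(1) by (subst null_sets_restrict_space) auto
  then show "AE s in leb_upto T. (if s < t then f s else 0) = (if s \<le> t then f s else 0)"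
    by (rule AE_I') auto
qed

lemma integrable_leb_restrict:
  fixes f :: "real \<Rightarrow> 'a::euclidean_space"
  assumes "integrable (leb_upto T) f" shows "integrable (leb_upto T) (\<lambda>s. if s \<le> t then f s else 0)"
proof (rule Bochner_Integration.integrable_bound[OF assms])
  show "(\<lambda>s. if s \<le> t then f s else 0) \<in> borel_measurable (leb_upto T)"
    using assms measurable_leb_id[of T] by measurable
qed auto

lemma integrable_leb_subinterval:
  fixes f :: "real \<Rightarrow> 'a::euclidean_space"
  assumes "integrable (leb_upto T) f" "t \<le> T" shows "integrable (leb_upto t) f"
proof -
  have "integrable lebesgue (\<lambda>x. if x \<in> {0..T} then f x else 0)"
    using assms(1) by (intro Lebesgue_Measure.integrable_restrict_UNIV[THEN iffD2]) auto
  then have "integrable lebesgue (\<lambda>x. indicat_real {0..t} x *\<^sub>R (if x \<in> {0..T} then f x else 0))"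
    by (intro integrable_mult_indicator) auto
  also have "(\<lambda>x. indicat_real {0..t} x *\<^sub>R (if x \<in> {0..T} then f x else 0)) = (\<lambda>x. if x \<in> {0..t} then f x else 0)"
    using assms(2) by (auto simp: indicator_def)
  finally show ?thesis by (rule Lebesgue_Measure.integrable_restrict_UNIV[THEN iffD1, rotated]) auto
qed

lemma primitive_continuous:
  fixes f :: "real \<Rightarrow> 'a::euclidean_space"
  shows "integrable (leb_upto T) f \<Longrightarrow> continuous_on {0..T} (primitive f)"
  unfolding primitive_def[abs_def] by (rule indefinite_integral_continuous_real)

lemma primitive_0 [simp]: "primitive f 0 = 0"
proof -
  have "{0::real} \<in> null_sets (leb_upto 0)" by simp
  then have "AE s in leb_upto 0. f s = 0" by (rule AE_I') auto
  then have "primitive f 0 = (LINT s|leb_upto 0. 0)"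
    unfolding primitive_def by (rule integral_eq_zero_AE[THEN trans]) simp
  then show ?thesis by simp
qed

lemma primitive_eq_integral:
  fixes f :: "real \<Rightarrow> 'a::euclidean_space"
  assumes "continuous_on {0..T} f" "t \<le> T"
  shows "primitive f t = integral {0..t} f"
  unfolding primitive_def
  by (rule lebesgue_integral_eq_integral) (use assms in \<open>auto intro!: continuous_imp_integrable_real intro: continuous_on_subset\<close>)

lemma primitive_has_derivative:
  fixes f :: "real \<Rightarrow> 'a::euclidean_space"
  assumes "continuous_on {0..T} f" "t \<in> {0..T}"
  shows "(primitive f has_vector_derivative f t) (at t within {0..T})"
proof (rule has_vector_derivative_transform[OF assms(2)])
  show "((\<lambda>u. integral {0..u} f) has_vector_derivative f t) (at t within {0..T})"
    by (rule integral_has_vector_derivative[OF assms])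
qed (use primitive_eq_integral[OF assms(1)] in auto)

lemma LINT_FTC:
  fixes F :: "real \<Rightarrow> 'a::euclidean_space"
  assumes F: "\<And>s. s \<in> {0..T} \<Longrightarrow> (F has_vector_derivative f s) (at s within {0..T})"
    and f: "continuous_on {0..T} f" and u: "0 \<le> u" "u \<le> t" "t \<le> T"
  shows "(LINT s|leb_upto T. (if u \<le> s \<and> s \<le> t then f s else 0)) = F t - F u"
proof -
  have sub: "{u..t} \<subseteq> {0..T}" using u by auto
  have "(LINT s|leb_upto T. (if u \<le> s \<and> s \<le> t then f s else 0)) = (LINT s|leb_upto T. (if s \<in> {u..t} then f s else 0))"
    by (intro Bochner_Integration.integral_cong) auto
  also have "\<dots> = (LINT s|lebesgue_on {u..t}. f s)" using sub by (intro integral_restrict) auto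
  also have "\<dots> = integral {u..t} f"
    using continuous_on_subset[OF f sub] by (intro lebesgue_integral_eq_integral continuous_imp_integrable_real) auto
  also have "\<dots> = F t - F u"
    using sub by (intro integral_unique fundamental_theorem_of_calculus u)
      (auto intro: has_vector_derivative_within_subset[OF F])
  finally show ?thesis .
qed

lemma LINT_FTC_full:
  fixes F :: "real \<Rightarrow> 'a::euclidean_space"
  assumes "\<And>s. s \<in> {0..T} \<Longrightarrow> (F has_vector_derivative f s) (at s within {0..T})"
    and "continuous_on {0..T} f" "0 \<le> T"
  shows "(LINT s|leb_upto T. f s) = F T - F 0"
proof -
  have "(LINT s|leb_upto T. f s) = (LINT s|leb_upto T. (if 0 \<le> s \<and> s \<le> T then f s else 0))"
    by (intro Bochner_Integration.integral_cong) auto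
  also have "\<dots> = F T - F 0" using assms by (intro LINT_FTC) auto
  finally show ?thesis .
qed

text \<open>g is only integrable, so the product rule is not at hand. Instead Fubini is used on the
  triangle u <= s <= t: integrating in u first gives the left-hand side, in s first gives h (X t - X
  u) (g u).\<close>

lemma integration_by_parts_primitive:
  fixes X :: "real \<Rightarrow> 'a::euclidean_space" and g :: "real \<Rightarrow> 'b::euclidean_space"
    and h :: "'a \<Rightarrow> 'b \<Rightarrow> 'c::euclidean_space"
  assumes h: "bounded_bilinear h"
    and X: "\<And>s. s \<in> {0..T} \<Longrightarrow> (X has_vector_derivative X' s) (at s within {0..T})"
    and X': "continuous_on {0..T} X'" and g: "integrable (leb_upto T) g" and t: "t \<in> {0..T}"
  shows "primitive (\<lambda>s. h (X' s) (primitive g s)) t = h (X t) (primitive g t) - primitive (\<lambda>s. h (X s) (g s)) t"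
proof -
  interpret h: bounded_bilinear h by (rule h)
  interpret pair_sigma_finite "leb_upto T" "leb_upto T"
    by (simp add: pair_sigma_finite_def sigma_finite_leb_upto)
  define f where "f s u = (if u \<le> s \<and> s \<le> t then h (X' s) (g u) else 0)" for s u
  have gm: "g \<in> borel_measurable (leb_upto T)" using g by auto
  have X'm: "X' \<in> borel_measurable (leb_upto T)" by (rule measurable_leb_continuous[OF X'])
  obtain K where K: "K > 0" "\<And>a b. norm (h a b) \<le> norm a * norm b * K" using h.pos_bounded by blast
  obtain B where B: "\<And>s. s \<in> {0..T} \<Longrightarrow> norm (X' s) \<le> B"
    using compact_imp_bounded[OF compact_continuous_image[OF X' compact_Icc]] unfolding bounded_iff by blast
  then have B0: "0 \<le> B" using t norm_ge_zero order_trans by blast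
  have Xc: "continuous_on {0..T} X"
    using X has_vector_derivative_continuous continuous_on_eq_continuous_within by blast
  have m1: "(\<lambda>p. h (X' (fst p)) (g (snd p))) \<in> borel_measurable (leb_upto T \<Otimes>\<^sub>M leb_upto T)"
    by (intro borel_measurable_bilinear[OF h] measurable_compose[OF measurable_fst X'm] measurable_compose[OF measurable_snd gm])
  have m2: "fst \<in> borel_measurable (leb_upto T \<Otimes>\<^sub>M leb_upto T)" "snd \<in> borel_measurable (leb_upto T \<Otimes>\<^sub>M leb_upto T)"
    using measurable_compose[OF measurable_fst measurable_leb_id] measurable_compose[OF measurable_snd measurable_leb_id] by auto
  have fm: "case_prod f \<in> borel_measurable (leb_upto T \<Otimes>\<^sub>M leb_upto T)"
    unfolding f_def case_prod_unfold using m1 m2 by measurable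
  have f_bound: "norm (f s u) \<le> B * K * norm (g u)" if "s \<in> {0..T}" for s u
  proof -
    have "norm (h (X' s) (g u)) \<le> norm (X' s) * norm (g u) * K" by (rule K)
    also have "\<dots> \<le> B * norm (g u) * K" using B[OF that] K by (intro mult_right_mono) auto
    finally show ?thesis using B0 K by (simp add: f_def mult_ac)
  qed
  have int: "integrable (leb_upto T \<Otimes>\<^sub>M leb_upto T) (case_prod f)"
  proof (rule Bochner_Integration.integrable_bound[OF _ fm])
    have "integrable (leb_upto T \<Otimes>\<^sub>M leb_upto T) (\<lambda>(s, u). norm (g u))"
    proof (rule Fubini_integrable)
      show "(\<lambda>(s, u). norm (g u)) \<in> borel_measurable (leb_upto T \<Otimes>\<^sub>M leb_upto T)"
        using measurable_compose[OF measurable_snd gm, of "leb_upto T"] by (simp add: case_prod_unfold)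
      show "integrable (leb_upto T) (\<lambda>x. LINT y|leb_upto T. norm (case (x, y) of (s, u) \<Rightarrow> norm (g u)))"
        using integrable_leb_upto_bounded[of "\<lambda>_. LINT y|leb_upto T. norm (g y)" T "\<bar>LINT y|leb_upto T. norm (g y)\<bar>"] by simp
    qed (use g in auto)
    then show "integrable (leb_upto T \<Otimes>\<^sub>M leb_upto T) (\<lambda>p. B * K * (case p of (s, u) \<Rightarrow> norm (g u)))"
      by (rule integrable_mult_right)
    show "AE p in leb_upto T \<Otimes>\<^sub>M leb_upto T. norm (case_prod f p) \<le> norm (B * K * (case p of (s, u) \<Rightarrow> norm (g u)))"
      by (rule AE_I2) (use f_bound B0 K in \<open>auto simp: space_pair_measure abs_mult\<close>)
  qed
  have inner_u: "(LINT u|leb_upto T. f s u) = (if s \<le> t then h (X' s) (primitive g s) else 0)" if s: "s \<in> {0..T}" for s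
  proof -
    have "(LINT u|leb_upto T. f s u) = (LINT u|leb_upto T. (if s \<le> t then h (X' s) (if u \<le> s then g u else 0) else 0))"
      by (intro Bochner_Integration.integral_cong) (auto simp: f_def h.zero_right)
    also have "\<dots> = (if s \<le> t then (LINT u|leb_upto T. h (X' s) (if u \<le> s then g u else 0)) else 0)" by simp
    also have "(LINT u|leb_upto T. h (X' s) (if u \<le> s then g u else 0)) = h (X' s) (primitive g s)"
      unfolding primitive_alt[OF s]
      by (rule integral_bounded_linear[OF h.bounded_linear_right integrable_leb_restrict[OF g]])
    finally show ?thesis .
  qed
  have inner_s: "(LINT s|leb_upto T. f s u) = (if u \<le> t then h (X t) (g u) - h (X u) (g u) else 0)" if u: "u \<in> {0..T}" for u
  proof (cases "u \<le> t")
    case True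
    have "(LINT s|leb_upto T. f s u) = (LINT s|leb_upto T. h (if u \<le> s \<and> s \<le> t then X' s else 0) (g u))"
      by (intro Bochner_Integration.integral_cong) (auto simp: f_def h.zero_left)
    also have "\<dots> = h (LINT s|leb_upto T. (if u \<le> s \<and> s \<le> t then X' s else 0)) (g u)"
    proof (rule integral_bounded_linear[OF h.bounded_linear_left])
      show "integrable (leb_upto T) (\<lambda>s. if u \<le> s \<and> s \<le> t then X' s else 0)"
        using X'm measurable_leb_id[of T] B B0 by (intro integrable_leb_upto_bounded[where C = B]) auto
    qed
    also have "(LINT s|leb_upto T. (if u \<le> s \<and> s \<le> t then X' s else 0)) = X t - X u"
      using u t True by (intro LINT_FTC[OF X X']) auto
    finally show ?thesis using True by (simp add: h.diff_left)
  next
    case False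
    then have "f s u = 0" for s by (auto simp: f_def)
    with False show ?thesis by simp
  qed
  have int1: "integrable (leb_upto T) (\<lambda>u. h (X t) (g u))"
    by (rule integrable_bounded_linear[OF h.bounded_linear_right g])
  have int2: "integrable (leb_upto T) (\<lambda>u. h (X u) (g u))"
  proof -
    obtain C where C: "\<And>s. s \<in> {0..T} \<Longrightarrow> norm (X s) \<le> C"
      using compact_imp_bounded[OF compact_continuous_image[OF Xc compact_Icc]] unfolding bounded_iff by blast
    have "0 \<le> C" using C[OF t] norm_ge_zero order_trans by blast
    show ?thesis
    proof (rule Bochner_Integration.integrable_bound[of _ "\<lambda>u. C * K * norm (g u)"])
      show "AE u in leb_upto T. norm (h (X u) (g u)) \<le> norm (C * K * norm (g u))"
      proof (rule AE_I2)
        fix u assume "u \<in> space (leb_upto T)"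
        then have "norm (X u) * norm (g u) * K \<le> C * norm (g u) * K" using C K by (intro mult_right_mono) auto
        then show "norm (h (X u) (g u)) \<le> norm (C * K * norm (g u))"
          using order_trans[OF K(2)[of "X u" "g u"]] \<open>0 \<le> C\<close> K(1) by (simp add: abs_mult mult_ac)
      qed
      show "(\<lambda>u. h (X u) (g u)) \<in> borel_measurable (leb_upto T)"
        by (rule borel_measurable_bilinear[OF h measurable_leb_continuous[OF Xc] gm])
    qed (use g in auto)
  qed
  have "primitive (\<lambda>s. h (X' s) (primitive g s)) t = (LINT s|leb_upto T. (LINT u|leb_upto T. f s u))"
    unfolding primitive_alt[OF t] by (intro Bochner_Integration.integral_cong refl) (simp only: space_lebesgue_on inner_u)
  also have "\<dots> = (LINT u|leb_upto T. (LINT s|leb_upto T. f s u))"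
    by (rule Fubini_integral[OF int, symmetric])
  also have "\<dots> = (LINT u|leb_upto T. (if u \<le> t then h (X t) (g u) else 0) - (if u \<le> t then h (X u) (g u) else 0))"
    by (intro Bochner_Integration.integral_cong refl) (simp add: inner_s)
  also have "\<dots> = primitive (\<lambda>u. h (X t) (g u)) t - primitive (\<lambda>u. h (X u) (g u)) t"
    unfolding primitive_alt[OF t]
    by (intro Bochner_Integration.integral_diff integrable_leb_restrict int1 int2)
  also have "primitive (\<lambda>u. h (X t) (g u)) t = h (X t) (primitive g t)"
    unfolding primitive_def using t
    by (intro integral_bounded_linear[OF h.bounded_linear_right] integrable_leb_subinterval[OF g]) auto
  finally show ?thesis .
qed

text \<open>The integral of f vanishes over all half-lines, which form an intersection-stable
  generator of the Borel sets, hence over every Borel set.\<close>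

lemma primitive_zero_imp_AE_zero:
  fixes f :: "real \<Rightarrow> 'a::euclidean_space"
  assumes f: "integrable (leb_upto T) f" and zero: "\<And>t. t \<in> {0..T} \<Longrightarrow> primitive f t = 0" and T: "0 \<le> T"
  shows "AE t in leb_upto T. f t = 0"
proof (rule sigma_finite_measure.density_zero[OF sigma_finite_leb_upto f])
  have meas: "B \<inter> {0..T} \<in> sets (leb_upto T)" if "B \<in> sets borel" for B
    using that by (auto simp: sets_restrict_space_iff)
  have ind: "integrable (leb_upto T) (\<lambda>x. indicat_real B x *\<^sub>R f x)" if "B \<in> sets borel" for B
  proof -
    have "integrable (leb_upto T) (\<lambda>x. indicat_real (B \<inter> {0..T}) x *\<^sub>R f x)"
      by (rule integrable_mult_indicator[OF meas[OF that] f])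
    then show ?thesis by (rule Bochner_Integration.integrable_cong[THEN iffD1, rotated 2]) (auto simp: indicator_def)
  qed
  have borel_zero: "(LINT x|leb_upto T. indicat_real B x *\<^sub>R f x) = 0" if "B \<in> sets borel" for B
  proof -
    have gen: "Int_stable (range (\<lambda>a::real. {..a}))" by (auto simp: Int_stable_def)
    have "B \<in> sigma_sets UNIV (range (\<lambda>a::real. {..a}))"
      using that by (simp add: borel_eq_atMost)
    with gen subset_UNIV[of "range (\<lambda>a::real. {..a})", folded Pow_UNIV] show ?thesis
    proof (induction rule: sigma_sets_induct_disjoint)
      case (basic A)
      then obtain a where A: "A = {..a}" by auto
      show ?case
      proof (cases "a < 0")
        case True
        then have "(LINT x|leb_upto T. indicat_real A x *\<^sub>R f x) = (LINT x|leb_upto T. 0)"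
          by (intro Bochner_Integration.integral_cong) (auto simp: A)
        then show ?thesis by simp
      next
        case False
        then have "(LINT x|leb_upto T. indicat_real A x *\<^sub>R f x) = primitive f (min a T)"
          using T by (subst primitive_alt[of _ T]) (auto simp: A indicator_def intro!: Bochner_Integration.integral_cong)
        then show ?thesis using False T by (simp add: zero)
      qed
    next
      case (compl A)
      have A: "A \<in> sets borel" using compl(1) by (simp add: borel_eq_atMost)
      have "(LINT x|leb_upto T. indicat_real (UNIV - A) x *\<^sub>R f x) = (LINT x|leb_upto T. f x - indicat_real A x *\<^sub>R f x)"
        by (intro Bochner_Integration.integral_cong) (auto simp: indicator_def)
      also have "\<dots> = (LINT x|leb_upto T. f x) - 0"
        by (subst Bochner_Integration.integral_diff[OF f ind[OF A]]) (simp add: compl)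
      also have "(LINT x|leb_upto T. f x) = primitive f T" by (simp add: primitive_def)
      finally show ?case using zero T by simp
    next
      case (union A)
      have A: "A i \<in> sets borel" for i using union(2) by (auto simp: borel_eq_atMost)
      have sums: "(\<lambda>i. indicat_real (A i) x) sums indicat_real (\<Union>i. A i) x" for x
        using union(1) by (intro indicator_sums) (auto simp: disjoint_family_on_def)
      have "(\<lambda>n. LINT x|leb_upto T. (\<Sum>i<n. indicat_real (A i) x *\<^sub>R f x)) \<longlonglongrightarrow> (LINT x|leb_upto T. indicat_real (\<Union>i. A i) x *\<^sub>R f x)"
      proof (rule integral_dominated_convergence)
        show "integrable (leb_upto T) (\<lambda>x. norm (f x))" using f by simp
        show "AE x in leb_upto T. (\<lambda>n. \<Sum>i<n. indicat_real (A i) x *\<^sub>R f x) \<longlonglongrightarrow> indicat_real (\<Union>i. A i) x *\<^sub>R f x"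
        proof (rule AE_I2)
          fix x
          show "(\<lambda>n. \<Sum>i<n. indicat_real (A i) x *\<^sub>R f x) \<longlonglongrightarrow> indicat_real (\<Union>i. A i) x *\<^sub>R f x"
            using sums[of x] unfolding sums_def scaleR_sum_left[symmetric] by (intro tendsto_scaleR tendsto_const)
        qed
        show "AE x in leb_upto T. norm (\<Sum>i<n. indicat_real (A i) x *\<^sub>R f x) \<le> norm (f x)" for n
        proof (rule AE_I2)
          fix x
          have "(\<Sum>i<n. indicat_real (A i) x) \<le> indicat_real (\<Union>i. A i) x"
            using sums[of x] by (intro sum_le_suminf[THEN order_trans]) (auto simp: sums_iff)
          also have "\<dots> \<le> 1" by (simp add: indicator_def)
          finally show "norm (\<Sum>i<n. indicat_real (A i) x *\<^sub>R f x) \<le> norm (f x)"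
            unfolding scaleR_sum_left[symmetric] by (simp add: mult_left_le_one_le sum_nonneg)
        qed
        show "(\<lambda>x. indicat_real (\<Union>i. A i) x *\<^sub>R f x) \<in> borel_measurable (leb_upto T)"
          by (intro borel_measurable_integrable ind sets.countable_UN) (use A in auto)
        show "(\<lambda>x. \<Sum>i<n. indicat_real (A i) x *\<^sub>R f x) \<in> borel_measurable (leb_upto T)" for n
          by (intro borel_measurable_sum borel_measurable_integrable ind A)
      qed
      moreover have "(LINT x|leb_upto T. (\<Sum>i<n. indicat_real (A i) x *\<^sub>R f x)) = 0" for n
        by (subst Bochner_Integration.integral_sum) (simp_all add: ind A union)
      ultimately show ?case by (simp add: LIMSEQ_const_iff)
    qed simp
  qed
  fix A assume A: "A \<in> sets (leb_upto T)"
  then have AL: "A \<in> sets lebesgue" "A \<subseteq> {0..T}" by (auto simp: sets_restrict_space_iff)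
  \<comment> \<open>The measure is complete, so its measurable sets are Borel only up to a null
    set.\<close>
  obtain C N where CN: "fsigma C" "N \<in> null_sets lebesgue" "C \<union> N = A" "disjnt C N"
    using lebesgue_set_almost_fsigma[OF AL(1)] by metis
  have C: "C \<in> sets borel" using CN(1) by cases auto
  have "N \<in> null_sets (leb_upto T)"
    using AL(2) CN(2,3) by (subst null_sets_restrict_space) auto
  then have "AE x in leb_upto T. indicat_real A x *\<^sub>R f x = indicat_real C x *\<^sub>R f x"
    using CN(3) by (intro AE_I'[of N]) (auto simp: indicator_def)
  then have "(LINT x|leb_upto T. indicat_real A x *\<^sub>R f x) = (LINT x|leb_upto T. indicat_real C x *\<^sub>R f x)"
    using ind[OF C] integrable_mult_indicator[OF A f] by (intro integral_cong_AE) auto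
  then show "(LINT x:A|leb_upto T. f x) = 0"
    unfolding set_lebesgue_integral_def using borel_zero[OF C] by simp
qed

section \<open>Fourier series\<close>

definition character :: "real \<Rightarrow> int \<Rightarrow> real \<Rightarrow> complex" where
  "character T k t = cis (2 * pi * of_int k * t / T)"

lemma character_add: "character T (k + l) t = character T k t * character T l t"
  by (simp add: character_def cis_mult algebra_simps add_divide_distrib)

lemma character_diff_arg: "character T k (t - s) = character T k t * character T (- k) s"
  by (simp add: character_def cis_mult algebra_simps diff_divide_distrib)

lemma character_0 [simp]: "character T 0 t = 1" "character T k 0 = 1"
  by (simp_all add: character_def)

lemma character_minus_mult [simp]: "character T k t * character T (- k) t = 1" "character T (- k) t * character T k t = 1"
  by (simp_all flip: character_add)

lemma character_period [simp]: "T > 0 \<Longrightarrow> character T k T = 1"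
  using cis_multiple_2pi[of "of_int k"] by (simp add: character_def mult.assoc)

lemma cnj_character: "cnj (character T k t) = character T (- k) t"
  by (simp add: character_def cis_cnj)

lemma norm_character [simp]: "cmod (character T k t) = 1"
  by (simp add: character_def)

lemma continuous_character: "continuous_on A (character T k)"
  unfolding character_def[abs_def] divide_inverse by (intro continuous_intros)

lemma measurable_character: "character T k \<in> borel_measurable (leb_upto T')"
  by (rule measurable_leb_continuous[OF continuous_character])

lemma cis_has_vector_derivative:
  "((\<lambda>t. cis (c * t)) has_vector_derivative (\<i> * of_real c * cis (c * t))) (at t within A)"
proof -
  have "((\<lambda>t. exp (t *\<^sub>R (\<i> * of_real c))) has_vector_derivative exp (t *\<^sub>R (\<i> * of_real c)) * (\<i> * of_real c)) (at t within A)"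
    by (rule exp_scaleR_has_vector_derivative_right)
  then show ?thesis by (simp add: cis_conv_exp scaleR_conv_of_real mult_ac)
qed

lemma character_primitive:
  assumes "k \<noteq> 0" "T > 0"
  shows "((\<lambda>t. character T k t / (\<i> * of_real (2 * pi * of_int k / T))) has_vector_derivative character T k t) (at t within A)"
proof -
  let ?c = "2 * pi * of_int k / T"
  have ch: "character T k = (\<lambda>t. cis (?c * t))" by (simp add: character_def[abs_def])
  have "((\<lambda>t. cis (?c * t) / (\<i> * of_real ?c)) has_vector_derivative \<i> * of_real ?c * cis (?c * t) / (\<i> * of_real ?c)) (at t within A)"
    by (rule bounded_linear.has_vector_derivative[OF bounded_linear_divide cis_has_vector_derivative])
  moreover have "\<i> * complex_of_real ?c \<noteq> 0" using assms by simp
  ultimately show ?thesis unfolding ch by simp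
qed

lemma integral_character:
  assumes "T > 0" shows "(LINT t|leb_upto T. character T k t) = (if k = 0 then of_real T else 0)"
proof (cases "k = 0")
  case True
  then show ?thesis using assms by (simp add: measure_restrict_space scaleR_conv_of_real)
next
  case False
  then show ?thesis
    using LINT_FTC_full[OF character_primitive[OF False assms] continuous_character] assms by simp
qed

text \<open>If S x = e^{-i theta} x and |x| = 1, this is the normalised eigenfunction of d/dt for
  the eigenvalue i(theta + 2 pi k)/T. The twist by theta is a separate factor so that it can be
  absorbed into other functions, leaving ordinary Fourier coefficients.\<close>

definition trig_vec :: "real \<Rightarrow> real \<Rightarrow> complex ^ 'n \<Rightarrow> int \<Rightarrow> ('n::finite) vfun" where
  "trig_vec T \<theta> x k = (\<lambda>t. (cis (\<theta> * t / T) * character T k t / of_real (sqrt T)) *s x)"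

lemma continuous_trig_vec: "continuous_on A (trig_vec T \<theta> x k)"
  unfolding trig_vec_def character_def divide_inverse
  by (intro bounded_bilinear.continuous_on[OF bounded_bilinear_smult] continuous_intros)

lemma trig_vec_L2: "trig_vec T \<theta> x k \<in> L2 T"
proof (rule L2_bounded)
  show "trig_vec T \<theta> x k \<in> borel_measurable (leb_upto T)"
    by (rule measurable_leb_continuous[OF continuous_trig_vec])
  show "norm (trig_vec T \<theta> x k t) \<le> norm x / \<bar>sqrt T\<bar>" if "t \<in> {0..T}" for t
    by (simp add: trig_vec_def norm_smult_vec norm_mult norm_divide)
qed

lemma l2_inner_trig_vec:
  "l2_inner T f (trig_vec T \<theta> x k) = (LINT t|leb_upto T. cis (- (\<theta> * t / T)) * cdot (f t) x * character T (- k) t) / of_real (sqrt T)"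
  unfolding l2_inner_cdot trig_vec_def cdot_smult_right
  by (simp add: cis_cnj cnj_character mult_ac flip: integral_divide_zero)

lemma trig_vec_orthonormal:
  assumes "T > 0" "cdot x x = 1"
  shows "l2_inner T (trig_vec T \<theta> x k) (trig_vec T \<theta> x l) = (if k = l then 1 else 0)"
proof -
  have *: "cis (- (\<theta> * t / T)) * cdot (trig_vec T \<theta> x k t) x * character T (- l) t = character T (k - l) t / of_real (sqrt T)" for t
  proof -
    have "cis (- (\<theta> * t / T)) * cdot (trig_vec T \<theta> x k t) x * character T (- l) t
        = (cis (- (\<theta> * t / T)) * cis (\<theta> * t / T)) * (character T k t * character T (- l) t) / of_real (sqrt T)"
      by (simp add: trig_vec_def cdot_smult_left assms)
    then show ?thesis by (simp add: cis_mult flip: character_add)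
  qed
  have "complex_of_real (sqrt T) * complex_of_real (sqrt T) = of_real T"
    using assms by (simp flip: of_real_mult)
  then show ?thesis
    unfolding l2_inner_trig_vec * using assms by (simp add: integral_character)
qed

lemma trig_vec_orthogonal: "cdot x y = 0 \<Longrightarrow> l2_inner T (trig_vec T \<theta> x k) (trig_vec T \<theta>' y l) = 0"
  by (simp add: l2_inner_cdot trig_vec_def cdot_smult_left cdot_smult_right)

text \<open>By Bessel's inequality only finitely many coefficients can exceed a given size. The
  finiteness form serves index sequences tending to either infinity.\<close>

lemma Riemann_Lebesgue:
  fixes g :: "real \<Rightarrow> complex"
  assumes T: "T > 0" and gm: "g \<in> borel_measurable (leb_upto T)" and bound: "\<And>t. t \<in> {0..T} \<Longrightarrow> cmod (g t) \<le> L"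
    and "\<epsilon> > 0"
  shows "finite {k. \<epsilon> \<le> cmod (LINT t|leb_upto T. g t * character T (- k) t)}"
proof (rule ccontr)
  define x :: "complex ^ 1" where "x = (\<chi> i. 1)"
  have xx: "cdot x x = 1" by (simp add: cdot_def x_def)
  define f where "f t = g t *s x" for t
  have nf: "norm (f t) = cmod (g t)" for t by (simp add: f_def norm_smult_vec norm_vec_def x_def L2_set_def)
  have fL: "f \<in> L2 T"
  proof (rule L2_bounded)
    show "f \<in> borel_measurable (leb_upto T)"
      unfolding f_def[abs_def] by (rule borel_measurable_bilinear[OF bounded_bilinear_smult gm]) simp
  qed (use bound nf in auto)
  let ?c = "\<lambda>k. LINT t|leb_upto T. g t * character T (- k) t"
  define e where "e = trig_vec T 0 x"
  have fe: "l2_inner T f (e k) = ?c k / of_real (sqrt T)" for k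
    unfolding e_def l2_inner_trig_vec by (simp add: f_def cdot_smult_left xx)
  have ee: "l2_inner T (e k) (e l) = (if k = l then 1 else 0)" for k l
    unfolding e_def by (rule trig_vec_orthonormal[OF T xx])
  have inj: "inj_on e K" for K
    by (rule inj_onI) (metis ee zero_neq_one)
  assume "infinite {k. \<epsilon> \<le> cmod (?c k)}"
  \<comment> \<open>More than this many coefficients of modulus at least \<epsilon> would exceed the
    Bessel bound; the factor T comes from the normalisation of the characters.\<close>
  moreover obtain n :: nat where n: "T * (l2_norm T f)\<^sup>2 / \<epsilon>\<^sup>2 < n" using reals_Archimedean2 by blast
  ultimately obtain K where K: "finite K" "card K = n" "K \<subseteq> {k. \<epsilon> \<le> cmod (?c k)}"
    using infinite_arbitrarily_large by blast
  have "orthonormal_set T (e ` K)"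
    unfolding orthonormal_set_def
  proof (intro conjI ballI)
    show "e ` K \<subseteq> L2 T" by (auto simp: e_def trig_vec_L2)
    fix a b assume "a \<in> e ` K" "b \<in> e ` K"
    then show "l2_inner T a b = (if a = b then 1 else 0)" using inj[of UNIV] by (auto simp: ee inj_eq)
  qed
  from Bessel_inequality[OF this _ fL] have "(\<Sum>k\<in>K. (cmod (?c k) / sqrt T)\<^sup>2) \<le> (l2_norm T f)\<^sup>2"
    using K(1) T by (simp add: sum.reindex[OF inj] fe norm_divide)
  moreover have "(\<Sum>k\<in>K. (cmod (?c k) / sqrt T)\<^sup>2) \<ge> (\<Sum>k\<in>K. (\<epsilon> / sqrt T)\<^sup>2)"
    using K(3) T \<open>\<epsilon> > 0\<close> by (intro sum_mono power_mono divide_right_mono) auto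
  ultimately have "real n * (\<epsilon>\<^sup>2 / T) \<le> (l2_norm T f)\<^sup>2" using T K(2) by (simp add: power_divide)
  with n T \<open>\<epsilon> > 0\<close> show False by (simp add: field_simps)
qed

lemma Riemann_Lebesgue_tendsto:
  fixes g :: "real \<Rightarrow> complex" and K :: "nat \<Rightarrow> int"
  assumes T: "T > 0" and gm: "g \<in> borel_measurable (leb_upto T)" and bound: "\<And>t. t \<in> {0..T} \<Longrightarrow> cmod (g t) \<le> L"
    and K: "filterlim K at_top sequentially \<or> filterlim K at_bot sequentially"
  shows "(\<lambda>N. LINT t|leb_upto T. g t * character T (- K N) t) \<longlonglongrightarrow> 0"
  unfolding tendsto_iff
proof (intro allI impI)
  fix \<epsilon> :: real assume "\<epsilon> > 0"
  define A where "A = {k. \<epsilon> \<le> cmod (LINT t|leb_upto T. g t * character T (- k) t)}"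
  have fin: "finite A" unfolding A_def by (rule Riemann_Lebesgue[OF T gm bound \<open>\<epsilon> > 0\<close>])
  from K have "\<forall>\<^sub>F N in sequentially. K N \<notin> A"
  proof
    assume "filterlim K at_top sequentially"
    then have "\<forall>\<^sub>F N in sequentially. Max (insert 0 A) + 1 \<le> K N" unfolding filterlim_at_top by blast
    then show ?thesis by eventually_elim (use Max_ge[OF finite.insertI[OF fin], of _ 0] in fastforce)
  next
    assume "filterlim K at_bot sequentially"
    then have "\<forall>\<^sub>F N in sequentially. K N \<le> Min (insert 0 A) - 1" unfolding filterlim_at_bot by blast
    then show ?thesis by eventually_elim (use Min_le[OF finite.insertI[OF fin], of _ 0] in fastforce)
  qed
  then show "\<forall>\<^sub>F N in sequentially. dist (LINT t|leb_upto T. g t * character T (- K N) t) 0 < \<epsilon>"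
    by eventually_elim (simp add: A_def)
qed

lemma sum_int_telescope: "a \<le> b + 1 \<Longrightarrow> (\<Sum>k\<in>{a..b}. h k - h (k - 1)) = h b - (h (a - 1) :: complex)" for a b :: int
proof (induction "nat (b + 1 - a)" arbitrary: b)
  case 0
  then have "b = a - 1" by simp
  then show ?case by simp
next
  case (Suc n)
  then have "{a..b} = insert b {a..b - 1}" by auto
  with Suc.hyps(1)[of "b - 1"] Suc.hyps(2) Suc.prems show ?case by simp
qed

text \<open>Chernoff's argument: \<open>G(r) = g(r) (1 - exp (2\<pi>i (r - t0) / T))\<close> with \<open>g\<close> bounded, so the partial
  sums of the Fourier series of \<open>G\<close> at \<open>t0\<close> telescope to coefficients of \<open>g\<close>.\<close>
lemma Chernoff_pointwise:
  fixes G :: "real \<Rightarrow> complex" and a b :: "nat \<Rightarrow> int"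
  assumes T: "T > 0" and Gm: "G \<in> borel_measurable (leb_upto T)"
    and bound: "\<And>r. r \<in> {0..T} \<Longrightarrow> cmod (G r) \<le> L * cmod (1 - character T 1 (r - t0))" and L: "0 \<le> L"
    and a: "filterlim a at_bot sequentially" and b: "filterlim b at_top sequentially"
  shows "(\<lambda>N. \<Sum>k\<in>{a N..b N}. character T k t0 * (LINT r|leb_upto T. G r * character T (- k) r)) \<longlonglongrightarrow> 0"
proof -
  \<comment> \<open>Where the denominator vanishes g is 0 by convention; the hypothesis
    \<open>bound\<close> forces G to vanish there as well, so the product formula below holds
    everywhere.\<close>
  define g where "g r = G r / (1 - character T 1 (r - t0))" for r
  have c1: "continuous_on UNIV (\<lambda>r. character T 1 (r - t0))" unfolding character_def divide_inverse by (intro continuous_intros)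
  have gm: "g \<in> borel_measurable (leb_upto T)"
    unfolding g_def[abs_def]
    by (intro borel_measurable_divide Gm borel_measurable_diff measurable_leb_continuous continuous_on_subset[OF c1]) auto
  have g_bound: "cmod (g r) \<le> L" if "r \<in> {0..T}" for r
    using bound[OF that] L by (auto simp: g_def norm_divide divide_le_eq)
  have G_g: "G r = g r - g r * (character T 1 r * character T (- 1) t0)" if "r \<in> {0..T}" for r
  proof -
    have "G r = g r * (1 - character T 1 (r - t0))"
      using bound[OF that] by (auto simp: g_def)
    then show ?thesis by (simp add: character_diff_arg algebra_simps)
  qed
  define h where "h k = character T k t0 * (LINT r|leb_upto T. g r * character T (- k) r)" for k
  have int: "integrable (leb_upto T) (\<lambda>r. g r * character T k r)" for k
    by (rule integrable_leb_upto_bounded[where C = L]) (auto intro!: borel_measurable_times gm measurable_character g_bound simp: norm_mult)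
  \<comment> \<open>Multiplying g by e^{2 pi i r/T} shifts its coefficients by one index, which
    produces the term h (k - 1).\<close>
  have step: "character T k t0 * (LINT r|leb_upto T. G r * character T (- k) r) = h k - h (k - 1)" for k
  proof -
    have "(LINT r|leb_upto T. G r * character T (- k) r)
        = (LINT r|leb_upto T. g r * character T (- k) r - character T (- 1) t0 * (g r * character T (- (k - 1)) r))"
    proof (intro Bochner_Integration.integral_cong refl)
      fix r assume "r \<in> space (leb_upto T)"
      then have r: "r \<in> {0..T}" by simp
      have "character T (- (k - 1)) r = character T 1 r * character T (- k) r" by (simp flip: character_add)
      then show "G r * character T (- k) r = g r * character T (- k) r - character T (- 1) t0 * (g r * character T (- (k - 1)) r)"
        by (simp add: G_g[OF r] algebra_simps)
    qed
    also have "\<dots> = (LINT r|leb_upto T. g r * character T (- k) r) - character T (- 1) t0 * (LINT r|leb_upto T. g r * character T (- (k - 1)) r)"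
      by (subst Bochner_Integration.integral_diff[OF int integrable_mult_right[OF int]]) simp
    finally have eq: "(LINT r|leb_upto T. G r * character T (- k) r) = \<dots>" .
    show ?thesis
      unfolding h_def eq using character_add[of T k "- 1" t0] by (simp add: right_diff_distrib mult.assoc)
  qed
  have nh: "cmod (h k) = cmod (LINT r|leb_upto T. g r * character T (- k) r)" for k by (simp add: h_def norm_mult)
  have "(\<lambda>N. h (b N)) \<longlonglongrightarrow> 0"
    using Riemann_Lebesgue_tendsto[OF T gm g_bound, of b] b by (simp add: tendsto_norm_zero_iff[symmetric, of "\<lambda>N. h (b N)"] nh tendsto_norm_zero_iff)
  moreover have "(\<lambda>N. h (a N - 1)) \<longlonglongrightarrow> 0"
  proof -
    have "filterlim (\<lambda>N. a N - 1) at_bot sequentially"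
      unfolding filterlim_at_bot
    proof
      fix Z :: int
      from a have "\<forall>\<^sub>F N in sequentially. a N \<le> Z" by (simp add: filterlim_at_bot)
      then show "\<forall>\<^sub>F N in sequentially. a N - 1 \<le> Z" by eventually_elim simp
    qed
    then show ?thesis
      using Riemann_Lebesgue_tendsto[OF T gm g_bound, of "\<lambda>N. a N - 1"]
      by (simp add: tendsto_norm_zero_iff[symmetric, of "\<lambda>N. h (a N - 1)"] nh tendsto_norm_zero_iff)
  qed
  ultimately have "(\<lambda>N. h (b N) - h (a N - 1)) \<longlonglongrightarrow> 0 - 0" by (intro tendsto_diff)
  moreover have "\<forall>\<^sub>F N in sequentially. h (b N) - h (a N - 1)
      = (\<Sum>k\<in>{a N..b N}. character T k t0 * (LINT r|leb_upto T. G r * character T (- k) r))"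
  proof -
    have "\<forall>\<^sub>F N in sequentially. a N \<le> 0" "\<forall>\<^sub>F N in sequentially. 0 \<le> b N"
      using a b by (simp_all add: filterlim_at_bot filterlim_at_top)
    then show ?thesis by eventually_elim (simp only: step, rule sum_int_telescope[symmetric], simp)
  qed
  ultimately show ?thesis by (simp add: tendsto_cong)
qed

text \<open>A crude Jordan inequality: sin x >= x cos x and cos^2 x >= 1/2 on [0, pi/4] give it for
  y = 2x, and reflection in pi/2 gives the rest.\<close>

lemma sin_lower_bound: assumes "0 \<le> y" "y \<le> pi" shows "min y (pi - y) \<le> 2 * sin y"
proof -
  have half: "y \<le> 2 * sin y" if y: "0 \<le> y" "y \<le> pi / 2" for y :: real
  proof -
    define x where "x = y / 2"
    have x: "0 \<le> x" "x \<le> pi / 4" using y by (auto simp: x_def)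
    have "sin 0 - 0 * cos 0 \<le> sin x - x * cos x"
    proof (rule DERIV_nonneg_imp_nondecreasing[OF x(1)])
      fix u assume u: "0 \<le> u" "u \<le> x"
      then have "0 \<le> u * sin u" using x by (intro mult_nonneg_nonneg sin_ge_zero) auto
      moreover have "((\<lambda>x. sin x - x * cos x) has_real_derivative u * sin u) (at u)"
        by (auto intro!: derivative_eq_intros)
      ultimately show "\<exists>d. ((\<lambda>x. sin x - x * cos x) has_real_derivative d) (at u) \<and> 0 \<le> d" by blast
    qed
    then have "x * cos x \<le> sin x" by simp
    have c: "cos (pi/4) \<le> cos x" using x by (intro cos_monotone_0_pi_le) auto
    then have c0: "0 < cos x" by (simp add: cos_45) (smt (verit) real_sqrt_gt_zero divide_pos_pos)
    have "(1/2::real) = (cos (pi/4))\<^sup>2" by (simp add: cos_45 power_divide)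
    also have "\<dots> \<le> (cos x)\<^sup>2" using c by (intro power_mono) (simp_all add: cos_45)
    finally have "x * (1/2) \<le> x * (cos x)\<^sup>2" using x by (intro mult_left_mono)
    also have "\<dots> = (x * cos x) * cos x" by (simp add: power2_eq_square)
    also have "\<dots> \<le> sin x * cos x" using \<open>x * cos x \<le> sin x\<close> c0 by (intro mult_right_mono) auto
    finally show ?thesis using sin_double[of x] by (simp add: x_def)
  qed
  show ?thesis
  proof (cases "y \<le> pi / 2")
    case True
    then show ?thesis using half[of y] assms by linarith
  next
    case False
    then show ?thesis using half[of "pi - y"] assms by simp
  qed
qed

text \<open>The modulus equals 2 |sin(pi x/T)|, which is comparable to the distance from x to the
  nearest multiple of T. This converts a Lipschitz bound on the circle into the hypothesis of
  \<open>Chernoff_pointwise\<close>.\<close>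

lemma character_lower_bound:
  assumes T: "T > 0" and x: "\<bar>x\<bar> \<le> T"
  shows "min \<bar>x\<bar> (T - \<bar>x\<bar>) \<le> T * cmod (1 - character T 1 x)"
proof -
  define y where "y = pi * \<bar>x\<bar> / T"
  have y: "0 \<le> y" "y \<le> pi" using T x by (auto simp: y_def divide_le_eq)
  have "cmod (1 - character T 1 x) = 2 * \<bar>sin (pi * x / T)\<bar>"
  proof -
    have "(cmod (1 - cis (2 * u)))\<^sup>2 = (2 * \<bar>sin u\<bar>)\<^sup>2" for u :: real
    proof -
      have "(cmod (1 - cis (2 * u)))\<^sup>2 = (1 - cos (2 * u))\<^sup>2 + (sin (2 * u))\<^sup>2"
        by (simp add: cmod_power2)
      also have "\<dots> = 2 - 2 * cos (2 * u)"
        using sin_cos_squared_add[of "2 * u"] by (simp add: power2_diff) 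
      also have "\<dots> = (2 * \<bar>sin u\<bar>)\<^sup>2" by (simp add: cos_double_sin power_mult_distrib)
      finally show ?thesis .
    qed
    then have "cmod (1 - cis (2 * u)) = 2 * \<bar>sin u\<bar>" for u :: real
      by (metis abs_ge_zero mult_nonneg_nonneg norm_ge_zero power2_eq_iff_nonneg zero_le_numeral)
    from this[of "pi * x / T"] show ?thesis by (simp add: character_def mult.assoc)
  qed
  also have "\<bar>sin (pi * x / T)\<bar> = sin y"
  proof (cases "x \<ge> 0")
    case True
    then show ?thesis using y sin_ge_zero[of y] by (simp add: y_def)
  next
    case False
    then have "sin (pi * x / T) = - sin y" by (simp add: y_def flip: sin_minus)
    then show ?thesis using y sin_ge_zero[of y] by simp
  qed
  finally have c: "cmod (1 - character T 1 x) = 2 * sin y" .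
  have "min y (pi - y) \<le> 2 * sin y" by (rule sin_lower_bound[OF y])
  moreover have "min y (pi - y) = pi / T * min \<bar>x\<bar> (T - \<bar>x\<bar>)"
    using T by (auto simp: y_def min_def field_simps)
  ultimately have "pi / T * min \<bar>x\<bar> (T - \<bar>x\<bar>) \<le> cmod (1 - character T 1 x)" by (simp add: c)
  then have "pi * min \<bar>x\<bar> (T - \<bar>x\<bar>) \<le> T * cmod (1 - character T 1 x)" using T by (simp add: field_simps)
  moreover have "1 * min \<bar>x\<bar> (T - \<bar>x\<bar>) \<le> pi * min \<bar>x\<bar> (T - \<bar>x\<bar>)"
    using x pi_gt3 by (intro mult_right_mono) auto
  ultimately show ?thesis by linarith
qed

text \<open>In the partial sums for f - f(t0) only the index 0 survives, so they form a constant
  sequence; by Chernoff it tends to 0.\<close>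

lemma Fourier_coefficients_const:
  fixes f :: "real \<Rightarrow> complex"
  assumes T: "T > 0" and Lip: "\<And>s t. s \<in> {0..T} \<Longrightarrow> t \<in> {0..T} \<Longrightarrow> cmod (f t - f s) \<le> L * \<bar>t - s\<bar>"
    and per: "f 0 = f T" and zero: "\<And>k. k \<noteq> 0 \<Longrightarrow> (LINT t|leb_upto T. f t * character T k t) = 0" and t0: "t0 \<in> {0..T}"
  shows "f t0 = (LINT t|leb_upto T. f t) / of_real T"
proof -
  have cont: "continuous_on {0..T} f"
  proof (rule lipschitz_on_continuous_on[of "max L 0"], rule lipschitz_onI)
    fix s t assume "s \<in> {0..T}" "t \<in> {0..T}"
    then have "cmod (f s - f t) \<le> L * \<bar>s - t\<bar>" by (rule Lip[rotated])
    also have "\<dots> \<le> max L 0 * \<bar>s - t\<bar>" by (intro mult_right_mono) auto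
    finally show "dist (f s) (f t) \<le> max L 0 * dist s t" by (simp add: dist_norm)
  qed simp
  have L: "0 \<le> L"
    using order_trans[OF norm_ge_zero Lip[of 0 T]] T by (simp add: zero_le_mult_iff)
  define G where "G t = f t - f t0" for t
  have bound: "cmod (G r) \<le> (2 * L * T) * cmod (1 - character T 1 (r - t0))" if r: "r \<in> {0..T}" for r
  proof -
    have "cmod (G r) \<le> 2 * L * min \<bar>r - t0\<bar> (T - \<bar>r - t0\<bar>)"
    proof -
      have 1: "cmod (G r) \<le> L * \<bar>r - t0\<bar>" unfolding G_def by (rule Lip[OF t0 r])
      \<comment> \<open>The path from t0 to r the other way round the circle, through the endpoints
        where f takes equal values.\<close>
      have 2: "cmod (G r) \<le> L * (T - \<bar>r - t0\<bar>)"
      proof (cases "t0 \<le> r")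
        case True
        have "G r = (f r - f T) + (f 0 - f t0)" by (simp add: G_def per)
        then have "cmod (G r) \<le> L * \<bar>r - T\<bar> + L * \<bar>0 - t0\<bar>"
          using norm_triangle_le[OF add_mono[OF Lip[of T r] Lip[of t0 0]]] r t0 by simp
        then show ?thesis using True r t0 by (simp add: algebra_simps abs_if split: if_splits)
      next
        case False
        have "G r = (f r - f 0) + (f T - f t0)" by (simp add: G_def per)
        then have "cmod (G r) \<le> L * \<bar>r - 0\<bar> + L * \<bar>T - t0\<bar>"
          using norm_triangle_le[OF add_mono[OF Lip[of 0 r] Lip[of t0 T]]] r t0 by simp
        then show ?thesis using False r t0 by (simp add: algebra_simps abs_if split: if_splits)
      qed
      have "cmod (G r) \<le> L * min \<bar>r - t0\<bar> (T - \<bar>r - t0\<bar>)" using 1 2 by (simp add: min_def)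
      also have "\<dots> \<le> 2 * L * min \<bar>r - t0\<bar> (T - \<bar>r - t0\<bar>)"
        using L r t0 by (intro mult_right_mono) (auto simp: abs_if)
      finally show ?thesis .
    qed
    also have "\<dots> \<le> 2 * L * (T * cmod (1 - character T 1 (r - t0)))"
      using L r t0 by (intro mult_left_mono character_lower_bound T) auto
    finally show ?thesis by (simp add: mult.assoc)
  qed
  have Gc: "continuous_on {0..T} G" unfolding G_def[abs_def] by (intro continuous_intros cont)
  have at_top: "filterlim (\<lambda>N. int N) at_top sequentially"
    by (rule filterlim_int_sequentially)
  have at_bot: "filterlim (\<lambda>N. - int N) at_bot sequentially"
    unfolding filterlim_at_bot eventually_sequentially
  proof
    fix Z :: int
    show "\<exists>N. \<forall>n\<ge>N. - int n \<le> Z" by (rule exI[of _ "nat (- Z)"]) auto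
  qed
  have lim: "(\<lambda>N. \<Sum>k\<in>{- int N..int N}. character T k t0 * (LINT r|leb_upto T. G r * character T (- k) r)) \<longlonglongrightarrow> 0"
    using L T by (intro Chernoff_pointwise[OF T measurable_leb_continuous[OF Gc] bound _ at_bot at_top]) auto
  have int: "integrable (leb_upto T) (\<lambda>r. f r * character T k r)" "integrable (leb_upto T) f" for k
    by (intro integrable_leb_continuous continuous_intros cont continuous_character)+
  have coef: "(LINT r|leb_upto T. G r * character T (- k) r) = (if k = 0 then (LINT t|leb_upto T. f t) - of_real T * f t0 else 0)" for k
  proof -
    have "(LINT r|leb_upto T. G r * character T (- k) r)
        = (LINT r|leb_upto T. f r * character T (- k) r - f t0 * character T (- k) r)"
      by (simp add: G_def algebra_simps)
    also have "\<dots> = (LINT r|leb_upto T. f r * character T (- k) r) - f t0 * (LINT r|leb_upto T. character T (- k) r)"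
      by (subst Bochner_Integration.integral_diff[OF int(1)])
        (auto intro!: integrable_leb_continuous continuous_character continuous_intros)
    finally show ?thesis using zero[of "- k"] by (simp add: integral_character[OF T] mult.commute)
  qed
  have "(\<Sum>k\<in>{- int N..int N}. character T k t0 * (LINT r|leb_upto T. G r * character T (- k) r)) = (LINT t|leb_upto T. f t) - of_real T * f t0" for N
    unfolding coef by (subst sum.remove[of _ 0]) (auto intro!: sum.neutral)
  with lim have "(LINT t|leb_upto T. f t) - of_real T * f t0 = 0" by (simp add: LIMSEQ_const_iff)
  then show ?thesis using T by (simp add: field_simps)
qed

lemma primitive_Lipschitz:
  fixes f :: "real \<Rightarrow> 'a::euclidean_space"
  assumes f: "continuous_on {0..T} f" and bound: "\<And>t. t \<in> {0..T} \<Longrightarrow> norm (f t) \<le> L"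
    and st: "s \<in> {0..T}" "t \<in> {0..T}"
  shows "norm (primitive f t - primitive f s) \<le> L * \<bar>t - s\<bar>"
proof -
  have "norm (primitive f t - primitive f s) \<le> L * norm (t - s)"
  proof (rule differentiable_bound[OF convex_closed_interval])
    show "(primitive f has_derivative (\<lambda>h. h *\<^sub>R f x)) (at x within {0..T})" if "x \<in> {0..T}" for x
      using primitive_has_derivative[OF f that] by (simp add: has_vector_derivative_def)
    show "onorm (\<lambda>h. h *\<^sub>R f x) \<le> L" if "x \<in> {0..T}" for x
      using mult_left_mono[OF bound[OF that] abs_ge_zero] by (intro onorm_le) (simp add: mult.commute)
  qed (use st in auto)
  then show ?thesis by simp
qed

text \<open>Integration by parts against a primitive of the character; the boundary term vanishes
  because the primitive of g is zero at both ends.\<close>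

lemma primitive_Fourier_coefficient:
  fixes g :: "real \<Rightarrow> complex"
  assumes T: "T > 0" and g: "integrable (leb_upto T) g" and k: "k \<noteq> 0" and gT: "primitive g T = 0"
    and zero: "(LINT t|leb_upto T. g t * character T k t) = 0"
  shows "(LINT t|leb_upto T. primitive g t * character T k t) = 0"
proof -
  define c where "c = \<i> * complex_of_real (2 * pi * of_int k / T)"
  let ?X = "\<lambda>t. character T k t / c"
  have "primitive (\<lambda>s. character T k s * primitive g s) T = ?X T * primitive g T - primitive (\<lambda>s. ?X s * g s) T"
    using T by (intro integration_by_parts_primitive[OF bounded_bilinear_mult character_primitive[OF k T, folded c_def] continuous_character g]) auto
  also have "primitive (\<lambda>s. ?X s * g s) T = (LINT s|leb_upto T. g s * character T k s / c)"
    by (simp add: primitive_def mult.commute)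
  also have "\<dots> = 0" unfolding integral_divide_zero zero by simp
  finally have "primitive (\<lambda>s. character T k s * primitive g s) T = 0" by (simp add: gT)
  then show ?thesis unfolding primitive_def[of _ T] by (simp add: mult.commute)
qed

text \<open>A twofold primitive of \<open>f\<close> is Lipschitz, so the pointwise convergence of Fourier series applies to it.\<close>
lemma Fourier_completeness:
  fixes f :: "real \<Rightarrow> complex"
  assumes T: "T > 0" and f: "integrable (leb_upto T) f"
    and zero: "\<And>k. (LINT t|leb_upto T. f t * character T k t) = 0"
  shows "AE t in leb_upto T. f t = 0"
proof -
  define F1 where "F1 = primitive f"
  have F1c: "continuous_on {0..T} F1" unfolding F1_def by (rule primitive_continuous[OF f])
  have F1T: "F1 T = 0" using zero[of 0] by (simp add: F1_def primitive_def)
  have F1z: "(LINT t|leb_upto T. F1 t * character T k t) = 0" if "k \<noteq> 0" for k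
    unfolding F1_def by (rule primitive_Fourier_coefficient[OF T f that F1T[unfolded F1_def] zero])
  \<comment> \<open>The mean of F1. Removing it leaves a function with all coefficients zero, whose
    primitive is again periodic.\<close>
  define c where "c = primitive F1 T / of_real T"
  define g where "g t = F1 t - c" for t
  have gc: "continuous_on {0..T} g" unfolding g_def[abs_def] by (intro continuous_intros F1c)
  have gi: "integrable (leb_upto T) g" by (rule integrable_leb_continuous[OF gc])
  have gz: "(LINT t|leb_upto T. g t * character T k t) = 0" for k
  proof -
    have "(LINT t|leb_upto T. g t * character T k t) = (LINT t|leb_upto T. F1 t * character T k t - c * character T k t)"
      by (simp add: g_def algebra_simps)
    also have "\<dots> = (LINT t|leb_upto T. F1 t * character T k t) - c * (LINT t|leb_upto T. character T k t)"
      by (subst Bochner_Integration.integral_diff)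
        (auto intro!: integrable_mult_right integrable_leb_continuous continuous_intros F1c continuous_character)
    also have "\<dots> = 0"
      unfolding integral_character[OF T] using F1z[of k] T by (cases "k = 0") (simp_all add: c_def primitive_def)
    finally show ?thesis .
  qed
  have gT: "primitive g T = 0" using gz[of 0] by (simp add: primitive_def)
  obtain L where L: "\<And>t. t \<in> {0..T} \<Longrightarrow> cmod (g t) \<le> L"
    using compact_imp_bounded[OF compact_continuous_image[OF gc compact_Icc]] unfolding bounded_iff by blast
  define F2 where "F2 = primitive g"
  \<comment> \<open>F2 is constant and starts at 0, so it vanishes; differentiating gives F1 = c on
    [0,T], and F1 0 = 0 gives c = 0.\<close>
  have const: "F2 t = (LINT t|leb_upto T. F2 t) / of_real T" if "t \<in> {0..T}" for t
  proof (rule Fourier_coefficients_const[OF T _ _ _ that, where L = L])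
    show "cmod (F2 t - F2 s) \<le> L * \<bar>t - s\<bar>" if "s \<in> {0..T}" "t \<in> {0..T}" for s t
      unfolding F2_def by (rule primitive_Lipschitz[OF gc L that])
    show "F2 0 = F2 T" by (simp add: F2_def gT)
    show "(LINT t|leb_upto T. F2 t * character T k t) = 0" if "k \<noteq> 0" for k
      unfolding F2_def by (rule primitive_Fourier_coefficient[OF T gi that gT gz])
  qed
  have F2: "F2 t = 0" if "t \<in> {0..T}" for t
    using const[OF that] const[of 0] T by (simp add: F2_def)
  have g0: "g t = 0" if t: "t \<in> {0..T}" for t
  proof (rule vector_derivative_unique_within)
    show "at t within {0..T} \<noteq> bot" using t T by (simp add: trivial_limit_within islimpt_Icc)
    show "(F2 has_vector_derivative g t) (at t within {0..T})" unfolding F2_def by (rule primitive_has_derivative[OF gc t])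
    show "(F2 has_vector_derivative 0) (at t within {0..T})"
      by (rule has_vector_derivative_transform[OF t _ has_vector_derivative_const]) (simp add: F2)
  qed
  have "c = 0" using g0[of 0] T by (simp add: g_def F1_def)
  then have "primitive f t = 0" if "t \<in> {0..T}" for t using g0[OF that] by (simp add: g_def F1_def)
  then show ?thesis using primitive_zero_imp_AE_zero[OF f] T by simp
qed

section \<open>The sawtooth and its asymmetric partial sums\<close>

definition sawtooth_coeff :: "int \<Rightarrow> complex" where
  "sawtooth_coeff k = (if k = 0 then 1 / 2 else 1 / (\<i> * of_real (2 * pi * of_int k)))"

text \<open>The function 1 - r/T is 1 at 0 and 0 at T; it carries a unit jump on the circle.\<close>

lemma sawtooth_coefficient:
  assumes T: "T > 0"
  shows "(LINT r|leb_upto T. of_real (1 - r / T) * character T (- k) r) = of_real T * sawtooth_coeff k"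
proof (cases "k = 0")
  case True
  have "(LINT r|leb_upto T. (1 - r / T)) = (T - T\<^sup>2 / (2 * T)) - (0 - 0\<^sup>2 / (2 * T))"
  proof (rule LINT_FTC_full)
    show "((\<lambda>r. r - r\<^sup>2 / (2 * T)) has_vector_derivative (1 - s / T)) (at s within {0..T})" for s
      unfolding has_real_derivative_iff_has_vector_derivative[symmetric]
      using T by (auto intro!: derivative_eq_intros)
    show "continuous_on {0..T} (\<lambda>s. 1 - s / T)" using T by (intro continuous_intros) auto
  qed (use T in simp)
  also have "\<dots> = T / 2" using T by (simp add: power2_eq_square)
  finally have "(LINT r|leb_upto T. complex_of_real (1 - r / T)) = of_real (T / 2)"
    by (simp only: integral_complex_of_real)
  then show ?thesis using True by (simp add: sawtooth_coeff_def)
next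
  case False
  define c where "c = \<i> * complex_of_real (2 * pi * of_int (- k) / T)"
  have c: "c \<noteq> 0" using False T by (simp add: c_def)
  \<comment> \<open>The antiderivative obtained by parts: the second summand cancels the term from
    differentiating the linear factor. By periodicity only the first summand contributes to the
    difference of the end values.\<close>
  let ?F = "\<lambda>r. of_real (1 - r / T) * (character T (- k) r / c) + (character T (- k) r / c) / (c * of_real T)"
  have "(LINT r|leb_upto T. of_real (1 - r / T) * character T (- k) r) = ?F T - ?F 0"
  proof (rule LINT_FTC_full)
    fix s assume "s \<in> {0..T}"
    have d: "((\<lambda>t. character T (- k) t / c) has_vector_derivative character T (- k) s) (at s within {0..T})"
      unfolding c_def by (rule character_primitive) (use False T in auto)
    have "((\<lambda>r. complex_of_real (1 - r / T)) has_vector_derivative of_real (- (1 / T))) (at s within {0..T})"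
      by (rule has_vector_derivative_of_real) (use T in \<open>auto intro!: derivative_eq_intros\<close>)
    from has_vector_derivative_mult[OF this d]
    have d1: "((\<lambda>r. of_real (1 - r / T) * (character T (- k) r / c)) has_vector_derivative
        (of_real (1 - s / T) * character T (- k) s + of_real (- (1 / T)) * (character T (- k) s / c))) (at s within {0..T})" .
    have d2: "((\<lambda>r. (character T (- k) r / c) / (c * of_real T)) has_vector_derivative character T (- k) s / (c * of_real T)) (at s within {0..T})"
      by (rule bounded_linear.has_vector_derivative[OF bounded_linear_divide d])
    show "(?F has_vector_derivative of_real (1 - s / T) * character T (- k) s) (at s within {0..T})"
      by (rule has_vector_derivative_eq_rhs[OF has_vector_derivative_add[OF d1 d2]]) (use c T in \<open>simp add: field_simps\<close>)
  next
    show "continuous_on {0..T} (\<lambda>s. of_real (1 - s / T) * character T (- k) s)"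
      using T by (intro continuous_intros continuous_character) auto
  qed (use T in simp)
  also have "\<dots> = - (1 / c)" using T by simp
  also have "\<dots> = of_real T * sawtooth_coeff k"
    using False T by (simp add: c_def sawtooth_coeff_def field_simps)
  finally show ?thesis .
qed

text \<open>The coefficients with nonzero index are odd in k and cancel in pairs.\<close>

lemma sawtooth_sum_symmetric: assumes "m \<ge> 0" shows "(\<Sum>k\<in>{- m..m}. sawtooth_coeff k) = 1 / 2"
proof -
  let ?S = "\<Sum>k\<in>{- m..m} - {0}. sawtooth_coeff k"
  have "?S = (\<Sum>k\<in>{- m..m} - {0}. - sawtooth_coeff k)"
    by (rule sum.reindex_bij_witness[where i = uminus and j = uminus]) (auto simp: sawtooth_coeff_def)
  then have "?S = 0" by (simp add: sum_negf)
  moreover have "(\<Sum>k\<in>{- m..m}. sawtooth_coeff k) = sawtooth_coeff 0 + ?S"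
    using assms by (intro sum.remove) auto
  ultimately show ?thesis by (simp add: sawtooth_coeff_def)
qed

text \<open>Beyond the largest symmetric window -m..m at most C indices remain, all on one side, and
  each contributes at most 1/m.\<close>

lemma sawtooth_sum_bound:
  fixes a b C :: int
  assumes ab: "a \<le> - 1" "1 \<le> b" and C: "\<bar>a + b\<bar> \<le> C"
  shows "cmod ((\<Sum>k\<in>{a..b}. sawtooth_coeff k) - 1 / 2) \<le> of_int C / of_int (min b (- a))"
proof -
  define m where "m = min b (- a)"
  have m: "1 \<le> m" "{- m..m} \<subseteq> {a..b}" using ab by (auto simp: m_def)
  have card: "card ({a..b} - {- m..m}) \<le> nat C"
  proof (cases "b \<le> - a")
    case True
    then have "{a..b} - {- m..m} = {a..- b - 1}" using ab by (auto simp: m_def)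
    then show ?thesis using C by simp
  next
    case False
    then have "{a..b} - {- m..m} = {- a + 1..b}" using ab by (auto simp: m_def)
    then show ?thesis using C by simp
  qed
  have small: "cmod (sawtooth_coeff k) \<le> 1 / of_int m" if "k \<in> {a..b} - {- m..m}" for k
  proof -
    have k: "m \<le> \<bar>k\<bar>" "k \<noteq> 0" using that m by auto
    have "real_of_int m \<le> 2 * pi * \<bar>of_int k\<bar>"
    proof -
      have "real_of_int m \<le> \<bar>of_int k\<bar>" using k(1) by linarith
      also have "\<dots> \<le> 2 * pi * \<bar>of_int k\<bar>" using pi_gt3 by (simp add: mult_le_cancel_right1)
      finally show ?thesis .
    qed
    then have "1 / (2 * pi * \<bar>real_of_int k\<bar>) \<le> 1 / of_int m" using m k by (intro divide_left_mono) auto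
    then show ?thesis using k by (simp add: sawtooth_coeff_def norm_divide norm_mult)
  qed
  have "(\<Sum>k\<in>{a..b}. sawtooth_coeff k) - 1 / 2 = (\<Sum>k\<in>{a..b} - {- m..m}. sawtooth_coeff k)"
    using m sawtooth_sum_symmetric[of m] by (simp add: sum_diff)
  then have "cmod ((\<Sum>k\<in>{a..b}. sawtooth_coeff k) - 1 / 2) \<le> (\<Sum>k\<in>{a..b} - {- m..m}. 1 / of_int m)"
    using small by (simp only: sum_norm_le)
  also have "\<dots> = real (card ({a..b} - {- m..m})) / of_int m" by simp
  also have "\<dots> \<le> of_int C / of_int m"
    using card C m by (intro divide_right_mono) (auto simp: nat_le_iff le_nat_iff)
  finally show ?thesis by (simp add: m_def)
qed

text \<open>The windows needed later are symmetric in the frequency theta + 2 pi k, so in k they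
  have a bounded offset, expressed by C.\<close>

lemma sawtooth_sum_tendsto:
  fixes a b :: "nat \<Rightarrow> int"
  assumes a: "filterlim a at_bot sequentially" and b: "filterlim b at_top sequentially"
    and C: "\<And>N. \<bar>a N + b N\<bar> \<le> C"
  shows "(\<lambda>N. \<Sum>k\<in>{a N..b N}. sawtooth_coeff k) \<longlonglongrightarrow> 1 / 2"
proof (rule LIM_zero_cancel, rule Lim_null_comparison)
  have "\<forall>\<^sub>F N in sequentially. a N \<le> - 1" "\<forall>\<^sub>F N in sequentially. 1 \<le> b N"
    using a b unfolding filterlim_at_bot filterlim_at_top by blast+
  then show "\<forall>\<^sub>F N in sequentially. norm ((\<Sum>k\<in>{a N..b N}. sawtooth_coeff k) - 1 / 2) \<le> of_int C / of_int (min (b N) (- a N))"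
    by eventually_elim (intro sawtooth_sum_bound C)
  have "filterlim (\<lambda>N. real_of_int (min (b N) (- a N))) at_top sequentially"
    unfolding filterlim_at_top
  proof
    fix Z :: real
    have "\<forall>\<^sub>F N in sequentially. a N \<le> - \<lceil>Z\<rceil>" "\<forall>\<^sub>F N in sequentially. \<lceil>Z\<rceil> \<le> b N"
      using a b unfolding filterlim_at_bot filterlim_at_top by blast+
    then show "\<forall>\<^sub>F N in sequentially. Z \<le> of_int (min (b N) (- a N))"
      by eventually_elim (simp add: min_def ceiling_le_iff, linarith?)
  qed
  then show "(\<lambda>N. of_int C / of_int (min (b N) (- a N)) :: real) \<longlonglongrightarrow> 0"
    by (intro tendsto_divide_0[OF tendsto_const] filterlim_at_top_imp_at_infinity)
qed

lemma integral_reflect_shift: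
  fixes f :: "real \<Rightarrow> complex"
  assumes "continuous_on {0..t} f"
  shows "integral {0..t} (\<lambda>r. f (t - r)) = integral {0..t} f"
proof (rule integral_unique)
  have "(f has_integral integral {0..t} f) (cbox 0 t)"
    using assms by (simp add: integrable_integral integrable_continuous_real)
  from has_integral_affinity[OF this, of "- 1" t]
  have "((\<lambda>r. f (t - r)) has_integral integral {0..t} f) ((\<lambda>x. t - x) ` {0..t})"
    by (simp add: add.commute)
  also have "(\<lambda>x. t - x) ` {0..t} = {0..t}"
    by (auto simp: image_iff intro: bexI[of _ "t - _"])
  finally show "((\<lambda>r. f (t - r)) has_integral integral {0..t} f) {0..t}" .
qed

text \<open>The sum is a partial sum at \<open>0\<close> of the Fourier series of \<open>H(r) = \<integral>\<^sub>r\<^sup>T a(t) b(t - r) dt\<close>, which jumps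
  from \<open>H(T) = 0\<close> to \<open>H(0) = \<integral> a b\<close>; the jump is removed by a sawtooth.\<close>
lemma Volterra_conditional_trace_scalar:
  fixes a b :: "real \<Rightarrow> complex" and p q :: "nat \<Rightarrow> int"
  assumes T: "T > 0" and ac: "continuous_on {0..T} a"
    and Lip: "\<And>s t. s \<in> {0..T} \<Longrightarrow> t \<in> {0..T} \<Longrightarrow> cmod (b t - b s) \<le> L * \<bar>t - s\<bar>"
    and p: "filterlim p at_bot sequentially" and q: "filterlim q at_top sequentially"
    and C: "\<And>N. \<bar>p N + q N\<bar> \<le> C"
  shows "(\<lambda>N. \<Sum>k\<in>{p N..q N}. (LINT t|leb_upto T. a t * character T (- k) t * primitive (\<lambda>s. b s * character T k s) t) / of_real T)
    \<longlonglongrightarrow> (LINT t|leb_upto T. a t * b t) / 2"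
proof -
  \<comment> \<open>Clamping the argument extends b to a Lipschitz function B on the whole line, so
    that B (t - r) makes sense for all r and t.\<close>
  define cl where "cl x = max 0 (min T x)" for x :: real
  have cl: "cl x \<in> {0..T}" for x using T by (simp add: cl_def)
  have cl_id: "cl x = x" if "x \<in> {0..T}" for x using that by (auto simp: cl_def)
  have cl_diff: "\<bar>cl x - cl y\<bar> \<le> \<bar>x - y\<bar>" for x y by (auto simp: cl_def max_def min_def)
  have L: "0 \<le> L" using order_trans[OF norm_ge_zero Lip[of 0 T]] T by (simp add: zero_le_mult_iff)
  define B where "B x = b (cl x)" for x
  have BL: "cmod (B x - B y) \<le> L * \<bar>x - y\<bar>" for x y
    unfolding B_def by (rule order_trans[OF Lip[OF cl cl] mult_left_mono[OF cl_diff L]])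
  have Bc: "continuous_on A B" for A
    by (rule lipschitz_on_continuous_on[of L], rule lipschitz_onI) (use BL L in \<open>auto simp: dist_norm\<close>)
  have bc: "continuous_on {0..T} b"
    by (rule continuous_on_eq[OF Bc]) (simp add: B_def cl_id)
  obtain Ca where Ca: "\<And>t. t \<in> {0..T} \<Longrightarrow> cmod (a t) \<le> Ca"
    using compact_imp_bounded[OF compact_continuous_image[OF ac compact_Icc]] unfolding bounded_iff by blast
  obtain Cb where Cb': "\<And>t. t \<in> {0..T} \<Longrightarrow> cmod (b t) \<le> Cb"
    using compact_imp_bounded[OF compact_continuous_image[OF bc compact_Icc]] unfolding bounded_iff by blast
  have Cb: "cmod (B x) \<le> Cb" for x unfolding B_def by (rule Cb'[OF cl])
  have Ca0: "0 \<le> Ca" using order_trans[OF norm_ge_zero Ca[of 0]] T by simp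
  have Cb0: "0 \<le> Cb" using order_trans[OF norm_ge_zero Cb] .
  note am = measurable_leb_continuous[OF ac]
  interpret pair_sigma_finite "leb_upto T" "leb_upto T"
    by (simp add: pair_sigma_finite_def sigma_finite_leb_upto)
  interpret P: finite_measure "leb_upto T \<Otimes>\<^sub>M leb_upto T"
    by (intro finite_measure_pair_measure finite_measure_leb_upto)
  define K where "K r t = (if r \<le> t then a t * B (t - r) else 0)" for r t
  have fst_snd: "fst \<in> borel_measurable (leb_upto T \<Otimes>\<^sub>M leb_upto T)" "snd \<in> borel_measurable (leb_upto T \<Otimes>\<^sub>M leb_upto T)"
    using measurable_compose[OF measurable_fst measurable_leb_id] measurable_compose[OF measurable_snd measurable_leb_id] by auto
  have Bm: "B \<in> borel_measurable borel" by (rule borel_measurable_continuous_onI[OF Bc])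
  have m1: "(\<lambda>p. a (snd p)) \<in> borel_measurable (leb_upto T \<Otimes>\<^sub>M leb_upto T)"
    by (rule measurable_compose[OF measurable_snd am])
  have m2: "(\<lambda>p. B (snd p - fst p)) \<in> borel_measurable (leb_upto T \<Otimes>\<^sub>M leb_upto T)"
    by (rule measurable_compose[OF borel_measurable_diff[OF fst_snd(2,1)] Bm])
  have m3: "(\<lambda>p. character T k (fst p)) \<in> borel_measurable (leb_upto T \<Otimes>\<^sub>M leb_upto T)" for k
    by (rule measurable_compose[OF measurable_fst measurable_character])
  have Km: "(\<lambda>(r, t). K r t) \<in> borel_measurable (leb_upto T \<Otimes>\<^sub>M leb_upto T)"
    unfolding K_def case_prod_unfold using m1 m2 fst_snd by measurable
  have K_bound: "cmod (K r t) \<le> Ca * Cb" if "t \<in> {0..T}" for r t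
    using mult_mono[OF Ca[OF that] Cb[of "t - r"]] Ca0 Cb0 by (simp add: K_def norm_mult)
  have K_section: "integrable (leb_upto T) (K r)" if "r \<in> {0..T}" for r
    using measurable_Pair2[OF Km, of r] that K_bound by (intro integrable_leb_upto_bounded[where C = "Ca * Cb"]) auto
  define H where "H r = (LINT t|leb_upto T. K r t)" for r
  have Hm: "H \<in> borel_measurable (leb_upto T)"
    unfolding H_def[abs_def] by (rule sigma_finite_measure.borel_measurable_lebesgue_integral[OF sigma_finite_leb_upto Km])
  have len: "(LINT t|leb_upto T. (if u \<le> t \<and> t \<le> v then 1 else 0 :: real)) = v - u" if "0 \<le> u" "u \<le> v" "v \<le> T" for u v
    using LINT_FTC[of T "\<lambda>t. t" "\<lambda>_. 1" u v] that by simp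
  have int1: "integrable (leb_upto T) (\<lambda>t. c * (if u \<le> t \<and> t \<le> v then 1 else 0 :: real))" for u v c
    using measurable_leb_id[of T] by (intro integrable_mult_right integrable_leb_upto_bounded[where C = 1]) auto
  \<comment> \<open>Near T the domain of integration shrinks to length T - r.\<close>
  have H_end: "cmod (H r) \<le> Ca * Cb * (T - r)" if r: "r \<in> {0..T}" for r
  proof -
    have "cmod (H r) \<le> (LINT t|leb_upto T. Ca * Cb * (if r \<le> t \<and> t \<le> T then 1 else 0))"
      unfolding H_def
    proof (rule Bochner_Integration.integral_norm_bound_integral[OF K_section[OF r] int1])
      fix t assume "t \<in> space (leb_upto T)"
      then have t: "t \<in> {0..T}" by simp
      show "cmod (K r t) \<le> Ca * Cb * (if r \<le> t \<and> t \<le> T then 1 else 0)"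
      proof (cases "r \<le> t")
        case True
        then show ?thesis using K_bound[OF t, of r] t by simp
      next
        case False
        then have "K r t = 0" by (simp add: K_def)
        with False show ?thesis by simp
      qed
    qed
    then show ?thesis using len[of r T] r by simp
  qed
  \<comment> \<open>For t >= r the integrands differ by O(r) because b is Lipschitz; the remaining
    part t < r has length r. Continuity of a is enough.\<close>
  have H_start: "cmod (H r - H 0) \<le> (Ca * L * T + Ca * Cb) * r" if r: "r \<in> {0..T}" for r
  proof -
    have r0: "0 \<in> {0..T}" using T by simp
    have eq: "H r - H 0 = (LINT t|leb_upto T. K r t - K 0 t)"
      unfolding H_def by (rule Bochner_Integration.integral_diff[OF K_section[OF r] K_section[OF r0], symmetric])
    have "cmod (H r - H 0) \<le> (LINT t|leb_upto T. Ca * L * r * (if 0 \<le> t \<and> t \<le> T then 1 else 0) + Ca * Cb * (if 0 \<le> t \<and> t \<le> r then 1 else 0))"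
      unfolding eq
    proof (rule Bochner_Integration.integral_norm_bound_integral)
      show "integrable (leb_upto T) (\<lambda>t. K r t - K 0 t)" by (intro Bochner_Integration.integrable_diff K_section r r0)
      show "integrable (leb_upto T) (\<lambda>t. Ca * L * r * (if 0 \<le> t \<and> t \<le> T then 1 else 0) + Ca * Cb * (if 0 \<le> t \<and> t \<le> r then 1 else 0))"
        by (intro Bochner_Integration.integrable_add int1)
      fix t assume "t \<in> space (leb_upto T)"
      then have t: "t \<in> {0..T}" by simp
      show "cmod (K r t - K 0 t) \<le> Ca * L * r * (if 0 \<le> t \<and> t \<le> T then 1 else 0) + Ca * Cb * (if 0 \<le> t \<and> t \<le> r then 1 else 0)"
      proof (cases "r \<le> t")
        case True
        then have "K r t - K 0 t = a t * (B (t - r) - B t)" using t by (simp add: K_def algebra_simps)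
        then have "cmod (K r t - K 0 t) \<le> Ca * (L * r)"
          using mult_mono[OF Ca[OF t] BL[of "t - r" t]] Ca0 r by (simp add: norm_mult)
        then show ?thesis using t Ca0 Cb0 by (auto simp: mult.assoc intro: add_increasing2)
      next
        case False
        then have "K r t - K 0 t = - K 0 t" by (simp add: K_def)
        then have "cmod (K r t - K 0 t) \<le> Ca * Cb" using K_bound[OF t, of 0] by simp
        moreover have "0 \<le> Ca * L * r" using Ca0 L r by simp
        ultimately show ?thesis using t False by simp
      qed
    qed
    also have "\<dots> = Ca * L * r * T + Ca * Cb * r"
    proof -
      have l1: "(LINT t|leb_upto T. (if 0 \<le> t \<and> t \<le> T then 1 else 0 :: real)) = T - 0"
        by (rule len) (use T in auto)
      have l2: "(LINT t|leb_upto T. (if 0 \<le> t \<and> t \<le> r then 1 else 0 :: real)) = r - 0"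
        by (rule len) (use r in auto)
      show ?thesis
        unfolding Bochner_Integration.integral_add[OF int1 int1] integral_mult_right_zero l1 l2 by (simp only: diff_zero)
    qed
    finally show ?thesis by (simp add: algebra_simps)
  qed
  \<comment> \<open>The subtracted multiple of the sawtooth has the same end values as H, so G is
    bounded by a multiple of the distance to 0 on the circle.\<close>
  define G where "G r = H r - H 0 * of_real (1 - r / T)" for r
  \<comment> \<open>The sum of the constants from both ends, so that one constant serves in both
    estimates of \<open>G_min\<close>.\<close>
  define D where "D = Ca * L * T + Ca * Cb + Ca * Cb + cmod (H 0) / T"
  have D0: "0 \<le> D" using Ca0 Cb0 L T by (simp add: D_def)
  have G_min: "cmod (G r) \<le> D * min \<bar>r - 0\<bar> (T - \<bar>r - 0\<bar>)" if r: "r \<in> {0..T}" for r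
  proof -
    have "G r = (H r - H 0) + H 0 * of_real (r / T)" by (simp add: G_def algebra_simps)
    then have "cmod (G r) \<le> cmod (H r - H 0) + cmod (H 0 * of_real (r / T))" by (simp only: norm_triangle_ineq)
    also have "\<dots> \<le> (Ca * L * T + Ca * Cb) * r + cmod (H 0) / T * r"
      using H_start[OF r] r T by (simp add: norm_mult norm_divide)
    also have "\<dots> \<le> D * r"
      using r Ca0 Cb0 by (simp add: D_def algebra_simps)
    finally have 1: "cmod (G r) \<le> D * r" .
    have "cmod (G r) \<le> cmod (H r) + cmod (H 0 * of_real (1 - r / T))" unfolding G_def by (rule norm_triangle_ineq4)
    also have "cmod (H 0 * of_real (1 - r / T)) = cmod (H 0) * \<bar>1 - r / T\<bar>" by (simp only: norm_mult norm_of_real)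
    also have "cmod (H 0) * \<bar>1 - r / T\<bar> = cmod (H 0) / T * (T - r)"
      using r T by (simp add: field_simps)
    also have "cmod (H r) + cmod (H 0) / T * (T - r) \<le> Ca * Cb * (T - r) + cmod (H 0) / T * (T - r)" using H_end[OF r] by simp
    also have "\<dots> = (Ca * Cb + cmod (H 0) / T) * (T - r)" by (simp only: distrib_right)
    also have "\<dots> \<le> D * (T - r)"
      using r Ca0 Cb0 L T by (intro mult_right_mono) (auto simp: D_def)
    finally have 2: "cmod (G r) \<le> D * (T - r)" .
    from 1 2 show ?thesis using r by (simp add: min_def)
  qed
  have G_bound: "cmod (G r) \<le> (D * T) * cmod (1 - character T 1 (r - 0))" if r: "r \<in> {0..T}" for r
  proof -
    have "D * min \<bar>r - 0\<bar> (T - \<bar>r - 0\<bar>) \<le> D * (T * cmod (1 - character T 1 (r - 0)))"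
      using r by (intro mult_left_mono character_lower_bound T D0) auto
    then show ?thesis using G_min[OF r] by (simp add: mult.assoc)
  qed
  have lin: "continuous_on {0..T} (\<lambda>r. complex_of_real (1 - r / T))" using T by (intro continuous_intros) auto
  have Gm: "G \<in> borel_measurable (leb_upto T)"
    unfolding G_def[abs_def] by (intro borel_measurable_diff Hm borel_measurable_times measurable_leb_continuous lin) simp
  have limG: "(\<lambda>N. \<Sum>k\<in>{p N..q N}. character T k 0 * (LINT r|leb_upto T. G r * character T (- k) r)) \<longlonglongrightarrow> 0"
    using D0 T by (intro Chernoff_pointwise[OF T Gm G_bound _ p q]) auto
  \<comment> \<open>Fubini and the substitution s = t - r, under which the character at r splits
    into one at t and one at s.\<close>
  have H_coef: "(LINT r|leb_upto T. H r * character T (- k) r)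
      = (LINT t|leb_upto T. a t * character T (- k) t * primitive (\<lambda>s. b s * character T k s) t)" for k
  proof -
    have m: "(\<lambda>(r, t). K r t * character T (- k) r) \<in> borel_measurable (leb_upto T \<Otimes>\<^sub>M leb_upto T)"
      using borel_measurable_times[OF Km m3[of "- k"]] by (simp add: case_prod_unfold)
    have int: "integrable (leb_upto T \<Otimes>\<^sub>M leb_upto T) (\<lambda>(r, t). K r t * character T (- k) r)"
      by (rule P.integrable_const_bound[OF _ m, of "Ca * Cb"], rule AE_I2)
        (use K_bound in \<open>auto simp: norm_mult space_pair_measure\<close>)
    have inner: "(LINT r|leb_upto T. K r t * character T (- k) r) = a t * character T (- k) t * primitive (\<lambda>s. b s * character T k s) t"
      if t: "t \<in> {0..T}" for t
    proof -
      let ?f = "\<lambda>s. B s * character T k s"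
      have fc: "continuous_on A ?f" for A by (intro continuous_intros Bc continuous_character)
      have gc: "continuous_on {0..t} (\<lambda>r. ?f (t - r))"
        by (intro continuous_on_compose2[OF fc[of UNIV]] continuous_intros) auto
      have "(LINT r|leb_upto T. K r t * character T (- k) r) = (LINT r|leb_upto T. a t * character T (- k) t * (if r \<in> {0..t} then ?f (t - r) else 0))"
      proof (intro Bochner_Integration.integral_cong refl)
        fix r assume "r \<in> space (leb_upto T)"
        moreover have "character T (- k) t * character T k (t - r) = character T (- k) r"
          unfolding character_diff_arg by simp
        ultimately show "K r t * character T (- k) r = a t * character T (- k) t * (if r \<in> {0..t} then ?f (t - r) else 0)"
          by (auto simp: K_def)
      qed
      also have "\<dots> = a t * character T (- k) t * (LINT r|leb_upto T. (if r \<in> {0..t} then ?f (t - r) else 0))"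
        by (rule integral_mult_right_zero)
      also have "(LINT r|leb_upto T. (if r \<in> {0..t} then ?f (t - r) else 0)) = (LINT r|leb_upto t. ?f (t - r))"
        using t by (intro integral_restrict) auto
      also have "\<dots> = integral {0..t} (\<lambda>r. ?f (t - r))"
        by (intro lebesgue_integral_eq_integral continuous_imp_integrable_real gc) auto
      also have "\<dots> = integral {0..t} ?f" by (rule integral_reflect_shift[OF fc])
      also have "\<dots> = primitive ?f t" using t by (intro primitive_eq_integral[OF fc, symmetric]) auto
      also have "\<dots> = primitive (\<lambda>s. b s * character T k s) t"
        unfolding primitive_def using t by (intro Bochner_Integration.integral_cong) (auto simp: B_def cl_id)
      finally show ?thesis .
    qed
    have "(LINT r|leb_upto T. H r * character T (- k) r) = (LINT r|leb_upto T. LINT t|leb_upto T. K r t * character T (- k) r)"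
      unfolding H_def by simp
    also have "\<dots> = (LINT t|leb_upto T. LINT r|leb_upto T. K r t * character T (- k) r)"
      by (rule Fubini_integral[OF int, symmetric])
    also have "\<dots> = (LINT t|leb_upto T. a t * character T (- k) t * primitive (\<lambda>s. b s * character T k s) t)"
      by (intro Bochner_Integration.integral_cong refl) (simp add: inner)
    finally show ?thesis .
  qed
  have Hi: "integrable (leb_upto T) (\<lambda>r. H r * character T (- k) r)" for k
  proof (rule integrable_leb_upto_bounded[where C = "Ca * Cb * T"])
    show "(\<lambda>r. H r * character T (- k) r) \<in> borel_measurable (leb_upto T)"
      by (rule borel_measurable_times[OF Hm measurable_character])
    fix r assume r: "r \<in> {0..T}"
    have "Ca * Cb * (T - r) \<le> Ca * Cb * T" using r Ca0 Cb0 by (intro mult_left_mono) auto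
    then show "cmod (H r * character T (- k) r) \<le> Ca * Cb * T" using H_end[OF r] by (simp add: norm_mult)
  qed
  have G_coef: "(LINT r|leb_upto T. G r * character T (- k) r) = (LINT r|leb_upto T. H r * character T (- k) r) - H 0 * (of_real T * sawtooth_coeff k)" for k
  proof -
    have "(LINT r|leb_upto T. G r * character T (- k) r)
        = (LINT r|leb_upto T. H r * character T (- k) r - H 0 * (of_real (1 - r / T) * character T (- k) r))"
      by (simp add: G_def left_diff_distrib mult.assoc)
    also have "\<dots> = (LINT r|leb_upto T. H r * character T (- k) r) - H 0 * (LINT r|leb_upto T. of_real (1 - r / T) * character T (- k) r)"
      by (subst Bochner_Integration.integral_diff[OF Hi])
        (intro integrable_leb_continuous continuous_on_mult continuous_on_const lin continuous_character, rule arg_cong[OF integral_mult_right_zero])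
    finally show ?thesis by (simp only: sawtooth_coefficient[OF T])
  qed
  have H0: "H 0 = (LINT t|leb_upto T. a t * b t)"
    unfolding H_def by (intro Bochner_Integration.integral_cong) (auto simp: K_def B_def cl_id)
  let ?s = "\<lambda>N. \<Sum>k\<in>{p N..q N}. (LINT r|leb_upto T. G r * character T (- k) r)"
  \<comment> \<open>The sums for G vanish in the limit by Chernoff, and the sawtooth sums tend to
    1/2.\<close>
  have "(\<lambda>N. ?s N / of_real T + H 0 * (\<Sum>k\<in>{p N..q N}. sawtooth_coeff k)) \<longlonglongrightarrow> 0 / of_real T + H 0 * (1 / 2)"
    using limG T by (intro tendsto_add tendsto_mult tendsto_const sawtooth_sum_tendsto[OF p q C] tendsto_divide) auto
  moreover have "?s N / of_real T + H 0 * (\<Sum>k\<in>{p N..q N}. sawtooth_coeff k)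
      = (\<Sum>k\<in>{p N..q N}. (LINT r|leb_upto T. H r * character T (- k) r) / of_real T)" for N
    using T unfolding sum_divide_distrib sum_distrib_left sum.distrib[symmetric] G_coef
    by (intro sum.cong refl) (simp add: field_simps)
  ultimately show ?thesis by (simp add: H_coef H0)
qed

section \<open>Linear systems\<close>

lemma mat_vector_mult: "mat c *v x = c *s x" for x :: "complex ^ 'n"
  by (simp add: vec_eq_iff matrix_vector_mult_def mat_def if_distrib[of "\<lambda>y. y * _"] cong: if_cong)

lemma mat_mult_component: "(mat c ** A) $ i $ j = c * A $ i $ j" "(A ** mat c) $ i $ j = c * A $ i $ j" for A :: "complex ^ 'n ^ 'n"
  by (simp_all add: matrix_matrix_mult_def mat_def if_distrib[of "\<lambda>y. y * _"] if_distrib[of "(*) _"] cong: if_cong)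

lemma mat_mult_commute: "A ** mat c = mat c ** A" for A :: "complex ^ 'n ^ 'n"
  by (simp add: vec_eq_iff mat_mult_component)

lemma mat_mult_left_commute: "A ** (mat c ** B) = mat c ** (A ** B)" for A B :: "complex ^ 'n ^ 'n"
  unfolding matrix_mul_assoc mat_mult_commute[of A] ..

lemma mat_mult_mat: "mat a ** mat b = (mat (a * b) :: complex ^ 'n ^ 'n)"
  by (simp add: vec_eq_iff mat_mult_component) (simp add: mat_def)

lemma bounded_linear_mat: "bounded_linear (mat :: complex \<Rightarrow> complex ^ 'n ^ 'n)"
  unfolding linear_conv_bounded_linear[symmetric] by (rule linearI) (simp_all add: mat_def vec_eq_iff)

text \<open>A square matrix with trivial kernel has a left inverse, which is two-sided; this
  justifies the choice in \<open>matrix_inv\<close>.\<close>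

lemma matrix_inv_mult:
  fixes A :: "complex ^ 'n ^ 'n"
  assumes "\<And>x. A *v x = 0 \<Longrightarrow> x = 0"
  shows "A ** matrix_inv A = mat 1" "matrix_inv A ** A = mat 1"
proof -
  obtain B where "B ** A = mat 1" using assms matrix_left_invertible_ker[of A] by auto
  then have "A ** B = mat 1 \<and> B ** A = mat 1" using matrix_left_right_inverse[of A B] by simp
  then have "A ** matrix_inv A = mat 1 \<and> matrix_inv A ** A = mat 1"
    unfolding matrix_inv_def by (rule someI)
  then show "A ** matrix_inv A = mat 1" "matrix_inv A ** A = mat 1" by auto
qed

lemma exp_has_vector_derivative:
  "((\<lambda>t. exp (c * complex_of_real t)) has_vector_derivative c * exp (c * of_real t)) (at t within S)"
  using exp_scaleR_has_vector_derivative_right[of c t S]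
  by (simp add: scaleR_conv_of_real mult.commute)

text \<open>Gronwall for |y|^2: its product with e^{-2Lt} is nonincreasing and with e^{2Lt}
  nondecreasing. Since s and t may come in either order, the one estimate gives uniqueness,
  invertibility of fundamental solutions and a bound on their inverses.\<close>

lemma linear_ode_bound:
  fixes y :: "real \<Rightarrow> complex ^ 'n"
  assumes ode: "\<And>t. t \<in> {0..T} \<Longrightarrow> (y has_vector_derivative N t *v y t) (at t within {0..T})"
    and N: "\<And>t. t \<in> {0..T} \<Longrightarrow> norm (N t) \<le> L" and st: "s \<in> {0..T}" "t \<in> {0..T}"
  shows "norm (y t) \<le> exp (L * T) * norm (y s)"
proof -
  have T: "0 \<le> T" using st by auto
  have L: "0 \<le> L" using order_trans[OF norm_ge_zero N[of 0]] T by auto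
  define \<phi> where "\<phi> t = y t \<bullet> y t" for t
  have \<phi>': "(\<phi> has_real_derivative 2 * (y u \<bullet> (N u *v y u))) (at u within {0..T})" if "u \<in> {0..T}" for u
    unfolding \<phi>_def[abs_def] has_real_derivative_iff_has_vector_derivative
    using bounded_bilinear.has_vector_derivative[OF bounded_bilinear_inner ode[OF that] ode[OF that]]
    by (simp add: inner_commute)
  have bound: "\<bar>2 * (y u \<bullet> (N u *v y u))\<bar> \<le> 2 * L * \<phi> u" if "u \<in> {0..T}" for u
  proof -
    have "\<bar>y u \<bullet> (N u *v y u)\<bar> \<le> norm (y u) * (norm (N u) * norm (y u))"
      by (rule order_trans[OF Cauchy_Schwarz_ineq2 mult_left_mono[OF norm_matrix_vector_mult_le]]) simp
    also have "\<dots> \<le> norm (y u) * (L * norm (y u))"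
      by (intro mult_left_mono mult_right_mono N that) auto
    finally show ?thesis by (simp add: \<phi>_def power2_norm_eq_inner[symmetric] power2_eq_square mult_ac abs_mult)
  qed
  have e': "((\<lambda>u. exp (c * u) * \<phi> u) has_real_derivative exp (c * u) * (c * \<phi> u + 2 * (y u \<bullet> (N u *v y u)))) (at u within {0..T})"
    if "u \<in> {0..T}" for u c
    by (rule derivative_eq_intros \<phi>'[OF that] refl | simp add: algebra_simps)+
  have cont: "continuous_on {a..b} (\<lambda>u. exp (c * u) * \<phi> u)" if "0 \<le> a" "b \<le> T" for a b c
    using that by (intro continuous_on_subset[OF DERIV_continuous_on[OF e']]) auto
  have at: "((\<lambda>u. exp (c * u) * \<phi> u) has_real_derivative exp (c * u) * (c * \<phi> u + 2 * (y u \<bullet> (N u *v y u)))) (at u)"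
    if "0 < u" "u < T" for u c
    using e'[of u c] that at_within_Icc_at[of 0 u T] by simp
  have "\<phi> t \<le> exp (2 * L * T) * \<phi> s"
  proof (cases "s \<le> t")
    case True
    have "exp (- (2 * L) * t) * \<phi> t \<le> exp (- (2 * L) * s) * \<phi> s"
    proof (rule DERIV_nonpos_imp_decreasing_open[OF True _ cont])
      fix u assume u: "s < u" "u < t"
      then have "0 < u" "u < T" using st by auto
      moreover have "- (2 * L) * \<phi> u + 2 * (y u \<bullet> (N u *v y u)) \<le> 0"
        using bound[of u] u st by (auto simp: abs_le_iff)
      ultimately show "\<exists>d. ((\<lambda>u. exp (- (2 * L) * u) * \<phi> u) has_real_derivative d) (at u) \<and> d \<le> 0"
        by (intro exI[of _ "exp (- (2 * L) * u) * (- (2 * L) * \<phi> u + 2 * (y u \<bullet> (N u *v y u)))"] conjI at)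
          (auto simp: mult_le_0_iff)
    qed (use st in auto)
    then have "exp (2 * L * t) * (exp (- (2 * L) * t) * \<phi> t) \<le> exp (2 * L * t) * (exp (- (2 * L) * s) * \<phi> s)"
      by (intro mult_left_mono) auto
    then have "\<phi> t \<le> exp (2 * L * (t - s)) * \<phi> s"
      unfolding mult.assoc[of "exp _", symmetric] exp_add[symmetric] by (simp add: algebra_simps)
    also have "\<dots> \<le> exp (2 * L * T) * \<phi> s"
      using L st by (intro mult_right_mono) (auto simp: \<phi>_def intro!: mult_left_mono)
    finally show ?thesis .
  next
    case False
    then have "t \<le> s" by simp
    have "exp ((2 * L) * t) * \<phi> t \<le> exp ((2 * L) * s) * \<phi> s"
    proof (rule DERIV_nonneg_imp_increasing_open[OF \<open>t \<le> s\<close> _ cont])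
      fix u assume u: "t < u" "u < s"
      then have "0 < u" "u < T" using st by auto
      moreover have "0 \<le> (2 * L) * \<phi> u + 2 * (y u \<bullet> (N u *v y u))"
        using bound[of u] u st by (auto simp: abs_le_iff)
      ultimately show "\<exists>d. ((\<lambda>u. exp ((2 * L) * u) * \<phi> u) has_real_derivative d) (at u) \<and> 0 \<le> d"
        by (intro exI[of _ "exp ((2 * L) * u) * ((2 * L) * \<phi> u + 2 * (y u \<bullet> (N u *v y u)))"] conjI at)
          auto
    qed (use st in auto)
    then have "exp (- (2 * L) * t) * (exp (2 * L * t) * \<phi> t) \<le> exp (- (2 * L) * t) * (exp (2 * L * s) * \<phi> s)"
      by (intro mult_left_mono) auto
    then have "\<phi> t \<le> exp (2 * L * (s - t)) * \<phi> s"
      unfolding mult.assoc[of "exp _", symmetric] exp_add[symmetric] by (simp add: algebra_simps)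
    also have "\<dots> \<le> exp (2 * L * T) * \<phi> s"
      using L st by (intro mult_right_mono) (auto simp: \<phi>_def intro!: mult_left_mono)
    finally show ?thesis .
  qed
  then have "(norm (y t))\<^sup>2 \<le> (exp (L * T) * norm (y s))\<^sup>2"
    by (simp add: \<phi>_def power2_norm_eq_inner power_mult_distrib exp_double[symmetric] mult.assoc)
  then show ?thesis by (rule power2_le_imp_le) simp
qed

text \<open>Each column has norm at most K, so the Frobenius norm is at most sqrt n K; the factor n
  is cruder and avoids the root.\<close>

lemma norm_matrix_le_operator_bound:
  fixes A :: "complex ^ 'n ^ 'n" and K :: real
  assumes "\<And>x. norm (A *v x) \<le> K * norm x" shows "norm A \<le> CARD('n) * K"
proof -
  have K: "0 \<le> K" using order_trans[OF norm_ge_zero assms[of "axis undefined 1"]] by simp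
  have col: "(A *v axis j 1) $ i = A $ i $ j" for i j
    by (simp add: matrix_vector_mult_def axis_def if_distrib[of "(*) _"] cong: if_cong)
  have "(norm A)\<^sup>2 = (\<Sum>i\<in>UNIV. \<Sum>j\<in>UNIV. (cmod (A $ i $ j))\<^sup>2)"
    by (simp add: norm_matrix_power2 norm_vec_power2)
  also have "\<dots> = (\<Sum>j\<in>UNIV. \<Sum>i\<in>UNIV. (cmod (A $ i $ j))\<^sup>2)" by (rule sum.swap)
  also have "\<dots> = (\<Sum>j\<in>UNIV. (norm (A *v axis j 1))\<^sup>2)" by (simp add: norm_vec_power2 col)
  also have "\<dots> \<le> (\<Sum>j\<in>(UNIV::'n set). K\<^sup>2)"
  proof (intro sum_mono power_mono)
    show "norm (A *v axis j 1) \<le> K" for j using assms[of "axis j 1"] by simp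
  qed simp
  also have "\<dots> \<le> (CARD('n) * K)\<^sup>2"
    using mult_right_mono[OF self_le_power[of "real CARD('n)" 2], of "K\<^sup>2"] by (simp add: power_mult_distrib Suc_leI)
  finally show ?thesis by (rule power2_le_imp_le) (use K in simp)
qed

lemma norm_matrix_mult_le:
  fixes A B :: "complex ^ 'n ^ 'n"
  shows "norm (A ** B) \<le> norm A * norm B * CARD('n)"
proof -
  have "norm (A ** B) \<le> CARD('n) * (norm A * norm B)"
  proof (rule norm_matrix_le_operator_bound)
    fix x
    have "norm (A *v (B *v x)) \<le> norm A * (norm B * norm x)"
      by (rule order_trans[OF norm_matrix_vector_mult_le mult_left_mono[OF norm_matrix_vector_mult_le norm_ge_zero]])
    then show "norm ((A ** B) *v x) \<le> norm A * norm B * norm x"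
      by (simp add: matrix_vector_mul_assoc mult.assoc)
  qed
  then show ?thesis by (simp add: mult.commute)
qed

lemma primitive_add:
  fixes f g :: "real \<Rightarrow> 'a::euclidean_space"
  assumes "integrable (leb_upto T) f" "integrable (leb_upto T) g" "t \<in> {0..T}"
  shows "primitive (\<lambda>s. f s + g s) t = primitive f t + primitive g t"
    and "primitive (\<lambda>s. f s - g s) t = primitive f t - primitive g t"
proof -
  have "integrable (leb_upto t) f" "integrable (leb_upto t) g"
    using integrable_leb_subinterval[OF assms(1), of t] integrable_leb_subinterval[OF assms(2), of t] assms(3) by auto
  then show "primitive (\<lambda>s. f s + g s) t = primitive f t + primitive g t"
    "primitive (\<lambda>s. f s - g s) t = primitive f t - primitive g t"
    unfolding primitive_def by simp_all
qed

definition Lipschitz_upto :: "real \<Rightarrow> (real \<Rightarrow> 'a::real_normed_vector) \<Rightarrow> bool" where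
  "Lipschitz_upto T f \<longleftrightarrow> (\<exists>L. \<forall>s\<in>{0..T}. \<forall>t\<in>{0..T}. norm (f t - f s) \<le> L * \<bar>t - s\<bar>)"

lemma Lipschitz_uptoD:
  assumes "Lipschitz_upto T f"
  shows "\<exists>L\<ge>0. \<forall>s\<in>{0..T}. \<forall>t\<in>{0..T}. norm (f t - f s) \<le> L * \<bar>t - s\<bar>"
proof -
  obtain L where L: "\<And>s t. s \<in> {0..T} \<Longrightarrow> t \<in> {0..T} \<Longrightarrow> norm (f t - f s) \<le> L * \<bar>t - s\<bar>"
    using assms unfolding Lipschitz_upto_def by blast
  show ?thesis
  proof (intro exI[of _ "max L 0"] conjI ballI)
    fix s t assume "s \<in> {0..T}" "t \<in> {0..T}"
    then show "norm (f t - f s) \<le> max L 0 * \<bar>t - s\<bar>"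
      by (rule order_trans[OF L]) (intro mult_right_mono; simp)
  qed simp
qed

lemma Lipschitz_upto_continuous: assumes "Lipschitz_upto T f" shows "continuous_on {0..T} f"
proof -
  obtain L where "0 \<le> L" "\<And>s t. s \<in> {0..T} \<Longrightarrow> t \<in> {0..T} \<Longrightarrow> norm (f t - f s) \<le> L * \<bar>t - s\<bar>"
    using Lipschitz_uptoD[OF assms] by blast
  then show ?thesis by (intro lipschitz_on_continuous_on[of L] lipschitz_onI) (auto simp: dist_norm)
qed

lemma continuous_on_Icc_bounded:
  fixes f :: "real \<Rightarrow> 'a::real_normed_vector"
  assumes "continuous_on {0..T} f"
  shows "\<exists>C\<ge>0. \<forall>t\<in>{0..T}. norm (f t) \<le> C"
proof -
  obtain C where C: "\<And>t. t \<in> {0..T} \<Longrightarrow> norm (f t) \<le> C"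
    using compact_imp_bounded[OF compact_continuous_image[OF assms compact_Icc]] unfolding bounded_iff by blast
  show ?thesis by (rule exI[of _ "max C 0"]) (use C in \<open>auto simp: le_max_iff_disj\<close>)
qed

lemma Lipschitz_upto_C1:
  fixes f :: "real \<Rightarrow> 'a::real_normed_vector"
  assumes f: "\<And>t. t \<in> {0..T} \<Longrightarrow> (f has_vector_derivative f' t) (at t within {0..T})" and f': "continuous_on {0..T} f'"
  shows "Lipschitz_upto T f"
proof -
  obtain C where C: "0 \<le> C" "\<And>t. t \<in> {0..T} \<Longrightarrow> norm (f' t) \<le> C" using continuous_on_Icc_bounded[OF f'] by blast
  have "norm (f t - f s) \<le> C * norm (t - s)" if "s \<in> {0..T}" "t \<in> {0..T}" for s t
  proof (rule differentiable_bound[OF convex_closed_interval[of 0 T]])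
    show "(f has_derivative (\<lambda>h. h *\<^sub>R f' x)) (at x within {0..T})" if "x \<in> {0..T}" for x
      using f[OF that] by (simp add: has_vector_derivative_def)
    show "onorm (\<lambda>h. h *\<^sub>R f' x) \<le> C" if "x \<in> {0..T}" for x
      using mult_left_mono[OF C(2)[OF that] abs_ge_zero] by (intro onorm_le) (simp add: mult.commute)
  qed (use that in auto)
  then show ?thesis unfolding Lipschitz_upto_def real_norm_def by blast
qed

lemma Lipschitz_upto_bilinear:
  fixes f :: "real \<Rightarrow> 'a::real_normed_vector" and g :: "real \<Rightarrow> 'b::real_normed_vector"
  assumes h: "bounded_bilinear h" and f: "Lipschitz_upto T f" and g: "Lipschitz_upto T g"
  shows "Lipschitz_upto T (\<lambda>t. h (f t) (g t))"
proof -
  interpret h: bounded_bilinear h by (rule h)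
  obtain K where K: "0 < K" "\<And>a b. norm (h a b) \<le> norm a * norm b * K" using h.pos_bounded by blast
  obtain Lf where Lf: "0 \<le> Lf" "\<And>s t. s \<in> {0..T} \<Longrightarrow> t \<in> {0..T} \<Longrightarrow> norm (f t - f s) \<le> Lf * \<bar>t - s\<bar>"
    using Lipschitz_uptoD[OF f] by blast
  obtain Lg where Lg: "0 \<le> Lg" "\<And>s t. s \<in> {0..T} \<Longrightarrow> t \<in> {0..T} \<Longrightarrow> norm (g t - g s) \<le> Lg * \<bar>t - s\<bar>"
    using Lipschitz_uptoD[OF g] by blast
  obtain Cf where Cf: "0 \<le> Cf" "\<And>t. t \<in> {0..T} \<Longrightarrow> norm (f t) \<le> Cf"
    using continuous_on_Icc_bounded[OF Lipschitz_upto_continuous[OF f]] by blast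
  obtain Cg where Cg: "0 \<le> Cg" "\<And>t. t \<in> {0..T} \<Longrightarrow> norm (g t) \<le> Cg"
    using continuous_on_Icc_bounded[OF Lipschitz_upto_continuous[OF g]] by blast
  have "norm (h (f t) (g t) - h (f s) (g s)) \<le> (Lf * Cg * K + Cf * Lg * K) * \<bar>t - s\<bar>"
    if st: "s \<in> {0..T}" "t \<in> {0..T}" for s t
  proof -
    have "h (f t) (g t) - h (f s) (g s) = h (f t - f s) (g t) + h (f s) (g t - g s)"
      by (simp add: h.diff_left h.diff_right)
    then have "norm (h (f t) (g t) - h (f s) (g s)) \<le> norm (f t - f s) * norm (g t) * K + norm (f s) * norm (g t - g s) * K"
      using norm_triangle_mono[OF K(2)[of "f t - f s" "g t"] K(2)[of "f s" "g t - g s"]] by simp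
    also have "\<dots> \<le> (Lf * \<bar>t - s\<bar>) * Cg * K + Cf * (Lg * \<bar>t - s\<bar>) * K"
    proof -
      have 1: "norm (f t - f s) * norm (g t) \<le> (Lf * \<bar>t - s\<bar>) * Cg"
        by (rule mult_mono[OF Lf(2)[OF st] Cg(2)[OF st(2)]]) (use Lf(1) in simp_all)
      have 2: "norm (f s) * norm (g t - g s) \<le> Cf * (Lg * \<bar>t - s\<bar>)"
        by (rule mult_mono[OF Cf(2)[OF st(1)] Lg(2)[OF st]]) (use Cf(1) in simp_all)
      show ?thesis using K(1) by (intro add_mono mult_right_mono 1 2) simp_all
    qed
    finally show ?thesis by (simp add: algebra_simps)
  qed
  then show ?thesis unfolding Lipschitz_upto_def by blast
qed

lemma orthogonal_matrix_cdot:
  fixes S :: "real ^ 'n ^ 'n"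
  assumes "orthogonal_matrix S"
  shows "cdot (map_matrix complex_of_real S *v x) (map_matrix complex_of_real S *v y) = cdot x y"
proof -
  have SS: "transpose S ** S = mat 1" using assms by (simp add: orthogonal_matrix_def)
  have "(adj (map_matrix complex_of_real S) ** map_matrix complex_of_real S) $ i $ j = of_real ((transpose S ** S) $ i $ j)" for i j
    by (simp add: matrix_matrix_mult_def adj_def transpose_def map_matrix_def)
  then have "adj (map_matrix complex_of_real S) ** map_matrix complex_of_real S = mat 1"
    unfolding SS by (simp add: vec_eq_iff mat_def)
  then show ?thesis
    by (simp add: cdot_adj matrix_vector_mul_assoc)
qed

section \<open>The fundamental solution and the resolvent\<close>

locale monodromy_data =
  fixes T :: real and S :: "real ^ 'n ^ ('n::finite)"
    and D0 D \<gamma> :: "real \<Rightarrow> complex ^ 'n ^ 'n" and \<nu> :: complex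
  assumes T_pos: "0 < T"
    and S_orth: "orthogonal_matrix S"
    and D0_cont: "continuous_on {0..T} D0"
    and D_cont: "continuous_on {0..T} D"
    and inv: "op_invertible T (shifted_ddt T S D0 \<nu>)"
    and \<gamma>_init: "\<gamma> 0 = mat 1"
    and \<gamma>_ode: "\<And>t. t \<in> {0..T} \<Longrightarrow> (\<gamma> has_vector_derivative (D0 t ** \<gamma> t)) (at t within {0..T})"
begin

abbreviation (input) Sc :: "complex ^ 'n ^ 'n" where "Sc \<equiv> map_matrix complex_of_real S"

definition X :: "real \<Rightarrow> complex ^ 'n ^ 'n" where "X t = mat (exp (- \<nu> * of_real t)) ** \<gamma> t"
definition B :: "real \<Rightarrow> complex ^ 'n ^ 'n" where "B t = mat (exp (\<nu> * of_real t)) ** matrix_inv (\<gamma> t)"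
definition A :: "real \<Rightarrow> complex ^ 'n ^ 'n" where "A t = D t ** X t"
definition N :: "real \<Rightarrow> complex ^ 'n ^ 'n" where "N t = D0 t - mat \<nu>"
definition M :: "complex ^ 'n ^ 'n" where "M = Sc ** \<gamma> T"
definition E :: "complex ^ 'n ^ 'n" where "E = mat (exp (\<nu> * of_real T))"
text \<open>The boundary condition z(0) = S z(T), solved for the initial value, reads z(0) = -Q
  applied to the integral of B f over [0,T]. The matrices of the theorem are G k = M_k Q.\<close>

definition Q :: "complex ^ 'n ^ 'n" where "Q = M ** matrix_inv (M - E)"
definition Dhat :: "real \<Rightarrow> complex ^ 'n ^ 'n" where "Dhat = (\<lambda>t. matrix_inv (\<gamma> t) ** D t ** \<gamma> t)"

lemma T_nonneg: "0 \<le> T" and in_0T: "0 \<in> {0..T}" "T \<in> {0..T}"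
  using T_pos by auto

lemma \<gamma>_cont: "continuous_on {0..T} \<gamma>"
  by (rule continuous_on_vector_derivative[OF \<gamma>_ode])

lemma matrix_mult_cont: "continuous_on U f \<Longrightarrow> continuous_on U g \<Longrightarrow> continuous_on U (\<lambda>t. (f t :: complex ^ 'n ^ 'n) ** (g t :: complex ^ 'n ^ 'n))"
  by (rule bounded_bilinear.continuous_on[OF bounded_bilinear_matrix_mult])

lemma matrix_vector_mult_cont: "continuous_on U f \<Longrightarrow> continuous_on U g \<Longrightarrow> continuous_on U (\<lambda>t. (f t :: complex ^ 'n ^ 'n) *v g t)"
  by (rule bounded_bilinear.continuous_on[OF bounded_bilinear_matrix_vector_mult])

lemma \<gamma>_vec_ode: "t \<in> {0..T} \<Longrightarrow> ((\<lambda>t. \<gamma> t *v c) has_vector_derivative D0 t *v (\<gamma> t *v c)) (at t within {0..T})"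
  using bounded_linear.has_vector_derivative[OF bounded_bilinear.bounded_linear_left[OF bounded_bilinear_matrix_vector_mult] \<gamma>_ode]
  by (simp add: matrix_vector_mul_assoc)

text \<open>Gronwall backwards in time: c is the value at 0 of the solution that vanishes at
  t.\<close>

lemma \<gamma>_ker: assumes "t \<in> {0..T}" "\<gamma> t *v c = 0" shows "c = 0"
proof -
  obtain L where L: "0 \<le> L" "\<And>t. t \<in> {0..T} \<Longrightarrow> norm (D0 t) \<le> L" using continuous_on_Icc_bounded[OF D0_cont] by blast
  have "norm (\<gamma> 0 *v c) \<le> exp (L * T) * norm (\<gamma> t *v c)"
    by (rule linear_ode_bound[OF \<gamma>_vec_ode L(2) assms(1) in_0T(1)])
  then show ?thesis by (simp add: assms \<gamma>_init)
qed

lemma \<gamma>_inv: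
  assumes "t \<in> {0..T}" shows "\<gamma> t ** matrix_inv (\<gamma> t) = mat 1" "matrix_inv (\<gamma> t) ** \<gamma> t = mat 1"
  by (rule matrix_inv_mult, erule \<gamma>_ker[OF assms])+

text \<open>From the identity a^{-1} - b^{-1} = a^{-1} (b - a) b^{-1}, with the inverses bounded by
  the backward Gronwall estimate. The Lipschitz property passes to B, the factor of the Volterra
  kernel that must be Lipschitz at the jump.\<close>

lemma \<gamma>_inv_Lipschitz: "Lipschitz_upto T (\<lambda>t. matrix_inv (\<gamma> t))"
proof -
  obtain L0 where L0: "0 \<le> L0" "\<And>t. t \<in> {0..T} \<Longrightarrow> norm (D0 t) \<le> L0" using continuous_on_Icc_bounded[OF D0_cont] by blast
  define K where "K = exp (L0 * T)"
  have K: "0 \<le> K" by (simp add: K_def)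
  have bound: "norm (matrix_inv (\<gamma> t)) \<le> CARD('n) * K" if t: "t \<in> {0..T}" for t
  proof (rule norm_matrix_le_operator_bound)
    fix x
    have "norm (\<gamma> 0 *v (matrix_inv (\<gamma> t) *v x)) \<le> K * norm (\<gamma> t *v (matrix_inv (\<gamma> t) *v x))"
      unfolding K_def by (rule linear_ode_bound[OF \<gamma>_vec_ode L0(2) t in_0T(1)])
    then show "norm (matrix_inv (\<gamma> t) *v x) \<le> K * norm x"
      by (simp add: \<gamma>_init matrix_vector_mul_assoc \<gamma>_inv[OF t])
  qed
  obtain L where L: "0 \<le> L" "\<And>s t. s \<in> {0..T} \<Longrightarrow> t \<in> {0..T} \<Longrightarrow> norm (\<gamma> t - \<gamma> s) \<le> L * \<bar>t - s\<bar>"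
    using Lipschitz_uptoD[OF Lipschitz_upto_C1[OF \<gamma>_ode matrix_mult_cont[OF D0_cont \<gamma>_cont]]] by blast
  define k where "k = real CARD('n)"
  have k0: "0 \<le> k" by (simp add: k_def)
  have k: "norm (a ** b) \<le> norm a * norm b * k" for a b :: "complex ^ 'n ^ 'n"
    unfolding k_def by (rule norm_matrix_mult_le)
  have "norm (matrix_inv (\<gamma> t) - matrix_inv (\<gamma> s)) \<le> (CARD('n) * K * L * k * (CARD('n) * K) * k) * \<bar>t - s\<bar>"
    if st: "s \<in> {0..T}" "t \<in> {0..T}" for s t
  proof -
    have eq: "matrix_inv (\<gamma> t) - matrix_inv (\<gamma> s) = matrix_inv (\<gamma> t) ** (\<gamma> s - \<gamma> t) ** matrix_inv (\<gamma> s)"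
    proof -
      have "matrix_inv (\<gamma> t) ** (\<gamma> s - \<gamma> t) ** matrix_inv (\<gamma> s)
          = matrix_inv (\<gamma> t) ** (\<gamma> s ** matrix_inv (\<gamma> s)) - (matrix_inv (\<gamma> t) ** \<gamma> t) ** matrix_inv (\<gamma> s)"
        by (simp add: bounded_bilinear.diff_left[OF bounded_bilinear_matrix_mult]
            bounded_bilinear.diff_right[OF bounded_bilinear_matrix_mult] matrix_mul_assoc)
      then show ?thesis by (simp add: \<gamma>_inv(1)[OF st(1)] \<gamma>_inv(2)[OF st(2)])
    qed
    have "norm (matrix_inv (\<gamma> t) ** (\<gamma> s - \<gamma> t) ** matrix_inv (\<gamma> s))
        \<le> norm (matrix_inv (\<gamma> t) ** (\<gamma> s - \<gamma> t)) * norm (matrix_inv (\<gamma> s)) * k" by (rule k)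
    also have "\<dots> \<le> (norm (matrix_inv (\<gamma> t)) * norm (\<gamma> s - \<gamma> t) * k) * norm (matrix_inv (\<gamma> s)) * k"
      using k0 by (intro mult_right_mono k) auto
    also have "\<dots> \<le> ((CARD('n) * K) * (L * \<bar>t - s\<bar>) * k) * (CARD('n) * K) * k"
    proof -
      have "norm (matrix_inv (\<gamma> t)) * norm (\<gamma> s - \<gamma> t) \<le> (CARD('n) * K) * (L * \<bar>t - s\<bar>)"
        using L(2)[OF st(2,1)] K by (intro mult_mono[OF bound[OF st(2)]]) (simp_all add: abs_minus_commute)
      then have "norm (matrix_inv (\<gamma> t)) * norm (\<gamma> s - \<gamma> t) * k \<le> (CARD('n) * K) * (L * \<bar>t - s\<bar>) * k"
        using k0 by (rule mult_right_mono)
      from mult_mono[OF this bound[OF st(1)]] show ?thesis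
        using k0 K L(1) by (intro mult_right_mono) simp_all
    qed
    finally show ?thesis unfolding eq by (simp add: mult_ac)
  qed
  then show ?thesis unfolding Lipschitz_upto_def by blast
qed

lemma mat_exp_derivative: "((\<lambda>t. mat (exp (c * of_real t)) :: complex ^ 'n ^ 'n) has_vector_derivative mat (c * exp (c * of_real t))) (at t within U)"
  by (rule bounded_linear.has_vector_derivative[OF bounded_linear_mat exp_has_vector_derivative])

lemma B_Lipschitz: "Lipschitz_upto T B"
  unfolding B_def[abs_def]
proof (rule Lipschitz_upto_bilinear[OF bounded_bilinear_matrix_mult _ \<gamma>_inv_Lipschitz])
  show "Lipschitz_upto T (\<lambda>t. mat (exp (\<nu> * of_real t)) :: complex ^ 'n ^ 'n)"
    by (rule Lipschitz_upto_C1[OF mat_exp_derivative])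
      (intro bounded_linear.continuous_on[OF bounded_linear_mat] continuous_intros)
qed

lemma B_cont: "continuous_on {0..T} B" by (rule Lipschitz_upto_continuous[OF B_Lipschitz])

lemma X_deriv: assumes "t \<in> {0..T}" shows "(X has_vector_derivative N t ** X t) (at t within {0..T})"
proof -
  have "(X has_vector_derivative mat (exp (- \<nu> * of_real t)) ** (D0 t ** \<gamma> t) + mat (- \<nu> * exp (- \<nu> * of_real t)) ** \<gamma> t) (at t within {0..T})"
    unfolding X_def[abs_def]
    by (rule bounded_bilinear.has_vector_derivative[OF bounded_bilinear_matrix_mult mat_exp_derivative \<gamma>_ode[OF assms]])
  also have "mat (exp (- \<nu> * of_real t)) ** (D0 t ** \<gamma> t) + mat (- \<nu> * exp (- \<nu> * of_real t)) ** \<gamma> t = N t ** X t"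
  proof -
    have "D0 t ** (mat (exp (- \<nu> * of_real t)) ** \<gamma> t) = mat (exp (- \<nu> * of_real t)) ** (D0 t ** \<gamma> t)"
      by (simp add: matrix_mul_assoc mat_mult_commute)
    then show ?thesis
      by (simp add: N_def X_def bounded_bilinear.diff_left[OF bounded_bilinear_matrix_mult])
        (simp add: vec_eq_iff mat_mult_component)
  qed
  finally show ?thesis .
qed

lemma X_cont: "continuous_on {0..T} X"
  by (rule continuous_on_vector_derivative[OF X_deriv])

lemma N_cont: "continuous_on {0..T} N"
  unfolding N_def[abs_def] by (intro continuous_intros D0_cont)

lemma A_cont: "continuous_on {0..T} A"
  unfolding A_def[abs_def] by (intro matrix_mult_cont D_cont X_cont)

lemma X_0: "X 0 = mat 1" by (simp add: X_def \<gamma>_init)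

lemma X_B: assumes "t \<in> {0..T}" shows "X t ** B t = mat 1"
proof -
  have "X t ** B t = mat (exp (- \<nu> * of_real t)) ** (\<gamma> t ** (mat (exp (\<nu> * of_real t)) ** matrix_inv (\<gamma> t)))"
    by (simp only: X_def B_def matrix_mul_assoc)
  also have "\<dots> = mat (exp (- \<nu> * of_real t)) ** (mat (exp (\<nu> * of_real t)) ** (\<gamma> t ** matrix_inv (\<gamma> t)))"
    by (simp only: mat_mult_left_commute[of "\<gamma> t"])
  also have "\<dots> = (mat (exp (- \<nu> * of_real t)) ** mat (exp (\<nu> * of_real t))) ** (\<gamma> t ** matrix_inv (\<gamma> t))"
    by (simp only: matrix_mul_assoc)
  finally have "X t ** B t = (mat (exp (- \<nu> * of_real t)) ** mat (exp (\<nu> * of_real t))) ** (\<gamma> t ** matrix_inv (\<gamma> t))" .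
  then show ?thesis by (simp add: mat_mult_mat \<gamma>_inv[OF assms] exp_minus)
qed

lemma A_B: "t \<in> {0..T} \<Longrightarrow> A t ** B t = D t"
  by (simp add: A_def X_B flip: matrix_mul_assoc)

text \<open>The scalar exponentials cancel, so \<nu> disappears from all iterated integrals.\<close>

lemma B_A: "B t ** A t = Dhat t"
proof -
  have "B t ** A t = mat (exp (\<nu> * of_real t)) ** (matrix_inv (\<gamma> t) ** (D t ** (mat (exp (- \<nu> * of_real t)) ** \<gamma> t)))"
    by (simp only: B_def A_def X_def matrix_mul_assoc)
  also have "\<dots> = mat (exp (\<nu> * of_real t)) ** (mat (exp (- \<nu> * of_real t)) ** (matrix_inv (\<gamma> t) ** (D t ** \<gamma> t)))"
    by (simp only: mat_mult_left_commute[of "D t"] mat_mult_left_commute[of "matrix_inv (\<gamma> t)"])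
  also have "\<dots> = (mat (exp (\<nu> * of_real t)) ** mat (exp (- \<nu> * of_real t))) ** (matrix_inv (\<gamma> t) ** (D t ** \<gamma> t))"
    by (simp only: matrix_mul_assoc)
  also have "\<dots> = Dhat t" by (simp add: mat_mult_mat exp_minus Dhat_def matrix_mul_assoc)
  finally show ?thesis .
qed

lemma X_vec_ode: "t \<in> {0..T} \<Longrightarrow> ((\<lambda>t. X t *v c) has_vector_derivative N t *v (X t *v c)) (at t within {0..T})"
  using bounded_linear.has_vector_derivative[OF bounded_bilinear.bounded_linear_left[OF bounded_bilinear_matrix_vector_mult] X_deriv]
  by (simp add: matrix_vector_mul_assoc)

lemma primitive_FTC:
  fixes F :: "real \<Rightarrow> 'a::euclidean_space"
  assumes "\<And>s. s \<in> {0..T} \<Longrightarrow> (F has_vector_derivative f s) (at s within {0..T})" "continuous_on {0..T} f" "t \<in> {0..T}"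
  shows "primitive f t = F t - F 0"
proof -
  have "primitive f t = (LINT s|leb_upto T. (if 0 \<le> s \<and> s \<le> t then f s else 0))"
    unfolding primitive_alt[OF assms(3)] by (intro Bochner_Integration.integral_cong) auto
  also have "\<dots> = F t - F 0" using assms by (intro LINT_FTC) auto
  finally show ?thesis .
qed

lemma L2_continuous: "continuous_on {0..T} f \<Longrightarrow> f \<in> L2 T"
  using continuous_on_Icc_bounded[of T f] L2_bounded[OF measurable_leb_continuous, of T f] by blast

lemma L2_matrix_mult:
  fixes C :: "real \<Rightarrow> complex ^ 'n ^ 'n"
  assumes "continuous_on {0..T} C" "f \<in> L2 T" shows "(\<lambda>t. C t *v f t) \<in> L2 T"
proof -
  obtain c where c: "0 \<le> c" "\<And>t. t \<in> {0..T} \<Longrightarrow> norm (C t) \<le> c" using continuous_on_Icc_bounded[OF assms(1)] by blast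
  show ?thesis
  proof (rule L2_dominated[OF assms(2), of _ c])
    show "(\<lambda>t. C t *v f t) \<in> borel_measurable (leb_upto T)"
      by (rule measurable_matrix_vector_mult[OF measurable_leb_continuous[OF assms(1)] L2_measurable[OF assms(2)]])
    show "norm (C t *v f t) \<le> c * norm (f t)" if "t \<in> {0..T}" for t
      using order_trans[OF norm_matrix_vector_mult_le mult_right_mono[OF c(2)[OF that] norm_ge_zero]] .
  qed
qed

text \<open>Rewrites the resolvent equation as z' = N z + f almost everywhere, ready for variation
  of constants.\<close>

lemma shifted_ddt_iff: "shifted_ddt T S D0 \<nu> z f \<longleftrightarrow> f \<in> L2 T \<and>
    (\<exists>w. ddt T S z w \<and> l2_eq T w (\<lambda>t. f t + N t *v z t))"
proof -
  have "l2_eq T f (\<lambda>t. w t + (- mult_op D0 z t + \<nu> *s z t)) \<longleftrightarrow> l2_eq T w (\<lambda>t. f t + N t *v z t)" for w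
    unfolding l2_eq_def
    by (intro AE_cong) (auto simp: mult_op_def N_def matrix_vector_mult_diff_rdistrib mat_vector_mult algebra_simps)
  then show ?thesis by (simp add: shifted_ddt_def op_add_def)
qed

text \<open>A kernel vector c yields the solution X c of the homogeneous equation which also
  satisfies the boundary condition; invertibility makes it null, but it vanishes nowhere unless c =
  0.\<close>

lemma M_E_ker: assumes "(M - E) *v c = 0" shows "c = 0"
proof (rule ccontr)
  assume "c \<noteq> 0"
  define z where "z t = X t *v c" for t
  have zc: "continuous_on {0..T} z" unfolding z_def[abs_def] by (intro matrix_vector_mult_cont X_cont continuous_intros)
  have zd: "(z has_vector_derivative N t *v z t) (at t within {0..T})" if "t \<in> {0..T}" for t
    unfolding z_def by (rule X_vec_ode[OF that])
  have Nz: "continuous_on {0..T} (\<lambda>t. N t *v z t)" by (intro matrix_vector_mult_cont N_cont zc)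
  have sob: "has_sobolev_deriv T z (\<lambda>t. N t *v z t)"
    unfolding has_sobolev_deriv_def
    using L2_continuous[OF zc] L2_continuous[OF Nz] primitive_FTC[OF zd Nz] by (simp add: primitive_def)
  have "M *v c = E *v c" using assms by (simp add: matrix_vector_mult_diff_rdistrib)
  then have "Sc *v z T = c"
    by (simp add: z_def X_def M_def E_def matrix_vector_mul_assoc[symmetric] mat_vector_mult vector_scalar_commute[symmetric]
        vector_smult_assoc exp_minus)
      (simp add: vector_scalar_commute vector_smult_assoc exp_minus)
  then have "ddt T S z (\<lambda>t. N t *v z t)"
    using sob by (auto simp: ddt_def ddt_domain_def W12_def z_def X_0)
  then have "shifted_ddt T S D0 \<nu> z (\<lambda>_. 0)" unfolding shifted_ddt_iff by auto
  moreover have "shifted_ddt T S D0 \<nu> (\<lambda>_. 0) (\<lambda>_. 0)"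
    unfolding shifted_ddt_iff
    by (intro conjI exI[of _ "\<lambda>_. 0"]) (auto simp: ddt_def ddt_domain_def W12_def has_sobolev_deriv_def intro!: exI[of _ "\<lambda>_. 0"])
  ultimately have "l2_eq T z (\<lambda>_. 0)" using inv by (auto simp: op_invertible_def)
  moreover have "z t \<noteq> 0" if "t \<in> {0..T}" for t
  proof
    assume "z t = 0"
    then have "B t *v 0 = 0" "X t *v c = 0" by (simp_all add: z_def)
    then have "mat (exp (- \<nu> * of_real t)) *v (\<gamma> t *v c) = 0" by (simp add: X_def matrix_vector_mul_assoc)
    then have "\<gamma> t *v c = 0" by (simp add: mat_vector_mult vec_eq_iff)
    with \<gamma>_ker[OF that] \<open>c \<noteq> 0\<close> show False by simp
  qed
  \<comment> \<open>A function that is nowhere zero and almost everywhere zero would make [0,T] a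
    null set, against T > 0.\<close>
  ultimately have "AE t in leb_upto T. False" unfolding l2_eq_def using AE_space by (auto elim: AE_mp)
  then obtain Z where Z: "{t \<in> space (leb_upto T). \<not> False} \<subseteq> Z" "emeasure (leb_upto T) Z = 0" "Z \<in> sets (leb_upto T)"
    by (rule AE_E)
  then have "emeasure (leb_upto T) {0..T} \<le> 0"
  proof -
    have "{0..T} \<subseteq> Z" using Z(1) by auto
    from emeasure_mono[OF this Z(3)] show ?thesis unfolding Z(2) .
  qed
  then show False using T_pos by (simp add: emeasure_restrict_space)
qed

lemmas M_E_inv = matrix_inv_mult[OF M_E_ker]

text \<open>E is scalar, so M commutes with M - E. The boundary condition produces the inverse on
  the left of M, whereas \<open>Q\<close> has it on the right.\<close>

lemma Q_alt: "Q = matrix_inv (M - E) ** M"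
proof -
  have "M ** (M - E) = (M - E) ** M"
    unfolding E_def by (simp add: bounded_bilinear.diff_left[OF bounded_bilinear_matrix_mult]
        bounded_bilinear.diff_right[OF bounded_bilinear_matrix_mult] mat_mult_commute)
  then have "matrix_inv (M - E) ** (M ** (M - E)) ** matrix_inv (M - E) = matrix_inv (M - E) ** ((M - E) ** M) ** matrix_inv (M - E)"
    by simp
  moreover have "matrix_inv (M - E) ** (M ** (M - E)) ** matrix_inv (M - E) = matrix_inv (M - E) ** M ** ((M - E) ** matrix_inv (M - E))"
    by (simp only: matrix_mul_assoc)
  moreover have "matrix_inv (M - E) ** ((M - E) ** M) ** matrix_inv (M - E) = (matrix_inv (M - E) ** (M - E)) ** M ** matrix_inv (M - E)"
    by (simp only: matrix_mul_assoc)
  ultimately show ?thesis by (simp add: M_E_inv Q_def)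
qed

lemma Bf_integrable: "f \<in> L2 T \<Longrightarrow> integrable (leb_upto T) (\<lambda>t. B t *v f t)"
  by (intro L2_integrable L2_matrix_mult B_cont)

text \<open>Variation of constants; the boundary condition gives the term with \<open>Q\<close>.\<close>
lemma shifted_ddt_solution:
  assumes z: "shifted_ddt T S D0 \<nu> z f" and t: "t \<in> {0..T}"
  shows "z t = X t *v (primitive (\<lambda>s. B s *v f s) t - Q *v primitive (\<lambda>s. B s *v f s) T)"
proof -
  obtain w where fL: "f \<in> L2 T" and w: "ddt T S z w" "l2_eq T w (\<lambda>t. f t + N t *v z t)"
    using z unfolding shifted_ddt_iff by blast
  have sob: "has_sobolev_deriv T z w" and z0: "z 0 = Sc *v z T"
    using w(1) by (simp_all add: ddt_def ddt_domain_def)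
  have wL: "w \<in> L2 T" and zw: "\<And>t. t \<in> {0..T} \<Longrightarrow> z t = z 0 + primitive w t"
    using sob unfolding has_sobolev_deriv_def primitive_def by blast+
  have zc: "continuous_on {0..T} z"
    by (rule continuous_on_eq[of _ "\<lambda>t. z 0 + primitive w t"])
      (auto intro!: continuous_intros primitive_continuous L2_integrable wL simp: zw[symmetric])
  have Nz: "continuous_on {0..T} (\<lambda>t. N t *v z t)" by (intro matrix_vector_mult_cont N_cont zc)
  define g where "g s = B s *v f s" for s
  have gi: "integrable (leb_upto T) g" unfolding g_def[abs_def] by (rule Bf_integrable[OF fL])
  \<comment> \<open>The candidate with the same initial value as z. Since f is only square
    integrable, z and y are compared through integral equations and not by differentiating
    them.\<close>
  define y where "y t = X t *v (z 0 + primitive g t)" for t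
  have yc: "continuous_on {0..T} y"
    unfolding y_def[abs_def] by (intro matrix_vector_mult_cont X_cont continuous_intros primitive_continuous gi)
  have Ny: "continuous_on {0..T} (\<lambda>t. N t *v y t)" by (intro matrix_vector_mult_cont N_cont yc)
  have w': "primitive w t = primitive f t + primitive (\<lambda>t. N t *v z t) t" if t: "t \<in> {0..T}" for t
  proof -
    have "primitive w t = primitive (\<lambda>t. f t + N t *v z t) t"
      unfolding primitive_alt[OF t]
    proof (rule integral_cong_AE)
      show "AE s in leb_upto T. (if s \<le> t then w s else 0) = (if s \<le> t then f s + N s *v z s else 0)"
        using w(2) unfolding l2_eq_def by eventually_elim simp
      show "(\<lambda>s. if s \<le> t then w s else 0) \<in> borel_measurable (leb_upto T)"
        by (rule borel_measurable_integrable[OF integrable_leb_restrict[OF L2_integrable[OF wL]]])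
      have "integrable (leb_upto T) (\<lambda>s. f s + N s *v z s)"
        by (intro Bochner_Integration.integrable_add L2_integrable fL integrable_leb_continuous Nz)
      from borel_measurable_integrable[OF integrable_leb_restrict[OF this]]
      show "(\<lambda>s. if s \<le> t then f s + N s *v z s else 0) \<in> borel_measurable (leb_upto T)" .
    qed
    also have "\<dots> = primitive f t + primitive (\<lambda>t. N t *v z t) t"
      by (rule primitive_add(1)[OF L2_integrable[OF fL] integrable_leb_continuous[OF Nz] t])
    finally show ?thesis .
  qed
  have NX: "continuous_on {0..T} (\<lambda>t. N t ** X t)" by (intro matrix_mult_cont N_cont X_cont)
  have y: "y t = z 0 + primitive f t + primitive (\<lambda>t. N t *v y t) t" if t: "t \<in> {0..T}" for t
  proof -
    have 1: "primitive (\<lambda>s. (N s ** X s) *v primitive g s) t = X t *v primitive g t - primitive (\<lambda>s. X s *v g s) t"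
      by (rule integration_by_parts_primitive[OF bounded_bilinear_matrix_vector_mult X_deriv NX gi t])
    have 2: "primitive (\<lambda>s. X s *v g s) t = primitive f t"
      unfolding primitive_def using t
      by (intro Bochner_Integration.integral_cong) (auto simp: g_def matrix_vector_mul_assoc X_B)
    have c1: "continuous_on {0..T} (\<lambda>s. N s *v (X s *v z 0))" "continuous_on {0..T} (\<lambda>s. (N s ** X s) *v primitive g s)"
      by (intro matrix_vector_mult_cont N_cont X_cont NX continuous_intros primitive_continuous gi)+
    have 3: "primitive (\<lambda>s. N s *v (X s *v z 0)) t = X t *v z 0 - X 0 *v z 0"
      by (rule primitive_FTC[OF X_vec_ode c1(1) t])
    have "primitive (\<lambda>t. N t *v y t) t = primitive (\<lambda>s. N s *v (X s *v z 0) + (N s ** X s) *v primitive g s) t"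
      by (simp add: y_def matrix_vector_right_distrib matrix_vector_mul_assoc[symmetric])
    also have "\<dots> = primitive (\<lambda>s. N s *v (X s *v z 0)) t + primitive (\<lambda>s. (N s ** X s) *v primitive g s) t"
      by (rule primitive_add(1)[OF integrable_leb_continuous[OF c1(1)] integrable_leb_continuous[OF c1(2)] t])
    finally show ?thesis unfolding 1 2 3 by (simp add: y_def X_0 matrix_vector_right_distrib)
  qed
  \<comment> \<open>f drops out of the difference, so d solves the homogeneous equation with a
    continuous derivative and initial value 0; Gronwall makes it zero.\<close>
  define d where "d t = z t - y t" for t
  have Nd: "continuous_on {0..T} (\<lambda>t. N t *v d t)"
    unfolding d_def by (intro matrix_vector_mult_cont N_cont continuous_intros zc yc)
  have d: "d t = primitive (\<lambda>t. N t *v d t) t" if t: "t \<in> {0..T}" for t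
  proof -
    have "primitive (\<lambda>t. N t *v d t) t = primitive (\<lambda>t. N t *v z t) t - primitive (\<lambda>t. N t *v y t) t"
      unfolding d_def matrix_vector_mult_diff_distrib
      by (rule primitive_add(2)[OF integrable_leb_continuous[OF Nz] integrable_leb_continuous[OF Ny] t])
    then show ?thesis using zw[OF t] w'[OF t] y[OF t] by (simp add: d_def)
  qed
  have d': "(d has_vector_derivative N t *v d t) (at t within {0..T})" if t: "t \<in> {0..T}" for t
    by (rule has_vector_derivative_transform[OF t d primitive_has_derivative[OF Nd t]])
  obtain L where L: "0 \<le> L" "\<And>t. t \<in> {0..T} \<Longrightarrow> norm (N t) \<le> L" using continuous_on_Icc_bounded[OF N_cont] by blast
  have "d 0 = 0" using d[OF in_0T(1)] by simp
  then have zy: "z t = y t" if "t \<in> {0..T}" for t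
    using linear_ode_bound[OF d' L(2) in_0T(1) that] by (simp add: d_def)
  define I where "I = primitive g T"
  have e: "Sc *v (X T *v v) = exp (- \<nu> * of_real T) *s (M *v v)" for v
    by (simp add: X_def M_def mat_vector_mult matrix_vector_mul_assoc[symmetric] vector_scalar_commute)
  have zT: "z T = X T *v (z 0 + I)" by (simp only: zy[OF in_0T(2)] y_def I_def)
  have z0': "z 0 = exp (- \<nu> * of_real T) *s (M *v (z 0 + I))"
    by (rule z0[THEN trans]) (simp only: zT e)
  \<comment> \<open>Multiplying the boundary condition by E removes the factor e^{-\<nu>T} and
    leaves (M - E) z(0) = -M I.\<close>
  have "E *v z 0 = E *v (exp (- \<nu> * of_real T) *s (M *v (z 0 + I)))"
    by (rule arg_cong[OF z0'])
  also have "\<dots> = M *v (z 0 + I)"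
    by (simp add: E_def mat_vector_mult vector_smult_assoc exp_minus)
  finally have "(M - E) *v z 0 = 0 - M *v I"
    by (simp only: matrix_vector_mult_diff_rdistrib matrix_vector_right_distrib) simp
  then have "matrix_inv (M - E) *v ((M - E) *v z 0) = matrix_inv (M - E) *v (0 - M *v I)" by simp
  then have "z 0 = - (Q *v I)"
    by (simp only: Q_alt matrix_vector_mul_assoc M_E_inv matrix_vector_mult_diff_distrib) simp
  then show ?thesis using zy[OF t] by (simp add: y_def I_def g_def[abs_def])
qed

end

section \<open>The operator and its powers\<close>

lemma L2_cong:
  assumes "f \<in> L2 T" "\<And>t. t \<in> {0..T} \<Longrightarrow> f t = g t" shows "g \<in> L2 T"
proof (rule L2_dominated[OF assms(1), of g 1])
  show "g \<in> borel_measurable (leb_upto T)"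
    using L2_measurable[OF assms(1)] by (rule measurable_cong[THEN iffD1, rotated]) (simp add: assms(2))
  show "norm (g t) \<le> 1 * norm (f t)" if "t \<in> {0..T}" for t using assms(2)[OF that] by simp
qed

lemma primitive_cong: "(\<And>s. s \<in> {0..t} \<Longrightarrow> f s = g s) \<Longrightarrow> primitive f t = primitive g t"
  unfolding primitive_def by (intro Bochner_Integration.integral_cong) auto

lemma primitive_bounded_linear:
  fixes h :: "'a::euclidean_space \<Rightarrow> 'b::euclidean_space"
  assumes h: "bounded_linear h" and f: "integrable (leb_upto T) f" and t: "t \<in> {0..T}"
  shows "primitive (\<lambda>s. h (f s)) t = h (primitive f t)"
  unfolding primitive_def
  by (rule integral_bounded_linear[OF h integrable_leb_subinterval[OF f]]) (use t in auto)

lemma primitive_sum: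
  fixes f :: "'i \<Rightarrow> real \<Rightarrow> 'a::euclidean_space"
  assumes "\<And>i. i \<in> I \<Longrightarrow> integrable (leb_upto T) (f i)" and t: "t \<in> {0..T}"
  shows "primitive (\<lambda>s. \<Sum>i\<in>I. f i s) t = (\<Sum>i\<in>I. primitive (f i) t)"
  unfolding primitive_def
  by (rule Bochner_Integration.integral_sum, rule integrable_leb_subinterval[OF assms(1)]) (use t in auto)

lemma trace_axis: "trace C = (\<Sum>j\<in>UNIV. (C *v axis j 1) $ j)" for C :: "complex ^ 'n ^ 'n"
  by (simp add: trace_def matrix_vector_mult_def axis_def if_distrib[of "(*) _"] cong: if_cong)

lemma axis_expansion: "x = (\<Sum>j\<in>UNIV. x $ j *s axis j 1)" for x :: "complex ^ 'n"
  by (simp add: vec_eq_iff sum_component axis_def if_distrib[of "(*) _"] cong: if_cong)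

lemma matrix_vector_sum_smult: "C *v (\<Sum>j\<in>J. c j *s x j) = (\<Sum>j\<in>J. c j *s (C *v x j))" for C :: "complex ^ 'n ^ 'n"
  by (simp add: bounded_bilinear.sum_right[OF bounded_bilinear_matrix_vector_mult] vector_scalar_commute)

text \<open>The index n occurs once for each i with n <= i < m.\<close>

lemma sum_triangle_const: "(\<Sum>i<m. \<Sum>n\<le>i. h n) = (\<Sum>n<m. of_nat (m - n) * (h n :: complex))"
proof (induction m)
  case (Suc m)
  have "(\<Sum>n<m. of_nat (Suc m - n) * h n) = (\<Sum>n<m. of_nat (m - n) * h n + h n)"
    by (intro sum.cong refl) (simp add: Suc_diff_le algebra_simps)
  then show ?case using Suc by (simp add: sum.distrib lessThan_Suc_atMost[symmetric])
qed simp

context monodromy_data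
begin

definition F :: "'n vfun \<Rightarrow> 'n vfun" where "F = mult_op D \<circ> op_inverse (shifted_ddt T S D0 \<nu>)"

definition total :: "'n vfun \<Rightarrow> complex ^ 'n" where "total f = primitive (\<lambda>s. B s *v f s) T"

text \<open>\<open>F\<close> involves a choice of representative; this explicit formula agrees with
  it at every point of [0,T] and is the form used for computing.\<close>

definition Fop :: "'n vfun \<Rightarrow> 'n vfun" where
  "Fop f = (\<lambda>t. A t *v (primitive (\<lambda>s. B s *v f s) t - Q *v total f))"

lemma F_props: assumes f: "f \<in> L2 T" shows F_L2: "F f \<in> L2 T" and F_Fop: "t \<in> {0..T} \<Longrightarrow> F f t = Fop f t"
proof -
  define z where "z = op_inverse (shifted_ddt T S D0 \<nu>) f"
  have "\<exists>z. shifted_ddt T S D0 \<nu> z f" using inv f by (simp add: op_invertible_def)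
  then have z: "shifted_ddt T S D0 \<nu> z f" unfolding z_def op_inverse_def by (rule someI_ex)
  then have "z \<in> L2 T" by (auto simp: shifted_ddt_iff ddt_def has_sobolev_deriv_def)
  then show "F f \<in> L2 T" using L2_matrix_mult[OF D_cont] by (simp add: F_def mult_op_def z_def)
  show "F f t = Fop f t" if "t \<in> {0..T}"
    using shifted_ddt_solution[OF z that]
    by (simp add: F_def mult_op_def z_def Fop_def A_def total_def matrix_vector_mul_assoc)
qed

lemma total_cong: "(\<And>t. t \<in> {0..T} \<Longrightarrow> f t = g t) \<Longrightarrow> total f = total g"
  unfolding total_def by (rule primitive_cong) simp

lemma Fop_cong: assumes "\<And>t. t \<in> {0..T} \<Longrightarrow> f t = g t" "t \<in> {0..T}" shows "Fop f t = Fop g t"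
proof -
  have "primitive (\<lambda>s. B s *v f s) t = primitive (\<lambda>s. B s *v g s) t" using assms by (intro primitive_cong) simp
  moreover have "total f = total g" by (rule total_cong[OF assms(1)])
  ultimately show ?thesis by (simp add: Fop_def)
qed

lemma Fop_L2: "f \<in> L2 T \<Longrightarrow> Fop f \<in> L2 T"
  by (rule L2_cong[OF F_L2 F_Fop])

lemma Fop_power_L2: "f \<in> L2 T \<Longrightarrow> (Fop ^^ m) f \<in> L2 T"
  by (induction m) (auto intro: Fop_L2)

lemma Fop_power_cong: "(\<And>t. t \<in> {0..T} \<Longrightarrow> f t = g t) \<Longrightarrow> t \<in> {0..T} \<Longrightarrow> (Fop ^^ m) f t = (Fop ^^ m) g t"
proof (induction m arbitrary: t)
  case (Suc m)
  then show ?case using Fop_cong[of "(Fop ^^ m) f" "(Fop ^^ m) g" t] by simp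
qed simp

lemma F_power:
  assumes "f \<in> L2 T" shows F_power_L2: "(F ^^ m) f \<in> L2 T" and F_power_Fop: "t \<in> {0..T} \<Longrightarrow> (F ^^ m) f t = (Fop ^^ m) f t"
proof -
  have *: "(F ^^ m) f \<in> L2 T \<and> (\<forall>t\<in>{0..T}. (F ^^ m) f t = (Fop ^^ m) f t)"
  proof (induction m)
    case (Suc m)
    then have L: "(F ^^ m) f \<in> L2 T" and eq: "\<And>t. t \<in> {0..T} \<Longrightarrow> (F ^^ m) f t = (Fop ^^ m) f t" by auto
    have "F ((F ^^ m) f) t = Fop ((Fop ^^ m) f) t" if "t \<in> {0..T}" for t
      using F_Fop[OF L that] Fop_cong[OF eq that] by simp
    then show ?case using F_L2[OF L] by simp
  qed (use assms in simp)
  show "(F ^^ m) f \<in> L2 T" using * by blast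
  show "(F ^^ m) f t = (Fop ^^ m) f t" if "t \<in> {0..T}" using * that by blast
qed

text \<open>The strict inequality makes the kernel vanish on the diagonal, as
  \<open>Volterra_power_trace\<close> demands.\<close>

definition kern :: "real \<Rightarrow> real \<Rightarrow> complex ^ 'n ^ 'n" where
  "kern t s = (if s < t then A t ** B s else 0)"

text \<open>Selecting a bound once gives the sublocale a fixed parameter.\<close>

definition kern_bound :: real where
  "kern_bound = (SOME C. bounded_kernel T kern C)"

lemma kern_bounded: "bounded_kernel T kern kern_bound"
proof -
  obtain a where a: "0 \<le> a" "\<And>t. t \<in> {0..T} \<Longrightarrow> norm (A t) \<le> a" using continuous_on_Icc_bounded[OF A_cont] by blast
  obtain b where b: "0 \<le> b" "\<And>t. t \<in> {0..T} \<Longrightarrow> norm (B t) \<le> b" using continuous_on_Icc_bounded[OF B_cont] by blast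
  have "bounded_kernel T kern (a * b * CARD('n))"
  proof
    have m: "(\<lambda>p. A (fst p) ** B (snd p)) \<in> borel_measurable (leb_upto T \<Otimes>\<^sub>M leb_upto T)"
      by (rule measurable_matrix_mult[OF measurable_compose[OF measurable_fst measurable_leb_continuous[OF A_cont]]
            measurable_compose[OF measurable_snd measurable_leb_continuous[OF B_cont]]])
    have fs: "fst \<in> borel_measurable (leb_upto T \<Otimes>\<^sub>M leb_upto T)" "snd \<in> borel_measurable (leb_upto T \<Otimes>\<^sub>M leb_upto T)"
      using measurable_compose[OF measurable_fst measurable_leb_id] measurable_compose[OF measurable_snd measurable_leb_id] by auto
    show "(\<lambda>(t, s). kern t s) \<in> borel_measurable (leb_upto T \<Otimes>\<^sub>M leb_upto T)"
      unfolding kern_def case_prod_unfold using m fs by measurable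
    fix t s assume ts: "t \<in> {0..T}" "s \<in> {0..T}"
    have "norm (A t) * norm (B s) \<le> a * b" using a b ts by (intro mult_mono) auto
    then have "norm (A t ** B s) \<le> a * b * CARD('n)"
      by (intro order_trans[OF norm_matrix_mult_le] mult_right_mono) auto
    then show "norm (kern t s) \<le> a * b * CARD('n)" using a b by (simp add: kern_def)
  qed (rule T_nonneg)
  then show ?thesis unfolding kern_bound_def by (rule someI)
qed

sublocale kern: bounded_kernel T kern kern_bound by (rule kern_bounded)

abbreviation V :: "'n vfun \<Rightarrow> 'n vfun" where "V \<equiv> kernel_op T kern"

lemma V_eq: assumes f: "f \<in> L2 T" and t: "t \<in> {0..T}" shows "V f t = A t *v primitive (\<lambda>s. B s *v f s) t"
proof -
  have BL: "(\<lambda>s. B s *v f s) \<in> L2 T" by (rule L2_matrix_mult[OF B_cont f])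
  have "V f t = (LINT s|leb_upto T. A t *v (if s < t then B s *v f s else 0))"
    unfolding kernel_op_def kern_def by (intro Bochner_Integration.integral_cong) (auto simp: matrix_vector_mul_assoc)
  also have "\<dots> = A t *v (LINT s|leb_upto T. (if s < t then B s *v f s else 0))"
  proof (rule integral_bounded_linear[OF bounded_bilinear.bounded_linear_right[OF bounded_bilinear_matrix_vector_mult]])
    show "integrable (leb_upto T) (\<lambda>s. if s < t then B s *v f s else 0)"
    proof (rule Bochner_Integration.integrable_bound[OF L2_integrable[OF BL]])
      show "(\<lambda>s. if s < t then B s *v f s else 0) \<in> borel_measurable (leb_upto T)"
        using L2_measurable[OF BL] measurable_leb_id[of T] by measurable
    qed auto
  qed
  also have "(LINT s|leb_upto T. (if s < t then B s *v f s else 0)) = primitive (\<lambda>s. B s *v f s) t"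
    by (rule primitive_strict[OF t L2_measurable[OF BL]])
  finally show ?thesis .
qed

lemma V_L2: "f \<in> L2 T \<Longrightarrow> V f \<in> L2 T" and V_power_L2: "f \<in> L2 T \<Longrightarrow> (V ^^ m) f \<in> L2 T"
  by (rule kern.kernel_op_L2 kern.kernel_op_power_L2; assumption)+

lemma Fop_V: "f \<in> L2 T \<Longrightarrow> t \<in> {0..T} \<Longrightarrow> Fop f t = V f t - A t *v (Q *v total f)"
  by (simp add: V_eq Fop_def matrix_vector_mult_diff_distrib)

text \<open>Each component of the integral of B f is an inner product with a fixed function, which
  exhibits F - V as a sum of rank one operators.\<close>

lemma total_component: assumes f: "f \<in> L2 T" shows "total f $ j = l2_inner T f (\<lambda>s. adj (B s) *v axis j 1)"
proof -
  have "total f $ j = primitive (\<lambda>s. (B s *v f s) $ j) T"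
    unfolding total_def by (rule primitive_bounded_linear[OF bounded_linear_vec_nth Bf_integrable[OF f] in_0T(2), symmetric])
  also have "\<dots> = l2_inner T f (\<lambda>s. adj (B s) *v axis j 1)"
    by (simp add: primitive_def l2_inner_cdot cdot_adj[of "adj _", symmetric] flip: cdot_axis_right)
       (simp add: cdot_adj)
  finally show ?thesis .
qed

lemma adj_B_L2: "(\<lambda>s. adj (B s) *v axis j 1) \<in> L2 T"
proof -
  obtain b where b: "0 \<le> b" "\<And>t. t \<in> {0..T} \<Longrightarrow> norm (B t) \<le> b" using continuous_on_Icc_bounded[OF B_cont] by blast
  show ?thesis
  proof (rule L2_bounded[of _ _ b])
    show "(\<lambda>s. adj (B s) *v axis j 1) \<in> borel_measurable (leb_upto T)"
      by (rule measurable_matrix_vector_mult[OF measurable_adj[OF measurable_leb_continuous[OF B_cont]] borel_measurable_const])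
    show "norm (adj (B t) *v axis j 1) \<le> b" if "t \<in> {0..T}" for t
      using norm_matrix_vector_mult_le[of "adj (B t)" "axis j 1"] b(2)[OF that] by simp
  qed
qed

lemma Fop_lincomb:
  assumes f: "\<And>i. i \<in> I \<Longrightarrow> f i \<in> L2 T" and t: "t \<in> {0..T}"
  shows "Fop (\<lambda>t. \<Sum>i\<in>I. c i *s f i t) t = (\<Sum>i\<in>I. c i *s Fop (f i) t)"
proof -
  have L: "(\<lambda>t. \<Sum>i\<in>I. c i *s f i t) \<in> L2 T" by (intro L2_sum L2_smult f)
  have V: "V (\<lambda>t. \<Sum>i\<in>I. c i *s f i t) t = (\<Sum>i\<in>I. c i *s V (f i) t)"
    by (rule kern.kernel_op_sum[OF f t])
  have tot: "total (\<lambda>t. \<Sum>i\<in>I. c i *s f i t) = (\<Sum>i\<in>I. c i *s total (f i))"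
  proof (rule vec_eq_iff[THEN iffD2], rule allI)
    fix j
    have "l2_inner T (\<lambda>t. \<Sum>i\<in>I. c i *s f i t) (\<lambda>s. adj (B s) *v axis j 1) = (\<Sum>i\<in>I. c i * l2_inner T (f i) (\<lambda>s. adj (B s) *v axis j 1))"
      by (subst l2_inner_sum_left[OF adj_B_L2]) (simp_all add: L2_smult f l2_inner_smult_left)
    then show "total (\<lambda>t. \<Sum>i\<in>I. c i *s f i t) $ j = (\<Sum>i\<in>I. c i *s total (f i)) $ j"
      unfolding total_component[OF L] by (simp add: sum_component total_component[OF f])
  qed
  have "Fop (\<lambda>t. \<Sum>i\<in>I. c i *s f i t) t = (\<Sum>i\<in>I. c i *s V (f i) t) - (\<Sum>i\<in>I. c i *s (A t *v (Q *v total (f i))))"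
    unfolding Fop_V[OF L t] V tot matrix_vector_sum_smult ..
  also have "\<dots> = (\<Sum>i\<in>I. c i *s Fop (f i) t)"
    unfolding sum_subtractf[symmetric]
    by (intro sum.cong refl) (simp add: Fop_V[OF f t] vec_eq_iff algebra_simps)
  finally show ?thesis .
qed

lemma Fop_diff:
  assumes "f \<in> L2 T" "g \<in> L2 T" "t \<in> {0..T}"
  shows "Fop (\<lambda>t. f t - g t) t = Fop f t - Fop g t"
  \<comment> \<open>The difference is the linear combination with coefficients 1 and -1, indexed by
    \<open>bool\<close>.\<close>
  using Fop_lincomb[of UNIV "\<lambda>b::bool. if b then f else g" t "\<lambda>b. if b then 1 else - 1"] assms
  by (simp add: UNIV_bool)

lemma Fop_power_diff:
  assumes "f \<in> L2 T" "g \<in> L2 T" "t \<in> {0..T}"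
  shows "(Fop ^^ m) (\<lambda>t. f t - g t) t = (Fop ^^ m) f t - (Fop ^^ m) g t"
  using assms(3)
proof (induction m arbitrary: t)
  case (Suc m)
  have "Fop ((Fop ^^ m) (\<lambda>t. f t - g t)) t = Fop (\<lambda>t. (Fop ^^ m) f t - (Fop ^^ m) g t) t"
    by (rule Fop_cong[OF Suc.IH Suc.prems])
  then show ?case by (simp add: Fop_diff[OF Fop_power_L2[OF assms(1)] Fop_power_L2[OF assms(2)] Suc.prems])
qed simp

lemma A_mult_L2: "continuous_on {0..T} (Z :: real \<Rightarrow> complex ^ 'n ^ 'n) \<Longrightarrow> (\<lambda>t. A t *v (Z t *v d)) \<in> L2 T"
  by (intro L2_continuous matrix_vector_mult_cont A_cont continuous_on_const)

lemma A_vec_L2: "(\<lambda>t. A t *v d) \<in> L2 T"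
  by (intro L2_continuous matrix_vector_mult_cont A_cont continuous_on_const)

text \<open>Telescoping \<open>F\<^sup>m - V\<^sup>m\<close>, where \<open>F - V\<close> has finite rank.\<close>
lemma Fop_power_expand:
  assumes "f \<in> L2 T" "t \<in> {0..T}"
  shows "(Fop ^^ m) f t = (V ^^ m) f t - (\<Sum>i<m. (Fop ^^ i) (\<lambda>t. A t *v (Q *v total ((V ^^ (m - 1 - i)) f))) t)"
  using assms(1)
proof (induction m arbitrary: f)
  case (Suc m)
  let ?\<psi> = "\<lambda>t. A t *v (Q *v total f)"
  have VL: "V f \<in> L2 T" by (rule V_L2[OF Suc.prems])
  have "(Fop ^^ Suc m) f t = (Fop ^^ m) (Fop f) t" by (simp add: funpow_swap1)
  also have "\<dots> = (Fop ^^ m) (\<lambda>t. V f t - ?\<psi> t) t"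
    by (rule Fop_power_cong[OF Fop_V[OF Suc.prems] assms(2)])
  also have "\<dots> = (Fop ^^ m) (V f) t - (Fop ^^ m) ?\<psi> t"
    by (rule Fop_power_diff[OF VL A_vec_L2 assms(2)])
  also have "(Fop ^^ m) (V f) t = (V ^^ m) (V f) t - (\<Sum>i<m. (Fop ^^ i) (\<lambda>t. A t *v (Q *v total ((V ^^ (m - 1 - i)) (V f)))) t)"
    by (rule Suc.IH[OF VL])
  also have "(\<Sum>i<m. (Fop ^^ i) (\<lambda>t. A t *v (Q *v total ((V ^^ (m - 1 - i)) (V f)))) t)
      = (\<Sum>i<m. (Fop ^^ i) (\<lambda>t. A t *v (Q *v total ((V ^^ (Suc m - 1 - i)) f))) t)"
  proof (intro sum.cong refl)
    fix i assume "i \<in> {..<m}"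
    then have "Suc m - 1 - i = Suc (m - 1 - i)" by auto
    then have "(V ^^ (m - 1 - i)) (V f) = (V ^^ (Suc m - 1 - i)) f" by (simp only: funpow.simps o_def funpow_swap1)
    then show "(Fop ^^ i) (\<lambda>t. A t *v (Q *v total ((V ^^ (m - 1 - i)) (V f)))) t
        = (Fop ^^ i) (\<lambda>t. A t *v (Q *v total ((V ^^ (Suc m - 1 - i)) f))) t" by (simp only:)
  qed
  also have "(V ^^ m) (V f) = (V ^^ Suc m) f" by (simp add: funpow_swap1)
  finally show ?case by (simp add: algebra_simps)
qed simp

section \<open>Iterated integrals and the trace of powers\<close>

abbreviation II :: "nat \<Rightarrow> real \<Rightarrow> complex ^ 'n ^ 'n" where "II \<equiv> iterated_integral Dhat"

lemma Dhat_cont: "continuous_on {0..T} Dhat"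
  unfolding B_A[symmetric, abs_def] by (intro matrix_mult_cont A_cont B_cont)

lemma II_cont: "continuous_on {0..T} (II l)"
proof (induction l)
  case (Suc l)
  have "(\<lambda>s. Dhat s ** II l s) integrable_on {0..T}"
    by (intro integrable_continuous_real matrix_mult_cont Dhat_cont Suc)
  then show ?case by (simp add: indefinite_integral_continuous_1)
qed simp

lemma II_Suc: "t \<in> {0..T} \<Longrightarrow> primitive (\<lambda>s. Dhat s ** II l s) t = II (Suc l) t"
  by (subst primitive_eq_integral[of T]) (auto intro: matrix_mult_cont Dhat_cont II_cont)

text \<open>Combinations of iterated integrals with constant matrices on the right. Multiplying by
  \<open>Dhat\<close> and integrating raises the shift a by one, so functions of the form A (ZZ d)
  are stable under V; F merely adds a constant term.\<close>

definition ZZ :: "nat \<Rightarrow> nat \<Rightarrow> (nat \<Rightarrow> complex ^ 'n ^ 'n) \<Rightarrow> real \<Rightarrow> complex ^ 'n ^ 'n" where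
  "ZZ i a R t = (\<Sum>l\<le>i. II (l + a) t ** R l)"

lemma ZZ_cont: "continuous_on {0..T} (ZZ i a R)"
  unfolding ZZ_def[abs_def] by (intro continuous_on_sum matrix_mult_cont II_cont continuous_on_const)

lemma primitive_ZZ: assumes t: "t \<in> {0..T}" shows "primitive (\<lambda>s. Dhat s ** ZZ i a R s) t = ZZ i (Suc a) R t"
proof -
  have int: "integrable (leb_upto T) (\<lambda>s. Dhat s ** II l s)" for l
    by (intro integrable_leb_continuous matrix_mult_cont Dhat_cont II_cont)
  have int': "integrable (leb_upto T) (\<lambda>s. (Dhat s ** II l s) ** R')" for l and R' :: "complex ^ 'n ^ 'n"
    by (intro integrable_leb_continuous matrix_mult_cont Dhat_cont II_cont continuous_on_const)
  have "(\<lambda>s. Dhat s ** ZZ i a R s) = (\<lambda>s. \<Sum>l\<le>i. (Dhat s ** II (l + a) s) ** R l)"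
    by (simp add: ZZ_def matrix_mult_sum_right matrix_mul_assoc)
  then have "primitive (\<lambda>s. Dhat s ** ZZ i a R s) t = (\<Sum>l\<le>i. primitive (\<lambda>s. (Dhat s ** II (l + a) s) ** R l) t)"
    by (simp only: primitive_sum[OF int' t])
  also have "\<dots> = (\<Sum>l\<le>i. primitive (\<lambda>s. Dhat s ** II (l + a) s) t ** R l)"
    by (simp only: primitive_bounded_linear[OF bounded_bilinear.bounded_linear_left[OF bounded_bilinear_matrix_mult] int t])
  finally show ?thesis by (simp add: II_Suc[OF t] ZZ_def)
qed

lemma primitive_B_A:
  fixes Z :: "real \<Rightarrow> complex ^ 'n ^ 'n"
  assumes Z: "continuous_on {0..T} Z" and t: "t \<in> {0..T}"
  shows "primitive (\<lambda>s. B s *v (A s *v (Z s *v d))) t = primitive (\<lambda>s. Dhat s ** Z s) t *v d"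
proof -
  have "(\<lambda>s. B s *v (A s *v (Z s *v d))) = (\<lambda>s. (Dhat s ** Z s) *v d)"
    by (simp add: matrix_vector_mul_assoc B_A matrix_mul_assoc)
  moreover have "integrable (leb_upto T) (\<lambda>s. Dhat s ** Z s)"
    by (intro integrable_leb_continuous matrix_mult_cont Dhat_cont Z)
  ultimately show ?thesis
    using primitive_bounded_linear[OF bounded_bilinear.bounded_linear_left[OF bounded_bilinear_matrix_vector_mult] _ t]
    by simp
qed

text \<open>Since B A = \<open>Dhat\<close>, one application of V to such a function is one further
  iterated integration.\<close>

lemma V_power_A:
  "t \<in> {0..T} \<Longrightarrow> (V ^^ a) (\<lambda>t. A t *v (ZZ i 0 R t *v d)) t = A t *v (ZZ i a R t *v d)"
proof (induction a arbitrary: t)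
  case (Suc a)
  let ?g = "\<lambda>t. A t *v (ZZ i a R t *v d)"
  have 1: "V ((V ^^ a) (\<lambda>t. A t *v (ZZ i 0 R t *v d))) = V ?g"
    by (rule kern.kernel_op_cong[OF Suc.IH])
  have 2: "V ?g t = A t *v (ZZ i (Suc a) R t *v d)"
    by (simp add: V_eq[OF A_mult_L2[OF ZZ_cont] Suc.prems] primitive_B_A[OF ZZ_cont Suc.prems] primitive_ZZ[OF Suc.prems])
  show ?case unfolding funpow.simps o_def 1 2 ..
qed simp

lemma total_V_power_A: "total ((V ^^ a) (\<lambda>t. A t *v (ZZ i 0 R t *v d))) = ZZ i (Suc a) R T *v d"
proof -
  have "total ((V ^^ a) (\<lambda>t. A t *v (ZZ i 0 R t *v d))) = total (\<lambda>t. A t *v (ZZ i a R t *v d))"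
    by (rule total_cong[OF V_power_A])
  then show ?thesis by (simp add: total_def primitive_B_A[OF ZZ_cont in_0T(2)] primitive_ZZ[OF in_0T(2)])
qed

text \<open>The coefficients of the inverse of 1 + Q M(x), where M(x) is the generating function of
  the M_j.\<close>

definition \<rho> :: "nat \<Rightarrow> complex ^ 'n ^ 'n" where "\<rho> = alternating_sum (\<lambda>j. Q ** II j T)"

text \<open>Each application of F raises every iterated integral by one index and adds the constant
  term -Q ZZ(T); this new constant obeys exactly the recursion of
  \<open>alternating_sum\<close>.\<close>

lemma Fop_power_A:
  "t \<in> {0..T} \<Longrightarrow> (Fop ^^ i) (\<lambda>t. A t *v d) t = A t *v (ZZ i 0 (\<lambda>l. \<rho> (i - l)) t *v d)"
proof (induction i arbitrary: t)
  case 0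
  then show ?case by (simp add: ZZ_def \<rho>_def alternating_sum_0)
next
  case (Suc i)
  let ?R = "\<lambda>l. \<rho> (i - l)"
  let ?g = "\<lambda>t. A t *v (ZZ i 0 ?R t *v d)"
  have 1: "primitive (\<lambda>s. B s *v ?g s) t = ZZ i 1 ?R t *v d" if "t \<in> {0..T}" for t
    by (simp add: primitive_B_A[OF ZZ_cont that] primitive_ZZ[OF that])
  have "(\<Sum>j=1..Suc i. Q ** II j T ** \<rho> (Suc i - j)) = (\<Sum>l\<le>i. Q ** II (Suc l) T ** \<rho> (i - l))"
    by (rule sum.reindex_bij_witness[where i = Suc and j = "\<lambda>j. j - 1"]) auto
  then have rho: "\<rho> (Suc i) = - (Q ** ZZ i 1 ?R T)"
    unfolding \<rho>_def by (subst alternating_sum_rec) (simp_all add: ZZ_def matrix_mult_sum_right matrix_mul_assoc)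
  have Z: "ZZ (Suc i) 0 (\<lambda>l. \<rho> (Suc i - l)) t = \<rho> (Suc i) + ZZ i 1 ?R t"
    unfolding ZZ_def by (subst sum.atMost_Suc_shift) simp
  have "(Fop ^^ Suc i) (\<lambda>t. A t *v d) t = Fop ?g t"
    using Fop_cong[OF Suc.IH Suc.prems] by simp
  also have "\<dots> = A t *v (ZZ i 1 ?R t *v d - Q *v (ZZ i 1 ?R T *v d))"
    unfolding Fop_def total_def 1[OF Suc.prems] 1[OF in_0T(2)] ..
  also have "\<dots> = A t *v (ZZ (Suc i) 0 (\<lambda>l. \<rho> (Suc i - l)) t *v d)"
    unfolding Z rho by (simp add: matrix_vector_mult_diff_rdistrib matrix_vector_mul_assoc)
  finally show ?case .
qed

definition G :: "nat \<Rightarrow> complex ^ 'n ^ 'n" where "G k = II k T ** M ** matrix_inv (M - E)"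

lemma G_alt: "G k = II k T ** Q"
  by (simp add: G_def Q_def matrix_mul_assoc)

text \<open>The push-through identity (1 + Q M(x))^{-1} Q = Q (1 + M(x) Q)^{-1}, coefficient by
  coefficient, with G(x) = M(x) Q.\<close>

lemma \<rho>_Q: "\<rho> n ** Q = Q ** alternating_sum G n"
proof (induction n rule: less_induct)
  case (less n)
  show ?case
  proof (cases "n = 0")
    case True
    then show ?thesis by (simp add: \<rho>_def alternating_sum_0)
  next
    case False
    have "\<rho> n ** Q = - (\<Sum>j=1..n. (Q ** II j T) ** (\<rho> (n - j) ** Q))"
      using False unfolding \<rho>_def by (subst alternating_sum_rec) (simp_all add: matrix_mult_minus matrix_mult_sum_left matrix_mul_assoc)
    also have "\<dots> = - (\<Sum>j=1..n. (Q ** II j T) ** (Q ** alternating_sum G (n - j)))"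
      using less by (intro arg_cong[of _ _ uminus] sum.cong refl) simp
    also have "\<dots> = Q ** alternating_sum G n"
      using False by (subst (2) alternating_sum_rec) (simp_all add: matrix_mult_minus matrix_mult_sum_right matrix_mul_assoc G_alt)
    finally show ?thesis .
  qed
qed

lemma F_power_has_trace:
  fixes \<phi> :: "nat \<Rightarrow> 'n vfun"
  assumes \<phi>: "orthonormal_seq T \<phi>" and m: "2 \<le> m"
  shows "has_trace T (F ^^ m) (- (\<Sum>j=1..m. of_nat j * trace (G j ** alternating_sum G (m - j))))"
proof -
  obtain m' where m': "m = Suc (Suc m')" using m by (metis add_2_eq_Suc le_Suc_ex)
  have V0: "has_trace T (V ^^ m) 0"
    unfolding m' by (rule kern.Volterra_power_trace[OF _ \<phi>]) (simp add: kern_def)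
  let ?V' = "kernel_op T (adj_kernel kern)"
  interpret kern': bounded_kernel T "adj_kernel kern" kern_bound by (rule kern.adj_bounded_kernel)
  let ?I = "{..<m} \<times> (UNIV :: 'n set)"
  let ?R = "\<lambda>i l. \<rho> (i - l)"
  define b where "b j = (\<lambda>s. adj (B s) *v axis j 1)" for j
  \<comment> \<open>The pair (i, j) stands for the j-th component of \<open>total\<close> after m -
    1 - i applications of V; those powers reach the representing function as adjoints. The powers of
    F are in v.\<close>
  define u where "u = (\<lambda>(i, j). (?V' ^^ (m - 1 - i)) (b j))"
  define v where "v = (\<lambda>(i, j) t. A t *v (ZZ i 0 (?R i) t *v (- (Q *v axis j 1))))"
  have bL: "b j \<in> L2 T" for j unfolding b_def by (rule adj_B_L2)
  have uL: "u p \<in> L2 T" and vL: "v p \<in> L2 T" for p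
    unfolding u_def v_def by (cases p; simp add: kern'.kernel_op_power_L2[OF bL] A_mult_L2[OF ZZ_cont])+
  have tr: "has_trace T (\<lambda>f t. (V ^^ m) f t + (\<Sum>p\<in>?I. l2_inner T f (u p) *s v p t)) (0 + (\<Sum>p\<in>?I. l2_inner T (v p) (u p)))"
    by (rule has_trace_add_finite_rank[OF T_nonneg V0 _ uL vL]) simp
  have eq: "(F ^^ m) f t = (V ^^ m) f t + (\<Sum>p\<in>?I. l2_inner T f (u p) *s v p t)" if f: "f \<in> L2 T" and t: "t \<in> {0..T}" for f t
  proof -
    have piece: "(Fop ^^ i) (\<lambda>t. A t *v (Q *v total ((V ^^ (m - 1 - i)) f))) t = - (\<Sum>j\<in>UNIV. l2_inner T f (u (i, j)) *s v (i, j) t)" for i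
    proof -
      let ?h = "(V ^^ (m - 1 - i)) f"
      have c: "total ?h $ j = l2_inner T f (u (i, j))" for j
        by (simp add: total_component[OF V_power_L2[OF f]] u_def b_def[symmetric] kern.kernel_op_power_adj[OF f bL])
      have "(Fop ^^ i) (\<lambda>t. A t *v (Q *v total ?h)) t = A t *v (ZZ i 0 (?R i) t *v (Q *v total ?h))"
        by (rule Fop_power_A[OF t])
      also have "\<dots> = (\<Sum>j\<in>UNIV. total ?h $ j *s (A t *v (ZZ i 0 (?R i) t *v (Q *v axis j 1))))"
        by (subst axis_expansion[of "total ?h"]) (simp only: matrix_vector_sum_smult)
      also have "\<dots> = - (\<Sum>j\<in>UNIV. l2_inner T f (u (i, j)) *s v (i, j) t)"
        unfolding sum_negf[symmetric] c v_def
        by (intro sum.cong refl) (simp add: vec_eq_iff matrix_vector_mult_def sum_negf sum_distrib_left)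
      finally show ?thesis .
    qed
    have "(F ^^ m) f t = (V ^^ m) f t - (\<Sum>i<m. (Fop ^^ i) (\<lambda>t. A t *v (Q *v total ((V ^^ (m - 1 - i)) f))) t)"
      unfolding F_power_Fop[OF f t] by (rule Fop_power_expand[OF f t])
    also have "\<dots> = (V ^^ m) f t + (\<Sum>i<m. \<Sum>j\<in>UNIV. l2_inner T f (u (i, j)) *s v (i, j) t)"
      unfolding piece by (simp add: sum_negf)
    finally show ?thesis by (simp add: sum.cartesian_product)
  qed
  have "has_trace T (F ^^ m) (0 + (\<Sum>p\<in>?I. l2_inner T (v p) (u p)))"
    by (rule has_trace_cong[OF tr F_power_L2 l2_eqI[OF eq[symmetric]]])
  moreover have "(\<Sum>p\<in>?I. l2_inner T (v p) (u p)) = - (\<Sum>j=1..m. of_nat j * trace (G j ** alternating_sum G (m - j)))"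
  proof -
    \<comment> \<open>The adjoint powers are moved back to v, where they add m - 1 - i integrations;
      \<open>total\<close> adds one more.\<close>
    have inner: "l2_inner T (v (i, j)) (u (i, j)) = - ((ZZ i (m - i) (?R i) T ** Q) *v axis j 1) $ j" if i: "i < m" for i j
    proof -
      have vL': "v (i, j) \<in> L2 T" by (rule vL)
      have "l2_inner T (v (i, j)) (u (i, j)) = l2_inner T ((V ^^ (m - 1 - i)) (v (i, j))) (b j)"
        by (simp add: u_def kern.kernel_op_power_adj[OF vL' bL])
      also have "\<dots> = total ((V ^^ (m - 1 - i)) (v (i, j))) $ j"
        by (simp add: total_component[OF V_power_L2[OF vL']] b_def)
      also have "\<dots> = (ZZ i (Suc (m - 1 - i)) (?R i) T *v (- (Q *v axis j 1))) $ j"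
        unfolding v_def prod.case total_V_power_A ..
      also have "Suc (m - 1 - i) = m - i" using i by simp
      finally show ?thesis by (simp add: matrix_vector_mul_assoc[symmetric]) (simp add: matrix_vector_mult_def sum_negf)
    qed
    \<comment> \<open>The index l + (m - i) depends on n = i - l only, so terms with equal n
      coincide; there are m - n of them, the source of the weight j.\<close>
    have g: "trace (II (l + (m - i)) T ** \<rho> (i - l) ** Q) = trace (G (m - (i - l)) ** alternating_sum G (i - l))" if "l \<le> i" "i < m" for l i
    proof -
      have "l + (m - i) = m - (i - l)" using that by simp
      then show ?thesis by (simp only: G_alt matrix_mul_assoc[symmetric] \<rho>_Q)
    qed
    have "(\<Sum>p\<in>?I. l2_inner T (v p) (u p)) = (\<Sum>i<m. \<Sum>j\<in>UNIV. l2_inner T (v (i, j)) (u (i, j)))"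
      by (simp add: sum.cartesian_product)
    also have "\<dots> = (\<Sum>i<m. - trace (ZZ i (m - i) (?R i) T ** Q))"
      by (intro sum.cong refl) (simp add: inner trace_axis sum_negf)
    also have "\<dots> = (\<Sum>i<m. - (\<Sum>l\<le>i. trace (G (m - (i - l)) ** alternating_sum G (i - l))))"
      unfolding ZZ_def matrix_mult_sum_left trace_sum
      by (intro sum.cong refl arg_cong[of _ _ uminus] g) auto
    also have "\<dots> = (\<Sum>i<m. - (\<Sum>n\<le>i. trace (G (m - n) ** alternating_sum G n)))"
    proof (rule sum.cong[OF refl])
      fix i
      show "- (\<Sum>l\<le>i. trace (G (m - (i - l)) ** alternating_sum G (i - l))) = - (\<Sum>n\<le>i. trace (G (m - n) ** alternating_sum G n))"
        by (rule arg_cong[of _ _ uminus], rule sum.reindex_bij_witness[where i = "\<lambda>n. i - n" and j = "\<lambda>l. i - l"]) auto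
    qed
    also have "\<dots> = - (\<Sum>n<m. of_nat (m - n) * trace (G (m - n) ** alternating_sum G n))"
      by (simp add: sum_negf sum_triangle_const)
    also have "(\<Sum>n<m. of_nat (m - n) * trace (G (m - n) ** alternating_sum G n)) = (\<Sum>j=1..m. of_nat j * trace (G j ** alternating_sum G (m - j)))"
      by (rule sum.reindex_bij_witness[where i = "\<lambda>j. m - j" and j = "\<lambda>n. m - n"]) auto
    finally show ?thesis .
  qed
  ultimately show ?thesis by simp
qed

end

section \<open>The conditional trace\<close>

lemma Lipschitz_upto_cis: "Lipschitz_upto T (\<lambda>t. cis (c * t))"
  by (rule Lipschitz_upto_C1[OF cis_has_vector_derivative]) (intro continuous_intros)

locale eigenbasis_data = monodromy_data T S D0 D \<gamma> \<nu>
  for T :: real and S :: "real ^ 'n ^ ('n::finite)" and D0 D \<gamma> :: "real \<Rightarrow> complex ^ 'n ^ 'n" and \<nu> :: complex +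
  fixes XX :: "(complex ^ 'n) set" and \<theta> :: "complex ^ 'n \<Rightarrow> real"
  assumes fin: "finite XX"
    and ortho: "\<And>x y. x \<in> XX \<Longrightarrow> y \<in> XX \<Longrightarrow> cdot x y = (if x = y then 1 else 0)"
    and eigen: "\<And>x. x \<in> XX \<Longrightarrow> map_matrix complex_of_real S *v x = exp (- (\<i> * of_real (\<theta> x))) *s x"
    and complete: "\<And>v. v = (\<Sum>x\<in>XX. cdot v x *s x)"
begin

definition ev :: "(complex ^ 'n) \<times> int \<Rightarrow> 'n vfun" where
  "ev = (\<lambda>(x, k). trig_vec T (\<theta> x) x k)"

text \<open>The eigenvalue of \<open>ev p\<close> is i times this number.\<close>

definition freq :: "(complex ^ 'n) \<times> int \<Rightarrow> real" where
  "freq = (\<lambda>(x, k). (\<theta> x + 2 * pi * of_int k) / T)"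

definition J :: "((complex ^ 'n) \<times> int) set" where "J = XX \<times> UNIV"

definition Idx :: "nat \<Rightarrow> ((complex ^ 'n) \<times> int) set" where
  "Idx n = {p \<in> J. \<bar>freq p\<bar> \<le> real n}"

lemma ev_L2: "ev p \<in> L2 T" by (cases p) (simp add: ev_def trig_vec_L2)

lemma ev_cont: "continuous_on {0..T} (ev p)" by (cases p) (simp add: ev_def continuous_trig_vec)

lemma ev_inner: assumes "p \<in> J" "p' \<in> J" shows "l2_inner T (ev p) (ev p') = (if p = p' then 1 else 0)"
proof -
  obtain x k y l where p: "p = (x, k)" "p' = (y, l)" "x \<in> XX" "y \<in> XX" using assms by (cases p; cases p') (auto simp: J_def)
  show ?thesis
  proof (cases "x = y")
    case True
    then show ?thesis using trig_vec_orthonormal[OF T_pos, of x "\<theta> x" k l] ortho[of x x] p by (simp add: ev_def)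
  next
    case False
    then show ?thesis using trig_vec_orthogonal[of x y T "\<theta> x" k "\<theta> y" l] ortho[of x y] p by (simp add: ev_def)
  qed
qed

lemma ev_inj: "inj_on ev J"
proof (rule inj_onI)
  fix p p' assume "p \<in> J" "p' \<in> J" "ev p = ev p'"
  then show "p = p'" using ev_inner[of p p'] ev_inner[of p p] by (auto split: if_splits)
qed

lemma ev_orthonormal: "orthonormal_set T (ev ` J)"
  unfolding orthonormal_set_def
proof (intro conjI ballI)
  show "ev ` J \<subseteq> L2 T" using ev_L2 by auto
  fix e e' assume "e \<in> ev ` J" "e' \<in> ev ` J"
  then obtain p p' where p: "p \<in> J" "p' \<in> J" "e = ev p" "e' = ev p'" by auto
  then show "l2_inner T e e' = (if e = e' then 1 else 0)"
    using ev_inner[OF p(1,2)] inj_on_eq_iff[OF ev_inj p(1,2)] by simp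
qed

text \<open>For each eigenvector x, the component of f along x becomes an ordinary periodic problem
  after multiplication by e^{-i theta t/T}, and Fourier completeness applies to it.\<close>

lemma ev_basis: "orthonormal_basis T (ev ` J)"
  unfolding orthonormal_basis_iff
proof (intro conjI ballI impI ev_orthonormal)
  fix f :: "'n vfun" assume f: "f \<in> L2 T" and zero: "\<forall>e\<in>ev ` J. l2_inner T f e = 0"
  have sT: "complex_of_real (sqrt T) \<noteq> 0" using T_pos by simp
  have ae: "AE t in leb_upto T. cdot (f t) x = 0" if x: "x \<in> XX" for x
  proof -
    define g where "g t = cis (- (\<theta> x * t / T)) * cdot (f t) x" for t
    have cm: "(\<lambda>t. cis (- (\<theta> x * t / T))) \<in> borel_measurable (leb_upto T)"
      by (rule measurable_leb_continuous) (simp only: divide_inverse, intro continuous_intros)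
    have xi: "integrable (leb_upto T) (\<lambda>t. cdot (f t) x)"
      by (rule integrable_bounded_linear[OF bounded_bilinear.bounded_linear_left[OF bounded_bilinear_cdot] L2_integrable[OF f]])
    have "integrable (leb_upto T) g"
    proof (rule Bochner_Integration.integrable_bound[OF xi])
      show "g \<in> borel_measurable (leb_upto T)" unfolding g_def[abs_def]
        by (rule borel_measurable_times[OF cm borel_measurable_integrable[OF xi]])
      show "AE t in leb_upto T. norm (g t) \<le> norm (cdot (f t) x)" by (simp add: g_def norm_mult)
    qed
    moreover have "(LINT t|leb_upto T. g t * character T k t) = 0" for k
    proof -
      \<comment> \<open>The second argument of the inner product is conjugated, which reverses the
        sign of k.\<close>
      have "(x, - k) \<in> J" using x by (simp add: J_def)
      then have "l2_inner T f (ev (x, - k)) = 0" using zero by blast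
      then have "l2_inner T f (trig_vec T (\<theta> x) x (- k)) = 0" by (simp add: ev_def)
      then show ?thesis using sT unfolding l2_inner_trig_vec g_def by simp
    qed
    ultimately have "AE t in leb_upto T. g t = 0" by (rule Fourier_completeness[OF T_pos])
    then show ?thesis by eventually_elim (simp add: g_def)
  qed
  have "AE t in leb_upto T. \<forall>x\<in>XX. cdot (f t) x = 0"
    using fin ae by (subst AE_ball_countable) (auto intro: countable_finite)
  then show "l2_eq T f (\<lambda>_. 0)"
    unfolding l2_eq_def
  proof eventually_elim
    case (elim t)
    show ?case by (subst complete[of "f t"]) (simp add: elim)
  qed
qed

lemma orthonormal_seq_exists: "\<exists>\<phi> :: nat \<Rightarrow> 'n vfun. orthonormal_seq T \<phi>"
proof -
  have "XX \<noteq> {}"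
  proof
    assume "XX = {}"
    then have "(axis undefined 1 :: complex ^ 'n) = 0" using complete[of "axis undefined 1"] by simp
    then show False by (simp add: axis_eq_0_iff)
  qed
  then have inf: "infinite J" unfolding J_def by (simp add: finite_cartesian_product_iff infinite_UNIV_int)
  have cnt: "countable J" unfolding J_def using fin by (intro countable_SIGMA) (auto intro: countable_finite)
  have bij: "bij_betw (from_nat_into J) UNIV J" by (rule bij_betw_from_nat_into[OF cnt inf])
  have "orthonormal_seq T (ev \<circ> from_nat_into J)"
    unfolding orthonormal_seq_def
  proof
    show "inj (ev \<circ> from_nat_into J)" using bij ev_inj by (intro comp_inj_on) (auto simp: bij_betw_def)
    have "range (ev \<circ> from_nat_into J) = ev ` J" using bij by (metis image_comp bij_betw_imp_surj_on)
    then show "orthonormal_basis T (range (ev \<circ> from_nat_into J))" using ev_basis by simp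
  qed
  then show ?thesis by blast
qed

lemma Idx_J: "Idx n \<subseteq> J" by (auto simp: Idx_def)

text \<open>The ends are those of a symmetric interval shifted by -theta/(2 pi), then rounded
  inwards.\<close>

lemma Idx_window:
  assumes "x \<in> XX"
  shows "{k. (x, k) \<in> Idx n} = {\<lceil>(- (n * T) - \<theta> x) / (2 * pi)\<rceil>..\<lfloor>(n * T - \<theta> x) / (2 * pi)\<rfloor>}"
proof (rule set_eqI)
  fix k :: int
  have "(x, k) \<in> Idx n \<longleftrightarrow> \<bar>\<theta> x + 2 * pi * of_int k\<bar> \<le> n * T"
    using assms T_pos by (simp add: Idx_def J_def freq_def divide_le_eq)
  also have "\<dots> \<longleftrightarrow> (- (n * T) - \<theta> x) \<le> of_int k * (2 * pi) \<and> of_int k * (2 * pi) \<le> n * T - \<theta> x"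
    by (auto simp: abs_le_iff algebra_simps)
  also have "\<dots> \<longleftrightarrow> (- (n * T) - \<theta> x) / (2 * pi) \<le> of_int k \<and> of_int k \<le> (n * T - \<theta> x) / (2 * pi)"
    using pi_gt_zero by (simp add: pos_divide_le_eq pos_le_divide_eq)
  also have "\<dots> \<longleftrightarrow> k \<in> {\<lceil>(- (n * T) - \<theta> x) / (2 * pi)\<rceil>..\<lfloor>(n * T - \<theta> x) / (2 * pi)\<rfloor>}"
    by (simp add: ceiling_le_iff le_floor_iff)
  finally show "k \<in> {k. (x, k) \<in> Idx n} \<longleftrightarrow> k \<in> {\<lceil>(- (n * T) - \<theta> x) / (2 * pi)\<rceil>..\<lfloor>(n * T - \<theta> x) / (2 * pi)\<rfloor>}" by simp
qed

lemma Idx_Sigma: "Idx n = (SIGMA x:XX. {\<lceil>(- (n * T) - \<theta> x) / (2 * pi)\<rceil>..\<lfloor>(n * T - \<theta> x) / (2 * pi)\<rfloor>})"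
proof -
  have "Idx n = (SIGMA x:XX. {k. (x, k) \<in> Idx n})" by (auto simp: Idx_def J_def)
  also have "\<dots> = (SIGMA x:XX. {\<lceil>(- (n * T) - \<theta> x) / (2 * pi)\<rceil>..\<lfloor>(n * T - \<theta> x) / (2 * pi)\<rfloor>})"
    by (intro Sigma_cong refl Idx_window)
  finally show ?thesis .
qed

lemma Idx_finite: "finite (Idx n)" unfolding Idx_Sigma using fin by auto

definition W :: "nat \<Rightarrow> 'n vfun set" where "W n = ev ` Idx n"

lemma W_props: "finite (W n)" "W n \<subseteq> ev ` J" "orthonormal_set T (W n)"
proof -
  show fw: "finite (W n)" and sub: "W n \<subseteq> ev ` J" unfolding W_def using Idx_finite Idx_J by blast+
  show "orthonormal_set T (W n)" by (rule orthonormal_subset[OF ev_orthonormal sub])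
qed

lemma W_L2: "e \<in> W n \<Longrightarrow> e \<in> L2 T" using ev_L2 by (auto simp: W_def)

text \<open>The cut-offs exhaust the basis, so sums that converge unconditionally over it converge
  along them.\<close>

lemma W_filterlim: "filterlim W (finite_subsets_at_top (ev ` J)) sequentially"
  unfolding filterlim_finite_subsets_at_top
proof (intro allI impI)
  fix Y assume Y: "finite Y \<and> Y \<subseteq> ev ` J"
  then obtain P where P: "finite P" "P \<subseteq> J" "Y = ev ` P" by (meson finite_subset_image)
  obtain n0 :: nat where n0: "\<forall>p\<in>P. \<bar>freq p\<bar> \<le> n0"
  proof -
    obtain n0 :: nat where "Max (insert 0 ((\<lambda>p. \<bar>freq p\<bar>) ` P)) \<le> n0" using real_arch_simple by blast
    then have "\<forall>p\<in>P. \<bar>freq p\<bar> \<le> n0" using P(1) by (auto simp: Max_le_iff)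
    then show ?thesis by (rule that)
  qed
  show "\<forall>\<^sub>F n in sequentially. finite (W n) \<and> Y \<subseteq> W n \<and> W n \<subseteq> ev ` J"
    using eventually_ge_at_top[of n0]
  proof eventually_elim
    case (elim n)
    have "P \<subseteq> Idx n"
    proof
      fix p assume p: "p \<in> P"
      have "\<bar>freq p\<bar> \<le> real n0" using n0 p by blast
      also have "\<dots> \<le> real n" using elim by simp
      finally show "p \<in> Idx n" using p P(2) by (auto simp: Idx_def)
    qed
    then show ?case using W_props(1,2) P(3) by (auto simp: W_def)
  qed
qed

lemma W_Parseval:
  assumes "f \<in> L2 T" "g \<in> L2 T"
  shows "(\<lambda>n. \<Sum>e\<in>W n. l2_inner T f e * l2_inner T e g) \<longlonglongrightarrow> l2_inner T f g"
  using filterlim_compose[OF Parseval[OF T_nonneg ev_basis assms, unfolded has_sum_def] W_filterlim] .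

lemma kernel_iff: "z \<in> op_kernel (scalar_minus_op T \<mu> (ddt T S)) \<longleftrightarrow> (\<exists>w. ddt T S z w \<and> l2_eq T w (\<lambda>t. \<mu> *s z t))"
proof -
  have "l2_eq T (\<lambda>_. 0) (\<lambda>t. \<mu> *s z t - w t) \<longleftrightarrow> l2_eq T w (\<lambda>t. \<mu> *s z t)" for w
    unfolding l2_eq_def by (rule AE_cong) auto
  then show ?thesis by (simp add: op_kernel_def scalar_minus_op_def)
qed

lemma exp_vec_derivative: "((\<lambda>t. exp (c * of_real t) *s v) has_vector_derivative c *s (exp (c * of_real t) *s v)) (at t within U)" for v :: "complex ^ 'n"
  using bounded_linear.has_vector_derivative[OF bounded_bilinear.bounded_linear_left[OF bounded_bilinear_smult] exp_has_vector_derivative]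
  by (simp add: vector_smult_assoc)

lemma ev_exp: "ev p t = exp (\<i> * of_real (freq p) * of_real t) *s (1 / of_real (sqrt T) *s fst p)"
proof -
  obtain x k where p: "p = (x, k)" by (cases p)
  have "cis (\<theta> x * t / T) * character T k t = exp (\<i> * of_real (freq p) * of_real t)"
    by (simp add: p freq_def character_def cis_mult) (simp add: cis_conv_exp add_divide_distrib algebra_simps)
  then show ?thesis by (simp add: p ev_def trig_vec_def vector_smult_assoc)
qed

lemma ev_kernel: assumes p: "p \<in> J" shows "ev p \<in> op_kernel (scalar_minus_op T (\<i> * of_real (freq p)) (ddt T S))"
proof -
  let ?\<mu> = "\<i> * complex_of_real (freq p)"
  define z where "z t = exp (?\<mu> * of_real t) *s (1 / of_real (sqrt T) *s fst p)" for t :: real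
  have ez: "ev p = z" by (rule ext) (simp add: z_def ev_exp)
  have zd: "(z has_vector_derivative ?\<mu> *s z t) (at t within {0..T})" for t
    unfolding z_def by (rule exp_vec_derivative)
  have zc: "continuous_on {0..T} z" using ev_cont ez by metis
  have mz: "continuous_on {0..T} (\<lambda>t. ?\<mu> *s z t)"
    by (intro bounded_bilinear.continuous_on[OF bounded_bilinear_smult] continuous_on_const zc)
  have zt: "z t = z 0 + (LINT s|lebesgue_on {0..t}. ?\<mu> *s z s)" if "t \<in> {0..T}" for t
    using primitive_FTC[OF zd mz that] by (simp add: primitive_def)
  have sob: "has_sobolev_deriv T z (\<lambda>t. ?\<mu> *s z t)"
    unfolding has_sobolev_deriv_def using L2_continuous[OF zc] L2_continuous[OF mz] zt by blast
  obtain x k where p': "p = (x, k)" "x \<in> XX" using p by (cases p) (auto simp: J_def)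
  have "?\<mu> * of_real T = \<i> * of_real (\<theta> x) + 2 * of_int k * of_real pi * \<i>"
    using T_pos by (simp add: p' freq_def) (simp add: algebra_simps)
  then have e: "exp (?\<mu> * of_real T) = exp (\<i> * of_real (\<theta> x))"
    by (simp add: exp_add exp_integer_2pi mult.commute mult.left_commute)
  have "map_matrix complex_of_real S *v z T = (exp (\<i> * of_real (\<theta> x)) * (1 / of_real (sqrt T))) *s (map_matrix complex_of_real S *v x)"
    by (simp add: z_def e[unfolded p'(1)] p'(1) vector_scalar_commute vector_smult_assoc)
  also have "\<dots> = z 0"
    by (simp add: eigen[OF p'(2)] z_def p' vector_smult_assoc exp_minus)
  finally have bc: "z 0 = map_matrix complex_of_real S *v z T" by (rule sym)
  have "ddt T S z (\<lambda>t. ?\<mu> *s z t)"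
    unfolding ddt_def ddt_domain_def W12_def using sob bc by blast
  then show ?thesis unfolding ez kernel_iff by (intro exI[of _ "\<lambda>t. ?\<mu> *s z t"]) simp
qed

lemma freq_spectrum: assumes p: "p \<in> J" shows "\<i> * of_real (freq p) \<in> op_spectrum T (ddt T S)"
proof -
  let ?A = "scalar_minus_op T (\<i> * of_real (freq p)) (ddt T S)"
  have "?A (ev p) (\<lambda>_. 0)" using ev_kernel[OF p] by (simp add: op_kernel_def)
  moreover have "?A (\<lambda>_. 0) (\<lambda>_. 0)"
  proof -
    have "ddt T S (\<lambda>_. 0) (\<lambda>_. 0)"
      by (auto simp: ddt_def ddt_domain_def W12_def has_sobolev_deriv_def intro!: exI[of _ "\<lambda>_. 0"])
    then show ?thesis unfolding scalar_minus_op_def by (intro conjI exI[of _ "\<lambda>_. 0"]) simp_all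
  qed
  moreover have "\<not> l2_eq T (ev p) (\<lambda>_. 0)"
  proof
    assume "l2_eq T (ev p) (\<lambda>_. 0)"
    then have "l2_norm T (ev p) = 0" using l2_norm_eq_0_iff[OF ev_L2] by simp
    then show False using l2_inner_self[of T "ev p"] ev_inner[OF p p] by simp
  qed
  ultimately show ?thesis unfolding op_spectrum_def op_invertible_def by blast
qed

lemma kernel_lincomb:
  assumes "\<And>i. i \<in> I \<Longrightarrow> z i \<in> op_kernel (scalar_minus_op T \<mu> (ddt T S))" "finite I"
  shows "(\<lambda>t. \<Sum>i\<in>I. c i *s z i t) \<in> op_kernel (scalar_minus_op T \<mu> (ddt T S))"
proof -
  from assms(1) have "\<forall>i\<in>I. \<exists>w. ddt T S (z i) w \<and> l2_eq T w (\<lambda>t. \<mu> *s z i t)" unfolding kernel_iff by blast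
  then obtain w where w: "\<And>i. i \<in> I \<Longrightarrow> ddt T S (z i) (w i)" "\<And>i. i \<in> I \<Longrightarrow> l2_eq T (w i) (\<lambda>t. \<mu> *s z i t)" by metis
  have L: "z i \<in> L2 T" "w i \<in> L2 T" "z i 0 = map_matrix complex_of_real S *v z i T" if "i \<in> I" for i
    using w(1)[OF that] by (simp_all add: ddt_def ddt_domain_def has_sobolev_deriv_def)
  have zt: "z i t = z i 0 + primitive (w i) t" if "i \<in> I" "t \<in> {0..T}" for i t
    using w(1)[OF that(1)] that(2) unfolding ddt_def has_sobolev_deriv_def primitive_def by blast
  let ?z = "\<lambda>t. \<Sum>i\<in>I. c i *s z i t" and ?w = "\<lambda>t. \<Sum>i\<in>I. c i *s w i t"
  have "has_sobolev_deriv T ?z ?w"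
    unfolding has_sobolev_deriv_def
  proof (intro conjI ballI)
    show "?z \<in> L2 T" "?w \<in> L2 T" by (intro L2_sum L2_smult L; assumption)+
    fix t assume t: "t \<in> {0..T}"
    have "primitive ?w t = (\<Sum>i\<in>I. primitive (\<lambda>t. c i *s w i t) t)"
      by (rule primitive_sum[OF L2_integrable[OF L2_smult[OF L(2)]] t])
    also have "\<dots> = (\<Sum>i\<in>I. c i *s primitive (w i) t)"
      by (intro sum.cong refl primitive_bounded_linear[OF bounded_bilinear.bounded_linear_right[OF bounded_bilinear_smult] L2_integrable[OF L(2)] t])
    finally have "?z 0 + primitive ?w t = (\<Sum>i\<in>I. c i *s (z i 0 + primitive (w i) t))"
      by (simp only: sum.distrib[symmetric] vector_add_ldistrib)
    also have "\<dots> = ?z t" by (intro sum.cong refl) (simp only: zt[OF _ t, symmetric])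
    finally show "?z t = ?z 0 + (LINT s|lebesgue_on {0..t}. ?w s)" by (simp only: primitive_def)
  qed
  moreover have "?z 0 = map_matrix complex_of_real S *v ?z T"
    unfolding matrix_vector_sum_smult by (intro sum.cong refl) (simp only: L(3)[symmetric])
  ultimately have "ddt T S ?z ?w" unfolding ddt_def ddt_domain_def W12_def by blast
  moreover have "l2_eq T ?w (\<lambda>t. \<mu> *s ?z t)"
  proof -
    have "AE t in leb_upto T. \<forall>i\<in>I. w i t = \<mu> *s z i t"
      using assms(2) w(2) unfolding l2_eq_def by (subst AE_ball_countable) (auto intro: countable_finite)
    then show ?thesis unfolding l2_eq_def
      by eventually_elim (simp add: vec_eq_iff sum_component sum_distrib_left mult.left_commute)
  qed
  ultimately show ?thesis unfolding kernel_iff by blast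
qed

text \<open>\<open>eigen_sum\<close> takes one kernel element per eigenvalue, while different x may
  share a frequency; equal eigenvalues are therefore grouped first.\<close>

lemma lincomb_in_eigen_sum: "(\<lambda>t. \<Sum>p\<in>Idx n. c p *s ev p t) \<in> eigen_sum T (ddt T S) (real n)"
proof -
  let ?\<mu> = "\<lambda>p. \<i> * complex_of_real (freq p)"
  define z where "z \<mu> t = (\<Sum>p\<in>{p \<in> Idx n. ?\<mu> p = \<mu>}. c p *s ev p t)" for \<mu> t
  have "(\<Sum>p\<in>Idx n. c p *s ev p t) = (\<Sum>\<mu>\<in>?\<mu> ` Idx n. z \<mu> t)" for t
    unfolding z_def by (rule sum.group[symmetric]) (use Idx_finite in auto)
  moreover have "z \<mu> \<in> op_kernel (scalar_minus_op T \<mu> (ddt T S))" for \<mu>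
    unfolding z_def[abs_def]
  proof (rule kernel_lincomb)
    fix p assume "p \<in> {p \<in> Idx n. ?\<mu> p = \<mu>}"
    then have p: "p \<in> J" "\<mu> = ?\<mu> p" using Idx_J by auto
    show "ev p \<in> op_kernel (scalar_minus_op T \<mu> (ddt T S))" unfolding p(2) by (rule ev_kernel[OF p(1)])
  qed (use Idx_finite in auto)
  moreover have "?\<mu> ` Idx n \<subseteq> {\<mu> \<in> op_spectrum T (ddt T S). cmod \<mu> \<le> real n}"
    using freq_spectrum Idx_J by (auto simp: norm_mult) (auto simp: Idx_def)
  ultimately show ?thesis
    unfolding eigen_sum_def using Idx_finite by blast
qed

text \<open>A kernel element is e^{\<mu>t} z(0), and the boundary condition makes z(0) an
  eigenvector of S for e^{-\<mu>T}. A nonzero component along x then forces \<mu> = i(theta + 2 pi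
  k)/T. This applies to arbitrary \<mu>, so the spectrum need not be determined beforehand.\<close>

lemma kernel_explicit:
  assumes z: "z \<in> op_kernel (scalar_minus_op T \<mu> (ddt T S))" and \<mu>: "cmod \<mu> \<le> real n"
  obtains c where "\<And>t. t \<in> {0..T} \<Longrightarrow> z t = (\<Sum>p\<in>Idx n. c p *s ev p t)"
proof -
  obtain w where w: "ddt T S z w" "l2_eq T w (\<lambda>t. \<mu> *s z t)" using z unfolding kernel_iff by blast
  have wL: "w \<in> L2 T" and bc: "z 0 = map_matrix complex_of_real S *v z T"
    using w(1) by (simp_all add: ddt_def ddt_domain_def has_sobolev_deriv_def)
  have zt: "z t = z 0 + primitive w t" if "t \<in> {0..T}" for t
    using w(1) that unfolding ddt_def has_sobolev_deriv_def primitive_def by blast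
  have zc: "continuous_on {0..T} z"
  proof (rule continuous_on_eq)
    show "continuous_on {0..T} (\<lambda>t. z 0 + primitive w t)"
      by (intro continuous_intros primitive_continuous L2_integrable wL)
    show "z 0 + primitive w t = z t" if "t \<in> {0..T}" for t by (rule zt[OF that, symmetric])
  qed
  have mz: "continuous_on {0..T} (\<lambda>t. \<mu> *s z t)"
    by (intro bounded_bilinear.continuous_on[OF bounded_bilinear_smult] continuous_on_const zc)
  have wz: "primitive w t = primitive (\<lambda>t. \<mu> *s z t) t" if t: "t \<in> {0..T}" for t
    unfolding primitive_alt[OF t]
  proof (rule integral_cong_AE)
    show "AE s in leb_upto T. (if s \<le> t then w s else 0) = (if s \<le> t then \<mu> *s z s else 0)"
      using w(2) unfolding l2_eq_def by eventually_elim simp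
  qed (rule borel_measurable_integrable[OF integrable_leb_restrict], rule L2_integrable[OF wL],
       rule borel_measurable_integrable[OF integrable_leb_restrict], rule integrable_leb_continuous[OF mz])
  define d where "d t = z t - exp (\<mu> * of_real t) *s z 0" for t
  have zd: "(z has_vector_derivative \<mu> *s z t) (at t within {0..T})" if t: "t \<in> {0..T}" for t
  proof (rule has_vector_derivative_transform[OF t])
    show "z s = z 0 + primitive (\<lambda>t. \<mu> *s z t) s" if "s \<in> {0..T}" for s using zt[OF that] wz[OF that] by (rule trans[OF _ arg_cong])
    show "((\<lambda>s. z 0 + primitive (\<lambda>t. \<mu> *s z t) s) has_vector_derivative \<mu> *s z t) (at t within {0..T})"
      using has_vector_derivative_add[OF has_vector_derivative_const primitive_has_derivative[OF mz t]] by simp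
  qed
  have dd: "(d has_vector_derivative mat \<mu> *v d t) (at t within {0..T})" if t: "t \<in> {0..T}" for t
    unfolding d_def[abs_def] mat_vector_mult
    using has_vector_derivative_diff[OF zd[OF t] exp_vec_derivative[of \<mu> "z 0" t]]
    by (simp add: vector_ssub_ldistrib)
  have "d 0 = 0" by (simp add: d_def)
  then have d0: "d t = 0" if "t \<in> {0..T}" for t
    using linear_ode_bound[OF dd order_refl in_0T(1) that] by simp
  have z_exp: "z t = exp (\<mu> * of_real t) *s z 0" if "t \<in> {0..T}" for t
    using d0[OF that] unfolding d_def by (simp only: right_minus_eq)
  have bc': "z 0 = exp (\<mu> * of_real T) *s (map_matrix complex_of_real S *v z 0)"
    by (rule trans[OF bc]) (simp only: z_exp[OF in_0T(2)] vector_scalar_commute)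
  have coeff: "cdot (z 0) x = 0 \<or> (\<exists>k. (x, k) \<in> Idx n \<and> \<i> * of_real (freq (x, k)) = \<mu>)" if x: "x \<in> XX" for x
  proof -
    define \<alpha> where "\<alpha> = exp (- (\<i> * complex_of_real (\<theta> x)))"
    have "\<alpha> = cis (- \<theta> x)" by (simp add: \<alpha>_def cis_conv_exp)
    then have a1: "\<alpha> * cnj \<alpha> = 1" by (simp add: cis_cnj cis_mult)
    have "cdot (z 0) x = exp (\<mu> * of_real T) * cdot (map_matrix complex_of_real S *v z 0) x"
      by (subst bc') (simp only: cdot_smult_left)
    \<comment> \<open>S is moved to the other argument by isometry, since x is an eigenvector with
      unimodular eigenvalue.\<close>
    also have "cdot (map_matrix complex_of_real S *v z 0) x = \<alpha> * cdot (z 0) x"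
    proof -
      have "cnj \<alpha> * cdot (map_matrix complex_of_real S *v z 0) x = cdot (map_matrix complex_of_real S *v z 0) (map_matrix complex_of_real S *v x)"
        by (simp add: eigen[OF x] cdot_smult_right \<alpha>_def)
      also have "\<dots> = cdot (z 0) x" by (rule orthogonal_matrix_cdot[OF S_orth])
      finally have "\<alpha> * cdot (z 0) x = (\<alpha> * cnj \<alpha>) * cdot (map_matrix complex_of_real S *v z 0) x"
        by (simp add: mult.assoc)
      then show ?thesis by (simp add: a1)
    qed
    finally have "cdot (z 0) x = (exp (\<mu> * of_real T) * \<alpha>) * cdot (z 0) x" by (simp add: mult.assoc)
    then have "cdot (z 0) x = 0 \<or> exp (\<mu> * of_real T) * \<alpha> = 1" by auto
    moreover have "\<exists>k. (x, k) \<in> Idx n \<and> \<i> * of_real (freq (x, k)) = \<mu>" if "exp (\<mu> * of_real T) * \<alpha> = 1"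
    proof -
      have "exp (\<mu> * of_real T - \<i> * of_real (\<theta> x)) = 1" using that by (simp add: \<alpha>_def exp_diff exp_minus divide_inverse)
      then obtain k :: int where k: "Re (\<mu> * of_real T - \<i> * of_real (\<theta> x)) = 0" "Im (\<mu> * of_real T - \<i> * of_real (\<theta> x)) = of_int (2 * k) * pi"
        unfolding exp_eq_1 by blast
      have "\<mu> = \<i> * of_real (freq (x, k))"
        using k T_pos by (simp add: complex_eq_iff freq_def field_simps)
      moreover have "(x, k) \<in> Idx n" using \<mu> x unfolding \<open>\<mu> = \<i> * of_real (freq (x, k))\<close> by (simp add: norm_mult Idx_def J_def)
      ultimately show ?thesis by blast
    qed
    ultimately show ?thesis by blast
  qed
  define kk where "kk x = (SOME k. (x, k) \<in> Idx n \<and> \<i> * of_real (freq (x, k)) = \<mu>)" for x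
  have kk: "(x, kk x) \<in> Idx n" "\<i> * of_real (freq (x, kk x)) = \<mu>" if "x \<in> XX" "cdot (z 0) x \<noteq> 0" for x
    using someI_ex[of "\<lambda>k. (x, k) \<in> Idx n \<and> \<i> * of_real (freq (x, k)) = \<mu>"] coeff[OF that(1)] that(2) unfolding kk_def by blast+
  define X' where "X' = {x \<in> XX. cdot (z 0) x \<noteq> 0}"
  define c where "c p = (if p \<in> (\<lambda>x. (x, kk x)) ` X' then of_real (sqrt T) * cdot (z 0) (fst p) else 0)" for p
  show ?thesis
  proof (rule that[of c])
    fix t assume t: "t \<in> {0..T}"
    have inj: "inj_on (\<lambda>x. (x, kk x)) X'" by (auto intro: inj_onI)
    have sT: "complex_of_real (sqrt T) \<noteq> 0" using T_pos by simp
    have "z t = exp (\<mu> * of_real t) *s (\<Sum>x\<in>XX. cdot (z 0) x *s x)"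
      using z_exp[OF t] complete[of "z 0"] by simp
    also have "(\<Sum>x\<in>XX. cdot (z 0) x *s x) = (\<Sum>x\<in>X'. cdot (z 0) x *s x)"
      using fin by (intro sum.mono_neutral_right) (auto simp: X'_def)
    also have "exp (\<mu> * of_real t) *s \<dots> = (\<Sum>x\<in>X'. c (x, kk x) *s ev (x, kk x) t)"
      unfolding bounded_bilinear.sum_right[OF bounded_bilinear_smult]
    proof (intro sum.cong refl)
      fix x assume x: "x \<in> X'"
      then have k: "\<i> * of_real (freq (x, kk x)) = \<mu>" using kk by (auto simp: X'_def)
      have "c (x, kk x) = of_real (sqrt T) * cdot (z 0) x" using x by (simp add: c_def)
      then show "exp (\<mu> * of_real t) *s (cdot (z 0) x *s x) = c (x, kk x) *s ev (x, kk x) t"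
        using sT by (simp add: ev_exp k vector_smult_assoc mult_ac)
    qed
    also have "\<dots> = (\<Sum>p\<in>(\<lambda>x. (x, kk x)) ` X'. c p *s ev p t)" by (simp add: sum.reindex[OF inj])
    also have "\<dots> = (\<Sum>p\<in>Idx n. c p *s ev p t)"
      by (rule sum.mono_neutral_left) (use Idx_finite kk in \<open>auto simp: X'_def c_def\<close>)
    finally show "z t = (\<Sum>p\<in>Idx n. c p *s ev p t)" .
  qed
qed

lemma eigen_sum_explicit:
  assumes "h \<in> eigen_sum T (ddt T S) (real n)"
  obtains c where "\<And>t. t \<in> {0..T} \<Longrightarrow> h t = (\<Sum>p\<in>Idx n. c p *s ev p t)"
proof -
  obtain I z where I: "finite I" "\<And>\<mu>. \<mu> \<in> I \<Longrightarrow> cmod \<mu> \<le> real n"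
      "\<And>\<mu>. \<mu> \<in> I \<Longrightarrow> z \<mu> \<in> op_kernel (scalar_minus_op T \<mu> (ddt T S))" and h: "h = (\<lambda>t. \<Sum>\<mu>\<in>I. z \<mu> t)"
    using assms unfolding eigen_sum_def by blast
  have "\<exists>c. \<forall>t\<in>{0..T}. z \<mu> t = (\<Sum>p\<in>Idx n. c p *s ev p t)" if "\<mu> \<in> I" for \<mu>
    by (rule kernel_explicit[OF I(3)[OF that] I(2)[OF that]]) blast
  then obtain c where c: "\<And>\<mu> t. \<mu> \<in> I \<Longrightarrow> t \<in> {0..T} \<Longrightarrow> z \<mu> t = (\<Sum>p\<in>Idx n. c \<mu> p *s ev p t)" by metis
  show ?thesis
  proof (rule that)
    fix t assume t: "t \<in> {0..T}"
    have "h t = (\<Sum>\<mu>\<in>I. \<Sum>p\<in>Idx n. c \<mu> p *s ev p t)" unfolding h by (intro sum.cong refl c t)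
    also have "\<dots> = (\<Sum>p\<in>Idx n. \<Sum>\<mu>\<in>I. c \<mu> p *s ev p t)" by (rule sum.swap)
    also have "\<dots> = (\<Sum>p\<in>Idx n. (\<Sum>\<mu>\<in>I. c \<mu> p) *s ev p t)"
      by (simp add: bounded_bilinear.sum_left[OF bounded_bilinear_smult])
    finally show "h t = (\<Sum>p\<in>Idx n. (\<Sum>\<mu>\<in>I. c \<mu> p) *s ev p t)" .
  qed
qed

end

lemma cdot_axis_expansion: "cdot (C *v y) x = (\<Sum>l\<in>UNIV. y $ l * cdot (C *v axis l 1) x)"
  for C :: "complex ^ 'n ^ 'n"
  by (subst axis_expansion[of y]) (simp only: matrix_vector_sum_smult cdot_sum_left cdot_smult_left)

lemma Lipschitz_upto_const: "Lipschitz_upto T (\<lambda>_. c)"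
  unfolding Lipschitz_upto_def by (intro exI[of _ 0]) simp

lemma floor_linear_at_top:
  fixes T c r :: real
  assumes "0 < T" "0 < r"
  shows "\<forall>\<^sub>F n :: nat in sequentially. Z \<le> \<lfloor>(n * T - c) / r\<rfloor>"
proof -
  obtain n0 :: nat where n0: "(of_int Z * r + c) / T \<le> n0" using real_arch_simple by blast
  show ?thesis
    using eventually_ge_at_top[of n0]
  proof eventually_elim
    case (elim n)
    then have "(of_int Z * r + c) / T \<le> n" using n0 by simp
    then show ?case using assms by (simp add: le_floor_iff field_simps)
  qed
qed

section \<open>Compressions to the eigenspaces\<close>

context eigenbasis_data
begin

abbreviation PP :: "nat \<Rightarrow> 'n vfun \<Rightarrow> 'n vfun" where
  "PP n \<equiv> orth_proj T (eigen_sum T (ddt T S) (real n))"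

lemma W_sum: "(\<Sum>e\<in>W n. g e) = (\<Sum>p\<in>Idx n. g (ev p))"
  unfolding W_def by (rule sum.reindex[OF inj_on_subset[OF ev_inj Idx_J], unfolded o_def])

lemma lincomb_L2: "(\<lambda>t. \<Sum>p\<in>Idx n. c p *s ev p t) \<in> L2 T"
  by (intro L2_sum L2_smult ev_L2)

lemma lincomb_inner:
  assumes q: "q \<in> Idx n" shows "l2_inner T (\<lambda>t. \<Sum>p\<in>Idx n. c p *s ev p t) (ev q) = c q"
proof -
  have "l2_inner T (\<lambda>t. \<Sum>p\<in>Idx n. c p *s ev p t) (ev q) = (\<Sum>p\<in>Idx n. c p * l2_inner T (ev p) (ev q))"
    by (simp add: l2_inner_sum_left[OF ev_L2 L2_smult[OF ev_L2]] l2_inner_smult_left)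
  also have "\<dots> = (\<Sum>p\<in>Idx n. if p = q then c p else 0)"
    using Idx_J q by (intro sum.cong refl) (simp add: ev_inner subset_eq)
  also have "\<dots> = c q" using q Idx_finite by simp
  finally show ?thesis .
qed

text \<open>The Fourier sum over \<open>W n\<close> meets the defining property of the projection,
  so the choice in \<open>orth_proj\<close> is legitimate; the coefficients of whatever was chosen
  are then forced. Equality holds on [0,T] only, as representatives are arbitrary elsewhere.\<close>

lemma PP_fourier:
  assumes f: "f \<in> L2 T" and t: "t \<in> {0..T}"
  shows "PP n f t = fourier_sum T (W n) f t"
proof -
  let ?V = "eigen_sum T (ddt T S) (real n)"
  let ?g = "fourier_sum T (W n) f"
  let ?R = "\<lambda>g. g \<in> ?V \<and> (\<forall>h\<in>?V. l2_inner T (\<lambda>t. f t - g t) h = 0)"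
  have g: "?g = (\<lambda>t. \<Sum>p\<in>Idx n. l2_inner T f (ev p) *s ev p t)"
    unfolding fourier_sum_def W_sum ..
  have gL: "?g \<in> L2 T" by (rule fourier_sum_L2[OF W_props(3)])
  have V_L2: "h \<in> L2 T" if "h \<in> ?V" for h
    using eigen_sum_explicit[OF that] L2_cong[OF lincomb_L2] by metis
  have "?R ?g"
  proof (intro conjI ballI)
    show "?g \<in> ?V" unfolding g by (rule lincomb_in_eigen_sum)
    fix h assume h: "h \<in> ?V"
    obtain c where c: "\<And>t. t \<in> {0..T} \<Longrightarrow> h t = (\<Sum>p\<in>Idx n. c p *s ev p t)" using eigen_sum_explicit[OF h] by blast
    have dL: "(\<lambda>t. f t - ?g t) \<in> L2 T" by (rule L2_diff[OF f gL])
    have z: "l2_inner T (\<lambda>t. f t - ?g t) (ev p) = 0" if "p \<in> Idx n" for p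
      unfolding l2_inner_diff_left[OF f gL ev_L2] unfolding g lincomb_inner[OF that] by simp
    have "l2_inner T (\<lambda>t. f t - ?g t) h = l2_inner T (\<lambda>t. f t - ?g t) (\<lambda>t. \<Sum>p\<in>Idx n. c p *s ev p t)"
      by (rule l2_inner_cong[OF l2_eq_refl l2_eqI[OF c] dL dL V_L2[OF h] lincomb_L2])
    also have "\<dots> = (\<Sum>p\<in>Idx n. cnj (c p) * l2_inner T (\<lambda>t. f t - ?g t) (ev p))"
      by (simp add: l2_inner_sum_right[OF dL L2_smult[OF ev_L2]] l2_inner_smult_right)
    also have "\<dots> = 0" by (intro sum.neutral ballI) (simp add: z)
    finally show "l2_inner T (\<lambda>t. f t - ?g t) h = 0" .
  qed
  then have R: "?R (PP n f)" unfolding orth_proj_def by (rule someI[of ?R])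
  then have PL: "PP n f \<in> L2 T" using V_L2 by blast
  obtain c where c: "\<And>t. t \<in> {0..T} \<Longrightarrow> PP n f t = (\<Sum>p\<in>Idx n. c p *s ev p t)"
    using eigen_sum_explicit R by blast
  have "c p = l2_inner T f (ev p)" if p: "p \<in> Idx n" for p
  proof -
    have "ev p = (\<lambda>t. \<Sum>q\<in>Idx n. (if q = p then 1 else 0) *s ev q t)"
    proof
      fix t
      have "(\<Sum>q\<in>Idx n. (if q = p then 1 else 0) *s ev q t) = (\<Sum>q\<in>Idx n. if q = p then ev q t else 0)"
        by (intro sum.cong refl) simp
      then show "ev p t = (\<Sum>q\<in>Idx n. (if q = p then 1 else 0) *s ev q t)" using p Idx_finite by simp
    qed
    then have "ev p \<in> ?V" using lincomb_in_eigen_sum[where n = n and c = "\<lambda>q. if q = p then 1 else 0"] by simp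
    then have "l2_inner T (\<lambda>t. f t - PP n f t) (ev p) = 0" using R by blast
    then have "l2_inner T f (ev p) = l2_inner T (PP n f) (ev p)"
      unfolding l2_inner_diff_left[OF f PL ev_L2] by simp
    also have "\<dots> = l2_inner T (\<lambda>t. \<Sum>p\<in>Idx n. c p *s ev p t) (ev p)"
      by (rule l2_inner_cong[OF l2_eqI[OF c] l2_eq_refl PL lincomb_L2 ev_L2 ev_L2])
    also have "\<dots> = c p" by (rule lincomb_inner[OF p])
    finally show ?thesis by simp
  qed
  then show ?thesis unfolding c[OF t] g by simp
qed

lemma PP_L2: "f \<in> L2 T \<Longrightarrow> PP n f \<in> L2 T"
  by (rule L2_cong[OF fourier_sum_L2[OF W_props(3)] PP_fourier[symmetric]])

text \<open>By linearity P F P f is the sum of <f, e> P F e over e in \<open>W n\<close>, an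
  operator of finite rank.\<close>

lemma PFP_has_trace: "has_trace T (PP n \<circ> F \<circ> PP n) (\<Sum>e\<in>W n. l2_inner T (F e) e)"
proof -
  have 1: "has_trace T (\<lambda>f t. 0 + (\<Sum>e\<in>W n. l2_inner T f e *s fourier_sum T (W n) (F e) t))
      (0 + (\<Sum>e\<in>W n. l2_inner T (fourier_sum T (W n) (F e)) e))"
    by (rule has_trace_add_finite_rank[OF T_nonneg has_trace_zero[OF T_nonneg] W_props(1) W_L2 fourier_sum_L2[OF W_props(3)]])
  have 2: "l2_inner T (fourier_sum T (W n) (F e)) e = l2_inner T (F e) e" if "e \<in> W n" for e
    using fourier_sum_inner_basis[OF W_props(3,1) subset_refl that, of "F e"] that by simp
  have "has_trace T (PP n \<circ> F \<circ> PP n) (0 + (\<Sum>e\<in>W n. l2_inner T (fourier_sum T (W n) (F e)) e))"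
  proof (rule has_trace_cong[OF 1])
    fix f :: "'n vfun" assume f: "f \<in> L2 T"
    have L: "PP n f \<in> L2 T" "F (PP n f) \<in> L2 T" by (intro PP_L2 F_L2 f)+
    show "(PP n \<circ> F \<circ> PP n) f \<in> L2 T" unfolding o_def by (intro PP_L2 F_L2 f)
    have S: "(\<lambda>t. \<Sum>e\<in>W n. l2_inner T f e *s F e t) \<in> L2 T" by (intro L2_sum L2_smult F_L2 W_L2)
    have FP: "F (PP n f) t = (\<Sum>e\<in>W n. l2_inner T f e *s F e t)" if t: "t \<in> {0..T}" for t
    proof -
      have "F (PP n f) t = Fop (PP n f) t" by (rule F_Fop[OF L(1) t])
      also have "\<dots> = Fop (\<lambda>t. \<Sum>e\<in>W n. l2_inner T f e *s e t) t"
        by (rule Fop_cong[OF _ t]) (simp only: PP_fourier[OF f] fourier_sum_def)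
      also have "\<dots> = (\<Sum>e\<in>W n. l2_inner T f e *s Fop e t)" by (rule Fop_lincomb[OF W_L2 t])
      also have "\<dots> = (\<Sum>e\<in>W n. l2_inner T f e *s F e t)"
        by (intro sum.cong refl) (simp only: F_Fop[OF W_L2 t])
      finally show ?thesis .
    qed
    have inner: "l2_inner T (F (PP n f)) e' = (\<Sum>e\<in>W n. l2_inner T f e * l2_inner T (F e) e')" if e': "e' \<in> W n" for e'
    proof -
      have "l2_inner T (F (PP n f)) e' = l2_inner T (\<lambda>t. \<Sum>e\<in>W n. l2_inner T f e *s F e t) e'"
        by (rule l2_inner_cong[OF l2_eqI[OF FP] l2_eq_refl L(2) S W_L2[OF e'] W_L2[OF e']])
      also have "\<dots> = (\<Sum>e\<in>W n. l2_inner T f e * l2_inner T (F e) e')"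
        by (simp add: l2_inner_sum_left[OF W_L2[OF e'] L2_smult[OF F_L2[OF W_L2]]] l2_inner_smult_left)
      finally show ?thesis .
    qed
    show "l2_eq T (\<lambda>t. 0 + (\<Sum>e\<in>W n. l2_inner T f e *s fourier_sum T (W n) (F e) t)) ((PP n \<circ> F \<circ> PP n) f)"
    proof (rule l2_eqI)
      fix t assume t: "t \<in> {0..T}"
      have "(PP n \<circ> F \<circ> PP n) f t = (\<Sum>e'\<in>W n. l2_inner T (F (PP n f)) e' *s e' t)"
        by (simp only: o_def PP_fourier[OF L(2) t] fourier_sum_def)
      also have "\<dots> = (\<Sum>e'\<in>W n. \<Sum>e\<in>W n. l2_inner T f e *s (l2_inner T (F e) e' *s e' t))"
        by (intro sum.cong refl) (simp add: inner vector_smult_assoc bounded_bilinear.sum_left[OF bounded_bilinear_smult])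
      also have "\<dots> = (\<Sum>e\<in>W n. \<Sum>e'\<in>W n. l2_inner T f e *s (l2_inner T (F e) e' *s e' t))" by (rule sum.swap)
      also have "\<dots> = (\<Sum>e\<in>W n. l2_inner T f e *s fourier_sum T (W n) (F e) t)"
        by (simp add: fourier_sum_def bounded_bilinear.sum_right[OF bounded_bilinear_smult])
      finally show "0 + (\<Sum>e\<in>W n. l2_inner T f e *s fourier_sum T (W n) (F e) t) = (PP n \<circ> F \<circ> PP n) f t" by simp
    qed
  qed
  then show ?thesis using 2 by simp
qed

text \<open>Together with \<open>b_coeff\<close>, splits the kernel A(t) B(s) between two basis
  functions for the same x into n products of scalar functions of t and of s. The twist by theta is
  absorbed, so only characters remain.\<close>

definition a_coeff :: "complex ^ 'n \<Rightarrow> 'n \<Rightarrow> real \<Rightarrow> complex" where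
  "a_coeff x l t = cis (- (\<theta> x / T * t)) * cdot (A t *v axis l 1) x"

definition b_coeff :: "complex ^ 'n \<Rightarrow> 'n \<Rightarrow> real \<Rightarrow> complex" where
  "b_coeff x l t = cis (\<theta> x / T * t) * (B t *v x) $ l"

lemma a_coeff_cont: "continuous_on {0..T} (a_coeff x l)"
  unfolding a_coeff_def[abs_def]
  by (intro continuous_intros bounded_bilinear.continuous_on[OF bounded_bilinear_cdot] matrix_vector_mult_cont A_cont)

lemma b_coeff_Lipschitz: "Lipschitz_upto T (b_coeff x l)"
proof -
  have "Lipschitz_upto T (\<lambda>t. cis (\<theta> x / T * t) * cdot (B t *v x) (axis l 1))"
    by (intro Lipschitz_upto_bilinear[OF bounded_bilinear_mult] Lipschitz_upto_cis
        Lipschitz_upto_bilinear[OF bounded_bilinear_cdot] Lipschitz_upto_bilinear[OF bounded_bilinear_matrix_vector_mult]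
        B_Lipschitz Lipschitz_upto_const)
  then show ?thesis by (simp only: cdot_axis_right b_coeff_def[abs_def])
qed

lemma b_coeff_cont: "continuous_on {0..T} (b_coeff x l)"
  by (rule Lipschitz_upto_continuous[OF b_coeff_Lipschitz])

lemma b_character_cont: "continuous_on {0..T} (\<lambda>s. b_coeff x l s * character T k s)"
  by (intro continuous_on_mult b_coeff_cont continuous_character)

text \<open>On the diagonal the twists cancel and A B = D, so the jump is the diagonal entry of D at
  x; summed over x it becomes the trace of D.\<close>

lemma sum_a_b: assumes "t \<in> {0..T}" shows "(\<Sum>l\<in>UNIV. a_coeff x l t * b_coeff x l t) = cdot (D t *v x) x"
proof -
  have "a_coeff x l t * b_coeff x l t = (B t *v x) $ l * cdot (A t *v axis l 1) x" for l
  proof -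
    have "cis (- (\<theta> x / T * t)) * cis (\<theta> x / T * t) = 1" by (simp add: cis_mult)
    moreover have "a_coeff x l t * b_coeff x l t
        = (cis (- (\<theta> x / T * t)) * cis (\<theta> x / T * t)) * ((B t *v x) $ l * cdot (A t *v axis l 1) x)"
      unfolding a_coeff_def b_coeff_def by (simp only: mult_ac)
    ultimately show ?thesis by (simp only: mult_1)
  qed
  then have "(\<Sum>l\<in>UNIV. a_coeff x l t * b_coeff x l t) = cdot (A t *v (B t *v x)) x"
    by (simp only: cdot_axis_expansion[of "A t" "B t *v x" x])
  then show ?thesis by (simp add: matrix_vector_mul_assoc A_B[OF assms])
qed

lemma V_ev_inner:
  "l2_inner T (V (ev (x, k))) (ev (x, k))
    = (\<Sum>l\<in>UNIV. (LINT t|leb_upto T. a_coeff x l t * character T (- k) t * primitive (\<lambda>s. b_coeff x l s * character T k s) t) / of_real T)"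
proof -
  let ?P = "\<lambda>l t. primitive (\<lambda>s. b_coeff x l s * character T k s) t"
  let ?r = "complex_of_real (sqrt T)"
  have r: "?r * ?r = of_real T" using T_pos by (simp flip: of_real_mult)
  have ev: "ev (x, k) t = (cis (\<theta> x / T * t) * character T k t / ?r) *s x" for t
    by (simp add: ev_def trig_vec_def)
  have y: "primitive (\<lambda>s. B s *v ev (x, k) s) t $ l = ?P l t / ?r" if t: "t \<in> {0..T}" for l t
  proof -
    have "primitive (\<lambda>s. B s *v ev (x, k) s) t $ l = primitive (\<lambda>s. (B s *v ev (x, k) s) $ l) t"
      by (rule primitive_bounded_linear[OF bounded_linear_vec_nth L2_integrable[OF L2_matrix_mult[OF B_cont ev_L2]] t, symmetric])
    also have "(\<lambda>s. (B s *v ev (x, k) s) $ l) = (\<lambda>s. b_coeff x l s * character T k s / ?r)"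
      by (rule ext) (simp add: ev b_coeff_def vector_scalar_commute mult_ac)
    also have "primitive (\<lambda>s. b_coeff x l s * character T k s / ?r) t = ?P l t / ?r"
      by (rule primitive_bounded_linear[OF bounded_linear_divide integrable_leb_continuous[OF b_character_cont] t])
    finally show ?thesis .
  qed
  have int: "integrable (leb_upto T) (\<lambda>t. a_coeff x l t * character T (- k) t * ?P l t)" for l
    by (intro integrable_leb_continuous continuous_on_mult a_coeff_cont continuous_character
        primitive_continuous b_character_cont)
  have pt: "cdot (V (ev (x, k)) t) (ev (x, k) t) = (\<Sum>l\<in>UNIV. a_coeff x l t * character T (- k) t * ?P l t) / of_real T"
    if t: "t \<in> {0..T}" for t
  proof -
    have "cdot (V (ev (x, k)) t) (ev (x, k) t)
        = cnj (cis (\<theta> x / T * t) * character T k t / ?r) * cdot (A t *v primitive (\<lambda>s. B s *v ev (x, k) s) t) x"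
      unfolding V_eq[OF ev_L2 t] by (subst (2) ev) (rule cdot_smult_right)
    also have "cnj (cis (\<theta> x / T * t) * character T k t / ?r) = cis (- (\<theta> x / T * t)) * character T (- k) t / ?r"
      by (simp add: cis_cnj cnj_character)
    also have "cdot (A t *v primitive (\<lambda>s. B s *v ev (x, k) s) t) x = (\<Sum>l\<in>UNIV. (?P l t / ?r) * cdot (A t *v axis l 1) x)"
      by (subst cdot_axis_expansion) (simp only: y[OF t])
    also have "cis (- (\<theta> x / T * t)) * character T (- k) t / ?r * (\<Sum>l\<in>UNIV. (?P l t / ?r) * cdot (A t *v axis l 1) x)
        = (\<Sum>l\<in>UNIV. a_coeff x l t * character T (- k) t * ?P l t / (?r * ?r))"
      unfolding sum_distrib_left by (intro sum.cong refl) (simp add: a_coeff_def mult_ac)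
    finally show ?thesis unfolding r sum_divide_distrib .
  qed
  have "l2_inner T (V (ev (x, k))) (ev (x, k)) = (LINT t|leb_upto T. (\<Sum>l\<in>UNIV. a_coeff x l t * character T (- k) t * ?P l t) / of_real T)"
    unfolding l2_inner_cdot by (intro Bochner_Integration.integral_cong refl pt) simp
  also have "\<dots> = (LINT t|leb_upto T. (\<Sum>l\<in>UNIV. a_coeff x l t * character T (- k) t * ?P l t)) / of_real T"
    by (rule integral_divide_zero)
  also have "(LINT t|leb_upto T. (\<Sum>l\<in>UNIV. a_coeff x l t * character T (- k) t * ?P l t))
      = (\<Sum>l\<in>UNIV. LINT t|leb_upto T. a_coeff x l t * character T (- k) t * ?P l t)"
    by (rule Bochner_Integration.integral_sum[OF int])
  finally show ?thesis unfolding sum_divide_distrib .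
qed

lemma Volterra_conditional_trace:
  "(\<lambda>n. \<Sum>e\<in>W n. l2_inner T (V e) e) \<longlonglongrightarrow> 1 / 2 * integral {0..T} (\<lambda>t. trace (D t))"
proof -
  define p where "p x n = \<lceil>(- (real n * T) - \<theta> x) / (2 * pi)\<rceil>" for x and n :: nat
  define q where "q x n = \<lfloor>(real n * T - \<theta> x) / (2 * pi)\<rfloor>" for x and n :: nat
  let ?v = "\<lambda>x l k. (LINT t|leb_upto T. a_coeff x l t * character T (- k) t * primitive (\<lambda>s. b_coeff x l s * character T k s) t) / of_real T"
  have sums: "(\<Sum>e\<in>W n. l2_inner T (V e) e) = (\<Sum>x\<in>XX. \<Sum>l\<in>UNIV. \<Sum>k\<in>{p x n..q x n}. ?v x l k)" for n
  proof -
    have "(\<Sum>e\<in>W n. l2_inner T (V e) e) = (\<Sum>x\<in>XX. \<Sum>k\<in>{p x n..q x n}. l2_inner T (V (ev (x, k))) (ev (x, k)))"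
      unfolding W_sum Idx_Sigma p_def[symmetric] q_def[symmetric]
      using fin by (subst sum.Sigma) (auto simp: case_prod_beta)
    also have "\<dots> = (\<Sum>x\<in>XX. \<Sum>l\<in>UNIV. \<Sum>k\<in>{p x n..q x n}. ?v x l k)"
      unfolding V_ev_inner by (intro sum.cong refl sum.swap)
    finally show ?thesis .
  qed
  have lim: "(\<lambda>n. \<Sum>k\<in>{p x n..q x n}. ?v x l k) \<longlonglongrightarrow> (LINT t|leb_upto T. a_coeff x l t * b_coeff x l t) / 2" for x l
  proof -
    obtain L where L: "\<forall>s\<in>{0..T}. \<forall>t\<in>{0..T}. cmod (b_coeff x l t - b_coeff x l s) \<le> L * \<bar>t - s\<bar>"
      using Lipschitz_uptoD[OF b_coeff_Lipschitz] by blast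
    \<comment> \<open>Expresses the lower end through a floor, so that one growth lemma covers both
      ends.\<close>
    have p_alt: "p x n = - \<lfloor>(real n * T - (- \<theta> x)) / (2 * pi)\<rfloor>" for n
      unfolding p_def ceiling_def by (simp add: diff_divide_distrib add_divide_distrib add.commute)
    show ?thesis
    \<comment> \<open>In C, |theta|/pi is twice the shift of the window, and 2 accounts for the two
      roundings.\<close>
    proof (rule Volterra_conditional_trace_scalar[OF T_pos a_coeff_cont, where L = L and C = "\<lceil>\<bar>\<theta> x\<bar> / pi\<rceil> + 2"])
      show "cmod (b_coeff x l t - b_coeff x l s) \<le> L * \<bar>t - s\<bar>" if "s \<in> {0..T}" "t \<in> {0..T}" for s t
        using L that by blast
      show "filterlim (p x) at_bot sequentially"
        unfolding filterlim_at_bot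
      proof
        fix Z :: int
        show "\<forall>\<^sub>F n in sequentially. p x n \<le> Z"
          using floor_linear_at_top[OF T_pos, of "2 * pi" "- Z" "- \<theta> x"] pi_gt_zero
          unfolding p_alt by (auto elim!: eventually_mono)
      qed
      show "filterlim (q x) at_top sequentially"
        unfolding filterlim_at_top q_def using floor_linear_at_top[OF T_pos, of "2 * pi"] pi_gt_zero by simp
      fix n
      define a b c :: real where "a = real n * T / (2 * pi)" and "b = \<theta> x / (2 * pi)" and "c = \<bar>\<theta> x\<bar> / pi"
      have "real_of_int (p x n) < - a - b + 1" "- a - b \<le> p x n"
        unfolding p_def a_def b_def by (simp_all add: diff_divide_distrib) linarith+
      moreover have "real_of_int (q x n) \<le> a - b" "a - b < real_of_int (q x n) + 1"
        unfolding q_def a_def b_def by (simp_all add: diff_divide_distrib)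
      moreover have "2 * \<bar>b\<bar> = c" by (simp add: b_def c_def abs_divide)
      moreover have "c \<le> of_int \<lceil>c\<rceil>" by (rule le_of_int_ceiling)
      ultimately have "\<bar>real_of_int (p x n) + real_of_int (q x n)\<bar> \<le> of_int \<lceil>c\<rceil> + 2" by linarith
      then have "real_of_int \<bar>p x n + q x n\<bar> \<le> real_of_int (\<lceil>c\<rceil> + 2)" by simp
      then show "\<bar>p x n + q x n\<bar> \<le> \<lceil>\<bar>\<theta> x\<bar> / pi\<rceil> + 2" unfolding of_int_le_iff c_def .
    qed
  qed
  have "(\<Sum>x\<in>XX. \<Sum>l\<in>UNIV. (LINT t|leb_upto T. a_coeff x l t * b_coeff x l t) / 2)
      = (LINT t|leb_upto T. (\<Sum>x\<in>XX. \<Sum>l\<in>UNIV. a_coeff x l t * b_coeff x l t)) / 2"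
  proof -
    have int: "integrable (leb_upto T) (\<lambda>t. a_coeff x l t * b_coeff x l t)" for x l
      by (intro integrable_leb_continuous continuous_on_mult a_coeff_cont b_coeff_cont)
    show ?thesis
      by (simp add: Bochner_Integration.integral_sum Bochner_Integration.integrable_sum int flip: sum_divide_distrib)
  qed
  also have "(LINT t|leb_upto T. (\<Sum>x\<in>XX. \<Sum>l\<in>UNIV. a_coeff x l t * b_coeff x l t)) = (LINT t|leb_upto T. trace (D t))"
    by (intro Bochner_Integration.integral_cong refl) (simp add: sum_a_b trace_eigenbasis[OF complete])
  also have "\<dots> = integral {0..T} (\<lambda>t. trace (D t))"
  proof -
    have "continuous_on {0..T} (\<lambda>t. trace (D t))"
      unfolding trace_def by (intro continuous_intros D_cont)
    then show ?thesis using primitive_eq_integral[of T "\<lambda>t. trace (D t)" T] by (simp add: primitive_def)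
  qed
  finally have eq: "(\<Sum>x\<in>XX. \<Sum>l\<in>UNIV. (LINT t|leb_upto T. a_coeff x l t * b_coeff x l t) / 2)
      = 1 / 2 * integral {0..T} (\<lambda>t. trace (D t))" by simp
  have "(\<lambda>n. \<Sum>x\<in>XX. \<Sum>l\<in>UNIV. \<Sum>k\<in>{p x n..q x n}. ?v x l k)
      \<longlonglongrightarrow> (\<Sum>x\<in>XX. \<Sum>l\<in>UNIV. (LINT t|leb_upto T. a_coeff x l t * b_coeff x l t) / 2)"
    by (intro tendsto_sum lim)
  then show ?thesis unfolding sums eq .
qed

lemma total_A: "total (\<lambda>t. A t *v d) = II 1 T *v d"
proof -
  have c1: "continuous_on {0..T} (\<lambda>_. mat 1 :: complex ^ 'n ^ 'n)" by (rule continuous_on_const)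
  have "total (\<lambda>t. A t *v d) = primitive (\<lambda>s. Dhat s ** mat 1) T *v d"
    using primitive_B_A[OF c1 in_0T(2), of d] by (simp add: total_def)
  also have "primitive (\<lambda>s. Dhat s ** mat 1) T = II 1 T" using II_Suc[OF in_0T(2), of 0] by simp
  finally show ?thesis .
qed

text \<open>For a finite sum of rank one operators Parseval converges along \<open>W n\<close> to
  the ordinary trace.\<close>

lemma finite_rank_conditional_trace:
  "(\<lambda>n. \<Sum>e\<in>W n. l2_inner T (\<lambda>t. A t *v (Q *v total e)) e) \<longlonglongrightarrow> trace (G 1)"
proof -
  let ?b = "\<lambda>j. \<lambda>s. adj (B s) *v axis j 1" and ?a = "\<lambda>j :: 'n. \<lambda>t. A t *v (Q *v axis j 1)"
  have "l2_inner T (\<lambda>t. A t *v (Q *v total e)) e = (\<Sum>j\<in>UNIV. l2_inner T (?a j) e * l2_inner T e (?b j))"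
    if e: "e \<in> W n" for e n
  proof -
    have *: "(\<lambda>t. A t *v (Q *v total e)) = (\<lambda>t. \<Sum>j\<in>UNIV. total e $ j *s ?a j t)"
      by (subst axis_expansion[of "total e"]) (simp only: matrix_vector_sum_smult)
    have "l2_inner T (\<lambda>t. A t *v (Q *v total e)) e = (\<Sum>j\<in>UNIV. total e $ j * l2_inner T (?a j) e)"
      unfolding * by (simp only: l2_inner_sum_left[OF W_L2[OF e] L2_smult[OF A_vec_L2]] l2_inner_smult_left)
    then show ?thesis by (simp only: total_component[OF W_L2[OF e]] mult.commute)
  qed
  then have eq: "(\<Sum>e\<in>W n. l2_inner T (\<lambda>t. A t *v (Q *v total e)) e)
      = (\<Sum>j\<in>UNIV. \<Sum>e\<in>W n. l2_inner T (?a j) e * l2_inner T e (?b j))" for n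
    by (subst sum.swap) (intro sum.cong refl, blast)
  have "(\<lambda>n. \<Sum>j\<in>UNIV. \<Sum>e\<in>W n. l2_inner T (?a j) e * l2_inner T e (?b j)) \<longlonglongrightarrow> (\<Sum>j\<in>UNIV. l2_inner T (?a j) (?b j))"
    by (intro tendsto_sum W_Parseval A_vec_L2 adj_B_L2)
  also have "(\<Sum>j\<in>UNIV. l2_inner T (?a j) (?b j)) = trace (G 1)"
    unfolding G_alt trace_axis[of "II 1 T ** Q"]
    by (intro sum.cong refl) (simp only: total_component[OF A_vec_L2, symmetric] total_A, simp only: matrix_vector_mul_assoc)
  finally show ?thesis unfolding eq .
qed

lemma F_conditional_trace:
  "has_conditional_trace T (ddt T S) F (1 / 2 * integral {0..T} (\<lambda>t. trace (D t)) - trace (G 1))"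
proof -
  have "l2_inner T (F e) e = l2_inner T (V e) e - l2_inner T (\<lambda>t. A t *v (Q *v total e)) e" if "e \<in> W n" for e n
  proof -
    note e = W_L2[OF that]
    have "l2_inner T (F e) e = l2_inner T (\<lambda>t. V e t - A t *v (Q *v total e)) e"
      by (rule l2_inner_cong[OF l2_eqI l2_eq_refl F_L2[OF e] L2_diff[OF V_L2[OF e] A_vec_L2] e e])
        (simp only: F_Fop[OF e] Fop_V[OF e])
    then show ?thesis by (simp only: l2_inner_diff_left[OF V_L2[OF e] A_vec_L2 e])
  qed
  then have "(\<Sum>e\<in>W n. l2_inner T (F e) e) = (\<Sum>e\<in>W n. l2_inner T (V e) e) - (\<Sum>e\<in>W n. l2_inner T (\<lambda>t. A t *v (Q *v total e)) e)" for n
    by (simp add: sum_subtractf)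
  then have "(\<lambda>n. \<Sum>e\<in>W n. l2_inner T (F e) e) \<longlonglongrightarrow> 1 / 2 * integral {0..T} (\<lambda>t. trace (D t)) - trace (G 1)"
    using tendsto_diff[OF Volterra_conditional_trace finite_rank_conditional_trace] by simp
  then show ?thesis
    unfolding has_conditional_trace_def Let_def
    by (intro exI[of _ "\<lambda>n. \<Sum>e\<in>W n. l2_inner T (F e) e"] conjI allI PFP_has_trace)
qed

end

theorem theorem1p3:
  fixes T :: real and S :: "real ^ 'n ^ 'n"
    and D0 D Dhat \<gamma>0 :: "real \<Rightarrow> complex ^ 'n ^ 'n"
    and \<nu> :: complex
    and F :: "('n::finite) vfun \<Rightarrow> 'n vfun"
    and M :: "complex ^ 'n ^ 'n" and G :: "nat \<Rightarrow> complex ^ 'n ^ 'n"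
  assumes T_pos: "0 < T"
    and S_orth: "orthogonal_matrix S"
    and D0_cont: "continuous_on {0..T} D0"
    and D_cont: "continuous_on {0..T} D"
    and inv: "op_invertible T (shifted_ddt T S D0 \<nu>)"
    and F_def: "F = mult_op D \<circ> op_inverse (shifted_ddt T S D0 \<nu>)"
    and \<gamma>0_init: "\<gamma>0 0 = mat 1"
    and \<gamma>0_ode: "\<And>t. t \<in> {0..T} \<Longrightarrow>
          (\<gamma>0 has_vector_derivative (D0 t ** \<gamma>0 t)) (at t within {0..T})"
    and M_def: "M = map_matrix complex_of_real S ** \<gamma>0 T"
    and Dhat_def: "Dhat = (\<lambda>t. matrix_inv (\<gamma>0 t) ** D t ** \<gamma>0 t)"
    and G_def: "G = (\<lambda>k. iterated_integral Dhat k T ** M **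
                          matrix_inv (M - mat (exp (\<nu> * complex_of_real T))))"
  shows "has_conditional_trace T (ddt T S) F
           (1 / 2 * integral {0..T} (\<lambda>t. trace (D t)) - trace (G 1)) \<and>
         (\<forall>m\<ge>2. has_trace T (F ^^ m)
           (of_nat m * (\<Sum>k=1..m. (- 1) ^ k / of_nat k *
              (\<Sum>js\<in>compositions m k. trace (matrix_prod_list (map G js))))))"
proof -
  obtain XX \<theta> where XX: "finite XX" "\<And>x y. x \<in> XX \<Longrightarrow> y \<in> XX \<Longrightarrow> cdot x y = (if x = y then 1 else 0)"
    "\<And>x. x \<in> XX \<Longrightarrow> map_matrix complex_of_real S *v x = exp (- (\<i> * of_real (\<theta> x))) *s x"
    "\<And>v. v = (\<Sum>x\<in>XX. cdot v x *s x)"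
    using unitary_eigenbasis[OF orthogonal_matrix_cdot[OF S_orth]] by blast
  interpret L: eigenbasis_data T S D0 D \<gamma>0 \<nu> XX \<theta>
    by unfold_locales (fact T_pos S_orth D0_cont D_cont inv \<gamma>0_init \<gamma>0_ode XX)+
  have F: "L.F = F" by (simp only: F_def L.F_def)
  have G: "L.G = G"
    by (rule ext) (simp only: G_def L.G_def M_def L.M_def L.E_def Dhat_def L.Dhat_def)
  obtain \<phi> :: "nat \<Rightarrow> 'n vfun" where \<phi>: "orthonormal_seq T \<phi>" using L.orthonormal_seq_exists by blast
  show ?thesis
  proof (intro conjI allI impI)
    show "has_conditional_trace T (ddt T S) F (1 / 2 * integral {0..T} (\<lambda>t. trace (D t)) - trace (G 1))"
      using L.F_conditional_trace unfolding F G .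
    fix m :: nat assume m: "2 \<le> m"
    then have "0 < m" by simp
    with L.F_power_has_trace[OF \<phi> m] show "has_trace T (F ^^ m)
        (of_nat m * (\<Sum>k=1..m. (- 1) ^ k / of_nat k *
          (\<Sum>js\<in>compositions m k. trace (matrix_prod_list (map G js)))))"
      unfolding F G by (simp only: log_trace_coefficient)
  qed
qed

end
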